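(* Let $1\le t<\infty$, $0<p<\infty$, $-n-1<q<\infty$, $1<s<\infty$, and $s+q>-1$. Let $g\in\mathcal{B}_{\frac{n+1+q}{p},\frac{t-1}{t}}$. Then $$\|T_g\|_{e,\,B_t(\mathbb{B}_n)\to F(p,q,s)}\asymp\operatorname{dist}_{\mathcal{B}_{\frac{n+1+q}{p},\frac{t-1}{t}}}\left(g,\ \mathcal{B}^0_{\frac{n+1+q}{p},\frac{t-1}{t}}\right)\asymp\limsup_{|z|\to1}|\Re g(z)|(1-|z|^2)^{\frac{n+1+q}{p}}\left(\log\frac{2}{1-|z|^2}\right)^{\frac{t-1}{t}}.$$
   Context: $\mathbb{B}_n$ is the open unit ball of $\mathbb{C}^n$ ($n\ge1$), $H(\mathbb{B}_n)$ the space of holomorphic functions on $\mathbb{B}_n$, $dv$ normalized volume measure, $d\tau(z)=(1-|z|^2)^{-n-1}dv(z)$. For $f\in H(\mathbb{B}_n)$, $\nabla f=(\partial f/\partial z_1,\dots,\partial f/\partial z_n)$ is the complex gradient and $\Re f(z)=\sum_{j=1}^n z_j\,\partial f/\partial z_j(z)$ the radial derivative. Operator: for $g\in H(\mathbb{B}_n)$, $T_gf(z)=\int_0^1 f(rz)\,\Re g(rz)\,\frac{dr}{r}$ for $f\in H(\mathbb{B}_n)$. Besov space: for $1\le t<\infty$, $B_t(\mathbb{B}_n)$ is the space of $f\in H(\mathbb{B}_n)$ such that $(1-|z|^2)^N\frac{\partial^m f}{\partial z^m}(z)\in L^t(\mathbb{B}_n,d\tau)$ for all multi-indices $m$ with $|m|=N$,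 for some positive integer $N>n/t$ (equivalently, for every such $N$). With such an $N$ fixed, the norm is $$\|f\|_{B_t}=\sum_{|m|\le N-1}\left|\frac{\partial^m f}{\partial z^m}(0)\right|+\sum_{|m|=N}\left(\int_{\mathbb{B}_n}\left|(1-|z|^2)^N\frac{\partial^m f}{\partial z^m}(z)\right|^t d\tau(z)\right)^{1/t}.$$ General function space: for $0<p<\infty$, $-n-1<q<\infty$, $0\le s<\infty$, $s+q>-1$, $F(p,q,s)$ is the space of $f\in H(\mathbb{B}_n)$ with $$\|f\|^p_{F(p,q,s)}=|f(0)|^p+\sup_{z\in\mathbb{B}_n}\int_{\mathbb{B}_n}|\nabla f(w)|^p(1-|w|^2)^qG^s(z,w)\,dv(w)<\infty,$$ where $G^s(z,w)=(G(z,w))^s$ and $G$ is the invariant Green's function $G(z,a)=g_0(\varphi_a(z))$, $g_0(z)=\frac{n+1}{2n}\int_{|z|}^1\frac{(1-x^2)^{n-1}}{x^{2n-1}}\,dx$, with $\varphi_a$ the involutive automorphism of $\mathbb{B}_n$ interchanging $0$ and $a$. Bloch-type spaces: for $\alpha>0$, $\beta\in\mathbb{R}$, $\mathcal{B}_{\alpha,\beta}$ is the space of $g\in H(\mathbb{B}_n)$ with $$\|g\|_{\mathcal{B}_{\alpha,\beta}}=\sup_{z\in\mathbb{B}_n}|\Re g(z)|(1-|z|^2)^\alpha\left(\log\frac{2}{1-|z|^2}\right)^\beta<\infty,$$ and $\mathcal{B}^0_{\alpha,\beta}$ is the subspace of those $g$ for which $\lim_{|z|\to1}|\Re g(z)|(1-|z|^2)^\alpha\left(\log\frac{2}{1-|z|^2}\right)^\beta=0$.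 Essential norm and distance: for a linear operator $T:X\to Y$ between Banach or quasi-Banach spaces, $\|T\|_{e,X\to Y}=\inf\{\|T-K\|_{X\to Y}:K\text{ compact from }X\text{ to }Y\}$, where $\|\cdot\|_{X\to Y}$ is the operator norm. For $X\subset Y$ and $f\in Y$, $\operatorname{dist}_Y(f,X)=\inf\{\|f-h\|_Y:h\in X\}$. A bounded linear operator $K:B_t(\mathbb{B}_n)\to F(p,q,s)$ is compact if $\|Kf_k\|_{F(p,q,s)}\to0$ for every bounded sequence $\{f_k\}$ in $B_t(\mathbb{B}_n)$ converging to $0$ uniformly on compact subsets of $\mathbb{B}_n$. $A\asymp B$ means $C^{-1}B\le A\le CB$ with $C>0$ independent of $g$.
   Formalization: When n ≥ 2 and s ≥ n/(n-1), F(p,q,s) contains only constants and the claim fails (e.g. g = z_1, where T_g 1 = z_1 is not in F(p,q,s)); in that range only, it is additionally assumed that T_g maps B_t into F(p,q,s). *)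

theory Defs
  imports "HOL-Analysis.Analysis"
begin

section \<open>Holomorphic functions on the unit ball\<close>

text \<open>
  The unit ball of complex n-space is \<^term>\<open>ball 0 1 :: (complex^'n) set\<close>; the norm on
  \<^typ>\<open>complex^'n\<close> is the Euclidean one and n is CARD('n).  A function on the ball is represented
  by its extension by zero to the whole space, so that a function on the ball has exactly one
  representative and the function spaces below are genuine complex vector spaces.
  Holomorphy is complex (Frechet) differentiability.
\<close>

definition hol_ball :: "(complex^'n \<Rightarrow> complex) set" where
  "hol_ball = {f. (\<forall>z\<in>ball 0 1. \<exists>D. (f has_derivative D) (at z) \<and>
                       (\<forall>(c::complex) v. D (c *s v) = c * D v)) \<and>
                  (\<forall>z. z \<notin> ball 0 1 \<longrightarrow> f z = 0)}"

definition partial_d :: "'n \<Rightarrow> (complex^'n \<Rightarrow> complex) \<Rightarrow> complex^'n \<Rightarrow> complex" where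
  "partial_d j f z = deriv (\<lambda>\<zeta>::complex. f (z + axis j \<zeta>)) 0"

text \<open>
  Mixed partial derivative for a multi-index m.  The type 'n carries no order, so the coordinate
  derivatives are taken in the order of some list in which each j occurs m j times; for
  holomorphic functions the partial derivatives commute and the order is irrelevant.
\<close>

definition multi_d :: "('n \<Rightarrow> nat) \<Rightarrow> (complex^'n \<Rightarrow> complex) \<Rightarrow> complex^'n \<Rightarrow> complex" where
  "multi_d m f = foldr partial_d (SOME js. \<forall>j. count_list js j = m j) f"

lemma multi_index_list_exists:
  fixes m :: "'n::finite \<Rightarrow> nat"
  shows "\<exists>js. \<forall>j. count_list js j = m j"
proof -
  obtain js where js: "mset js = Abs_multiset m"
    using ex_mset by blast
  have "count (Abs_multiset m) = m"
    by (rule Abs_multiset_inverse) simp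
  then have "\<forall>j. count_list js j = m j"
    by (metis count_mset js)
  then show ?thesis ..
qed

definition grad :: "(complex^'n \<Rightarrow> complex) \<Rightarrow> complex^'n \<Rightarrow> complex^'n" where
  "grad f z = (\<chi> j. partial_d j f z)"

definition radial_d :: "(complex^'n \<Rightarrow> complex) \<Rightarrow> complex^'n \<Rightarrow> complex" where
  "radial_d f z = (\<Sum>j\<in>UNIV. z $ j * partial_d j f z)"

definition T_op :: "(complex^'n \<Rightarrow> complex) \<Rightarrow> (complex^'n \<Rightarrow> complex) \<Rightarrow> complex^'n \<Rightarrow> complex" where
  "T_op g f z = (if z \<in> ball 0 1
     then (LBINT r:{0<..<1}. f (r *\<^sub>R z) * radial_d g (r *\<^sub>R z) / of_real r) else 0)"


section \<open>Measures and the invariant Green function\<close>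

definition vol :: "(complex^'n) measure" where
  "vol = uniform_measure lborel (ball 0 1)"

definition inv_vol :: "(complex^'n) measure" where
  "inv_vol = density vol (\<lambda>z. ennreal ((1 - norm z ^ 2) powr (- real CARD('n) - 1)))"

definition cinner :: "complex^'n \<Rightarrow> complex^'n \<Rightarrow> complex" where
  "cinner z w = (\<Sum>j\<in>UNIV. z $ j * cnj (w $ j))"

definition proj :: "complex^'n \<Rightarrow> complex^'n \<Rightarrow> complex^'n" where
  "proj a z = (cinner z a / cinner a a) *s a"

text \<open>
  For \<^prop>\<open>a = 0\<close> the projection is zero (division by zero), which gives the usual
  convention that the automorphism is then the map sending z to -z.
\<close>

definition invol :: "complex^'n \<Rightarrow> complex^'n \<Rightarrow> complex^'n" where
  "invol a z = (1 / (1 - cinner z a)) *s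
     (a - proj a z - complex_of_real (sqrt (1 - norm a ^ 2)) *s (z - proj a z))"

lemma cinner_self: "cinner a a = complex_of_real (norm a ^ 2)"
proof -
  have "norm a ^ 2 = (\<Sum>j\<in>UNIV. cmod (a $ j) ^ 2)"
    by (simp add: norm_vec_def L2_set_def sum_nonneg)
  then show ?thesis
    unfolding cinner_def by (simp add: complex_norm_square[symmetric])
qed

lemma invol_0: "invol a 0 = a"
  by (simp add: invol_def proj_def cinner_def vec_eq_iff)

lemma invol_self:
  assumes "a \<in> ball 0 1"
  shows "invol a a = 0"
  using assms by (cases "a = 0") (simp_all add: invol_def proj_def cinner_self vec_eq_iff)

lemma invol_invol:
  assumes a: "a \<in> ball 0 1" and nz: "cinner z a \<noteq> 1"
  shows "invol a (invol a z) = z"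
proof (cases "a = 0")
  case True
  show ?thesis unfolding True by (simp add: invol_def proj_def cinner_def vec_eq_iff)
next
  case False
  define S where "S = complex_of_real (sqrt (1 - norm a ^ 2))"
  define c where "c = cinner z a"
  define d where "d = cinner a a"
  define w where "w = invol a z"
  have D: "1 - c \<noteq> 0" using nz by (simp add: c_def)
  have na: "norm a ^ 2 < 1"
    using a by (simp add: abs_square_less_1)
  then have "sqrt (1 - norm a ^ 2) * sqrt (1 - norm a ^ 2) = 1 - norm a ^ 2" by simp
  then have "S * S = of_real (1 - norm a ^ 2)" unfolding S_def of_real_mult[symmetric] by (rule arg_cong)
  then have S2: "S * S = 1 - d" by (simp add: d_def cinner_self)
  have d: "d \<noteq> 0" using False by (simp add: d_def cinner_self)
  have "1 - d = complex_of_real (1 - norm a ^ 2)" by (simp add: d_def cinner_self)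
  then have d1: "1 - d \<noteq> 0" using na by (metis less_numeral_extra(3) diff_gt_0_iff_gt of_real_eq_0_iff)
  have wj: "w $ j = (1 / (1 - c)) * (a $ j - c / d * a $ j - S * (z $ j - c / d * a $ j))" for j
    by (simp only: w_def invol_def proj_def S_def c_def d_def vector_minus_component vector_smult_component)
  define k where "k = 1 / (1 - c)"
  define r where "r = c / d"
  have "cinner w a = (\<Sum>j\<in>UNIV. k * (1 - r + S * r) * (a $ j * cnj (a $ j))
                          - k * S * (z $ j * cnj (a $ j)))"
    unfolding cinner_def wj k_def[symmetric] r_def[symmetric] by (simp add: algebra_simps)
  also have "\<dots> = k * (1 - r + S * r) * d - k * S * c"
    unfolding sum_subtractf sum_distrib_left[symmetric] c_def d_def cinner_def ..
  also have "\<dots> = k * (d - r * d + S * (r * d) - S * c)" by (simp add: algebra_simps)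
  also have "\<dots> = (d - c) / (1 - c)" using d by (simp add: k_def r_def)
  finally have cw: "cinner w a = (d - c) / (1 - c)" .
  have one: "1 - cinner w a = (1 - d) / (1 - c)" using D unfolding cw by (simp add: field_simps)
  have "invol a w $ j = z $ j" for j
  proof -
    define u where "u = (d - c) / (1 - c) / d * a $ j"
    define v where "v = z $ j - c / d * a $ j"
    have "u = k * (1 - r) * a $ j"
      using d by (simp add: u_def k_def r_def diff_divide_distrib)
    then have "w $ j = u - k * S * v"
      unfolding wj v_def k_def[symmetric] r_def[symmetric] by (simp add: algebra_simps)
    then have wu: "w $ j = u - S * v / (1 - c)" by (simp add: k_def)
    have "invol a w $ j = 1 / ((1 - d) / (1 - c)) * (a $ j - u - S * (w $ j - u))"
      unfolding one[symmetric]
      by (simp only: invol_def proj_def cw u_def d_def S_def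
          vector_minus_component vector_smult_component)
    also have "a $ j - u - S * (w $ j - u) = a $ j - u + (S * S) * v / (1 - c)"
      unfolding wu by (simp add: algebra_simps)
    also have "\<dots> = (1 - d) / (1 - c) * (c / d * a $ j + v)"
    proof -
      have "a $ j - u = (1 - d) / (1 - c) * (c / d * a $ j)"
        using d D unfolding u_def by (simp add: field_simps)
      then show ?thesis unfolding S2 by (simp add: algebra_simps)
    qed
    finally show ?thesis using D d1 by (simp add: v_def)
  qed
  then show ?thesis by (simp add: vec_eq_iff w_def)
qed

text \<open>
  Powers of extended nonnegative reals with positive exponent.  The Green function is
  \<^term>\<open>\<infinity>\<close> on the diagonal.
\<close>

definition epowr :: "ennreal \<Rightarrow> real \<Rightarrow> ennreal" where
  "epowr x a = (if x = \<infinity> then \<infinity> else ennreal (enn2real x powr a))"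

definition green0 :: "complex^'n \<Rightarrow> ennreal" where
  "green0 z = ennreal ((real CARD('n) + 1) / (2 * real CARD('n))) *
     (\<integral>\<^sup>+x\<in>{norm z..1}. ennreal ((1 - x ^ 2) ^ (CARD('n) - 1) / x ^ (2 * CARD('n) - 1)) \<partial>lborel)"

definition green :: "complex^'n \<Rightarrow> complex^'n \<Rightarrow> ennreal" where
  "green z a = green0 (invol a z)"


section \<open>Function spaces\<close>

text \<open>
  All norms are valued in \<^typ>\<open>ennreal\<close>, so that they may be infinite for functions outside the
  space in question.
\<close>

definition besov_term :: "nat \<Rightarrow> real \<Rightarrow> ('n::finite \<Rightarrow> nat) \<Rightarrow> (complex^'n \<Rightarrow> complex) \<Rightarrow> ennreal" where
  "besov_term N t m f =
     (\<integral>\<^sup>+z. ennreal (cmod ((1 - norm z ^ 2) ^ N *\<^sub>R multi_d m f z) powr t) \<partial>inv_vol)"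

definition besov :: "real \<Rightarrow> (complex^'n \<Rightarrow> complex) set" where
  "besov t = {f \<in> hol_ball. \<exists>N>0. real N > real CARD('n) / t \<and>
                (\<forall>m. sum m UNIV = N \<longrightarrow> besov_term N t m f < \<infinity>)}"

definition besov_norm :: "nat \<Rightarrow> real \<Rightarrow> (complex^'n \<Rightarrow> complex) \<Rightarrow> ennreal" where
  "besov_norm N t f =
     (\<Sum>m | sum m UNIV \<le> N - 1. ennreal (cmod (multi_d m f 0))) +
     (\<Sum>m | sum m UNIV = N. epowr (besov_term N t m f) (1 / t))"

definition F_norm :: "real \<Rightarrow> real \<Rightarrow> real \<Rightarrow> (complex^'n \<Rightarrow> complex) \<Rightarrow> ennreal" where
  "F_norm p q s f = epowr
     (ennreal (cmod (f 0) powr p) +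
      (SUP z\<in>ball 0 1. \<integral>\<^sup>+w. ennreal (norm (grad f w) powr p * (1 - norm w ^ 2) powr q)
                                * epowr (green z w) s \<partial>vol))
     (1 / p)"

definition F_space :: "real \<Rightarrow> real \<Rightarrow> real \<Rightarrow> (complex^'n \<Rightarrow> complex) set" where
  "F_space p q s = {f \<in> hol_ball. F_norm p q s f < \<infinity>}"

definition bloch_weight :: "real \<Rightarrow> real \<Rightarrow> (complex^'n \<Rightarrow> complex) \<Rightarrow> complex^'n \<Rightarrow> real" where
  "bloch_weight \<alpha> \<beta> g z =
     cmod (radial_d g z) * (1 - norm z ^ 2) powr \<alpha> * (ln (2 / (1 - norm z ^ 2))) powr \<beta>"

definition bloch_norm :: "real \<Rightarrow> real \<Rightarrow> (complex^'n \<Rightarrow> complex) \<Rightarrow> ennreal" where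
  "bloch_norm \<alpha> \<beta> g = (SUP z\<in>ball 0 1. ennreal (bloch_weight \<alpha> \<beta> g z))"

definition bloch :: "real \<Rightarrow> real \<Rightarrow> (complex^'n \<Rightarrow> complex) set" where
  "bloch \<alpha> \<beta> = {g \<in> hol_ball. bloch_norm \<alpha> \<beta> g < \<infinity>}"

definition to_sphere :: "(complex^'n) filter" where
  "to_sphere = filtercomap norm (at_left 1)"

definition little_bloch :: "real \<Rightarrow> real \<Rightarrow> (complex^'n \<Rightarrow> complex) set" where
  "little_bloch \<alpha> \<beta> = {g \<in> bloch \<alpha> \<beta>. (bloch_weight \<alpha> \<beta> g \<longlongrightarrow> 0) to_sphere}"


section \<open>Operators, essential norm and distance\<close>

type_synonym 'n fn = "(complex, 'n) vec \<Rightarrow> complex"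

definition linear_op :: "('n::finite) fn set \<Rightarrow> ('n fn \<Rightarrow> 'n fn) \<Rightarrow> bool" where
  "linear_op X T \<longleftrightarrow> (\<forall>f\<in>X. \<forall>h\<in>X. \<forall>a b::complex.
     T (\<lambda>z. a * f z + b * h z) = (\<lambda>z. a * T f z + b * T h z))"

definition op_norm :: "('n::finite) fn set \<Rightarrow> ('n fn \<Rightarrow> ennreal) \<Rightarrow> ('n fn \<Rightarrow> ennreal) \<Rightarrow> ('n fn \<Rightarrow> 'n fn) \<Rightarrow> ennreal" where
  "op_norm X nX nY T = (SUP f\<in>{f\<in>X. nX f \<le> 1}. nY (T f))"

text \<open>
  Compactness is tested on norm-bounded sequences that converge to zero uniformly on
  compact subsets of the ball.
\<close>

definition compact_op ::
  "('n::finite) fn set \<Rightarrow> ('n fn \<Rightarrow> ennreal) \<Rightarrow> 'n fn set \<Rightarrow> ('n fn \<Rightarrow> ennreal) \<Rightarrow> ('n fn \<Rightarrow> 'n fn) \<Rightarrow> bool" where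
  "compact_op X nX Y nY K \<longleftrightarrow>
     linear_op X K \<and> K ` X \<subseteq> Y \<and>
     (\<exists>C::real. \<forall>f\<in>X. nY (K f) \<le> ennreal C * nX f) \<and>
     (\<forall>f :: nat \<Rightarrow> 'n fn.
        range f \<subseteq> X \<and> (\<exists>M::real. \<forall>k. nX (f k) \<le> ennreal M) \<and>
        (\<forall>S. compact S \<and> S \<subseteq> ball 0 1 \<longrightarrow> uniform_limit S f (\<lambda>z. 0) sequentially)
        \<longrightarrow> (\<lambda>k. nY (K (f k))) \<longlonglongrightarrow> 0)"

text \<open>
  The essential norm is meaningful only for an operator T that maps X into Y.  For the operator
  \<^term>\<open>T_op g\<close> into \<^term>\<open>F_space p q s\<close> this can fail: with n = CARD('n), the Green function
  has a singularity of order 2 (n - 1) at the pole when n is at least 2, so for n \<le> s (n - 1) the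
  power \<^term>\<open>\<lambda>w. epowr (green z w) s\<close> is not locally integrable there and
  \<^term>\<open>F_space p q s\<close> contains only constants.
\<close>

definition ess_norm ::
  "('n::finite) fn set \<Rightarrow> ('n fn \<Rightarrow> ennreal) \<Rightarrow> 'n fn set \<Rightarrow> ('n fn \<Rightarrow> ennreal) \<Rightarrow> ('n fn \<Rightarrow> 'n fn) \<Rightarrow> ennreal" where
  "ess_norm X nX Y nY T =
     (INF K\<in>{K. compact_op X nX Y nY K}. op_norm X nX nY (\<lambda>f z. T f z - K f z))"

definition dist_to :: "(('n::finite) fn \<Rightarrow> ennreal) \<Rightarrow> 'n fn \<Rightarrow> 'n fn set \<Rightarrow> ennreal" where
  "dist_to nY f X = (INF h\<in>X. nY (\<lambda>z. f z - h z))"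

definition comparable :: "real \<Rightarrow> ennreal \<Rightarrow> ennreal \<Rightarrow> bool" where
  "comparable C A B \<longleftrightarrow> ennreal (inverse C) * B \<le> A \<and> A \<le> ennreal C * B"

end

theory Submission
  imports Defs "HOL-Complex_Analysis.Cauchy_Integral_Formula"
begin

text \<open>
  Since the radial derivative of \<^term>\<open>T_op g f\<close> is \<open>f\<close> times that of \<open>g\<close>, the sharp growth
  \<open>\<bar>f z\<bar> \<le> C \<parallel>f\<parallel> (log (2 / (1 - \<bar>z\<bar>\<^sup>2)))\<^sup>\<beta>\<close> of Besov functions bounds the operator by the Bloch-type
  norm of its symbol, and symbols in the little space give compact operators; this bounds the
  essential norm by the distance.  Dilations \<open>g (r z)\<close> belong to the little space, and the weight is
  almost increasing in \<open>1 - \<bar>z\<bar>\<^sup>2\<close>, so the distance is controlled by the limes superior.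
  Conversely, the functions \<open>log (2 / (1 - \<langle>z, w\<rangle>))\<close>, or \<open>(1 - \<langle>z, w\<rangle>)\<^sup>-\<^sup>N\<close> if \<open>t = 1\<close>, suitably
  normalised, attain the growth bound at \<open>w\<close> and tend to zero locally uniformly as \<open>w\<close> tends to the
  sphere, so compact perturbations cannot lower the limes superior; the point evaluation needed here
  is the mean value inequality on the Bergman ball around \<open>w\<close>, where the Green function is bounded
  below.

  When \<open>n \<le> s (n - 1)\<close> the target space consists of constants, and the hypothesis on the range of
  the operator forces the symbol to be constant.
\<close>

text \<open>Every estimate rests on one invariant integral. For s > 1 and s (n - 1) < n the integral
  of \<open>epowr (green z w) s\<close> against \<open>inv_vol\<close> is finite and independent of
  \<open>z\<close>. Up to constants, the supremum in \<open>F_norm\<close> is then at most a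
  weighted supremum of the gradient, while it always dominates the same weighted supremum of the
  radial derivative, so that the problem becomes pointwise. Invariance of \<open>inv_vol\<close>
  under \<open>invol\<close> also carries the mean value inequality on Bergman balls and the
  integral estimate behind the test functions. It avoids a Jacobian in n variables: a unitary
  reflection moves the centre to a coordinate axis, where the involution is a disc automorphism in
  one coordinate and multiplies the others by a factor depending on that coordinate, so that Tonelli
  and one complex variable suffice. The symbol controls only radial derivatives, but
  \<open>F_norm\<close> contains the full gradient; Cauchy estimates lose one power of
  \<open>1 - norm z\<close>, and the integral defining the operator returns it. For p < 1 the target
  is only quasi-normed, hence the lower bound compares radial derivatives at single points.\<close>

section \<open>Lebesgue measure under affine maps and linear isometries\<close>

lemma nn_integral_lborel_translate:
  fixes F :: "'a::euclidean_space \<Rightarrow> ennreal"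
  assumes [measurable]: "F \<in> borel_measurable borel"
  shows "(\<integral>\<^sup>+x. F (t + x) \<partial>lborel) = (\<integral>\<^sup>+x. F x \<partial>lborel)"
proof -
  have "(\<integral>\<^sup>+x. F x \<partial>lborel) = (\<integral>\<^sup>+x. F x \<partial>density (distr lborel borel (\<lambda>x. t + 1 *\<^sub>R x)) (\<lambda>_. \<bar>1::real\<bar>^DIM('a)))"
    by (subst lborel_affine[of 1 t]) auto
  also have "\<dots> = (\<integral>\<^sup>+x. F (t + x) \<partial>lborel)"
    by (subst nn_integral_density) (auto simp: nn_integral_distr)
  finally show ?thesis ..
qed

lemma nn_integral_lborel_reflect:
  fixes F :: "'a::euclidean_space \<Rightarrow> ennreal"
  assumes [measurable]: "F \<in> borel_measurable borel"
  shows "(\<integral>\<^sup>+x. F (t - x) \<partial>lborel) = (\<integral>\<^sup>+x. F x \<partial>lborel)"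
proof -
  have "(\<integral>\<^sup>+x. F x \<partial>lborel) = (\<integral>\<^sup>+x. F x \<partial>density (distr lborel borel (\<lambda>x. t + (-1) *\<^sub>R x)) (\<lambda>_. \<bar>-1::real\<bar>^DIM('a)))"
    by (subst lborel_affine[of "-1" t]) auto
  also have "\<dots> = (\<integral>\<^sup>+x. F (t - x) \<partial>lborel)"
    by (subst nn_integral_density) (auto simp: nn_integral_distr)
  finally show ?thesis ..
qed

lemma nn_integral_lborel_scaleR:
  fixes F :: "'a::euclidean_space \<Rightarrow> ennreal"
  assumes [measurable]: "F \<in> borel_measurable borel" and c: "c \<noteq> (0::real)"
  shows "ennreal (\<bar>c\<bar>^DIM('a)) * (\<integral>\<^sup>+x. F (c *\<^sub>R x) \<partial>lborel) = (\<integral>\<^sup>+x. F x \<partial>lborel)"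
proof -
  have "(\<integral>\<^sup>+x. F x \<partial>lborel) = (\<integral>\<^sup>+x. F x \<partial>density (distr lborel borel (\<lambda>x. 0 + c *\<^sub>R x)) (\<lambda>_. \<bar>c\<bar>^DIM('a)))"
    by (subst lborel_affine[of c 0]) (use c in auto)
  also have "\<dots> = ennreal (\<bar>c\<bar>^DIM('a)) * (\<integral>\<^sup>+x. F (c *\<^sub>R x) \<partial>lborel)"
    by (subst nn_integral_density) (auto simp: nn_integral_distr nn_integral_cmult)
  finally show ?thesis ..
qed

text \<open>The Fubini argument for the uniqueness of translation invariant measures.\<close>

lemma nn_integral_lborel_linear_proportional:
  fixes F G :: "'a::euclidean_space \<Rightarrow> ennreal" and f :: "'a \<Rightarrow> 'a"
  assumes [measurable]: "F \<in> borel_measurable borel" "G \<in> borel_measurable borel"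
    and f: "linear f" and h: "\<And>x. f (h x) = x"
  shows "(\<integral>\<^sup>+x. F (f x) \<partial>lborel) * (\<integral>\<^sup>+x. G x \<partial>lborel) = (\<integral>\<^sup>+x. G (f x) \<partial>lborel) * (\<integral>\<^sup>+x. F x \<partial>lborel)"
proof -
  have [measurable]: "f \<in> borel_measurable borel"
    using f by (intro borel_measurable_continuous_onI linear_continuous_on) (simp add: linear_conv_bounded_linear)
  have "(\<integral>\<^sup>+x. F (f x) \<partial>lborel) * (\<integral>\<^sup>+x. G x \<partial>lborel) = (\<integral>\<^sup>+x. \<integral>\<^sup>+y. F (f x) * G (f x + y) \<partial>lborel \<partial>lborel)"
    by (simp add: nn_integral_cmult nn_integral_multc nn_integral_lborel_translate)
  also have "\<dots> = (\<integral>\<^sup>+y. \<integral>\<^sup>+x. F (f x) * G (f x + y) \<partial>lborel \<partial>lborel)"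
    by (rule lborel_pair.Fubini') measurable
  also have "\<dots> = (\<integral>\<^sup>+y. \<integral>\<^sup>+x. F (f (- h y + x)) * G (f (- h y + x) + y) \<partial>lborel \<partial>lborel)"
    by (intro nn_integral_cong nn_integral_lborel_translate[symmetric]) measurable
  also have "\<dots> = (\<integral>\<^sup>+y. \<integral>\<^sup>+x. F (f x - y) * G (f x) \<partial>lborel \<partial>lborel)"
    using f by (simp add: linear_diff h)
  also have "\<dots> = (\<integral>\<^sup>+x. \<integral>\<^sup>+y. F (f x - y) * G (f x) \<partial>lborel \<partial>lborel)"
    by (rule lborel_pair.Fubini') measurable
  also have "\<dots> = (\<integral>\<^sup>+x. G (f x) \<partial>lborel) * (\<integral>\<^sup>+x. F x \<partial>lborel)"
    by (simp add: nn_integral_multc nn_integral_lborel_reflect) (simp add: nn_integral_multc mult.commute)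
  finally show ?thesis .
qed

text \<open>By proportionality one test function fixes the factor: the indicator of the unit ball is
  unchanged by \<open>f\<close> and has a finite positive integral, so the factor is 1.\<close>

lemma nn_integral_lborel_isometry:
  fixes F :: "'a::euclidean_space \<Rightarrow> ennreal" and f :: "'a \<Rightarrow> 'a"
  assumes [measurable]: "F \<in> borel_measurable borel"
    and f: "linear f" and h: "\<And>x. f (h x) = x" and n: "\<And>x. norm (f x) = norm x"
  shows "(\<integral>\<^sup>+x. F (f x) \<partial>lborel) = (\<integral>\<^sup>+x. F x \<partial>lborel)"
proof -
  let ?v = "emeasure lborel (ball 0 1 :: 'a set)"
  have v: "(\<integral>\<^sup>+x. indicator (ball 0 1 :: 'a set) x \<partial>lborel) = ?v" by simp
  have "(\<integral>\<^sup>+x. F (f x) \<partial>lborel) * ?v = (\<integral>\<^sup>+x. indicator (ball 0 1) (f x) \<partial>lborel) * (\<integral>\<^sup>+x. F x \<partial>lborel)"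
    unfolding v[symmetric] by (rule nn_integral_lborel_linear_proportional[OF _ _ f h]) (auto intro: borel_measurable_indicator)
  also have "(\<integral>\<^sup>+x. indicator (ball 0 1) (f x) \<partial>lborel) = (\<integral>\<^sup>+x. indicator (ball 0 1 :: 'a set) x \<partial>lborel)"
    by (intro nn_integral_cong) (simp add: indicator_def n)
  finally have "(\<integral>\<^sup>+x. F (f x) \<partial>lborel) * ?v = (\<integral>\<^sup>+x. F x \<partial>lborel) * ?v" by (simp add: mult.commute)
  moreover have "?v \<noteq> 0" "?v \<noteq> \<infinity>"
    using unit_ball_vol_pos[of "real DIM('a)"] by (auto simp: emeasure_ball less_imp_neq[symmetric])
  ultimately show ?thesis
    by (metis ennreal_mult_divide_eq infinity_ennreal_def)
qed

text \<open>Multiplication by \<open>c\<close> is the rotation by \<open>sgn c\<close> followed by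
  the real scaling by \<open>cmod c\<close>; the exponent 2 is the real dimension of the
  plane.\<close>

lemma nn_integral_complex_mult:
  fixes F :: "complex \<Rightarrow> ennreal"
  assumes [measurable]: "F \<in> borel_measurable borel" and c: "c \<noteq> 0"
  shows "ennreal ((cmod c)\<^sup>2) * (\<integral>\<^sup>+x. F (c * x) \<partial>lborel) = (\<integral>\<^sup>+x. F x \<partial>lborel)"
proof -
  have "(\<integral>\<^sup>+x. F (c * x) \<partial>lborel) = (\<integral>\<^sup>+x. F (cmod c *\<^sub>R (sgn c * x)) \<partial>lborel)"
    using c by (simp add: scaleR_conv_of_real mult.assoc[symmetric] sgn_eq)
  also have "\<dots> = (\<integral>\<^sup>+x. F (cmod c *\<^sub>R x) \<partial>lborel)"
    by (rule nn_integral_lborel_isometry[where h="\<lambda>x. x / sgn c"])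
       (use c in \<open>auto intro!: linearI simp: algebra_simps norm_mult norm_sgn sgn_zero_iff\<close>)
  finally have "(\<integral>\<^sup>+x. F (c * x) \<partial>lborel) = (\<integral>\<^sup>+x. F (cmod c *\<^sub>R x) \<partial>lborel)" .
  with nn_integral_lborel_scaleR[of F "cmod c"] c show ?thesis by simp
qed

subsection \<open>Integration over one coordinate\<close>

definition upd :: "'n \<Rightarrow> complex \<Rightarrow> complex^'n \<Rightarrow> complex^'n" where
  "upd k c x = (\<chi> i. if i = k then c else x $ i)"

lemma measurable_vec_PiM [measurable]:
  "(\<lambda>f. \<chi> i. f i) \<in> (\<Pi>\<^sub>M i\<in>(UNIV::'n::finite set). (lborel::complex measure)) \<rightarrow>\<^sub>M borel"
proof -
    have "(\<lambda>f. \<Sum>i\<in>UNIV. axis i (f i)) \<in> (\<Pi>\<^sub>M i\<in>(UNIV::'n::finite set). (lborel::complex measure)) \<rightarrow>\<^sub>M borel"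
    proof (rule borel_measurable_sum)
      fix i :: 'n
      have [measurable]: "(\<lambda>c::complex. axis i c) \<in> borel \<rightarrow>\<^sub>M borel"
        by (intro borel_measurable_continuous_onI bounded_linear.continuous_on[OF _ continuous_on_id] linear_conv_bounded_linear[THEN iffD1])
           (auto intro!: linearI simp: vec_eq_iff axis_def)
      show "(\<lambda>f. axis i (f i)) \<in> (\<Pi>\<^sub>M i\<in>UNIV. (lborel::complex measure)) \<rightarrow>\<^sub>M borel" by measurable
    qed
    also have "(\<lambda>f. \<Sum>i\<in>UNIV. axis i (f i)) = (\<lambda>f. \<chi> i. (f i :: complex))"
      by (auto simp: fun_eq_iff vec_eq_iff axis_def if_distrib cong: if_cong)
    finally show ?thesis .
qed

text \<open>Makes Tonelli available for one coordinate at a time. Both measures agree on boxes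
  because the basis of \<open>complex^'n\<close> is the disjoint union of the bases of the
  coordinate planes.\<close>

lemma lborel_vec_PiM:
  "(lborel :: (complex^'n) measure) = distr (\<Pi>\<^sub>M i\<in>(UNIV::'n set). lborel) borel (\<lambda>f. \<chi> i. f i)"
proof (rule lborel_eqI)
  interpret product_sigma_finite "\<lambda>_::'n. lborel :: complex measure" by standard
  fix l u :: "complex^'n" assume le: "\<And>b. b \<in> Basis \<Longrightarrow> l \<bullet> b \<le> u \<bullet> b"
  have B: "Basis = (\<Union>i\<in>(UNIV::'n set). axis i ` (Basis :: complex set))" by (auto simp: Basis_vec_def)
  have leb: "\<And>i b. b \<in> Basis \<Longrightarrow> l $ i \<bullet> b \<le> u $ i \<bullet> b"
  proof -
    fix i :: 'n and b :: complex assume "b \<in> Basis"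
    then have "axis i b \<in> Basis" by (auto simp: B)
    from le[OF this] show "l $ i \<bullet> b \<le> u $ i \<bullet> b" by (simp add: inner_axis)
  qed
  have box: "(\<lambda>f. \<chi> i. f i) -` box l u = (\<Pi>\<^sub>E i\<in>UNIV. box (l $ i) (u $ i))"
    by (auto simp: box_def B inner_axis PiE_def Pi_def)
  have "emeasure (distr (\<Pi>\<^sub>M i\<in>(UNIV::'n set). lborel) borel (\<lambda>f. \<chi> i. f i)) (box l u)
      = emeasure (\<Pi>\<^sub>M i\<in>(UNIV::'n set). lborel) (\<Pi>\<^sub>E i\<in>UNIV. box (l $ i) (u $ i))"
    by (subst emeasure_distr) (auto simp: box space_PiM)
  also have "\<dots> = (\<Prod>i\<in>UNIV. emeasure lborel (box (l $ i) (u $ i)))"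
    by (rule emeasure_PiM) auto
  also have "\<dots> = (\<Prod>i\<in>UNIV. ennreal (\<Prod>b\<in>Basis. (u $ i - l $ i) \<bullet> b))"
    using leb by (intro prod.cong refl) (simp add: emeasure_lborel_box)
  also have "\<dots> = ennreal (\<Prod>i\<in>UNIV. \<Prod>b\<in>Basis. (u $ i - l $ i) \<bullet> b)"
    using leb by (intro prod_ennreal prod_nonneg) (auto simp: inner_diff_left)
  also have "(\<Prod>i\<in>UNIV. \<Prod>b\<in>Basis. (u $ i - l $ i) \<bullet> b) = (\<Prod>b\<in>Basis. (u - l) \<bullet> b)"
    unfolding B
    by (subst prod.UNION_disjoint)
       (auto simp: axis_eq_axis prod.reindex inj_on_def inner_axis nonzero_Basis intro!: prod.cong)
  finally show "emeasure (distr (\<Pi>\<^sub>M i\<in>(UNIV::'n set). lborel) borel (\<lambda>f. \<chi> i. f i)) (box l u)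
      = ennreal (\<Prod>b\<in>Basis. (u - l) \<bullet> b)" .
qed simp

lemma nn_integral_coordinate:
  fixes F :: "complex^'n \<Rightarrow> ennreal"
  assumes [measurable]: "F \<in> borel_measurable borel"
  shows "(\<integral>\<^sup>+x. F x \<partial>lborel) =
    (\<integral>\<^sup>+f. \<integral>\<^sup>+c. F (upd k c (\<chi> i. f i)) \<partial>lborel \<partial>(\<Pi>\<^sub>M i\<in>UNIV - {k}. lborel))"
proof -
  interpret product_sigma_finite "\<lambda>_::'n. lborel :: complex measure" by standard
  have k: "insert k (UNIV - {k}) = UNIV" by auto
  have "(\<integral>\<^sup>+x. F x \<partial>lborel) = (\<integral>\<^sup>+f. F (\<chi> i. f i) \<partial>(\<Pi>\<^sub>M i\<in>insert k (UNIV - {k}). lborel))"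
    unfolding k by (subst lborel_vec_PiM) (subst nn_integral_distr; simp)
  also have "\<dots> = (\<integral>\<^sup>+f. \<integral>\<^sup>+c. F (\<chi> i. (f(k := c)) i) \<partial>lborel \<partial>(\<Pi>\<^sub>M i\<in>UNIV - {k}. lborel))"
    by (rule product_nn_integral_insert) (auto simp: k)
  also have "\<dots> = (\<integral>\<^sup>+f. \<integral>\<^sup>+c. F (upd k c (\<chi> i. f i)) \<partial>lborel \<partial>(\<Pi>\<^sub>M i\<in>UNIV - {k}. lborel))"
    by (intro nn_integral_cong arg_cong[where f=F]) (auto simp: upd_def vec_eq_iff)
  finally show ?thesis .
qed

text \<open>The form in which the coordinate changes below are applied: a substitution in the
  coordinate \<open>k\<close>, with the others frozen in \<open>x\<close>.\<close>

lemma nn_integral_coordinate_cong: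
  fixes F G :: "complex^'n \<Rightarrow> ennreal"
  assumes "F \<in> borel_measurable borel" "G \<in> borel_measurable borel"
    and "\<And>x. (\<integral>\<^sup>+c. F (upd k c x) \<partial>lborel) = (\<integral>\<^sup>+c. G (upd k c x) \<partial>lborel)"
  shows "(\<integral>\<^sup>+x. F x \<partial>lborel) = (\<integral>\<^sup>+x. G x \<partial>lborel)"
  using assms by (simp add: nn_integral_coordinate[where k=k])

subsection \<open>Biholomorphic changes of variables\<close>

text \<open>The plane as \<open>real^2\<close>, where the Jacobian of a map is the determinant of a
  matrix.\<close>

definition cvec :: "complex \<Rightarrow> real^2" where "cvec z = vector [Re z, Im z]"
definition vecc :: "real^2 \<Rightarrow> complex" where "vecc x = Complex (x$1) (x$2)"

lemma vecc_cvec [simp]: "vecc (cvec z) = z" and cvec_vecc [simp]: "cvec (vecc x) = x"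
  by (auto simp: cvec_def vecc_def vec_eq_iff forall_2)

lemma cvec_eq_iff [simp]: "cvec x = cvec y \<longleftrightarrow> x = y"
  by (metis vecc_cvec)

lemma pred_ball [measurable]: "Measurable.pred borel (\<lambda>x. x \<in> ball (c :: 'a::euclidean_space) r)"
  and indicator_ball_measurable [measurable, simp]:
    "(indicator (ball c r) :: 'a \<Rightarrow> ennreal) \<in> borel_measurable borel"
  by (auto intro!: borel_measurable_indicator simp: pred_def)

lemma bounded_linear_cvec: "bounded_linear cvec" and bounded_linear_vecc: "bounded_linear vecc"
  by (auto simp: linear_conv_bounded_linear[symmetric] cvec_def vecc_def vec_eq_iff forall_2
      complex_eq_iff intro!: linearI)

lemma measurable_cvec [measurable]: "cvec \<in> borel_measurable borel"
  and measurable_vecc [measurable]: "vecc \<in> borel_measurable borel"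
  by (auto intro!: borel_measurable_continuous_onI linear_continuous_on bounded_linear_cvec bounded_linear_vecc)

lemma lborel_vecc: "(lborel :: complex measure) = distr lborel borel vecc"
proof (rule lborel_eqI)
  fix l u :: complex assume le: "\<And>b. b \<in> Basis \<Longrightarrow> l \<bullet> b \<le> u \<bullet> b"
  have B: "(Basis :: (real^2) set) = {axis 1 1, axis 2 1}" "axis 1 1 \<noteq> (axis 2 1 :: real^2)"
    by (auto simp: Basis_vec_def UNIV_2 axis_eq_axis)
  have le': "Re l \<le> Re u" "Im l \<le> Im u" using le[of 1] le[of \<i>] by (auto simp: Basis_complex_def)
  have box: "vecc -` box l u = box (cvec l) (cvec u)"
    by (auto simp: box_def Basis_complex_def B inner_axis cvec_def vecc_def)
  have "emeasure (distr lborel borel vecc) (box l u) = emeasure lborel (box (cvec l) (cvec u))"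
    by (subst emeasure_distr) (auto simp: box)
  also have "\<dots> = ennreal ((Re u - Re l) * (Im u - Im l))"
    by (subst emeasure_lborel_box) (use le' B(2) in \<open>auto simp: B inner_axis cvec_def inner_diff_left\<close>)
  also have "(Re u - Re l) * (Im u - Im l) = (\<Prod>b\<in>Basis. (u - l) \<bullet> b)"
    by (simp add: Basis_complex_def)
  finally show "emeasure (distr lborel borel vecc) (box l u) = ennreal (\<Prod>b\<in>Basis. (u - l) \<bullet> b)" .
qed simp

text \<open>The real Jacobian of a holomorphic map is the determinant of multiplication by
  \<open>f' z\<close>, which is \<open>(cmod (f' z))\<^sup>2\<close>.\<close>

lemma nn_integral_holomorphic_image:
  fixes f f' :: "complex \<Rightarrow> complex"
  assumes S[measurable]: "S \<in> sets borel" and im[measurable]: "f ` S \<in> sets borel"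
    and d: "\<And>z. z \<in> S \<Longrightarrow> (f has_field_derivative f' z) (at z)" and inj: "inj_on f S"
    and [measurable]: "f' \<in> borel_measurable borel" and fin: "emeasure lborel (f ` S) < \<infinity>"
  shows "(\<integral>\<^sup>+z. ennreal ((cmod (f' z))\<^sup>2) * indicator S z \<partial>lborel) = emeasure lborel (f ` S)"
proof -
  define R where "R = cvec ` S"
  define F where "F = cvec \<circ> f \<circ> vecc"
  define F' where "F' = (\<lambda>x h. cvec (f' (vecc x) * vecc h))"
  have cv: "cvec ` X = vecc -` X" for X by (auto simp: image_iff) (metis cvec_vecc)
  have R: "R = vecc -` S" unfolding R_def by (rule cv)
  have FR: "F ` R = vecc -` (f ` S)" unfolding cv[symmetric] by (simp add: R_def F_def image_comp o_def)
  have [measurable]: "R \<in> sets borel"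
    unfolding R using measurable_sets[OF measurable_vecc S] by simp
  have [measurable]: "F ` R \<in> sets borel"
    unfolding FR using measurable_sets[OF measurable_vecc im] by simp
  have em: "emeasure lborel (F ` R) = emeasure lborel (f ` S)"
    unfolding FR by (subst lborel_vecc) (simp add: emeasure_distr)
  have der: "(F has_derivative F' x) (at x within R)" if "x \<in> R" for x
  proof -
    have "(f has_derivative (*) (f' (vecc x))) (at (vecc x))"
      using d[of "vecc x"] that by (simp add: R has_field_derivative_def)
    from has_derivative_compose[OF bounded_linear_imp_has_derivative[OF bounded_linear_vecc] this]
    have "((\<lambda>x. f (vecc x)) has_derivative (\<lambda>h. f' (vecc x) * vecc h)) (at x)" by simp
    from has_derivative_compose[OF this bounded_linear_imp_has_derivative[OF bounded_linear_cvec]]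
    show ?thesis unfolding F_def F'_def by (simp add: o_def has_derivative_at_withinI)
  qed
  have injF: "inj_on F R"
    using inj unfolding inj_on_def F_def R_def by auto
  have vecc_axis: "vecc (axis 1 1) = 1" "vecc (axis 2 1) = \<i>"
    by (auto simp: vecc_def axis_def complex_eq_iff)
  have det: "\<bar>det (matrix (F' x))\<bar> = (cmod (f' (vecc x)))\<^sup>2" for x
    unfolding cmod_power2 by (simp add: det_2 matrix_def F'_def vecc_axis cvec_def power2_eq_square)
  have "F ` R \<in> lmeasurable"
    unfolding fmeasurable_def using fin by (auto simp: em)
  then have "((\<lambda>x. \<bar>det (matrix (F' x))\<bar>) has_integral measure lebesgue (F ` R)) R"
    using has_measure_differentiable_image[of R F F' "measure lebesgue (F ` R)"] der injF by auto
  then have "(\<integral>\<^sup>+x. ennreal ((cmod (f' (vecc x)))\<^sup>2) * indicator R x \<partial>lborel) = ennreal (measure lebesgue (F ` R))"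
    unfolding det by (intro nn_integral_has_integral_lebesgue') auto
  also have "ennreal (measure lebesgue (F ` R)) = emeasure lborel (F ` R)"
    using emeasure_eq_ennreal_measure[of lborel "F ` R"] fin em by auto
  also have "(\<integral>\<^sup>+x. ennreal ((cmod (f' (vecc x)))\<^sup>2) * indicator R x \<partial>lborel)
     = (\<integral>\<^sup>+x. ennreal ((cmod (f' (vecc x)))\<^sup>2) * indicator S (vecc x) \<partial>lborel)"
    by (intro nn_integral_cong) (simp add: R indicator_def)
  also have "\<dots> = (\<integral>\<^sup>+z. ennreal ((cmod (f' z))\<^sup>2) * indicator S z \<partial>distr lborel borel vecc)"
    by (subst nn_integral_distr) auto
  finally show ?thesis unfolding em lborel_vecc[symmetric] .
qed

section \<open>The involutive automorphisms of the disc\<close>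

definition moeb :: "complex \<Rightarrow> complex \<Rightarrow> complex" where
  "moeb c z = (c - z) / (1 - cnj c * z)"

definition moebd :: "complex \<Rightarrow> complex \<Rightarrow> complex" where
  "moebd c z = - (of_real (1 - (cmod c)\<^sup>2)) / (1 - cnj c * z)\<^sup>2"

lemma one_minus_mult_neq_0:
  fixes c z :: complex assumes "cmod c < 1" "cmod z < 1" shows "1 - cnj c * z \<noteq> 0"
proof
  assume "1 - cnj c * z = 0"
  then have "cmod (cnj c * z) = 1" by simp
  moreover have "cmod (cnj c * z) < 1 * 1" unfolding norm_mult using assms by (intro mult_strict_mono) auto
  ultimately show False by simp
qed

lemma moeb_norm:
  assumes "cmod c < 1" "cmod z < 1"
  shows "1 - (cmod (moeb c z))\<^sup>2 = (1 - (cmod c)\<^sup>2) * (1 - (cmod z)\<^sup>2) / (cmod (1 - cnj c * z))\<^sup>2"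
proof -
  have nz: "(cmod (1 - cnj c * z))\<^sup>2 \<noteq> 0" using one_minus_mult_neq_0[OF assms] by simp
  have "(cmod (1 - cnj c * z))\<^sup>2 - (cmod (c - z))\<^sup>2 = (1 - (cmod c)\<^sup>2) * (1 - (cmod z)\<^sup>2)"
    unfolding cmod_power2 by (simp add: algebra_simps power2_eq_square)
  then show ?thesis using nz by (simp add: moeb_def norm_divide power_divide field_simps)
qed

lemma moeb_disc:
  assumes "cmod c < 1" "cmod z < 1" shows "cmod (moeb c z) < 1"
proof -
  have "1 - (cmod (moeb c z))\<^sup>2 > 0"
    unfolding moeb_norm[OF assms] using assms one_minus_mult_neq_0[OF assms]
    by (intro divide_pos_pos mult_pos_pos) (auto simp: power_less_one_iff abs_square_less_1)
  then show ?thesis by (simp add: abs_square_less_1)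
qed

lemma moeb_moeb:
  assumes "cmod c < 1" "cmod z < 1" shows "moeb c (moeb c z) = z"
proof -
  define d where "d = 1 - cnj c * z"
  have d: "d \<noteq> 0" unfolding d_def by (rule one_minus_mult_neq_0[OF assms])
  have e: "1 - cnj c * c \<noteq> 0" using one_minus_mult_neq_0[OF assms(1) assms(1)] by simp
  have "c - moeb c z = (c * d - (c - z)) / d" "1 - cnj c * moeb c z = (d - cnj c * (c - z)) / d"
    unfolding moeb_def d_def[symmetric] using d by (simp_all add: field_simps)
  moreover have "c * d - (c - z) = z * (1 - cnj c * c)" "d - cnj c * (c - z) = 1 - cnj c * c"
    by (simp_all add: d_def algebra_simps)
  ultimately show ?thesis using d e by (simp add: moeb_def[of c "moeb c z"])
qed

lemma moeb_deriv:
  assumes "cmod c < 1" "cmod z < 1" shows "(moeb c has_field_derivative moebd c z) (at z)"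
proof -
  have nz: "1 - cnj c * z \<noteq> 0" by (rule one_minus_mult_neq_0[OF assms])
  have "(moeb c has_field_derivative ((0 - 1) * (1 - cnj c * z) - (c - z) * (0 - cnj c * 1)) / ((1 - cnj c * z) * (1 - cnj c * z))) (at z)"
    unfolding moeb_def[abs_def] using nz by (intro derivative_intros) auto
  moreover have "(0 - 1) * (1 - cnj c * z) - (c - z) * (0 - cnj c * 1) = - of_real (1 - (cmod c)\<^sup>2)"
    unfolding of_real_diff of_real_1 complex_norm_square by (simp add: algebra_simps)
  ultimately show ?thesis by (simp only: moebd_def power2_eq_square)
qed

text \<open>The weighted measure is pushed forward by \<open>moeb c\<close> and compared with
  Lebesgue measure on Borel sets. As \<open>moeb c\<close> is its own inverse on the disc,
  \<open>A \<inter> ball 0 1\<close> is the image of its preimage \<open>S\<close>, and the area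
  formula applies.\<close>

lemma nn_integral_moeb:
  fixes F :: "complex \<Rightarrow> ennreal"
  assumes c: "cmod c < 1" and F[measurable]: "F \<in> borel_measurable borel"
  shows "(\<integral>\<^sup>+z. F (moeb c z) * (ennreal ((cmod (moebd c z))\<^sup>2) * indicator (ball 0 1) z) \<partial>lborel)
    = (\<integral>\<^sup>+z. F z * indicator (ball 0 1) z \<partial>lborel)"
proof -
  have [measurable]: "moeb c \<in> borel_measurable borel" "moebd c \<in> borel_measurable borel"
    unfolding moeb_def[abs_def] moebd_def[abs_def] by measurable
  let ?D = "density lborel (\<lambda>z. ennreal ((cmod (moebd c z))\<^sup>2) * indicator (ball 0 1) z)"
  have eq: "distr ?D borel (moeb c) = density lborel (indicator (ball 0 1))"
  proof (rule measure_eqI)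
    fix A assume "A \<in> sets (distr ?D borel (moeb c))"
    then have [measurable]: "A \<in> sets borel" by simp
    have [measurable]: "moeb c -` A \<in> sets borel"
      using measurable_sets[of "moeb c" borel borel A] by simp
    define S where "S = moeb c -` A \<inter> ball 0 1"
    have [measurable]: "S \<in> sets borel"
      unfolding S_def by measurable
    have im: "moeb c ` S = A \<inter> ball 0 1"
    proof
      show "moeb c ` S \<subseteq> A \<inter> ball 0 1" using moeb_disc[OF c] by (auto simp: S_def)
      show "A \<inter> ball 0 1 \<subseteq> moeb c ` S"
        using moeb_disc[OF c] moeb_moeb[OF c] by (force simp: S_def image_iff)
    qed
    have "emeasure (distr ?D borel (moeb c)) A = (\<integral>\<^sup>+z. ennreal ((cmod (moebd c z))\<^sup>2) * indicator S z \<partial>lborel)"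
    proof -
      have "emeasure (distr ?D borel (moeb c)) A = emeasure ?D (moeb c -` A)"
        by (subst emeasure_distr) auto
      also have "\<dots> = (\<integral>\<^sup>+z. ennreal ((cmod (moebd c z))\<^sup>2) * indicator (ball 0 1) z * indicator (moeb c -` A) z \<partial>lborel)"
        by (rule emeasure_density; measurable)
      also have "\<dots> = (\<integral>\<^sup>+z. ennreal ((cmod (moebd c z))\<^sup>2) * indicator S z \<partial>lborel)"
        by (intro nn_integral_cong) (auto simp: S_def indicator_def)
      finally show ?thesis .
    qed
    also have "\<dots> = emeasure lborel (moeb c ` S)"
    proof (rule nn_integral_holomorphic_image)
      show "inj_on (moeb c) S" using moeb_moeb[OF c] by (intro inj_on_inverseI[of _ "moeb c"]) (auto simp: S_def)
      show "emeasure lborel (moeb c ` S) < \<infinity>"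
        unfolding im using emeasure_mono[of "A \<inter> ball 0 1" "ball 0 1" lborel] emeasure_lborel_ball_finite[of "0::complex" 1]
        by (auto intro: le_less_trans)
      show "moeb c ` S \<in> sets borel" unfolding im by simp
    qed (auto simp: S_def intro!: moeb_deriv[OF c])
    also have "\<dots> = emeasure (density lborel (indicator (ball 0 1))) A"
      unfolding im by (simp add: emeasure_density indicator_inter_arith[symmetric] Int_commute)
    finally show "emeasure (distr ?D borel (moeb c)) A = emeasure (density lborel (indicator (ball 0 1))) A" .
  qed simp
  have "(\<integral>\<^sup>+z. F (moeb c z) * (ennreal ((cmod (moebd c z))\<^sup>2) * indicator (ball 0 1) z) \<partial>lborel)
    = (\<integral>\<^sup>+z. F z \<partial>distr ?D borel (moeb c))"
    by (subst nn_integral_distr, simp, simp, subst nn_integral_density, measurable, measurable) (simp add: mult.commute)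
  also have "\<dots> = (\<integral>\<^sup>+z. F z * indicator (ball 0 1) z \<partial>lborel)"
    unfolding eq by (subst nn_integral_density, measurable, measurable) (simp add: mult.commute)
  finally show ?thesis .
qed

subsection \<open>The involutions of the ball\<close>

lemma upd_nth [simp]: "upd k c x $ i = (if i = k then c else x $ i)" by (simp add: upd_def)

lemma upd_sum: "upd k c x = x - axis k (x $ k) + axis k c"
  by (auto simp: vec_eq_iff axis_def)

lemma measurable_axis [measurable]: "(\<lambda>c::complex. axis (k::'n::finite) c) \<in> borel \<rightarrow>\<^sub>M borel"
  by (intro borel_measurable_continuous_onI linear_continuous_on linear_conv_bounded_linear[THEN iffD1])
     (auto intro!: linearI simp: vec_eq_iff axis_def)

lemma measurable_upd [measurable]:
  assumes [measurable]: "f \<in> borel_measurable M" "h \<in> borel_measurable M"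
  shows "(\<lambda>x. upd k (f x) (h x :: complex^'n)) \<in> M \<rightarrow>\<^sub>M borel"
proof -
  have [measurable]: "(\<lambda>x. x $ k) \<in> borel_measurable (borel :: (complex^'n) measure)"
    by (intro borel_measurable_continuous_onI continuous_intros)
  show ?thesis unfolding upd_sum by measurable
qed

definition slab :: "'n \<Rightarrow> (complex^'n) set" where "slab j = {x. cmod (x $ j) < 1}"

text \<open>The action of \<open>invol (axis j c)\<close> on the coordinates other than
  \<open>j\<close>, with \<open>\<kappa>\<close> in the role of the common factor.\<close>

definition ball_shear :: "'n \<Rightarrow> (complex \<Rightarrow> complex) \<Rightarrow> 'n set \<Rightarrow> complex^'n \<Rightarrow> complex^'n" where
  "ball_shear j \<kappa> K x = (\<chi> k. if k \<in> K then \<kappa> (x $ j) * x $ k else x $ k)"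

lemma measurable_vec_nth [measurable]:
  "(\<lambda>x. x $ k) \<in> borel_measurable (borel :: (complex^'n) measure)"
  by (intro borel_measurable_continuous_onI continuous_intros)

lemma sum_axis: "(\<Sum>k\<in>UNIV. axis k (g k)) = (\<chi> k. (g k :: complex))"
  by (auto simp: fun_eq_iff vec_eq_iff axis_def if_distrib cong: if_cong)

lemma measurable_ball_shear [measurable]:
  fixes j :: "'n::finite"
  assumes [measurable]: "\<kappa> \<in> borel_measurable borel"
  shows "ball_shear j \<kappa> K \<in> borel_measurable borel"
proof -
  have "ball_shear j \<kappa> K x = (\<Sum>k\<in>UNIV. axis k (if k \<in> K then \<kappa> (x $ j) * x $ k else x $ k))" for x
    unfolding sum_axis ball_shear_def ..
  then show ?thesis by (subst ball_shear_def[abs_def]) (simp add: ball_shear_def[symmetric], measurable)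
qed

text \<open>Multiplying the coordinates in \<open>K\<close> by factors that depend on the coordinate \<open>j\<close> only.\<close>

lemma nn_integral_ball_shear:
  fixes F :: "complex^'n \<Rightarrow> ennreal" and w :: "complex \<Rightarrow> ennreal"
  assumes \<kappa>[measurable]: "\<kappa> \<in> borel_measurable borel" and nz: "\<And>z. \<kappa> z \<noteq> 0"
    and [measurable]: "F \<in> borel_measurable borel" "w \<in> borel_measurable borel"
    and K: "finite K" "j \<notin> K"
  shows "(\<integral>\<^sup>+x. F (ball_shear j \<kappa> K x) * (w (x $ j) * ennreal (((cmod (\<kappa> (x $ j)))\<^sup>2) ^ card K)) \<partial>lborel)
    = (\<integral>\<^sup>+x. F x * w (x $ j) \<partial>lborel)"
  using K
proof (induction K rule: finite_induct)
  case empty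
  have "ball_shear j \<kappa> {} x = x" for x by (simp add: ball_shear_def vec_eq_iff)
  then show ?case by simp
next
  case (insert k K)
  then have jk: "j \<noteq> k" "j \<notin> K" "k \<notin> K" by auto
  have "(\<integral>\<^sup>+x. F (ball_shear j \<kappa> (insert k K) x) * (w (x $ j) * ennreal (((cmod (\<kappa> (x $ j)))\<^sup>2) ^ card (insert k K))) \<partial>lborel)
    = (\<integral>\<^sup>+x. F (ball_shear j \<kappa> K x) * (w (x $ j) * ennreal (((cmod (\<kappa> (x $ j)))\<^sup>2) ^ card K)) \<partial>lborel)"
  \<comment> \<open>With the coordinate \<open>j\<close> frozen, the coordinate \<open>k\<close> is
    multiplied by a constant, at the cost of one factor
    \<open>(cmod (\<kappa> (x $ j)))\<^sup>2\<close>.\<close>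
  proof (rule nn_integral_coordinate_cong[where k=k])
    fix x :: "complex^'n"
    let ?c = "\<kappa> (x $ j)"
    define G where "G = (\<lambda>c. F (upd k c (ball_shear j \<kappa> K x)))"
    have [measurable]: "G \<in> borel_measurable borel" unfolding G_def by measurable
    have 1: "ball_shear j \<kappa> (insert k K) (upd k c x) = upd k (?c * c) (ball_shear j \<kappa> K x)"
      and 2: "ball_shear j \<kappa> K (upd k c x) = upd k c (ball_shear j \<kappa> K x)" for c
      using jk by (auto simp: ball_shear_def vec_eq_iff)
    have "(\<integral>\<^sup>+c. F (ball_shear j \<kappa> (insert k K) (upd k c x)) * (w (upd k c x $ j) * ennreal (((cmod (\<kappa> (upd k c x $ j)))\<^sup>2) ^ card (insert k K))) \<partial>lborel)
      = (\<integral>\<^sup>+c. G (?c * c) * (w (x $ j) * ennreal (((cmod ?c)\<^sup>2) ^ Suc (card K))) \<partial>lborel)"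
      using jk insert.hyps by (intro nn_integral_cong) (simp add: 1 G_def)
    also have "\<dots> = (ennreal ((cmod ?c)\<^sup>2) * (\<integral>\<^sup>+c. G (?c * c) \<partial>lborel)) * (w (x $ j) * ennreal (((cmod ?c)\<^sup>2) ^ card K))"
      by (subst nn_integral_multc; simp add: ennreal_mult mult_ac)
    also have "ennreal ((cmod ?c)\<^sup>2) * (\<integral>\<^sup>+c. G (?c * c) \<partial>lborel) = (\<integral>\<^sup>+c. G c \<partial>lborel)"
      by (rule nn_integral_complex_mult) (use nz in auto)
    also have "(\<integral>\<^sup>+c. G c \<partial>lborel) * (w (x $ j) * ennreal (((cmod ?c)\<^sup>2) ^ card K))
      = (\<integral>\<^sup>+c. G c * (w (x $ j) * ennreal (((cmod ?c)\<^sup>2) ^ card K)) \<partial>lborel)"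
      by (simp add: nn_integral_multc)
    also have "\<dots> = (\<integral>\<^sup>+c. F (ball_shear j \<kappa> K (upd k c x)) * (w (upd k c x $ j) * ennreal (((cmod (\<kappa> (upd k c x $ j)))\<^sup>2) ^ card K)) \<partial>lborel)"
      using jk by (intro nn_integral_cong) (simp add: 2 G_def)
    finally show "(\<integral>\<^sup>+c. F (ball_shear j \<kappa> (insert k K) (upd k c x)) * (w (upd k c x $ j) * ennreal (((cmod (\<kappa> (upd k c x $ j)))\<^sup>2) ^ card (insert k K))) \<partial>lborel)
      = (\<integral>\<^sup>+c. F (ball_shear j \<kappa> K (upd k c x)) * (w (upd k c x $ j) * ennreal (((cmod (\<kappa> (upd k c x $ j)))\<^sup>2) ^ card K)) \<partial>lborel)" .
  qed measurable
  with insert show ?case by simp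
qed

lemma one_minus_norm_pos: "norm (z :: 'a::real_normed_vector) < 1 \<Longrightarrow> 0 < 1 - (norm z)\<^sup>2"
  by (simp add: abs_square_less_1)

lemma norm_vec_split:
  fixes x :: "complex^'n"
  shows "(norm x)\<^sup>2 = (cmod (x $ j))\<^sup>2 + (\<Sum>k\<in>UNIV - {j}. (cmod (x $ k))\<^sup>2)"
proof -
  have "(norm x)\<^sup>2 = (\<Sum>k\<in>UNIV. (cmod (x $ k))\<^sup>2)"
    by (simp add: norm_vec_def L2_set_def sum_nonneg)
  then show ?thesis by (simp add: sum.remove[of UNIV j])
qed

lemma cinner_axis: "cinner z (axis j c) = z $ j * cnj c"
  by (simp add: cinner_def axis_def if_distrib cong: if_cong)

lemma cinner_commute: "cinner z w = cnj (cinner w z)"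
  by (simp add: cinner_def mult.commute)

lemma cinner_add_left: "cinner (x + y) w = cinner x w + cinner y w"
  and cinner_diff_left: "cinner (x - y) w = cinner x w - cinner y w"
  and cinner_scale_left: "cinner (c *s x) w = c * cinner x w"
  and cinner_add_right: "cinner w (x + y) = cinner w x + cinner w y"
  and cinner_diff_right: "cinner w (x - y) = cinner w x - cinner w y"
  and cinner_scale_right: "cinner w (c *s x) = cnj c * cinner w x"
  by (simp_all add: cinner_def algebra_simps sum.distrib sum_subtractf sum_distrib_left)

lemma cinner_0 [simp]: "cinner 0 w = 0" "cinner w 0 = 0" by (simp_all add: cinner_def)

lemma norm_cinner_le: "cmod (cinner z w) \<le> norm z * norm w"
proof -
  have "cmod (cinner z w) \<le> (\<Sum>j\<in>UNIV. \<bar>cmod (z $ j)\<bar> * \<bar>cmod (w $ j)\<bar>)"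
    unfolding cinner_def by (rule order_trans[OF norm_sum]) (simp add: norm_mult)
  also have "\<dots> \<le> norm z * norm w"
    unfolding norm_vec_def by (rule L2_set_mult_ineq)
  finally show ?thesis .
qed

lemma one_minus_cinner_neq_0:
  assumes "norm z < 1" "norm w < 1" shows "1 - cinner z w \<noteq> 0"
proof
  assume "1 - cinner z w = 0"
  then have "cmod (cinner z w) = 1" by simp
  moreover have "norm z * norm w < 1 * 1" using assms by (intro mult_strict_mono') auto
  ultimately show False using norm_cinner_le[of z w] by simp
qed

text \<open>The numerator of \<open>invol a z\<close> is the sum of \<open>p\<close>, along
  \<open>a\<close>, and a multiple of \<open>y\<close>, orthogonal to \<open>a\<close>, so its norm
  follows from Pythagoras. The case a = 0 is carried along: there \<open>d = 0\<close> forces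
  \<open>c = 0\<close>, and the divisions by \<open>d\<close> give 0.\<close>

lemma norm_invol:
  assumes a: "norm a < 1" and z: "norm z < 1"
  shows "1 - (norm (invol a z))\<^sup>2 = (1 - (norm a)\<^sup>2) * (1 - (norm z)\<^sup>2) / (cmod (1 - cinner z a))\<^sup>2"
proof -
  define S where "S = complex_of_real (sqrt (1 - (norm a)\<^sup>2))"
  define c where "c = cinner z a"
  define d where "d = cinner a a"
  define e where "e = cinner z z"
  define k where "k = 1 / (1 - c)"
  define y where "y = z - proj a z"
  define p where "p = a - proj a z"
  have D: "1 - c \<noteq> 0" unfolding c_def by (rule one_minus_cinner_neq_0[OF z a])
  have S2: "S * S = 1 - d" "cnj S = S"
    unfolding S_def d_def cinner_self of_real_mult[symmetric] using one_minus_norm_pos[OF a] by simp_all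
  have cd: "cnj d = d" "cinner a z = cnj c" unfolding d_def c_def by (simp_all add: cinner_self cinner_commute[of a])
  have c0: "c = 0" if "d = 0" using that by (simp add: d_def c_def cinner_self)
  have pp: "cinner (proj a z) (proj a z) = c * cnj c / d" "cinner z (proj a z) = c * cnj c / d"
     "cinner (proj a z) z = c * cnj c / d" "cinner a (proj a z) = cnj c" "cinner (proj a z) a = c"
    unfolding proj_def c_def[symmetric] d_def[symmetric] using c0
    by (auto simp: cinner_scale_left cinner_scale_right cd c_def[symmetric] d_def[symmetric])
  have yy: "cinner y y = e - c * cnj c / d" "cinner p y = 0" "cinner y p = 0"
    "cinner p p = d - c - cnj c + c * cnj c / d"
    unfolding y_def p_def cinner_diff_left cinner_diff_right pp
    by (simp_all add: cd e_def[symmetric] c_def[symmetric] d_def[symmetric])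
  have "cinner (invol a z) (invol a z) = k * cnj k * (cinner p p + S * S * cinner y y)"
    unfolding invol_def c_def[symmetric] S_def[symmetric] y_def[symmetric] p_def[symmetric] k_def[symmetric]
    by (simp add: cinner_scale_left cinner_scale_right cinner_diff_left cinner_diff_right yy(2,3) S2(2) algebra_simps)
  also have "cinner p p + S * S * cinner y y = d - c - cnj c + c * cnj c / d + (1 - d) * (e - c * cnj c / d)"
    by (simp add: yy S2)
  also have "\<dots> = (1 - c) * (1 - cnj c) - (1 - d) * (1 - e)"
    using c0 by (cases "d = 0") (simp_all add: field_simps)
  finally have "cinner (invol a z) (invol a z) = 1 - (1 - d) * (1 - e) / ((1 - c) * cnj (1 - c))"
    using D unfolding k_def by (simp add: diff_divide_distrib)
  also have "(1 - c) * cnj (1 - c) = of_real ((cmod (1 - c))\<^sup>2)"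
    by (simp only: complex_norm_square)
  finally have "complex_of_real ((norm (invol a z))\<^sup>2) = of_real (1 - (1 - (norm a)\<^sup>2) * (1 - (norm z)\<^sup>2) / (cmod (1 - c))\<^sup>2)"
    unfolding d_def e_def cinner_self by simp
  then show ?thesis unfolding of_real_eq_iff c_def by simp
qed

lemma invol_ball:
  assumes "norm a < 1" "norm z < 1" shows "norm (invol a z) < 1"
proof -
  have "0 < (cmod (1 - cinner z a))\<^sup>2"
    using one_minus_cinner_neq_0[OF assms(2,1)] by simp
  then have "0 < 1 - (norm (invol a z))\<^sup>2"
    unfolding norm_invol[OF assms] using one_minus_norm_pos assms by (intro divide_pos_pos mult_pos_pos) auto
  then show ?thesis by (simp add: abs_square_less_1)
qed

text \<open>The formula of \<open>norm_invol\<close> is symmetric. This matters because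
  \<open>green z w\<close> is \<open>green0 (invol w z)\<close>, while invariance of the measure
  concerns the map sending \<open>w\<close> to \<open>invol z w\<close>.\<close>

lemma norm_invol_commute:
  assumes "norm a < 1" "norm z < 1" shows "norm (invol a z) = norm (invol z a)"
proof -
  have "cmod (1 - cinner z a) = cmod (1 - cinner a z)"
    by (subst cinner_commute) (metis complex_cnj_diff complex_cnj_one complex_mod_cnj)
  then have "1 - (norm (invol a z))\<^sup>2 = 1 - (norm (invol z a))\<^sup>2"
    unfolding norm_invol[OF assms] norm_invol[OF assms(2,1)] by (simp add: mult.commute)
  then show ?thesis by simp
qed

subsection \<open>Invariance of the measure\<close>

text \<open>The density of \<open>inv_vol\<close> over Lebesgue measure on the whole space, up to
  the volume of the ball.\<close>

definition tau_weight :: "complex^'n \<Rightarrow> ennreal" where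
  "tau_weight z = ennreal ((1 - (norm z)\<^sup>2) powr (- real CARD('n) - 1)) * indicator (ball 0 1) z"

lemma measurable_vec_lambda [measurable (raw)]:
  assumes "\<And>k::'n::finite. f k \<in> borel_measurable M"
  shows "(\<lambda>x. \<chi> k. (f k x :: complex)) \<in> borel_measurable M"
proof -
  have "(\<lambda>x. \<Sum>k\<in>UNIV. axis k (f k x)) \<in> borel_measurable M"
    by (rule borel_measurable_sum) (use measurable_compose[OF assms measurable_axis] in auto)
  then show ?thesis unfolding sum_axis .
qed

lemma measurable_scale [measurable (raw)]:
  assumes [measurable]: "f \<in> borel_measurable M" "h \<in> borel_measurable M"
  shows "(\<lambda>x. f x *s (h x :: complex^'n)) \<in> borel_measurable M"
  unfolding vector_scalar_mult_def by measurable

lemma measurable_cinner [measurable (raw)]: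
  assumes [measurable]: "f \<in> borel_measurable M" "h \<in> borel_measurable M"
  shows "(\<lambda>x. cinner (f x) (h x)) \<in> borel_measurable M"
proof -
  have [measurable]: "cnj \<in> borel_measurable borel"
    by (intro borel_measurable_continuous_onI continuous_intros)
  show ?thesis unfolding cinner_def by measurable
qed

lemma measurable_invol [measurable (raw)]:
  assumes [measurable]: "f \<in> borel_measurable M" "h \<in> borel_measurable M"
  shows "(\<lambda>x. invol (f x :: complex^'n) (h x)) \<in> borel_measurable M"
  unfolding invol_def proj_def by measurable

lemma measurable_tau_weight [measurable]: "tau_weight \<in> borel_measurable borel"
  unfolding tau_weight_def[abs_def] by measurable

lemma norm_axis_complex: "norm (axis j c :: complex^'n) = cmod c"
proof -
  have "(norm (axis j c :: complex^'n))\<^sup>2 = (cmod c)\<^sup>2"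
    by (subst norm_vec_split[of _ j]) (simp add: axis_def)
  then show ?thesis by simp
qed

text \<open>The value 1 of \<open>\<kappa>\<close> off the disc keeps it nonzero everywhere, as the
  substitution in \<open>nn_integral_ball_shear\<close> requires. For \<open>c = 0\<close> both
  sides are \<open>- x\<close>.\<close>

lemma invol_axis:
  fixes x :: "complex^'n"
  assumes c: "cmod c < 1" and x: "cmod (x $ j) < 1"
  defines "\<kappa> \<equiv> \<lambda>z. if cmod z < 1 then - of_real (sqrt (1 - (cmod c)\<^sup>2)) / (1 - cnj c * z) else 1"
  shows "invol (axis j c) x = upd j (moeb c (x $ j)) (ball_shear j \<kappa> (UNIV - {j}) x)"
proof (cases "c = 0")
  case True
  have e: "axis j c = (0 :: complex^'n)" using True by (simp add: axis_def vec_eq_iff)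
  have "invol 0 x = - x" by (simp add: vec_eq_iff invol_def proj_def)
  then show ?thesis unfolding e using x True
    by (simp add: vec_eq_iff moeb_def ball_shear_def \<kappa>_def)
next
  case False
  have p: "proj (axis j c) x = axis j (x $ j)"
    unfolding proj_def cinner_axis using False by (simp add: vec_eq_iff axis_def)
  show ?thesis unfolding vec_eq_iff
  proof
    fix i
    show "invol (axis j c) x $ i = upd j (moeb c (x $ j)) (ball_shear j \<kappa> (UNIV - {j}) x) $ i"
      unfolding invol_def p cinner_axis norm_axis_complex
      using x by (auto simp: axis_def moeb_def ball_shear_def \<kappa>_def mult.commute diff_divide_distrib)
  qed
qed

text \<open>With E = A / D, the map multiplies \<open>1 - (norm x)\<^sup>2\<close> by E. The disc
  automorphism contributes E^2 to the Jacobian and each of the other n - 1 coordinates contributes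
  E, so E^(n + 1) cancels exactly. Points of the slab outside the ball stay outside, and both
  weights vanish there.\<close>

lemma tau_weight_invol_axis:
  fixes x :: "complex^'n"
  assumes c: "cmod c < 1" and x: "cmod (x $ j) < 1"
  defines "k \<equiv> - of_real (sqrt (1 - (cmod c)\<^sup>2)) / (1 - cnj c * x $ j)"
  shows "tau_weight x = tau_weight (invol (axis j c) x) *
    (ennreal ((cmod (moebd c (x $ j)))\<^sup>2) * ennreal (((cmod k)\<^sup>2) ^ (CARD('n) - 1)))"
proof (cases "norm x < 1")
  case True
  let ?a = "axis j c :: complex^'n"
  have a: "norm ?a < 1" using c by (simp add: norm_axis_complex)
  define A where "A = 1 - (cmod c)\<^sup>2"
  define X where "X = 1 - (norm x)\<^sup>2"
  define D where "D = (cmod (1 - cnj c * x $ j))\<^sup>2"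
  have pos: "A > 0" "X > 0" "D > 0"
    using one_minus_norm_pos[OF c] one_minus_norm_pos[OF True] one_minus_mult_neq_0[OF c x]
    by (auto simp: A_def X_def D_def)
  have k: "(cmod k)\<^sup>2 = A / D"
    using pos by (simp add: k_def norm_divide power_divide D_def A_def)
  have m: "(cmod (moebd c (x $ j)))\<^sup>2 = (A / D)\<^sup>2"
    unfolding moebd_def norm_minus_cancel norm_divide norm_power norm_of_real power_divide A_def[symmetric] D_def
    using pos by simp
  have i: "1 - (norm (invol ?a x))\<^sup>2 = A * X / D"
    unfolding norm_invol[OF a True] by (simp add: A_def X_def D_def norm_axis_complex cinner_axis mult.commute)
  define E where "E = A / D"
  have E: "E > 0" "A * X / D = E * X" using pos by (simp_all add: E_def)
  have "X powr (- real CARD('n) - 1) = E powr ((- real CARD('n) - 1) + (real CARD('n) + 1)) * X powr (- real CARD('n) - 1)"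
    using E by simp
  also have "\<dots> = (A * X / D) powr (- real CARD('n) - 1) * (A / D) powr (real CARD('n) + 1)"
    unfolding E(2) E_def[symmetric] powr_add using pos E by (simp only: powr_mult mult_ac)
  also have "(A / D) powr (real CARD('n) + 1) = (A / D) ^ (CARD('n) + 1)"
    using pos powr_realpow[of "A / D" "CARD('n) + 1"] by (simp add: add.commute)
  also have "\<dots> = (A / D)\<^sup>2 * (A / D) ^ (CARD('n) - 1)"
  proof -
    have e: "CARD('n) + 1 = 2 + (CARD('n) - 1)" using zero_less_card_finite[where 'a='n] by linarith
    show ?thesis by (simp only: e power_add)
  qed
  finally show ?thesis
    using True invol_ball[OF a True] pos unfolding tau_weight_def k m i X_def[symmetric]
    by (simp add: ennreal_mult ennreal_power[symmetric])
next
  case False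
  let ?a = "axis j c :: complex^'n"
  have a: "norm ?a < 1" using c by (simp add: norm_axis_complex)
  have nz: "cinner x ?a \<noteq> 1" using one_minus_mult_neq_0[OF c x] by (auto simp: cinner_axis mult.commute)
  have "\<not> norm (invol ?a x) < 1"
    using invol_ball[OF a, of "invol ?a x"] invol_invol[of ?a x] a nz False by auto
  with False show ?thesis by (simp add: tau_weight_def)
qed

text \<open>The shear of the coordinates other than \<open>j\<close> is undone before the
  substitution by \<open>moeb c\<close> in the coordinate \<open>j\<close>, because the factor of
  the shear depends on the original \<open>x $ j\<close>.\<close>

lemma nn_integral_invol_axis:
  fixes F :: "complex^'n \<Rightarrow> ennreal"
  assumes c: "cmod c < 1" and [measurable]: "F \<in> borel_measurable borel"
  shows "(\<integral>\<^sup>+x. F (invol (axis j c) x) * tau_weight x \<partial>lborel) = (\<integral>\<^sup>+x. F x * tau_weight x \<partial>lborel)"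
proof -
  define \<kappa> where "\<kappa> = (\<lambda>z. if cmod z < 1 then - of_real (sqrt (1 - (cmod c)\<^sup>2)) / (1 - cnj c * z) else 1)"
  define w where "w = (\<lambda>z. ennreal ((cmod (moebd c z))\<^sup>2) * indicator (ball 0 1) z)"
  define H where "H = (\<lambda>x. F x * tau_weight x)"
  define G where "G = (\<lambda>x. H (upd j (moeb c (x $ j)) x))"
  have [measurable]: "moeb c \<in> borel_measurable borel" "moebd c \<in> borel_measurable borel"
    unfolding moeb_def[abs_def] moebd_def[abs_def] by measurable
  have [measurable]: "\<kappa> \<in> borel_measurable borel" "w \<in> borel_measurable borel"
      "H \<in> borel_measurable borel" "G \<in> borel_measurable borel"
    unfolding \<kappa>_def w_def H_def G_def by measurable
  have c2: "1 - (cmod c)\<^sup>2 > 0" by (rule one_minus_norm_pos[OF c])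
  have nz: "\<kappa> z \<noteq> 0" for z
    using one_minus_mult_neq_0[OF c, of z] c2 by (auto simp: \<kappa>_def)
  have sl: "tau_weight x = tau_weight x * indicator (ball 0 1) (x $ j)" for x :: "complex^'n"
    using Finite_Cartesian_Product.norm_nth_le[of x j] by (auto simp: tau_weight_def indicator_def)
  have "(\<integral>\<^sup>+x. F (invol (axis j c) x) * tau_weight x \<partial>lborel)
      = (\<integral>\<^sup>+x. G (ball_shear j \<kappa> (UNIV - {j}) x) * (w (x $ j) * ennreal (((cmod (\<kappa> (x $ j)))\<^sup>2) ^ card (UNIV - {j}))) \<partial>lborel)"
  proof (rule nn_integral_cong)
    fix x :: "complex^'n"
    show "F (invol (axis j c) x) * tau_weight x = G (ball_shear j \<kappa> (UNIV - {j}) x) * (w (x $ j) * ennreal (((cmod (\<kappa> (x $ j)))\<^sup>2) ^ card (UNIV - {j})))"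
    proof (cases "cmod (x $ j) < 1")
      case True
      have "ball_shear j \<kappa> (UNIV - {j}) x $ j = x $ j" by (simp add: ball_shear_def)
      then have "G (ball_shear j \<kappa> (UNIV - {j}) x) = H (invol (axis j c) x)"
        unfolding G_def \<kappa>_def by (simp add: invol_axis[OF c True])
      then show ?thesis
        using True tau_weight_invol_axis[OF c True]
        by (simp add: H_def w_def \<kappa>_def card_Diff_singleton mult_ac)
    next
      case False
      then show ?thesis using sl[of x] by (simp add: w_def)
    qed
  qed
  also have "\<dots> = (\<integral>\<^sup>+x. G x * w (x $ j) \<partial>lborel)"
    by (rule nn_integral_ball_shear) (use nz in auto)
  also have "\<dots> = (\<integral>\<^sup>+x. H x * indicator (ball 0 1) (x $ j) \<partial>lborel)"
  proof (rule nn_integral_coordinate_cong[where k=j])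
    fix x :: "complex^'n"
    have "(\<integral>\<^sup>+z. H (upd j (moeb c z) x) * w z \<partial>lborel) = (\<integral>\<^sup>+z. H (upd j z x) * indicator (ball 0 1) z \<partial>lborel)"
      unfolding w_def by (rule nn_integral_moeb[OF c, where F="\<lambda>z. H (upd j z x)"]) measurable
    moreover have "upd j (moeb c z) (upd j z x) = upd j (moeb c z) x" for z by (simp add: vec_eq_iff)
    ultimately show "(\<integral>\<^sup>+z. G (upd j z x) * w (upd j z x $ j) \<partial>lborel) =
       (\<integral>\<^sup>+z. H (upd j z x) * indicator (ball 0 1) (upd j z x $ j) \<partial>lborel)"
      by (simp add: G_def)
  qed measurable
  also have "\<dots> = (\<integral>\<^sup>+x. F x * tau_weight x \<partial>lborel)"
    using sl by (intro nn_integral_cong) (metis H_def mult.assoc)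
  finally show ?thesis .
qed

subsection \<open>Unitary reflections\<close>

text \<open>The unitary reflection in the hyperplane orthogonal to \<open>v\<close>. For v = 0,
  division by zero makes it the identity.\<close>

definition householder :: "complex^'n \<Rightarrow> complex^'n \<Rightarrow> complex^'n" where
  "householder v x = x - (2 * cinner x v / cinner v v) *s v"

lemma householder_lincomb: "householder v (x + y) = householder v x + householder v y" "householder v (x - y) = householder v x - householder v y" "householder v (c *s x) = c *s householder v x"
  by (simp_all add: householder_def vec_eq_iff cinner_add_left cinner_diff_left cinner_scale_left algebra_simps add_divide_distrib diff_divide_distrib)

lemma cinner_self_0: "cinner v v = 0 \<longleftrightarrow> v = 0"
  unfolding cinner_self of_real_eq_0_iff by simp

lemma cinner_householder: "cinner (householder v x) (householder v y) = cinner x y"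
proof (cases "v = 0")
  case False
  then have nz: "cinner v v \<noteq> 0" by (simp add: cinner_self_0)
  have r: "cnj (cinner v v) = cinner v v" "cnj (cinner y v) = cinner v y"
    by (simp_all add: cinner_self cinner_commute[of v])
  show ?thesis using nz
    by (simp add: householder_def cinner_diff_left cinner_diff_right cinner_scale_left cinner_scale_right r field_simps)
qed (simp add: householder_def)

lemma householder_invol: "householder v (householder v x) = x"
proof (cases "v = 0")
  case False
  then have nz: "cinner v v \<noteq> 0" by (simp add: cinner_self_0)
  have "cinner (householder v x) v = - cinner x v"
    using nz by (simp add: householder_def cinner_diff_left cinner_scale_left)
  then show ?thesis unfolding householder_def[of v "householder v x"] by (simp add: householder_def vec_eq_iff)
qed (simp add: householder_def)

lemma norm_eq_cinner: "norm x = norm y \<longleftrightarrow> cinner x x = cinner y y"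
  unfolding cinner_self of_real_eq_iff by simp

lemma norm_householder: "norm (householder v x) = norm x"
  by (simp add: norm_eq_cinner cinner_householder)

lemma linear_householder: "linear (householder v)"
proof (rule linearI)
  have s: "c *\<^sub>R x = complex_of_real c *s x" for c and x :: "complex^'n"
    by (simp only: vec_eq_iff vector_smult_component vector_scaleR_component) (simp add: scaleR_conv_of_real)
  show "householder v (c *\<^sub>R x) = c *\<^sub>R householder v x" for c x unfolding s by (rule householder_lincomb)
qed (rule householder_lincomb)

lemma nn_integral_householder:
  fixes F :: "complex^'n \<Rightarrow> ennreal"
  assumes "F \<in> borel_measurable borel"
  shows "(\<integral>\<^sup>+x. F (householder v x) \<partial>lborel) = (\<integral>\<^sup>+x. F x \<partial>lborel)"
  by (rule nn_integral_lborel_isometry[OF assms linear_householder householder_invol norm_householder])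

lemma invol_householder: "invol (householder v a) (householder v x) = householder v (invol a x)"
  by (simp add: invol_def proj_def householder_lincomb cinner_householder norm_householder)

text \<open>Reflection in the difference of two vectors of equal norm exchanges them if their inner
  product is real. Hence \<open>c\<close> carries the phase of \<open>a $ j\<close>; if
  \<open>a $ j = 0\<close> any phase serves, and 1 is taken because \<open>sgn 0 = 0\<close> would
  spoil the norm.\<close>

lemma householder_to_axis:
  fixes a :: "complex^'n"
  obtains v c where "householder v a = axis j c"
proof
  define c where "c = (if a $ j = 0 then complex_of_real (norm a) else of_real (norm a) * sgn (a $ j))"
  define v where "v = a - axis j c"
  have cc: "c * cnj c = of_real ((norm a)\<^sup>2)"
    by (auto simp: c_def complex_norm_square[symmetric] norm_mult norm_sgn power2_eq_square)
  have real: "a $ j * cnj c = cnj (a $ j) * c"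
    by (auto simp: c_def sgn_eq complex_norm_square[symmetric])
  define e where "e = cinner a a - a $ j * cnj c"
  have aa: "cinner a a = of_real ((norm a)\<^sup>2)" by (rule cinner_self)
  have "cinner (axis j c) a = cnj (a $ j) * c" by (subst cinner_commute) (simp add: cinner_axis)
  then have "cinner v v = (cinner a a - a $ j * cnj c) - (a $ j * cnj c - c * cnj c)" and av: "cinner a v = e"
    by (simp_all add: v_def e_def cinner_diff_left cinner_diff_right cinner_axis algebra_simps) (use real in \<open>simp_all add: axis_def algebra_simps\<close>)
  then have vv: "cinner v v = 2 * e" unfolding cc aa[symmetric] e_def by simp
  show "householder v a = axis j c"
  proof (cases "v = 0")
    case True then show ?thesis by (simp add: householder_def v_def)
  next
    case False
    then have "e \<noteq> 0" using cinner_self_0[of v] vv by auto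
    then show ?thesis by (simp add: householder_def vv av) (simp add: v_def)
  qed
qed

text \<open>Unitary maps conjugate involutions into involutions and preserve the weight, so a
  reflection of \<open>a\<close> to an axis reduces the claim to the axial case.\<close>

lemma nn_integral_invol_lborel:
  fixes F :: "complex^'n \<Rightarrow> ennreal"
  assumes a: "norm a < 1" and [measurable]: "F \<in> borel_measurable borel"
  shows "(\<integral>\<^sup>+x. F (invol a x) * tau_weight x \<partial>lborel) = (\<integral>\<^sup>+x. F x * tau_weight x \<partial>lborel)"
proof -
  \<comment> \<open>Any coordinate serves; the statement does not mention \<open>j\<close>.\<close>
  fix j :: 'n
  obtain v c where v: "householder v a = axis j c" by (rule householder_to_axis)
  have c: "cmod c < 1" using norm_householder[of v a] a by (simp add: v norm_axis_complex)
  have [measurable]: "householder v \<in> borel_measurable borel"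
    unfolding householder_def[abs_def] by measurable
  have W: "tau_weight (householder v x) = tau_weight x" for x by (simp add: tau_weight_def norm_householder indicator_def)
  have "(\<integral>\<^sup>+x. F (invol a x) * tau_weight x \<partial>lborel)
     = (\<integral>\<^sup>+x. F (householder v (invol (axis j c) (householder v x))) * tau_weight (householder v x) \<partial>lborel)"
    by (simp only: W v[symmetric] invol_householder householder_invol)
  also have "\<dots> = (\<integral>\<^sup>+x. F (householder v (invol (axis j c) x)) * tau_weight x \<partial>lborel)"
    by (rule nn_integral_householder[where F="\<lambda>x. F (householder v (invol (axis j c) x)) * tau_weight x"]) measurable
  also have "\<dots> = (\<integral>\<^sup>+x. F (householder v x) * tau_weight x \<partial>lborel)"
    by (rule nn_integral_invol_axis[OF c, where F="\<lambda>x. F (householder v x)"]) measurable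
  also have "\<dots> = (\<integral>\<^sup>+x. F (householder v x) * tau_weight (householder v x) \<partial>lborel)" by (simp only: W)
  also have "\<dots> = (\<integral>\<^sup>+x. F x * tau_weight x \<partial>lborel)"
    by (rule nn_integral_householder[where F="\<lambda>x. F x * tau_weight x"]) measurable
  finally show ?thesis .
qed

section \<open>Integration with respect to \<open>vol\<close> and \<open>inv_vol\<close>\<close>

lemma emeasure_unit_ball:
  "emeasure lborel (ball 0 1 :: (complex^'n) set) \<noteq> 0" "emeasure lborel (ball 0 1 :: (complex^'n) set) \<noteq> \<infinity>"
  using unit_ball_vol_pos[of "real DIM(complex^'n)"] emeasure_lborel_ball_finite[of "0 :: complex^'n" 1]
  by (auto simp: emeasure_ball less_imp_neq[symmetric])

lemma sets_vol [simp, measurable_cong]: "sets (vol :: (complex^'n) measure) = sets borel"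
  by (simp add: vol_def)

lemma sets_inv_vol [simp, measurable_cong]: "sets (inv_vol :: (complex^'n) measure) = sets borel"
  by (simp add: inv_vol_def)

lemma nn_integral_vol:
  fixes F :: "complex^'n \<Rightarrow> ennreal"
  assumes [measurable]: "F \<in> borel_measurable borel"
  shows "(\<integral>\<^sup>+x. F x \<partial>vol) = (\<integral>\<^sup>+x. F x * indicator (ball 0 1) x \<partial>lborel) / emeasure lborel (ball 0 1 :: (complex^'n) set)"
  unfolding vol_def by (rule nn_integral_uniform_measure) auto

lemma nn_integral_inv_vol_vol:
  fixes F :: "complex^'n \<Rightarrow> ennreal"
  assumes [measurable]: "F \<in> borel_measurable borel"
  shows "(\<integral>\<^sup>+x. F x \<partial>inv_vol) = (\<integral>\<^sup>+x. F x * ennreal ((1 - (norm x)\<^sup>2) powr (- real CARD('n) - 1)) \<partial>vol)"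
  unfolding inv_vol_def by (subst nn_integral_density) (auto simp: mult.commute)

lemma nn_integral_inv_vol:
  fixes F :: "complex^'n \<Rightarrow> ennreal"
  assumes [measurable]: "F \<in> borel_measurable borel"
  shows "(\<integral>\<^sup>+x. F x \<partial>inv_vol) = (\<integral>\<^sup>+x. F x * tau_weight x \<partial>lborel) / emeasure lborel (ball 0 1 :: (complex^'n) set)"
  by (simp add: nn_integral_inv_vol_vol nn_integral_vol tau_weight_def mult.assoc)

theorem nn_integral_invol:
  fixes F :: "complex^'n \<Rightarrow> ennreal"
  assumes "norm a < 1" and "F \<in> borel_measurable borel"
  shows "(\<integral>\<^sup>+x. F (invol a x) \<partial>inv_vol) = (\<integral>\<^sup>+x. F x \<partial>inv_vol)"
  using assms by (simp add: nn_integral_inv_vol nn_integral_invol_lborel)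

section \<open>Radial integrals and their convergence\<close>

lemma card_pos: "0 < CARD('n::finite)" by (rule zero_less_card_finite)

text \<open>Polar coordinates through tails: two measures on the line with finite tails agree once
  they give the same mass to every \<open>{x<..}\<close>. Here this mass is 1 - y^(2 n), with
  \<open>y\<close> the value of \<open>x\<close> clipped to [0, 1].\<close>

lemma distr_norm_vol:
  "distr (vol :: (complex^'n) measure) borel norm =
    density lborel (\<lambda>r. ennreal (2 * real CARD('n) * r ^ (2 * CARD('n) - 1)) * indicator {0..1} r)"
proof (rule measure_eqI_lessThan)
  let ?V = "vol :: (complex^'n) measure" and ?B = "ball 0 1 :: (complex^'n) set"
  let ?m = "2 * CARD('n)"
  define u where "u = unit_ball_vol (real ?m)"
  have u: "u > 0" unfolding u_def by (rule unit_ball_vol_pos) simp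
  have dim: "DIM(complex^'n) = ?m" by simp
  have eB: "emeasure lborel ?B = ennreal u" by (simp add: emeasure_ball u_def mult.commute)
  have Mx: "emeasure (distr ?V borel norm) {x<..} = ennreal (1 - (max 0 (min 1 x)) ^ ?m)" for x :: real
  proof -
    have [measurable]: "{z :: complex^'n. x < norm z} \<in> sets borel" by measurable
    have "emeasure (distr ?V borel norm) {x<..} = emeasure ?V {z. x < norm z}"
      by (subst emeasure_distr) (auto simp: vimage_def vol_def)
    also have "\<dots> = emeasure lborel (?B \<inter> {z. x < norm z}) / emeasure lborel ?B"
      unfolding vol_def by (rule emeasure_uniform_measure) auto
    also have "emeasure lborel (?B \<inter> {z. x < norm z}) = ennreal (u * (1 - (max 0 (min 1 x)) ^ ?m))"
    proof (cases "x < 0")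
      case True
      then have "?B \<inter> {z. x < norm z} = ?B" using norm_ge_zero by (auto intro: less_le_trans)
      then show ?thesis using True eB by (simp add: power_0_left)
    next
      case False
      define y where "y = max 0 (min 1 x)"
      have y: "0 \<le> y" "y \<le> 1" by (auto simp: y_def)
      have eC: "emeasure lborel (cball 0 y :: (complex^'n) set) = ennreal (u * y ^ ?m)"
        using y by (simp add: emeasure_cball u_def mult.commute)
      have eB1: "emeasure lborel ?B = emeasure lborel (cball 0 1 :: (complex^'n) set)"
        by (simp add: emeasure_cball emeasure_ball)
      have "?B \<inter> {z. x < norm z} = ?B - cball 0 y" using False by (auto simp: y_def)
      \<comment> \<open>The open and the closed unit ball differ by a sphere, which is a null set;
        the mass can therefore be computed as a difference of closed balls.\<close>
      also have "emeasure lborel \<dots> = emeasure lborel ((cball 0 1 :: (complex^'n) set) - cball 0 y)"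
      proof (rule emeasure_eq_AE)
        have "negligible (sphere (0 :: complex^'n) 1)" by (rule negligible_sphere)
        then have "AE z in lebesgue. z \<notin> sphere (0 :: complex^'n) 1"
          by (intro AE_not_in) (simp add: negligible_iff_null_sets)
        then have "AE z in lborel. z \<notin> sphere (0 :: complex^'n) 1" by (simp add: AE_completion_iff)
        then show "AE z in lborel. z \<in> ?B - cball 0 y \<longleftrightarrow> z \<in> cball 0 1 - cball 0 y"
          by eventually_elim auto
      qed auto
      also have "\<dots> = emeasure lborel (cball 0 1 :: (complex^'n) set) - emeasure lborel (cball 0 y :: (complex^'n) set)"
        by (rule emeasure_Diff) (use y eC in auto)
      also have "\<dots> = ennreal (u * (1 - y ^ ?m))"
        unfolding eC eB1[symmetric] eB using u y by (subst ennreal_minus) (auto simp: algebra_simps)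
      finally show ?thesis unfolding y_def .
    qed
    also have "ennreal (u * (1 - (max 0 (min 1 x)) ^ ?m)) / emeasure lborel ?B = ennreal (1 - (max 0 (min 1 x)) ^ ?m)"
      unfolding eB using u by (subst divide_ennreal) (auto intro!: power_le_one mult_nonneg_nonneg)
    finally show ?thesis .
  qed
  show "emeasure (distr ?V borel norm) {x<..} < \<infinity>" for x unfolding Mx by simp
  show "emeasure (distr ?V borel norm) {x<..} = emeasure (density lborel (\<lambda>r. ennreal (2 * real CARD('n) * r ^ (?m - 1)) * indicator {0..1} r)) {x<..}" for x
  proof -
    define y where "y = max 0 (min 1 x)"
    have y: "0 \<le> y" "y \<le> 1" by (auto simp: y_def)
    have "emeasure (density lborel (\<lambda>r. ennreal (2 * real CARD('n) * r ^ (?m - 1)) * indicator {0..1} r)) {x<..}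
      = (\<integral>\<^sup>+r. ennreal (2 * real CARD('n) * r ^ (?m - 1)) * indicator {0..1} r * indicator {x<..} r \<partial>lborel)"
      by (rule emeasure_density) auto
    also have "\<dots> = (\<integral>\<^sup>+r. ennreal (2 * real CARD('n) * r ^ (?m - 1)) * indicator {y..1} r \<partial>lborel)"
    proof (rule nn_integral_cong_AE)
      have "AE r in lborel. r \<noteq> y" by (rule AE_lborel_singleton)
      then show "AE r in lborel. ennreal (2 * real CARD('n) * r ^ (?m - 1)) * indicator {0..1} r * indicator {x<..} r
         = ennreal (2 * real CARD('n) * r ^ (?m - 1)) * indicator {y..1} r"
        by eventually_elim (auto simp: indicator_def y_def max_def min_def split: if_splits)
    qed
    also have "\<dots> = ennreal (1 ^ ?m - y ^ ?m)"
      by (rule nn_integral_FTC_Icc) (use y in \<open>auto intro!: derivative_eq_intros\<close>)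
    finally show ?thesis unfolding Mx y_def by simp
  qed
qed (auto simp: vol_def)

lemma nn_integral_vol_radial:
  assumes [measurable]: "G \<in> borel_measurable borel"
  shows "(\<integral>\<^sup>+z. G (norm z) \<partial>(vol :: (complex^'n) measure)) =
    (\<integral>\<^sup>+r. ennreal (2 * real CARD('n) * r ^ (2 * CARD('n) - 1)) * indicator {0..1} r * G r \<partial>lborel)"
proof -
  have "(\<integral>\<^sup>+z. G (norm z) \<partial>(vol :: (complex^'n) measure)) = (\<integral>\<^sup>+r. G r \<partial>distr (vol :: (complex^'n) measure) borel norm)"
    by (subst nn_integral_distr) auto
  then show ?thesis unfolding distr_norm_vol by (subst (asm) nn_integral_density) auto
qed

text \<open>After passing to the radius, the integrand is dominated by that of the Beta integral
  with parameters 2 n - a and b + 1; the remaining factor (1 + r)^b is at most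
  2^\<bar>b\<bar>.\<close>

lemma vol_powr_finite:
  assumes a: "a < 2 * real CARD('n)" and b: "-1 < b"
  shows "(\<integral>\<^sup>+z. ennreal (norm z powr (-a) * (1 - (norm z)\<^sup>2) powr b) \<partial>(vol :: (complex^'n) measure)) < \<infinity>"
proof -
  define A where "A = 2 * real CARD('n) - a"
  have A: "A > 0" "b + 1 > 0" using a b by (auto simp: A_def)
  define C where "C = 2 * real CARD('n) * 2 powr \<bar>b\<bar>"
  have "(\<integral>\<^sup>+z. ennreal (norm z powr (-a) * (1 - (norm z)\<^sup>2) powr b) \<partial>(vol :: (complex^'n) measure))
    = (\<integral>\<^sup>+r. ennreal (2 * real CARD('n) * r ^ (2 * CARD('n) - 1)) * indicator {0..1} r * ennreal (r powr (-a) * (1 - r\<^sup>2) powr b) \<partial>lborel)"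
    by (rule nn_integral_vol_radial[where G="\<lambda>r. ennreal (r powr (-a) * (1 - r\<^sup>2) powr b)"]) measurable
  also have "\<dots> \<le> (\<integral>\<^sup>+r. ennreal C * (ennreal (r powr (A - 1) * (1 - r) powr ((b + 1) - 1)) * indicator {0..1} r) \<partial>lborel)"
  proof (rule nn_integral_mono)
    fix r :: real
    have "2 * real CARD('n) * r ^ (2 * CARD('n) - 1) * (r powr (-a) * (1 - r\<^sup>2) powr b) \<le> C * (r powr (A - 1) * (1 - r) powr b)" if r: "0 \<le> r" "r \<le> 1"
    proof (cases "r = 0 \<or> r = 1")
      case False
      with r have r: "0 < r" "r < 1" by auto
      have "r ^ (2 * CARD('n) - 1) = r powr (2 * real CARD('n) - 1)"
        using r card_pos[where 'n='n] by (subst powr_realpow[symmetric]) (auto simp: of_nat_diff)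
      then have 1: "r ^ (2 * CARD('n) - 1) * r powr (-a) = r powr (A - 1)"
        by (simp add: powr_add[symmetric] A_def algebra_simps)
      have "1 - r\<^sup>2 = (1 - r) * (1 + r)" by (simp add: algebra_simps power2_eq_square)
      then have 2: "(1 - r\<^sup>2) powr b = (1 - r) powr b * (1 + r) powr b" using r by (simp add: powr_mult)
      have 3: "(1 + r) powr b \<le> 2 powr \<bar>b\<bar>"
      proof -
        have "(1 + r) powr b \<le> (1 + r) powr \<bar>b\<bar>" using r by (intro powr_mono) auto
        also have "\<dots> \<le> 2 powr \<bar>b\<bar>" using r by (intro powr_mono2) auto
        finally show ?thesis .
      qed
      have "2 * real CARD('n) * r ^ (2 * CARD('n) - 1) * (r powr (-a) * (1 - r\<^sup>2) powr b)
        = 2 * real CARD('n) * r powr (A - 1) * (1 - r) powr b * (1 + r) powr b"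
        unfolding 2 1[symmetric] by (simp add: mult_ac)
      also have "\<dots> \<le> 2 * real CARD('n) * r powr (A - 1) * (1 - r) powr b * 2 powr \<bar>b\<bar>"
        using 3 by (intro mult_left_mono) auto
      finally show ?thesis by (simp add: C_def mult_ac)
    qed (auto simp: C_def)
    then show "ennreal (2 * real CARD('n) * r ^ (2 * CARD('n) - 1)) * indicator {0..1} r * ennreal (r powr (-a) * (1 - r\<^sup>2) powr b)
      \<le> ennreal C * (ennreal (r powr (A - 1) * (1 - r) powr ((b + 1) - 1)) * indicator {0..1} r)"
      by (auto simp: indicator_def ennreal_mult[symmetric] C_def intro!: ennreal_leI)
  qed
  also have "\<dots> = ennreal C * (\<integral>\<^sup>+r. ennreal (r powr (A - 1) * (1 - r) powr ((b + 1) - 1)) * indicator {0..1} r \<partial>lborel)"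
    by (rule nn_integral_cmult) auto
  also have "(\<integral>\<^sup>+r. ennreal (r powr (A - 1) * (1 - r) powr ((b + 1) - 1)) * indicator {0..1} r \<partial>lborel) = ennreal (Beta A (b + 1))"
    by (rule nn_integral_has_integral_lebesgue') (use has_integral_Beta_real[OF A] in auto)
  also have "ennreal C * ennreal (Beta A (b + 1)) < \<infinity>" by (simp add: ennreal_mult_less_top)
  finally show ?thesis .
qed

text \<open>The exponent is minus the real dimension, so the radial integral dominates that of 1 / r
  over [d, e / 2]. The final \<open>d\<close> makes this logarithm equal to \<open>K + 1\<close>,
  beyond the supposed value \<open>K\<close>.\<close>

lemma vol_powr_infinite:
  assumes e: "0 < e" "e < 1"
  shows "(\<integral>\<^sup>+z. ennreal (norm z powr (- 2 * real CARD('n))) * indicator (ball 0 e) z \<partial>(vol :: (complex^'n) measure)) = \<infinity>"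
    (is "?I = _")
proof (rule ccontr)
  assume "?I \<noteq> \<infinity>"
  then obtain K where K: "?I = ennreal K" "K \<ge> 0" by (cases ?I) auto
  have le: "ennreal (ln (e / 2) - ln d) \<le> ?I" if d: "0 < d" "d \<le> e / 2" for d
  proof -
    have "ennreal (ln (e / 2) - ln d) = (\<integral>\<^sup>+r. ennreal (1 / r) * indicator {d..e/2} r \<partial>lborel)"
      by (rule nn_integral_FTC_Icc[symmetric]) (use d in \<open>auto intro!: derivative_eq_intros\<close>)
    also have "\<dots> \<le> (\<integral>\<^sup>+r. ennreal (2 * real CARD('n) * r ^ (2 * CARD('n) - 1)) * indicator {0..1} r * (ennreal (r powr (- 2 * real CARD('n))) * indicator {..<e} r) \<partial>lborel)"
    proof (rule nn_integral_mono)
      fix r :: real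
      have "1 / r \<le> 2 * real CARD('n) * r ^ (2 * CARD('n) - 1) * r powr (- 2 * real CARD('n))" if r: "d \<le> r"
      proof -
        have r: "0 < r" using r d by auto
        have "r ^ (2 * CARD('n) - 1) = r powr (2 * real CARD('n) - 1)"
          using r card_pos[where 'n='n] by (subst powr_realpow[symmetric]) (auto simp: of_nat_diff)
        then have "r ^ (2 * CARD('n) - 1) * r powr (- 2 * real CARD('n)) = r powr (-1)"
          by (simp add: powr_add[symmetric])
        also have "\<dots> = 1 / r" using r by (simp add: powr_minus_divide)
        finally have "2 * real CARD('n) * r ^ (2 * CARD('n) - 1) * r powr (- 2 * real CARD('n)) = 2 * real CARD('n) * (1 / r)"
          by (simp only: mult.assoc)
        moreover have "1 * (1 / r) \<le> 2 * real CARD('n) * (1 / r)"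
        proof (rule mult_right_mono)
          have "1 \<le> real CARD('n)" using card_pos[where 'n='n] by simp
          then show "1 \<le> 2 * real CARD('n)" by linarith
        qed (use r in auto)
        ultimately show ?thesis by simp
      qed
      then show "ennreal (1 / r) * indicator {d..e/2} r \<le> ennreal (2 * real CARD('n) * r ^ (2 * CARD('n) - 1)) * indicator {0..1} r * (ennreal (r powr (- 2 * real CARD('n))) * indicator {..<e} r)"
        using d e by (auto simp: indicator_def ennreal_mult[symmetric] intro!: ennreal_leI)
    qed
    also have "\<dots> = (\<integral>\<^sup>+z. ennreal (norm z powr (- 2 * real CARD('n))) * indicator {..<e} (norm z) \<partial>(vol :: (complex^'n) measure))"
      by (rule nn_integral_vol_radial[symmetric, where G="\<lambda>r. ennreal (r powr (- 2 * real CARD('n))) * indicator {..<e} r"]) measurable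
    also have "\<dots> = ?I" by (intro nn_integral_cong) (auto simp: indicator_def)
    finally show ?thesis .
  qed
  define d where "d = e / 2 * exp (- (K + 1))"
  have "exp (- (K + 1)) \<le> 1" using K by simp
  then have "d > 0" "d \<le> e / 2" using e unfolding d_def by (auto intro!: mult_left_le)
  from le[OF this] have "ln (e / 2) - ln d \<le> K" using K by (simp add: ennreal_le_iff)
  moreover have "ln d = ln (e / 2) - (K + 1)" unfolding d_def using e by (subst ln_mult) auto
  ultimately show False by simp
qed

subsection \<open>The Green function\<close>

lemma epowr_mono: "0 \<le> a \<Longrightarrow> x \<le> y \<Longrightarrow> epowr x a \<le> epowr y a"
  by (cases x; cases y) (auto simp: epowr_def top_unique intro!: ennreal_leI powr_mono2)

lemma epowr_ennreal: "0 \<le> x \<Longrightarrow> epowr (ennreal x) a = ennreal (x powr a)"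
  by (simp add: epowr_def)

lemma measurable_epowr [measurable]: "(\<lambda>x. epowr x a) \<in> borel_measurable borel"
  unfolding epowr_def by measurable

lemma measurable_green0 [measurable]: "green0 \<in> borel_measurable borel"
proof -
  have "(\<lambda>z. \<integral>\<^sup>+x. ennreal ((1 - x\<^sup>2) ^ (CARD('n) - 1) / x ^ (2 * CARD('n) - 1)) * (if norm z \<le> x \<and> x \<le> 1 then 1 else 0) \<partial>lborel) \<in> borel_measurable (borel :: (complex^'n) measure)"
    by measurable
  also have "(\<lambda>z :: complex^'n. \<integral>\<^sup>+x. ennreal ((1 - x\<^sup>2) ^ (CARD('n) - 1) / x ^ (2 * CARD('n) - 1)) * (if norm z \<le> x \<and> x \<le> 1 then 1 else 0) \<partial>lborel)
    = (\<lambda>z. \<integral>\<^sup>+x\<in>{norm z..1}. ennreal ((1 - x\<^sup>2) ^ (CARD('n) - 1) / x ^ (2 * CARD('n) - 1)) \<partial>lborel)"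
    by (intro ext nn_integral_cong) (auto simp: indicator_def)
  finally show ?thesis unfolding green0_def[abs_def] by measurable
qed

lemma green0_norm_cong:
  fixes z w :: "complex^'n"
  shows "norm z = norm w \<Longrightarrow> green0 z = green0 w"
  by (simp add: green0_def)

text \<open>The exponent \<open>2 n - 2 + \<delta>\<close> absorbs the logarithmic singularity in dimension one.\<close>

lemma green0_upper:
  fixes \<delta> :: real
  assumes \<delta>: "0 < \<delta>" "\<delta> \<le> 1"
  obtains C where "C > 0" "\<And>z :: complex^'n. z \<noteq> 0 \<Longrightarrow> norm z < 1 \<Longrightarrow>
    green0 z \<le> ennreal (C * (norm z powr (- (2 * real CARD('n) - 2 + \<delta>)) * (1 - (norm z)\<^sup>2) powr real CARD('n)))"
proof
  define C where "C = (real CARD('n) + 1) / (2 * real CARD('n)) / \<delta>"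
  show "C > 0" using \<delta> by (simp add: C_def)
  fix z :: "complex^'n" assume z: "z \<noteq> 0" "norm z < 1"
  define r where "r = norm z"
  define \<gamma> where "\<gamma> = 2 * real CARD('n) - 2 + \<delta>"
  have r: "0 < r" "r < 1" using z by (auto simp: r_def)
  have n1: "1 \<le> real CARD('n)" using card_pos[where 'n='n] by simp
  have \<gamma>: "\<gamma> > 0" using \<delta> n1 unfolding \<gamma>_def by linarith
  have "(\<integral>\<^sup>+x\<in>{r..1}. ennreal ((1 - x\<^sup>2) ^ (CARD('n) - 1) / x ^ (2 * CARD('n) - 1)) \<partial>lborel)
     \<le> (\<integral>\<^sup>+x. ennreal ((1 - r\<^sup>2) ^ (CARD('n) - 1) * r powr (-\<gamma>)) * (ennreal (x powr (\<delta> - 1)) * indicator {r..1} x) \<partial>lborel)"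
  proof (rule nn_integral_mono)
    fix x :: real
    have "(1 - x\<^sup>2) ^ (CARD('n) - 1) / x ^ (2 * CARD('n) - 1) \<le> (1 - r\<^sup>2) ^ (CARD('n) - 1) * r powr (-\<gamma>) * x powr (\<delta> - 1)" if x: "r \<le> x" "x \<le> 1"
    proof -
      have x0: "0 < x" using x r by auto
      have "x ^ (2 * CARD('n) - 1) = x powr (2 * real CARD('n) - 1)"
        using x0 card_pos[where 'n='n] by (subst powr_realpow[symmetric]) (auto simp: of_nat_diff)
      then have "1 / x ^ (2 * CARD('n) - 1) = x powr (- \<gamma>) * x powr (\<delta> - 1)"
        by (simp add: powr_minus_divide[symmetric] powr_add[symmetric] \<gamma>_def)
      also have "\<dots> \<le> r powr (-\<gamma>) * x powr (\<delta> - 1)"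
        using x r \<gamma> by (intro mult_right_mono powr_mono2') auto
      finally have 1: "1 / x ^ (2 * CARD('n) - 1) \<le> r powr (-\<gamma>) * x powr (\<delta> - 1)" .
      have 2: "(1 - x\<^sup>2) ^ (CARD('n) - 1) \<le> (1 - r\<^sup>2) ^ (CARD('n) - 1)"
        using x r by (intro power_mono) (auto intro!: power_mono power_le_one)
      have "(1 - x\<^sup>2) ^ (CARD('n) - 1) * (1 / x ^ (2 * CARD('n) - 1)) \<le> (1 - r\<^sup>2) ^ (CARD('n) - 1) * (r powr (-\<gamma>) * x powr (\<delta> - 1))"
        using 1 2 x0 r by (intro mult_mono) (auto intro!: zero_le_power power_le_one)
      then show ?thesis by (simp add: mult.assoc)
    qed
    then show "ennreal ((1 - x\<^sup>2) ^ (CARD('n) - 1) / x ^ (2 * CARD('n) - 1)) * indicator {r..1} x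
      \<le> ennreal ((1 - r\<^sup>2) ^ (CARD('n) - 1) * r powr (-\<gamma>)) * (ennreal (x powr (\<delta> - 1)) * indicator {r..1} x)"
      using r by (auto simp: indicator_def ennreal_mult'[symmetric] power_le_one intro!: ennreal_leI)
  qed
  also have "\<dots> = ennreal ((1 - r\<^sup>2) ^ (CARD('n) - 1) * r powr (-\<gamma>)) * (\<integral>\<^sup>+x. ennreal (x powr (\<delta> - 1)) * indicator {r..1} x \<partial>lborel)"
    by (rule nn_integral_cmult) auto
  also have "(\<integral>\<^sup>+x. ennreal (x powr (\<delta> - 1)) * indicator {r..1} x \<partial>lborel) = ennreal (1 powr \<delta> / \<delta> - r powr \<delta> / \<delta>)"
    by (rule nn_integral_FTC_Icc) (use r \<delta> in \<open>auto intro!: derivative_eq_intros simp: powr_diff\<close>)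
  \<comment> \<open>The integral contributes the last factor \<open>1 - r\<^sup>2\<close>, raising
    the exponent from n - 1 to n: 1 - r^\<delta> \<le> 1 - r^2 as \<delta> \<le> 1.\<close>
  also have "\<dots> \<le> ennreal ((1 - r\<^sup>2) / \<delta>)"
  proof (rule ennreal_leI)
    have "r\<^sup>2 \<le> r powr 1" using r by (simp add: power2_eq_square mult_le_cancel_left1)
    also have "\<dots> \<le> r powr \<delta>" using r \<delta> by (intro powr_mono') auto
    finally show "1 powr \<delta> / \<delta> - r powr \<delta> / \<delta> \<le> (1 - r\<^sup>2) / \<delta>"
      using \<delta> by (simp add: diff_divide_distrib[symmetric] divide_right_mono)
  qed
  finally have I: "(\<integral>\<^sup>+x\<in>{r..1}. ennreal ((1 - x\<^sup>2) ^ (CARD('n) - 1) / x ^ (2 * CARD('n) - 1)) \<partial>lborel)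
     \<le> ennreal ((1 - r\<^sup>2) ^ (CARD('n) - 1) * r powr (-\<gamma>)) * ennreal ((1 - r\<^sup>2) / \<delta>)"
    by (simp add: mult_left_mono)
  have r2: "0 < 1 - r\<^sup>2" using r by (simp add: abs_square_less_1)
  have p: "(1 - r\<^sup>2) ^ (CARD('n) - 1) * (1 - r\<^sup>2) = (1 - r\<^sup>2) powr real CARD('n)"
    unfolding powr_realpow[OF r2] by (rule power_minus_mult[OF card_pos])
  have "green0 z \<le> ennreal ((real CARD('n) + 1) / (2 * real CARD('n))) * (ennreal ((1 - r\<^sup>2) ^ (CARD('n) - 1) * r powr (-\<gamma>)) * ennreal ((1 - r\<^sup>2) / \<delta>))"
    unfolding green0_def r_def[symmetric] using I by (rule mult_left_mono) simp
  also have "\<dots> = ennreal ((real CARD('n) + 1) / (2 * real CARD('n)) * ((1 - r\<^sup>2) ^ (CARD('n) - 1) * r powr (-\<gamma>) * ((1 - r\<^sup>2) / \<delta>)))"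
    using r2 \<delta> by (simp add: ennreal_mult'[symmetric] less_imp_le)
  also have "(real CARD('n) + 1) / (2 * real CARD('n)) * ((1 - r\<^sup>2) ^ (CARD('n) - 1) * r powr (-\<gamma>) * ((1 - r\<^sup>2) / \<delta>))
    = C * (r powr (-\<gamma>) * ((1 - r\<^sup>2) ^ (CARD('n) - 1) * (1 - r\<^sup>2)))"
    by (simp add: C_def)
  also note p
  finally show "green0 z \<le> ennreal (C * (norm z powr (- (2 * real CARD('n) - 2 + \<delta>)) * (1 - (norm z)\<^sup>2) powr real CARD('n)))"
    unfolding r_def \<gamma>_def .
qed

text \<open>Only the part of the integral over [r, 2 r] is kept; there x \<le> 1/2 and 1 - x^2 \<ge>
  3/4. The free \<open>r\<close> serves two purposes: r = 1/4 gives a uniform bound on a Bergman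
  ball, r = norm z the singularity at the pole.\<close>

lemma green0_lower:
  obtains c where "c > 0" "\<And>(z :: complex^'n) r. 0 < r \<Longrightarrow> r \<le> 1/4 \<Longrightarrow> norm z \<le> r \<Longrightarrow>
    ennreal (c * r powr (- (2 * real CARD('n) - 2))) \<le> green0 z"
proof
  define k where "k = (real CARD('n) + 1) / (2 * real CARD('n))"
  define c where "c = k * (3/4) ^ (CARD('n) - 1) / 2 ^ (2 * CARD('n) - 1)"
  have k: "k > 0" by (simp add: k_def)
  show "c > 0" using k by (simp add: c_def)
  fix z :: "complex^'n" and r :: real assume r: "0 < r" "r \<le> 1/4" "norm z \<le> r"
  have "ennreal ((3/4) ^ (CARD('n) - 1) / (2 * r) ^ (2 * CARD('n) - 1)) * emeasure lborel {r..2*r}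
      = (\<integral>\<^sup>+x. ennreal ((3/4) ^ (CARD('n) - 1) / (2 * r) ^ (2 * CARD('n) - 1)) * indicator {r..2*r} x \<partial>lborel)"
    by (subst nn_integral_cmult_indicator) auto
  also have "\<dots> \<le> (\<integral>\<^sup>+x\<in>{norm z..1}. ennreal ((1 - x\<^sup>2) ^ (CARD('n) - 1) / x ^ (2 * CARD('n) - 1)) \<partial>lborel)"
  proof (rule nn_integral_mono)
    fix x :: real
    have "(3/4) ^ (CARD('n) - 1) / (2 * r) ^ (2 * CARD('n) - 1) \<le> (1 - x\<^sup>2) ^ (CARD('n) - 1) / x ^ (2 * CARD('n) - 1)" if x: "r \<le> x" "x \<le> 2 * r"
    proof (rule frac_le)
      have "x\<^sup>2 \<le> (1/2)\<^sup>2" using x r by (intro power_mono) auto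
      then have "3/4 \<le> 1 - x\<^sup>2" by (simp add: power2_eq_square)
      then show "(3/4) ^ (CARD('n) - 1) \<le> (1 - x\<^sup>2) ^ (CARD('n) - 1)" by (intro power_mono) auto
      then show "0 \<le> (1 - x\<^sup>2) ^ (CARD('n) - 1)" by (rule order_trans[rotated]) simp
      show "x ^ (2 * CARD('n) - 1) \<le> (2 * r) ^ (2 * CARD('n) - 1)" using x r by (intro power_mono) auto
      show "0 < x ^ (2 * CARD('n) - 1)" using x r by auto
    qed
    then show "ennreal ((3/4) ^ (CARD('n) - 1) / (2 * r) ^ (2 * CARD('n) - 1)) * indicator {r..2*r} x
      \<le> ennreal ((1 - x\<^sup>2) ^ (CARD('n) - 1) / x ^ (2 * CARD('n) - 1)) * indicator {norm z..1} x"
      using r by (auto simp: indicator_def intro!: ennreal_leI)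
  qed
  finally have "ennreal k * (ennreal ((3/4) ^ (CARD('n) - 1) / (2 * r) ^ (2 * CARD('n) - 1)) * emeasure lborel {r..2*r}) \<le> green0 z"
    unfolding green0_def k_def by (rule mult_left_mono) simp
  also have "ennreal k * (ennreal ((3/4) ^ (CARD('n) - 1) / (2 * r) ^ (2 * CARD('n) - 1)) * emeasure lborel {r..2*r})
    = ennreal (k * ((3/4) ^ (CARD('n) - 1) / (2 * r) ^ (2 * CARD('n) - 1) * r))"
    using r k by (simp add: ennreal_mult'[symmetric])
  also have "k * ((3/4) ^ (CARD('n) - 1) / (2 * r) ^ (2 * CARD('n) - 1) * r) = c * (r / r ^ (2 * CARD('n) - 1))"
    by (simp add: c_def power_mult_distrib)
  also have "r ^ (2 * CARD('n) - 1) = r powr (2 * real CARD('n) - 1)"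
    using r card_pos[where 'n='n] by (subst powr_realpow[symmetric]) (auto simp: of_nat_diff)
  also have "r / r powr (2 * real CARD('n) - 1) = r powr (- (2 * real CARD('n) - 2))"
  proof -
    have "r / r powr (2 * real CARD('n) - 1) = r powr 1 / r powr (2 * real CARD('n) - 1)" using r by simp
    also have "\<dots> = r powr (1 - (2 * real CARD('n) - 1))" by (simp only: powr_diff)
    finally show ?thesis by (simp add: algebra_simps)
  qed
  finally show "ennreal (c * r powr (- (2 * real CARD('n) - 2))) \<le> green0 z" .
qed

text \<open>At the pole, the choice of \<open>\<delta>\<close> gives a \<le> n + s (n - 1) < 2 n, so
  half of the available room absorbs the correction by \<open>\<delta>\<close>. At the sphere, the
  n-th power of \<open>1 - (norm w)\<^sup>2\<close> yields the exponent n s - n - 1, which exceeds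
  -1 since s > 1.\<close>

lemma green0_integrable:
  assumes s: "1 < s" and n: "s * (real CARD('n) - 1) < real CARD('n)"
  shows "(\<integral>\<^sup>+w. epowr (green0 w) s \<partial>(inv_vol :: (complex^'n) measure)) < \<infinity>"
proof -
  define \<delta> where "\<delta> = min 1 ((real CARD('n) - s * (real CARD('n) - 1)) / s)"
  have \<delta>: "0 < \<delta>" "\<delta> \<le> 1" using s n by (auto simp: \<delta>_def)
  obtain C where C: "C > 0" "\<And>z :: complex^'n. z \<noteq> 0 \<Longrightarrow> norm z < 1 \<Longrightarrow>
    green0 z \<le> ennreal (C * (norm z powr (- (2 * real CARD('n) - 2 + \<delta>)) * (1 - (norm z)\<^sup>2) powr real CARD('n)))"
    using green0_upper[where 'n='n, OF \<delta>] by blast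
  define a where "a = (2 * real CARD('n) - 2 + \<delta>) * s"
  define b where "b = real CARD('n) * s - real CARD('n) - 1"
  have "\<delta> * s \<le> real CARD('n) - s * (real CARD('n) - 1)" using s by (simp add: \<delta>_def min_def field_simps)
  then have a: "a < 2 * real CARD('n)" using n by (simp add: a_def algebra_simps)
  have "real CARD('n) * 1 < real CARD('n) * s" using s card_pos[where 'n='n] by (intro mult_strict_left_mono) auto
  then have b: "-1 < b" by (simp add: b_def)
  have "(\<integral>\<^sup>+w. epowr (green0 w) s \<partial>(inv_vol :: (complex^'n) measure))
     = (\<integral>\<^sup>+w. epowr (green0 w) s * ennreal ((1 - (norm w)\<^sup>2) powr (- real CARD('n) - 1)) \<partial>(vol :: (complex^'n) measure))"
    by (rule nn_integral_inv_vol_vol) measurable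
  also have "\<dots> \<le> (\<integral>\<^sup>+w. ennreal (C powr s) * ennreal (norm w powr (-a) * (1 - (norm w)\<^sup>2) powr b) \<partial>(vol :: (complex^'n) measure))"
  proof (rule nn_integral_mono_AE)
    have "AE w in lborel. w \<noteq> (0 :: complex^'n)" by (rule AE_lborel_singleton)
    then have "AE w in vol. w \<noteq> (0 :: complex^'n)" unfolding vol_def by (auto intro: AE_uniform_measureI)
    moreover have "AE w in vol. w \<in> (ball 0 1 :: (complex^'n) set)" unfolding vol_def
      by (rule AE_uniform_measureI) auto
    ultimately show "AE w in (vol :: (complex^'n) measure). epowr (green0 w) s * ennreal ((1 - (norm w)\<^sup>2) powr (- real CARD('n) - 1))
      \<le> ennreal (C powr s) * ennreal (norm w powr (-a) * (1 - (norm w)\<^sup>2) powr b)"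
    proof eventually_elim
      case (elim w)
      then have w: "w \<noteq> 0" "norm w < 1" by auto
      have w2: "0 < 1 - (norm w)\<^sup>2" by (rule one_minus_norm_pos[OF w(2)])
      have "epowr (green0 w) s \<le> epowr (ennreal (C * (norm w powr (- (2 * real CARD('n) - 2 + \<delta>)) * (1 - (norm w)\<^sup>2) powr real CARD('n)))) s"
        using s by (intro epowr_mono C w) auto
      also have "\<dots> = ennreal ((C * (norm w powr (- (2 * real CARD('n) - 2 + \<delta>)) * (1 - (norm w)\<^sup>2) powr real CARD('n))) powr s)"
        using C(1) by (intro epowr_ennreal) auto
      also have "(C * (norm w powr (- (2 * real CARD('n) - 2 + \<delta>)) * (1 - (norm w)\<^sup>2) powr real CARD('n))) powr s
         = C powr s * (norm w powr (-a) * (1 - (norm w)\<^sup>2) powr (real CARD('n) * s))"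
        using C(1) by (simp add: powr_mult powr_powr a_def minus_mult_left)
      finally have "epowr (green0 w) s * ennreal ((1 - (norm w)\<^sup>2) powr (- real CARD('n) - 1)) \<le>
         ennreal (C powr s * (norm w powr (-a) * (1 - (norm w)\<^sup>2) powr (real CARD('n) * s))) * ennreal ((1 - (norm w)\<^sup>2) powr (- real CARD('n) - 1))"
        by (rule mult_right_mono) simp
      also have "\<dots> = ennreal (C powr s) * ennreal (norm w powr (-a) * ((1 - (norm w)\<^sup>2) powr (real CARD('n) * s) * (1 - (norm w)\<^sup>2) powr (- real CARD('n) - 1)))"
        by (simp add: ennreal_mult'[symmetric] mult_ac)
      also have "(1 - (norm w)\<^sup>2) powr (real CARD('n) * s) * (1 - (norm w)\<^sup>2) powr (- real CARD('n) - 1) = (1 - (norm w)\<^sup>2) powr b"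
        by (simp add: powr_add[symmetric] b_def algebra_simps)
      finally show ?case .
    qed
  qed
  also have "\<dots> = ennreal (C powr s) * (\<integral>\<^sup>+w. ennreal (norm w powr (-a) * (1 - (norm w)\<^sup>2) powr b) \<partial>(vol :: (complex^'n) measure))"
    by (rule nn_integral_cmult) measurable
  also have "\<dots> < \<infinity>" using vol_powr_finite[OF a b] by (simp add: ennreal_mult_less_top)
  finally show ?thesis .
qed

subsection \<open>Holomorphic functions of several variables\<close>

definition holo :: "(complex^'n) set \<Rightarrow> (complex^'n \<Rightarrow> complex) \<Rightarrow> bool" where
  "holo S f \<longleftrightarrow> (\<forall>z\<in>S. \<exists>D. (f has_derivative D) (at z) \<and> (\<forall>(c::complex) v. D (c *s v) = c * D v))"

text \<open>For holomorphic \<open>f\<close> the Frechet derivative at \<open>z\<close> as a linear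
  form in \<open>v\<close>; written through \<open>partial_d\<close> so that it is a total function
  of \<open>f\<close> and \<open>z\<close>.\<close>

definition dh :: "(complex^'n \<Rightarrow> complex) \<Rightarrow> complex^'n \<Rightarrow> complex^'n \<Rightarrow> complex" where
  "dh f z v = (\<Sum>j\<in>UNIV. v $ j * partial_d j f z)"

lemma radial_d_dh: "radial_d f z = dh f z z"
  by (simp add: radial_d_def dh_def)

lemma dh_axis: "dh f z (axis j c) = c * partial_d j f z"
proof -
  have "dh f z (axis j c) = (\<Sum>i\<in>UNIV. if i = j then c * partial_d i f z else 0)"
    unfolding dh_def by (intro sum.cong) (auto simp: axis_def)
  then show ?thesis by simp
qed

lemma dh_scale: "dh f z (c *s v) = c * dh f z v"
  and dh_add: "dh f z (v + w) = dh f z v + dh f z w"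
  by (simp_all add: dh_def sum_distrib_left sum.distrib algebra_simps)

lemma axis_scale: "axis j c = c *s (axis j 1 :: complex^'n)"
  by (auto simp: axis_def vec_eq_iff)

lemma axis_complex_0 [simp]: "axis j (0::complex) = (0 :: complex^'n)"
  by (auto simp: axis_def vec_eq_iff)

lemma vec_axis_expansion: "(v :: complex^'n) = (\<Sum>j\<in>UNIV. v $ j *s axis j 1)"
proof -
  have "(\<Sum>j\<in>UNIV. v $ j *s axis j 1) = (\<Sum>j\<in>UNIV. axis j (v $ j))" by (simp only: axis_scale[symmetric])
  also have "\<dots> = v" unfolding sum_axis by (simp add: vec_eq_iff)
  finally show ?thesis ..
qed

lemma bounded_linear_scale: "bounded_linear (\<lambda>c::complex. c *s (v :: complex^'n))"
  by (auto simp: linear_conv_bounded_linear[symmetric] vec_eq_iff algebra_simps intro!: linearI)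

lemma has_derivative_complex_line:
  assumes "(f has_derivative D) (at (z + c *s v))" and lin: "\<And>(a::complex) u. D (a *s u) = a * D u"
  shows "((\<lambda>a. f (z + a *s v)) has_field_derivative D v) (at c)"
proof -
  have "((\<lambda>a. z + a *s v) has_derivative (\<lambda>a. a *s v)) (at c)"
    by (auto intro!: derivative_eq_intros bounded_linear_imp_has_derivative bounded_linear_scale)
  from has_derivative_compose[OF this assms(1)]
  show ?thesis by (simp add: lin has_field_derivative_def mult.commute[of _ "D v"])
qed

lemma holo_has_derivative:
  assumes "holo S f" "z \<in> S"
  shows "(f has_derivative dh f z) (at z)"
proof -
  obtain D where D: "(f has_derivative D) (at z)" and lin: "\<And>(c::complex) v. D (c *s v) = c * D v"
    using assms unfolding holo_def by blast
  have pd: "partial_d j f z = D (axis j 1)" for j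
    using has_derivative_complex_line[of f D z 0 "axis j 1"] D lin
    by (simp add: partial_d_def axis_scale[symmetric] DERIV_imp_deriv)
  have "D v = dh f z v" for v
  proof -
    have "D v = D (\<Sum>j\<in>UNIV. v $ j *s axis j 1)" using vec_axis_expansion[of v] by simp
    also have "\<dots> = (\<Sum>j\<in>UNIV. D (v $ j *s axis j 1))"
      by (rule linear_sum) (rule has_derivative_linear[OF D])
    finally show ?thesis by (simp add: lin dh_def pd)
  qed
  then have "D = dh f z" by blast
  with D show ?thesis by simp
qed

lemma holoI:
  assumes "\<And>z. z \<in> S \<Longrightarrow> (f has_derivative D z) (at z)" "\<And>z (c::complex) v. z \<in> S \<Longrightarrow> D z (c *s v) = c * D z v"
  shows "holo S f"
  unfolding holo_def
proof
  fix z assume "z \<in> S"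
  with assms show "\<exists>D. (f has_derivative D) (at z) \<and> (\<forall>(c::complex) v. D (c *s v) = c * D v)"
    by (intro exI[of _ "D z"]) auto
qed

lemma dh_unique:
  assumes D: "(f has_derivative D) (at z)" and lin: "\<And>(c::complex) v. D (c *s v) = c * D v"
  shows "dh f z = D"
proof -
  have "holo {z} f" by (rule holoI[where D="\<lambda>_. D"]) (use assms in auto)
  from holo_has_derivative[OF this] have "(f has_derivative dh f z) (at z)" by simp
  then show ?thesis using D by (rule has_derivative_unique)
qed

lemma holo_continuous: "holo S f \<Longrightarrow> continuous_on S f"
  by (intro continuous_at_imp_continuous_on ballI has_derivative_continuous[OF holo_has_derivative])

lemma holo_cong:
  assumes "open S" "\<And>z. z \<in> S \<Longrightarrow> f z = g z" "holo S f"
  shows "holo S g"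
  unfolding holo_def
proof
  fix z assume z: "z \<in> S"
  then obtain D where D: "(f has_derivative D) (at z)" "\<forall>(c::complex) v. D (c *s v) = c * D v"
    using assms(3) unfolding holo_def by blast
  then have "(g has_derivative D) (at z)"
    using has_derivative_transform_within_open[OF D(1) assms(1) z] assms(2) by blast
  with D show "\<exists>D. (g has_derivative D) (at z) \<and> (\<forall>(c::complex) v. D (c *s v) = c * D v)" by blast
qed

lemma partial_d_cong:
  assumes S: "open S" "z \<in> S" and eq: "\<And>z. z \<in> S \<Longrightarrow> f z = g z"
  shows "partial_d j f z = partial_d j g z"
  unfolding partial_d_def
proof (rule deriv_cong_ev)
  have "open ((\<lambda>c. z + c *s axis j (1::complex)) -` S)"
    by (intro open_vimage S(1) continuous_intros linear_continuous_on bounded_linear_scale)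
  then have "\<forall>\<^sub>F c in nhds 0. c \<in> (\<lambda>c. z + c *s axis j (1::complex)) -` S"
    by (rule eventually_nhds_in_open) (use S in simp)
  then show "\<forall>\<^sub>F c in nhds 0. f (z + axis j c) = g (z + axis j c)"
    by eventually_elim (simp add: eq axis_scale[symmetric])
qed simp

lemma dh_cong:
  assumes "open S" "z \<in> S" "\<And>z. z \<in> S \<Longrightarrow> f z = g z"
  shows "dh f z v = dh g z v"
  unfolding dh_def using partial_d_cong[OF assms] by simp

lemma holo_line:
  assumes "holo S f" "z + c *s v \<in> S"
  shows "((\<lambda>a. f (z + a *s v)) has_field_derivative dh f (z + c *s v) v) (at c)"
  using has_derivative_complex_line[OF holo_has_derivative[OF assms] dh_scale] .

lemma holo_const: "holo S (\<lambda>z. c)"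
  by (rule holoI[where D="\<lambda>z v. 0"]) auto

lemma holo_add: "holo S f \<Longrightarrow> holo S g \<Longrightarrow> holo S (\<lambda>z. f z + g z)"
  by (rule holoI[where D="\<lambda>z v. dh f z v + dh g z v"])
     (auto intro: has_derivative_add holo_has_derivative simp: dh_scale algebra_simps)

lemma holo_mult: "holo S f \<Longrightarrow> holo S g \<Longrightarrow> holo S (\<lambda>z. f z * g z)"
  by (rule holoI[where D="\<lambda>z v. f z * dh g z v + dh f z v * g z"])
     (rule has_derivative_mult, (rule holo_has_derivative, assumption+)+, simp add: dh_scale algebra_simps)

lemma holo_nth: "holo S (\<lambda>z. z $ j)"
  by (rule holoI[where D="\<lambda>z v. v $ j"])
     (auto intro: bounded_linear_imp_has_derivative bounded_linear_vec_nth)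

lemma holo_sum: "finite I \<Longrightarrow> (\<And>i. i \<in> I \<Longrightarrow> holo S (f i)) \<Longrightarrow> holo S (\<lambda>z. \<Sum>i\<in>I. f i z)"
  by (induction I rule: finite_induct) (auto intro: holo_const holo_add)

lemma dh_sub:
  assumes "holo S f" "holo S g" "z \<in> S"
  shows "dh (\<lambda>z. f z - g z) z v = dh f z v - dh g z v"
proof -
  have "dh (\<lambda>z. f z - g z) z = (\<lambda>v. dh f z v - dh g z v)"
    by (rule dh_unique) (auto intro: has_derivative_diff holo_has_derivative assms simp: dh_scale algebra_simps)
  then show ?thesis by simp
qed

lemma partial_d_dh: "partial_d j f z = dh f z (axis j 1)"
  by (simp add: dh_axis)

subsection \<open>Cauchy's formulas on complex lines\<close>

text \<open>The unit circle over [0, 1], in the parametrisation of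
  \<open>circlepath\<close>.\<close>

definition circ :: "real \<Rightarrow> complex" where "circ t = exp (2 * of_real pi * \<i> * of_real t)"

lemma norm_circ [simp]: "cmod (circ t) = 1"
  by (simp add: circ_def norm_exp_eq_Re)

lemma circ_neq_0 [simp]: "circ t \<noteq> 0" by (simp add: circ_def)

lemma continuous_on_circ [continuous_intros]: "continuous_on A circ"
  unfolding circ_def by (intro continuous_intros)

text \<open>On the circle the differential is 2 \<pi> i (u - z) dt, which cancels one power in
  Cauchy's formula and turns it into an average.\<close>

lemma circle_mean_deriv:
  assumes c: "continuous_on (cball z r) f" and h: "f holomorphic_on ball z r" and r: "r > 0"
  shows "((\<lambda>t. f (z + of_real r * circ t) / (of_real r * circ t) ^ k) has_integral (deriv ^^ k) f z / fact k) {0..1}"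
proof -
  have "((\<lambda>u. f u / (u - z) ^ (Suc k)) has_contour_integral ((2 * pi * \<i>) / (fact k) * (deriv ^^ k) f z)) (circlepath z r)"
    by (rule Cauchy_has_contour_integral_higher_derivative_circlepath[OF c h]) (use r in auto)
  then have *: "((\<lambda>t. f (circlepath z r t) / (circlepath z r t - z) ^ (Suc k) * vector_derivative (circlepath z r) (at t)) has_integral ((2 * pi * \<i>) / (fact k) * (deriv ^^ k) f z)) {0..1}"
    by (simp only: has_contour_integral)
  have cp: "circlepath z r t = z + of_real r * circ t" for t by (simp add: circlepath circ_def)
  have vd: "vector_derivative (circlepath z r) (at t) = 2 * pi * \<i> * (of_real r * circ t)" for t
    by (simp add: vector_derivative_circlepath circ_def mult_ac)
  note * = *[unfolded cp vd add_diff_cancel_left']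
  have e: "1 / (2 * pi * \<i>) * (a / w ^ Suc k * (2 * pi * \<i> * w)) = a / w ^ k" if "w \<noteq> 0" for a w :: complex
    using that by (simp add: field_simps)
  have "1 / (2 * pi * \<i>) * ((2 * pi * \<i>) / (fact k) * (deriv ^^ k) f z) = (deriv ^^ k) f z / fact k"
    by (simp add: field_simps)
  with has_integral_mult_right[OF *, of "1 / (2 * pi * \<i>)"] r show ?thesis
    by (simp only: e no_zero_divisors of_real_eq_0_iff circ_neq_0 less_imp_neq[symmetric] not_False_eq_True)
qed

lemma holo_line_holomorphic:
  assumes h: "holo S f" and S: "\<And>a. cmod a \<le> r \<Longrightarrow> z + a *s v \<in> S"
  shows "(\<lambda>a. f (z + a *s v)) holomorphic_on cball 0 r"
  unfolding holomorphic_on_def field_differentiable_def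
proof
  fix a assume "a \<in> cball (0::complex) r"
  then have "z + a *s v \<in> S" by (intro S) simp
  from has_field_derivative_at_within[OF holo_line[OF h this]]
  show "\<exists>f'. ((\<lambda>a. f (z + a *s v)) has_field_derivative f') (at a within cball 0 r)" ..
qed

lemma holo_circle_mean:
  assumes h: "holo S f" and S: "\<And>a. cmod a \<le> r \<Longrightarrow> z + a *s v \<in> S" and r: "0 < r"
  shows "((\<lambda>t. f (z + (of_real r * circ t) *s v)) has_integral f z) {0..1}"
    and "((\<lambda>t. f (z + (of_real r * circ t) *s v) / (of_real r * circ t)) has_integral dh f z v) {0..1}"
proof -
  have hol: "(\<lambda>a. f (z + a *s v)) holomorphic_on cball 0 r" by (rule holo_line_holomorphic[OF h S])
  note * = circle_mean_deriv[OF holomorphic_on_imp_continuous_on[OF hol] holomorphic_on_subset[OF hol ball_subset_cball] r]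
  show "((\<lambda>t. f (z + (of_real r * circ t) *s v)) has_integral f z) {0..1}"
    using *[of 0] by simp
  have "deriv (\<lambda>a. f (z + a *s v)) 0 = dh f z v"
    using DERIV_imp_deriv[OF holo_line[OF h, of z 0 v]] S[of 0] r by simp
  then show "((\<lambda>t. f (z + (of_real r * circ t) *s v) / (of_real r * circ t)) has_integral dh f z v) {0..1}"
    using *[of 1] by simp
qed

lemma dh_Cauchy_estimate:
  assumes h: "holo S f" and S: "\<And>a. cmod a \<le> r \<Longrightarrow> z + a *s v \<in> S" and r: "0 < r"
    and B: "\<And>a. cmod a = r \<Longrightarrow> cmod (f (z + a *s v)) \<le> B"
  shows "cmod (dh f z v) \<le> B / r"
proof -
  have "cmod (f (z + (of_real r * circ t) *s v)) \<le> B" for t using r by (intro B) (simp add: norm_mult)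
  then have "cmod (f (z + (of_real r * circ t) *s v) / (of_real r * circ t)) \<le> B / r" for t
    using r by (simp add: norm_divide norm_mult divide_right_mono)
  moreover have "0 \<le> B / r" using r by (intro divide_nonneg_pos order_trans[OF norm_ge_zero B[of "of_real r"]]) auto
  ultimately have "cmod (dh f z v) \<le> B / r * measure lborel (cbox 0 (1::real))"
    using holo_circle_mean(2)[OF h S r]
    by (intro has_integral_bound[where f="\<lambda>t. f (z + (of_real r * circ t) *s v) / (of_real r * circ t)"]) (simp_all only: cbox_interval)
  then show ?thesis by simp
qed

subsection \<open>Partial derivatives are holomorphic\<close>

text \<open>The derivative \<open>dh f z\<close> as an element of a normed space of linear maps, the
  form required for differentiating under an integral.\<close>

definition dhb :: "(complex^'n \<Rightarrow> complex) \<Rightarrow> complex^'n \<Rightarrow> (complex^'n) \<Rightarrow>\<^sub>L complex" where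
  "dhb f z = (\<Sum>j\<in>UNIV. blinfun_mult_right (partial_d j f z) o\<^sub>L Blinfun (\<lambda>v. v $ j))"

lemma dhb_apply: "blinfun_apply (dhb f z) v = dh f z v"
  by (simp add: dhb_def dh_def blinfun.sum_left bounded_linear_Blinfun_apply bounded_linear_vec_nth mult.commute)

lemma continuous_on_dhb:
  assumes "\<And>j. continuous_on S (partial_d j f)"
  shows "continuous_on S (dhb f)"
  unfolding dhb_def using assms
  by (intro continuous_intros bounded_linear.continuous_on[OF bounded_linear_blinfun_mult_right]) auto

lemma continuous_on_scale [continuous_intros]:
  fixes g :: "'a::topological_space \<Rightarrow> complex^'n"
  assumes "continuous_on A f" "continuous_on A g"
  shows "continuous_on A (\<lambda>x. f x *s g x)"
  unfolding vector_scalar_mult_def using assms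
  by (intro continuous_on_vec_lambda continuous_intros)

lemma norm_scale: "norm (c *s (v :: complex^'n)) = cmod c * norm v"
proof -
  have "(norm (c *s v))\<^sup>2 = (cmod c * norm v)\<^sup>2"
    by (simp add: norm_vec_def L2_set_def sum_nonneg norm_mult power_mult_distrib sum_distrib_left)
  then show ?thesis by simp
qed

lemma ball_line:
  assumes "cball z0 (2 * r) \<subseteq> S" "z \<in> ball z0 r" "cmod a \<le> r" "norm v \<le> 1"
  shows "z + a *s v \<in> S"
proof -
  have "norm (a *s v) \<le> r * 1" unfolding norm_scale
    using assms(3,4) order_trans[OF norm_ge_zero assms(3)] by (intro mult_mono) auto
  then have "dist z0 (z + a *s v) \<le> 2 * r"
    using assms(2) dist_triangle[of z0 "z + a *s v" z] by (simp add: dist_norm)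
  then show ?thesis using assms(1) by auto
qed

text \<open>\<open>holo\<close> provides a derivative at each point and nothing on its continuity.
  Cauchy's formula on circles of a fixed radius expresses the partial derivatives near
  \<open>z0\<close> as an integral of a continuous function with parameter. The radius is half of
  \<open>e\<close>, so that the circles stay in \<open>S\<close> for all centres in
  \<open>ball z0 r\<close>.\<close>

lemma partial_d_continuous:
  assumes h: "holo S f" and S: "open S"
  shows "continuous_on S (partial_d j f)"
proof -
  have "isCont (partial_d j f) z0" if z0: "z0 \<in> S" for z0
  proof -
    obtain e where e: "e > 0" "cball z0 e \<subseteq> S" using S z0 open_contains_cball by blast
    define r where "r = e / 2"
    have r: "r > 0" "cball z0 (2 * r) \<subseteq> S" using e by (auto simp: r_def)
    let ?F = "\<lambda>z t. f (z + (of_real r * circ t) *s axis j 1) / (of_real r * circ t)"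
    have eq: "partial_d j f z = integral (cbox 0 1) (?F z)" if "z \<in> ball z0 r" for z
      using holo_circle_mean(2)[OF h ball_line[OF r(2) that, of _ "axis j 1"] r(1)]
      by (simp add: partial_d_dh norm_axis_complex integral_unique)
    have "continuous_on (ball z0 r) (\<lambda>z. integral (cbox 0 1) (?F z))"
    proof (rule integral_continuous_on_param)
      show "continuous_on (ball z0 r \<times> cbox 0 1) (\<lambda>(z, t). ?F z t)"
        unfolding split_beta
      proof (intro continuous_on_divide continuous_on_compose2[OF holo_continuous[OF h]])
        show "(\<lambda>x. fst x + (of_real r * circ (snd x)) *s axis j 1) ` (ball z0 r \<times> cbox 0 1) \<subseteq> S"
          using r by (auto intro!: ball_line[OF r(2)] simp: norm_mult norm_axis_complex)
      qed (use r in \<open>auto intro!: continuous_intros continuous_on_compose2[OF continuous_on_circ[of UNIV]]\<close>)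
    qed
    then have "continuous_on (ball z0 r) (partial_d j f)"
      by (rule continuous_on_eq) (simp add: eq)
    then show ?thesis using r by (simp add: continuous_on_eq_continuous_at)
  qed
  then show ?thesis by (rule continuous_at_imp_continuous_on[rule_format])
qed

text \<open>Cauchy's integral for \<open>partial_d j f\<close> is differentiated under the integral
  sign, now that the derivative of \<open>f\<close> is known to be continuous. The formula for
  \<open>D\<close> is kept because it also shows that partial derivatives commute.\<close>

lemma partial_d_has_derivative:
  fixes j :: "'n::finite" and c :: complex and v :: "complex^'n"
  assumes h: "holo S f" and r: "r > 0" "cball z0 (2 * r) \<subseteq> S" and S: "open S"
  defines "D \<equiv> \<lambda>v. integral {0..1} (\<lambda>t. dh f (z0 + (of_real r * circ t) *s axis j 1) v / (of_real r * circ t))"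
  shows "(partial_d j f has_derivative D) (at z0)" and "D (c *s v) = c * D v"
proof -
  let ?F = "\<lambda>z t. f (z + (of_real r * circ t) *s axis j 1) / (of_real r * circ t)"
  let ?G = "\<lambda>z t. blinfun_mult_right (1 / (of_real r * circ t)) o\<^sub>L dhb f (z + (of_real r * circ t) *s axis j 1)"
  have mem: "z + (of_real r * circ t) *s axis j 1 \<in> S" if "z \<in> ball z0 r" for z t
    using r that by (auto intro!: ball_line[OF r(2)] simp: norm_mult norm_axis_complex)
  have eq: "partial_d j f z = integral (cbox 0 1) (?F z)" if "z \<in> ball z0 r" for z
    using holo_circle_mean(2)[OF h ball_line[OF r(2) that, of _ "axis j 1"] r(1)]
    by (simp add: partial_d_dh norm_axis_complex integral_unique)
  have cont: "continuous_on (ball z0 r \<times> cbox 0 1) (\<lambda>(z, t). ?G z t)"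
    unfolding split_beta
  proof (intro continuous_intros continuous_on_compose2[OF continuous_on_dhb[OF partial_d_continuous[OF h S]]]
      bounded_linear.continuous_on[OF bounded_linear_blinfun_mult_right])
    show "(\<lambda>x. fst x + (of_real r * circ (snd x)) *s axis j 1) ` (ball z0 r \<times> cbox 0 1) \<subseteq> S"
      using mem by auto
  qed (use r in \<open>auto intro!: continuous_intros continuous_on_compose2[OF continuous_on_circ[of UNIV]]\<close>)
  have app: "blinfun_apply (?G z t) v = dh f (z + (of_real r * circ t) *s axis j 1) v / (of_real r * circ t)" for z t v
    by (simp add: dhb_apply)
  have "((\<lambda>z. integral (cbox 0 1) (?F z)) has_derivative blinfun_apply (integral (cbox 0 1) (?G z0))) (at z0 within ball z0 r)"
  proof (rule leibniz_rule[OF _ _ cont])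
    fix z t assume z: "z \<in> ball z0 r" and t: "t \<in> cbox 0 (1::real)"
    have "(f has_derivative dh f (z + (of_real r * circ t) *s axis j 1)) (at (z + (of_real r * circ t) *s axis j 1))"
      by (rule holo_has_derivative[OF h mem[OF z]])
    then have "((\<lambda>z. f (z + (of_real r * circ t) *s axis j 1)) has_derivative dh f (z + (of_real r * circ t) *s axis j 1)) (at z)"
      by (rule has_derivative_compose[rotated]) (auto intro!: derivative_eq_intros)
    then have "((\<lambda>z. ?F z t) has_derivative (\<lambda>v. dh f (z + (of_real r * circ t) *s axis j 1) v / (of_real r * circ t))) (at z)"
      unfolding divide_inverse by (rule has_derivative_mult_left)
    then show "((\<lambda>z. ?F z t) has_derivative blinfun_apply (?G z t)) (at z within ball z0 r)"
      unfolding app by (rule has_derivative_at_withinI)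
  next
    fix z assume z: "z \<in> ball z0 r"
    show "?F z integrable_on cbox 0 1"
      using holo_circle_mean(2)[OF h ball_line[OF r(2) z, of _ "axis j 1"] r(1)]
      by (auto simp: norm_axis_complex)
  qed (use r in auto)
  then have d: "((\<lambda>z. integral (cbox 0 1) (?F z)) has_derivative blinfun_apply (integral (cbox 0 1) (?G z0))) (at z0)"
    using r by (simp add: at_within_open[of z0 "ball z0 r"])
  have "continuous_on (cbox 0 1) (\<lambda>t. case (z0, t) of (z, t) \<Rightarrow> ?G z t)"
    by (rule continuous_on_compose2[OF cont]) (use r in \<open>auto intro!: continuous_intros\<close>)
  then have "continuous_on (cbox 0 1) (?G z0)" by (simp only: prod.case)
  then have int: "?G z0 integrable_on cbox 0 1" by (rule integrable_continuous)
  have D: "blinfun_apply (integral (cbox 0 1) (?G z0)) = D"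
    unfolding D_def by (rule ext) (subst blinfun_apply_integral[OF int], simp only: app, simp)
  show "(partial_d j f has_derivative D) (at z0)"
    unfolding D[symmetric]
    by (rule has_derivative_transform_within_open[OF d, of "ball z0 r"]) (use r eq in simp_all)
  show "D (c *s v) = c * D v" unfolding D_def dh_scale
    by (subst integral_mult_right[symmetric]) (simp add: mult.assoc)
qed

lemma holo_partial_d:
  assumes "holo S f" "open S" shows "holo S (partial_d j f)"
  unfolding holo_def
proof
  fix z assume "z \<in> S"
  then obtain e where e: "e > 0" "cball z e \<subseteq> S" using \<open>open S\<close> open_contains_cball by blast
  then have "e / 2 > 0" "cball z (2 * (e / 2)) \<subseteq> S" by auto
  note * = partial_d_has_derivative[OF assms(1) this assms(2), of j]
  show "\<exists>D. (partial_d j f has_derivative D) (at z) \<and> (\<forall>(c::complex) v. D (c *s v) = c * D v)"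
    by (intro exI conjI allI) (rule *)+
qed

text \<open>The derivative of Cauchy's integral for \<open>partial_d j f\<close> in direction
  \<open>i\<close> is Cauchy's integral in direction \<open>j\<close> for
  \<open>partial_d i f\<close>.\<close>

lemma partial_d_commute:
  assumes h: "holo S f" and S: "open S" and z: "z \<in> S"
  shows "partial_d i (partial_d j f) z = partial_d j (partial_d i f) z"
proof -
  obtain e where e: "e > 0" "cball z e \<subseteq> S" using S z open_contains_cball by blast
  define r where "r = e / 2"
  have r: "r > 0" "cball z (2 * r) \<subseteq> S" using e by (auto simp: r_def)
  have "dh (partial_d j f) z = (\<lambda>v. integral {0..1} (\<lambda>t. dh f (z + (of_real r * circ t) *s axis j 1) v / (of_real r * circ t)))"
    by (rule dh_unique) (rule partial_d_has_derivative[OF h r S])+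
  then have "partial_d i (partial_d j f) z = integral {0..1} (\<lambda>t. partial_d i f (z + (of_real r * circ t) *s axis j 1) / (of_real r * circ t))"
    by (simp add: partial_d_dh[of i])
  also have "\<dots> = dh (partial_d i f) z (axis j 1)"
    using holo_circle_mean(2)[OF holo_partial_d[OF h S, of i] ball_line[OF r(2), of z _ "axis j 1"] r(1)] r
    by (simp add: norm_axis_complex integral_unique)
  finally show ?thesis by (simp add: dh_axis)
qed

lemma holo_radial_d:
  assumes "holo S f" "open S" shows "holo S (radial_d f)"
  unfolding radial_d_def by (intro holo_sum holo_mult holo_nth holo_partial_d assms) auto

subsection \<open>Subharmonicity of powers of the modulus\<close>

text \<open>Turns a function that is continuous on the ball into a Borel function on the whole
  space, where the integrals live.\<close>

definition cut :: "(complex^'n \<Rightarrow> 'a::zero) \<Rightarrow> complex^'n \<Rightarrow> 'a" where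
  "cut f z = (if z \<in> ball 0 1 then f z else 0)"

lemma measurable_if_ball:
  fixes f :: "complex^'n \<Rightarrow> 'b::{second_countable_topology, real_normed_vector}"
  assumes "continuous_on (ball c r) f"
  shows "(\<lambda>z. if z \<in> ball c r then f z else 0) \<in> borel_measurable borel"
  by (rule borel_measurable_continuous_on_if) (use assms in auto)

lemma measurable_cut:
  fixes f :: "complex^'n \<Rightarrow> 'b::{second_countable_topology, real_normed_vector}"
  assumes "continuous_on (ball 0 1) f"
  shows "cut f \<in> borel_measurable borel"
  unfolding cut_def[abs_def] by (rule measurable_if_ball[OF assms])

lemma nn_integral_circ:
  fixes F :: "complex^'n \<Rightarrow> ennreal"
  assumes "F \<in> borel_measurable borel"
  shows "(\<integral>\<^sup>+u. F (circ t *s u) \<partial>lborel) = (\<integral>\<^sup>+u. F u \<partial>lborel)"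
proof (rule nn_integral_lborel_isometry[OF assms, where h="\<lambda>u. (1 / circ t) *s u"])
  have s: "r *\<^sub>R u = complex_of_real r *s u" for r and u :: "complex^'n"
    by (simp only: vec_eq_iff vector_smult_component vector_scaleR_component) (simp add: scaleR_conv_of_real)
  show "linear (\<lambda>u :: complex^'n. circ t *s u)"
    by (rule linearI) (simp_all add: s vec_eq_iff algebra_simps)
qed (simp_all add: vec_eq_iff norm_scale)

text \<open>Each point \<open>u\<close> lies on the circle of all \<open>circ t *s u\<close> in a
  complex line through the centre, where the one-variable mean value property holds. These rotations
  preserve Lebesgue measure and the ball, so averaging over \<open>t\<close> and \<open>u\<close>
  gives the claim.\<close>

lemma holo_mean_le:
  fixes h :: "complex^'n \<Rightarrow> complex"
  assumes h: "holo S h" and S: "cball y \<rho> \<subseteq> S" and \<rho>: "\<rho> > 0"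
  shows "ennreal (cmod (h y)) * emeasure lborel (ball y \<rho>) \<le> (\<integral>\<^sup>+u\<in>ball y \<rho>. ennreal (cmod (h u)) \<partial>lborel)"
proof -
  define H where "H = (\<lambda>u. if u \<in> ball 0 \<rho> then h (y + u) else 0)"
  have cont: "continuous_on (ball 0 \<rho>) (\<lambda>u. h (y + u))"
    by (rule continuous_on_compose2[OF holo_continuous[OF h]]) (use S in \<open>auto intro!: continuous_intros simp: subset_iff dist_norm\<close>)
  have [measurable]: "H \<in> borel_measurable borel"
    unfolding H_def by (rule measurable_if_ball[OF cont])
  have [measurable]: "circ \<in> borel_measurable borel"
    by (intro borel_measurable_continuous_onI continuous_intros)
  have em: "emeasure lborel (ball y \<rho>) = emeasure lborel (ball (0 :: complex^'n) \<rho>)"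
    using \<rho> by (simp add: emeasure_ball)
  have pt: "ennreal (cmod (h y)) * indicator (ball 0 \<rho>) u \<le> (\<integral>\<^sup>+t. ennreal (cmod (H (circ t *s u))) * indicator {0..1} t \<partial>lborel)" for u :: "complex^'n"
  proof (cases "norm u < \<rho>")
    case True
    have mem: "y + a *s u \<in> S" if "cmod a \<le> 1" for a
    proof -
      have "norm (a *s u) \<le> 1 * \<rho>" unfolding norm_scale using that True \<rho> by (intro mult_mono) auto
      then show ?thesis using S by (auto simp: subset_iff dist_norm)
    qed
    have Hc: "H (circ t *s u) = h (y + circ t *s u)" for t using True by (simp add: H_def norm_scale)
    have hi: "((\<lambda>t. h (y + circ t *s u)) has_integral h y) {0..1}"
      using holo_circle_mean(1)[OF h mem, of 1] by simp
    have "continuous_on {0..1} (\<lambda>t. h (y + circ t *s u))"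
      by (rule continuous_on_compose2[OF holo_continuous[OF h]]) (use mem in \<open>auto intro!: continuous_intros\<close>)
    then have ni: "(\<lambda>t. cmod (h (y + circ t *s u))) integrable_on {0..1}"
      by (intro integrable_continuous_real continuous_intros)
    have "cmod (h y) \<le> integral {0..1} (\<lambda>t. cmod (h (y + circ t *s u)))"
      using integral_norm_bound_integral[OF has_integral_integrable[OF hi] ni] hi by (simp add: integral_unique)
    also have "ennreal (integral {0..1} (\<lambda>t. cmod (h (y + circ t *s u)))) = (\<integral>\<^sup>+t. ennreal (cmod (h (y + circ t *s u))) * indicator {0..1} t \<partial>lborel)"
      by (rule nn_integral_has_integral_lebesgue'[symmetric]) (use ni in \<open>auto intro: integrable_integral\<close>)
    finally show ?thesis using True by (simp add: Hc ennreal_leI)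
  qed simp
  have "ennreal (cmod (h y)) * emeasure lborel (ball y \<rho>) = (\<integral>\<^sup>+u. ennreal (cmod (h y)) * indicator (ball (0 :: complex^'n) \<rho>) u \<partial>lborel)"
    unfolding em by (subst nn_integral_cmult_indicator) auto
  also have "\<dots> \<le> (\<integral>\<^sup>+u. \<integral>\<^sup>+t. ennreal (cmod (H (circ t *s u))) * indicator {0..1} t \<partial>lborel \<partial>lborel)"
    by (rule nn_integral_mono) (rule pt)
  also have "\<dots> = (\<integral>\<^sup>+t. \<integral>\<^sup>+u. ennreal (cmod (H (circ t *s u))) * indicator {0..1} t \<partial>lborel \<partial>lborel)"
    by (rule lborel_pair.Fubini') measurable
  also have "\<dots> = (\<integral>\<^sup>+t. (\<integral>\<^sup>+u. ennreal (cmod (H u)) \<partial>lborel) * indicator {0..1} (t::real) \<partial>lborel)"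
  proof (rule nn_integral_cong)
    fix t :: real
    have "(\<integral>\<^sup>+u. ennreal (cmod (H (circ t *s u))) \<partial>lborel) = (\<integral>\<^sup>+u. ennreal (cmod (H u)) \<partial>lborel)"
      by (rule nn_integral_circ[where F="\<lambda>u. ennreal (cmod (H u))"]) measurable
    then show "(\<integral>\<^sup>+u. ennreal (cmod (H (circ t *s u))) * indicator {0..1} t \<partial>lborel) = (\<integral>\<^sup>+u. ennreal (cmod (H u)) \<partial>lborel) * indicator {0..1} t"
      by (subst nn_integral_multc) auto
  qed
  also have "\<dots> = (\<integral>\<^sup>+u. ennreal (cmod (H u)) \<partial>lborel)"
    by (subst nn_integral_cmult_indicator) auto
  also have "\<dots> = (\<integral>\<^sup>+u. ennreal (cmod (H (- y + u))) \<partial>lborel)"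
    by (rule nn_integral_lborel_translate[where F="\<lambda>u. ennreal (cmod (H u))", symmetric]) measurable
  also have "\<dots> = (\<integral>\<^sup>+u\<in>ball y \<rho>. ennreal (cmod (h u)) \<partial>lborel)"
    by (intro nn_integral_cong) (auto simp: H_def indicator_def dist_norm norm_minus_commute)
  finally show ?thesis .
qed

text \<open>Prepares the absorption of a / 2. If x > a / 2, write x as x^(1 - p) x^p; the first
  factor is compared with a^(1 - p) through x > a / 2 for p \<ge> 1 and through x \<le> k a for p <
  1.\<close>

lemma le_half_plus_powr:
  fixes x a p k :: real
  assumes "0 \<le> x" "0 < a" "0 < p" "x \<le> k * a" "1 \<le> k"
  shows "x \<le> a / 2 + (2 powr (p - 1) + k powr (1 - p)) * a powr (1 - p) * x powr p"
proof (cases "x \<le> a / 2")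
  case True
  have "0 \<le> (2 powr (p - 1) + k powr (1 - p)) * a powr (1 - p) * x powr p" by simp
  with True show ?thesis by linarith
next
  case False
  then have x: "0 < x" using assms by auto
  have "x powr (1 - p) \<le> (2 powr (p - 1) + k powr (1 - p)) * a powr (1 - p)"
  proof (cases "p \<ge> 1")
    case True
    have "x powr (1 - p) \<le> (a / 2) powr (1 - p)" using True False assms by (intro powr_mono2') auto
    also have "\<dots> = 2 powr (p - 1) * a powr (1 - p)"
      using assms powr_minus_divide[of 2 "1 - p"] by (simp add: powr_divide)
    also have "\<dots> \<le> (2 powr (p - 1) + k powr (1 - p)) * a powr (1 - p)" by (intro mult_right_mono) auto
    finally show ?thesis .
  next
    case False
    have "x powr (1 - p) \<le> (k * a) powr (1 - p)" using False assms by (intro powr_mono2) auto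
    also have "\<dots> = k powr (1 - p) * a powr (1 - p)" using assms by (simp add: powr_mult)
    also have "\<dots> \<le> (2 powr (p - 1) + k powr (1 - p)) * a powr (1 - p)" by (intro mult_right_mono) auto
    finally show ?thesis .
  qed
  then have "x powr (1 - p) * x powr p \<le> (2 powr (p - 1) + k powr (1 - p)) * a powr (1 - p) * x powr p"
    by (rule mult_right_mono) simp
  moreover have "x powr (1 - p) * x powr p = x" using x by (simp add: powr_add[symmetric])
  ultimately show ?thesis using assms by linarith
qed

text \<open>For exponents below one the mean value inequality is applied where
  \<open>(1/4 - \<bar>u\<bar>)\<^sup>\<kappa> \<bar>h u\<bar>\<close> is maximal (an idea of Hardy and Littlewood): there \<open>h\<close> is
  controlled on a whole ball by its value at the centre.\<close>

lemma holo_submean_0: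
  fixes p :: real
  assumes p: "0 < p"
  obtains C where "C > 0" "\<And>h :: complex^'n \<Rightarrow> complex. holo (ball 0 1) h \<Longrightarrow>
    ennreal (cmod (h 0) powr p) \<le> ennreal C * (\<integral>\<^sup>+u\<in>ball 0 (1/4). ennreal (cmod (h u) powr p) \<partial>lborel)"
proof
  define m where "m = 2 * CARD('n)"
  define R where "R = (1/4 :: real)"
  \<comment> \<open>With this exponent, the p-th power of the maximised quantity carries the factor
    (R - norm u)^m, which is the volume of a ball of that radius up to a constant.\<close>
  define \<kappa> where "\<kappa> = real m / p"
  define k where "k = (2::real) powr \<kappa>"
  define K where "K = 2 powr (p - 1) + k powr (1 - p)"
  define V where "V = unit_ball_vol (real m)"
  define C where "C = 2 * K * 2 ^ m / (V * R ^ m)"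
  have \<kappa>: "\<kappa> > 0" using p card_pos[where 'n='n] by (simp add: \<kappa>_def m_def)
  have k: "k \<ge> 1" using \<kappa> by (simp add: k_def ge_one_powr_ge_zero)
  have K: "K > 0" unfolding K_def using k by (intro add_pos_pos) auto
  have V: "V > 0" unfolding V_def by (rule unit_ball_vol_pos) simp
  show "C > 0" using K V by (simp add: C_def R_def)
  fix h :: "complex^'n \<Rightarrow> complex" assume h: "holo (ball 0 1) h"
  have hc: "continuous_on (ball 0 1) h" by (rule holo_continuous[OF h])
  let ?I = "\<integral>\<^sup>+u\<in>ball 0 R. ennreal (cmod (h u) powr p) \<partial>lborel"
  define H where "H = (\<lambda>u. if u \<in> ball 0 1 then h u else 0)"
  have [measurable]: "H \<in> borel_measurable borel" unfolding H_def by (rule measurable_if_ball[OF hc])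
  show "ennreal (cmod (h 0) powr p) \<le> ennreal C * (\<integral>\<^sup>+u\<in>ball 0 (1/4). ennreal (cmod (h u) powr p) \<partial>lborel)"
  proof (cases "h 0 = 0 \<or> ?I = \<infinity>")
    case True
    have "C \<noteq> 0" using \<open>C > 0\<close> by simp
    then show ?thesis using True \<open>C > 0\<close> by (auto simp: R_def ennreal_mult_top)
  next
    case False
    then have h0: "h 0 \<noteq> 0" and "?I \<noteq> \<infinity>" by auto
    then obtain I where I: "?I = ennreal I" "I \<ge> 0" by (cases ?I) auto
    define \<phi> where "\<phi> = (\<lambda>u. (R - norm u) powr \<kappa> * cmod (h u))"
    have "continuous_on (cball 0 R) \<phi>"
      unfolding \<phi>_def using \<kappa>
      by (intro continuous_intros continuous_on_powr' continuous_on_subset[OF hc]) (auto simp: R_def)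
    then obtain y where y: "y \<in> cball 0 R" "\<And>u. u \<in> cball 0 R \<Longrightarrow> \<phi> u \<le> \<phi> y"
      using continuous_attains_sup[of "cball 0 R" \<phi>] by (auto simp: R_def)
    have "0 < \<phi> 0" using h0 by (simp add: \<phi>_def R_def)
    also have \<phi>0: "\<phi> 0 \<le> \<phi> y" by (rule y) (simp add: R_def)
    finally have "R - norm y \<noteq> 0" "h y \<noteq> 0" by (auto simp: \<phi>_def)
    then have yR: "norm y < R" using y(1) by simp
    define a where "a = cmod (h y)"
    have a: "a > 0" using \<open>h y \<noteq> 0\<close> by (simp add: a_def)
    \<comment> \<open>Half the distance from \<open>y\<close> to the boundary: on
      \<open>ball y \<rho>\<close> the distance is still at least \<open>\<rho>\<close>, so
      maximality gives \<bar>h u\<bar> \<le> 2^\<kappa> a.\<close>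
    define \<rho> where "\<rho> = (R - norm y) / 2"
    have \<rho>: "\<rho> > 0" "R - norm y = 2 * \<rho>" using yR by (auto simp: \<rho>_def)
    have uR: "\<rho> \<le> R - norm u" if "u \<in> cball y \<rho>" for u
      using that norm_triangle_ineq2[of u y] \<rho>(2) by (simp add: dist_norm norm_minus_commute)
    have hu: "cmod (h u) \<le> k * a" if u: "u \<in> ball y \<rho>" for u
    proof -
      have uR': "\<rho> \<le> R - norm u" using uR[of u] u by simp
      have "\<rho> powr \<kappa> * cmod (h u) \<le> (R - norm u) powr \<kappa> * cmod (h u)"
        using uR' \<rho> \<kappa> by (intro mult_right_mono powr_mono2) auto
      also have "\<dots> \<le> (2 * \<rho>) powr \<kappa> * a"
        using y(2)[of u] uR' \<rho> unfolding \<phi>_def \<rho>(2) a_def by simp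
      also have "\<dots> = \<rho> powr \<kappa> * (k * a)" using \<rho> by (simp add: powr_mult k_def)
      finally show ?thesis using \<rho> by simp
    qed
      have ballR: "norm u < R" if "u \<in> cball y \<rho>" for u using uR[OF that] \<rho> by linarith
    have "ball y \<rho> \<subseteq> ball 0 R" using ballR by auto
    then have mono: "(\<integral>\<^sup>+u\<in>ball y \<rho>. ennreal (cmod (h u) powr p) \<partial>lborel) \<le> ennreal I"
      unfolding I(1)[symmetric] by (intro nn_integral_mono) (auto simp: indicator_def)
    have eB: "emeasure lborel (ball y \<rho>) = ennreal (V * \<rho> ^ m)"
      using \<rho> by (simp add: emeasure_ball V_def m_def mult.commute)
    have "ennreal (a * (V * \<rho> ^ m)) = ennreal (cmod (h y)) * emeasure lborel (ball y \<rho>)"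
      unfolding eB a_def using V \<rho> by (simp add: ennreal_mult)
    also have "\<dots> \<le> (\<integral>\<^sup>+u\<in>ball y \<rho>. ennreal (cmod (h u)) \<partial>lborel)"
      by (rule holo_mean_le[OF h _ \<rho>(1)]) (use ballR in \<open>fastforce simp: R_def\<close>)
    also have "\<dots> \<le> (\<integral>\<^sup>+u. ennreal (a / 2) * indicator (ball y \<rho>) u + ennreal (K * a powr (1 - p)) * (ennreal (cmod (H u) powr p) * indicator (ball y \<rho>) u) \<partial>lborel)"
    proof (rule nn_integral_mono)
      fix u
      show "ennreal (cmod (h u)) * indicator (ball y \<rho>) u \<le> ennreal (a / 2) * indicator (ball y \<rho>) u + ennreal (K * a powr (1 - p)) * (ennreal (cmod (H u) powr p) * indicator (ball y \<rho>) u)"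
      proof (cases "u \<in> ball y \<rho>")
        case True
        have "norm u < 1" using ballR[of u] True by (auto simp: R_def)
        then have Hu: "H u = h u" by (simp add: H_def)
        have "cmod (h u) \<le> a / 2 + K * a powr (1 - p) * cmod (h u) powr p"
          unfolding K_def by (rule le_half_plus_powr) (use a p k hu[OF True] in auto)
        then have "ennreal (cmod (h u)) \<le> ennreal (a / 2) + ennreal (K * a powr (1 - p)) * ennreal (cmod (h u) powr p)"
          using a K by (subst ennreal_mult[symmetric]) (auto simp: ennreal_plus[symmetric] simp del: ennreal_plus intro!: ennreal_leI)
        then show ?thesis using True Hu by simp
      qed simp
    qed
    also have "\<dots> = ennreal (a / 2) * emeasure lborel (ball y \<rho>) + ennreal (K * a powr (1 - p)) * (\<integral>\<^sup>+u. ennreal (cmod (H u) powr p) * indicator (ball y \<rho>) u \<partial>lborel)"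
      by (subst nn_integral_add, measurable, measurable, subst nn_integral_cmult_indicator, simp, subst nn_integral_cmult, measurable)
    also have "(\<integral>\<^sup>+u. ennreal (cmod (H u) powr p) * indicator (ball y \<rho>) u \<partial>lborel) = (\<integral>\<^sup>+u\<in>ball y \<rho>. ennreal (cmod (h u) powr p) \<partial>lborel)"
    proof (rule nn_integral_cong)
      fix u show "ennreal (cmod (H u) powr p) * indicator (ball y \<rho>) u = ennreal (cmod (h u) powr p) * indicator (ball y \<rho>) u"
        using ballR[of u] by (auto simp: indicator_def H_def R_def)
    qed
    also have "ennreal (a / 2) * emeasure lborel (ball y \<rho>) + ennreal (K * a powr (1 - p)) * (\<integral>\<^sup>+u\<in>ball y \<rho>. ennreal (cmod (h u) powr p) \<partial>lborel)
      \<le> ennreal (a / 2) * ennreal (V * \<rho> ^ m) + ennreal (K * a powr (1 - p)) * ennreal I"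
      unfolding eB by (intro add_mono mult_left_mono mono) auto
    also have "\<dots> = ennreal (a / 2 * (V * \<rho> ^ m) + K * a powr (1 - p) * I)"
    proof -
      have 1: "ennreal (a / 2) * ennreal (V * \<rho> ^ m) = ennreal (a / 2 * (V * \<rho> ^ m))"
        by (rule ennreal_mult[symmetric]) (use a V \<rho> in auto)
      have 2: "ennreal (K * a powr (1 - p)) * ennreal I = ennreal (K * a powr (1 - p) * I)"
        by (rule ennreal_mult[symmetric]) (use a K I in auto)
      show ?thesis unfolding 1 2 by (rule ennreal_plus[symmetric]) (use a V \<rho> K I in auto)
    qed
    finally have *: "ennreal (a * (V * \<rho> ^ m)) \<le> ennreal (a / 2 * (V * \<rho> ^ m) + K * a powr (1 - p) * I)" .
    have "0 \<le> a / 2 * (V * \<rho> ^ m) + K * a powr (1 - p) * I"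
      by (intro add_nonneg_nonneg mult_nonneg_nonneg) (use a V \<rho> K I in auto)
    with * have "a * (V * \<rho> ^ m) \<le> a / 2 * (V * \<rho> ^ m) + K * a powr (1 - p) * I"
      by (simp only: ennreal_le_iff)
    \<comment> \<open>The term with a / 2 is absorbed on the left. This is legitimate because
      \<open>a\<close> is a finite number, being the value of \<open>h\<close> at a point.\<close>
    then have "a * (V * \<rho> ^ m) \<le> 2 * K * a powr (1 - p) * I" by simp
    then have "a powr (p - 1) * (a * (V * \<rho> ^ m)) \<le> a powr (p - 1) * (2 * K * a powr (1 - p) * I)"
      by (rule mult_left_mono) simp
    moreover have "a powr (p - 1) * a = a powr p" "a powr (p - 1) * a powr (1 - p) = 1"
      using a by (auto simp: powr_add[symmetric] powr_mult_base mult.commute)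
    ultimately have 1: "a powr p * (V * \<rho> ^ m) \<le> 2 * K * I"
      by (simp only: mult.assoc[symmetric]) (simp add: mult_ac)
    have "\<phi> 0 powr p \<le> \<phi> y powr p" using \<phi>0 p \<open>0 < \<phi> 0\<close> by (intro powr_mono2) auto
    moreover have \<kappa>p: "(x powr \<kappa>) powr p = x ^ m" if "x > 0" for x
    proof -
      have "\<kappa> * p = real m" using p by (simp add: \<kappa>_def)
      then have "(x powr \<kappa>) powr p = x powr real m" by (simp only: powr_powr)
      also have "\<dots> = x ^ m" by (rule powr_realpow[OF that])
      finally show ?thesis .
    qed
    have "\<phi> 0 powr p = R ^ m * cmod (h 0) powr p" by (simp add: \<phi>_def powr_mult \<kappa>p) (simp add: R_def \<kappa>p)
    moreover have "\<phi> y powr p = (2 * \<rho>) ^ m * a powr p"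
      unfolding \<phi>_def \<rho>(2) a_def[symmetric] using \<rho> by (simp add: powr_mult \<kappa>p del: powr_powr)
    ultimately have "V * (R ^ m * cmod (h 0) powr p) \<le> V * ((2 * \<rho>) ^ m * a powr p)"
      using V by simp
    also have "\<dots> = 2 ^ m * (a powr p * (V * \<rho> ^ m))" by (simp add: power_mult_distrib)
    also have "\<dots> \<le> 2 ^ m * (2 * K * I)" using 1 by (intro mult_left_mono) auto
    finally have "cmod (h 0) powr p \<le> C * I"
      using V by (simp add: C_def R_def field_simps)
    then have "ennreal (cmod (h 0) powr p) \<le> ennreal C * ?I"
      unfolding I(1) using \<open>C > 0\<close> I by (simp add: ennreal_mult[symmetric] ennreal_leI)
    then show ?thesis by (simp add: R_def)
  qed
qed

section \<open>Composition of holomorphic functions with the involutions\<close>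

lemma holo_inverse:
  assumes f: "holo S f" and nz: "\<And>z. z \<in> S \<Longrightarrow> f z \<noteq> 0"
  shows "holo S (\<lambda>z. inverse (f z))"
proof (rule holoI[where D="\<lambda>z v. - (inverse (f z) * dh f z v * inverse (f z))"])
  fix z assume "z \<in> S"
  then show "((\<lambda>z. inverse (f z)) has_derivative (\<lambda>v. - (inverse (f z) * dh f z v * inverse (f z)))) (at z)"
    by (intro Deriv.has_derivative_inverse holo_has_derivative[OF f] nz)
qed (simp add: dh_scale)

lemma holo_compose:
  fixes \<phi> :: "complex^'m \<Rightarrow> complex^'n"
  assumes \<phi>: "\<And>j. holo S (\<lambda>z. \<phi> z $ j)" and im: "\<And>z. z \<in> S \<Longrightarrow> \<phi> z \<in> T" and h: "holo T h"
  shows "holo S (\<lambda>z. h (\<phi> z))"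
proof (rule holoI[where D="\<lambda>z v. dh h (\<phi> z) (\<Sum>j\<in>UNIV. axis j (dh (\<lambda>z. \<phi> z $ j) z v))"])
  fix z assume z: "z \<in> S"
  have "((\<lambda>z. \<Sum>j\<in>UNIV. axis j (\<phi> z $ j)) has_derivative (\<lambda>v. \<Sum>j\<in>UNIV. axis j (dh (\<lambda>z. \<phi> z $ j) z v))) (at z)"
  proof (intro has_derivative_sum)
    fix j :: 'n
    have bl: "bounded_linear (\<lambda>c::complex. axis j c)"
      by (auto simp: linear_conv_bounded_linear[symmetric] vec_eq_iff axis_def intro!: linearI)
    show "((\<lambda>z. axis j (\<phi> z $ j)) has_derivative (\<lambda>v. axis j (dh (\<lambda>z. \<phi> z $ j) z v))) (at z)"
      by (rule bounded_linear.has_derivative[OF bl holo_has_derivative[OF \<phi> z]])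
  qed
  then have "(\<phi> has_derivative (\<lambda>v. \<Sum>j\<in>UNIV. axis j (dh (\<lambda>z. \<phi> z $ j) z v))) (at z)"
    by (simp add: sum_axis)
  from has_derivative_compose[OF this holo_has_derivative[OF h im[OF z]]]
  show "((\<lambda>z. h (\<phi> z)) has_derivative (\<lambda>v. dh h (\<phi> z) (\<Sum>j\<in>UNIV. axis j (dh (\<lambda>z. \<phi> z $ j) z v)))) (at z)" .
next
  fix z c v
  have "(\<Sum>j\<in>UNIV. axis j (dh (\<lambda>z. \<phi> z $ j) z (c *s v))) = c *s (\<Sum>j\<in>UNIV. axis j (dh (\<lambda>z. \<phi> z $ j) z v))"
    unfolding sum_axis by (simp add: vec_eq_iff dh_scale)
  then show "dh h (\<phi> z) (\<Sum>j\<in>UNIV. axis j (dh (\<lambda>z. \<phi> z $ j) z (c *s v))) = c * dh h (\<phi> z) (\<Sum>j\<in>UNIV. axis j (dh (\<lambda>z. \<phi> z $ j) z v))"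
    by (simp add: dh_scale)
qed

lemma holo_diff: "holo S f \<Longrightarrow> holo S g \<Longrightarrow> holo S (\<lambda>z. f z - g z)"
  using holo_add[of S f "\<lambda>z. (-1) * g z"] holo_mult[OF holo_const, of S g "-1"] by simp

lemma holo_cinner: "holo S (\<lambda>z. cinner z w)"
  unfolding cinner_def by (intro holo_sum holo_mult holo_nth holo_const) auto

lemma holo_invol:
  fixes a :: "complex^'n"
  assumes a: "norm a < 1" shows "holo (ball 0 1) (\<lambda>z. invol a z $ j)"
proof -
  define S where "S = complex_of_real (sqrt (1 - norm a ^ 2))"
  have "holo (ball 0 1) (\<lambda>z. inverse (1 - cinner z a) * (a $ j - cinner z a * (1 / cinner a a * a $ j) - S * (z $ j - cinner z a * (1 / cinner a a * a $ j))))"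
    by (intro holo_mult holo_inverse holo_diff holo_const holo_cinner holo_nth)
       (use one_minus_cinner_neq_0[OF _ a] in auto)
  moreover have "invol a z $ j = inverse (1 - cinner z a) * (a $ j - cinner z a * (1 / cinner a a * a $ j) - S * (z $ j - cinner z a * (1 / cinner a a * a $ j)))" for z
    by (simp only: invol_def proj_def S_def vector_minus_component vector_smult_component) (simp add: divide_inverse)
  ultimately show ?thesis by simp
qed

lemma invol_invol_ball:
  fixes a z :: "complex^'n"
  shows "norm a < 1 \<Longrightarrow> norm z < 1 \<Longrightarrow> invol a (invol a z) = z"
  using one_minus_cinner_neq_0[of z a] by (intro invol_invol) auto

text \<open>The estimate at the origin is applied to \<open>h\<close> composed with
  \<open>invol a\<close>. The invariant weight is at least 1, and invariance carries the integral
  over the small ball to the Bergman ball around \<open>a\<close>.\<close>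

lemma holo_submean:
  fixes p :: real
  assumes p: "0 < p"
  obtains C where "C > 0" "\<And>(h :: complex^'n \<Rightarrow> complex) a. holo (ball 0 1) h \<Longrightarrow> norm a < 1 \<Longrightarrow>
    ennreal (cmod (h a) powr p) \<le> ennreal C * (\<integral>\<^sup>+w. ennreal (cmod (h w) powr p) * indicator {w. norm (invol a w) < 1/4} w \<partial>inv_vol)"
proof -
  obtain C where C: "C > 0" "\<And>h :: complex^'n \<Rightarrow> complex. holo (ball 0 1) h \<Longrightarrow>
    ennreal (cmod (h 0) powr p) \<le> ennreal C * (\<integral>\<^sup>+u\<in>ball 0 (1/4). ennreal (cmod (h u) powr p) \<partial>lborel)"
    using holo_submean_0[where 'n='n, OF p] by blast
  define V where "V = measure lborel (ball 0 1 :: (complex^'n) set)"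
  have V: "emeasure lborel (ball 0 1 :: (complex^'n) set) = ennreal V" "V > 0"
    using emeasure_unit_ball[where 'n='n] by (auto simp: V_def emeasure_eq_ennreal_measure zero_less_measure_iff)
  have V': "ennreal V * (x / ennreal V) = x" for x
    using V mult_divide_eq_ennreal[of "ennreal V" x] by (simp add: ennreal_times_divide mult.commute)
  show thesis
  proof
    show "C * V > 0" using C V by simp
    fix h :: "complex^'n \<Rightarrow> complex" and a :: "complex^'n" assume h: "holo (ball 0 1) h" and a: "norm a < 1"
    define H where "H = cut h"
    have [measurable]: "H \<in> borel_measurable borel" unfolding H_def by (rule measurable_cut[OF holo_continuous[OF h]])
    have ha: "holo (ball 0 1) (\<lambda>z. h (invol a z))"
      by (rule holo_compose[OF holo_invol[OF a] _ h]) (use invol_ball[OF a] in auto)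
    have "ennreal (cmod (h a) powr p) \<le> ennreal C * (\<integral>\<^sup>+u\<in>ball 0 (1/4). ennreal (cmod (h (invol a u)) powr p) \<partial>lborel)"
      using C(2)[OF ha] by (simp add: invol_0)
    also have "(\<integral>\<^sup>+u\<in>ball 0 (1/4). ennreal (cmod (h (invol a u)) powr p) \<partial>lborel)
      \<le> (\<integral>\<^sup>+u. (ennreal (cmod (H (invol a u)) powr p) * indicator (ball 0 (1/4)) (invol a (invol a u))) * tau_weight u \<partial>lborel)"
    proof (rule nn_integral_mono)
      fix u :: "complex^'n"
      show "ennreal (cmod (h (invol a u)) powr p) * indicator (ball 0 (1/4)) u \<le> (ennreal (cmod (H (invol a u)) powr p) * indicator (ball 0 (1/4)) (invol a (invol a u))) * tau_weight u"
      proof (cases "norm u < 1/4")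
        case True
        then have u: "norm u < 1" by simp
        have "1 \<le> (1 - (norm u)\<^sup>2) powr (- real CARD('n) - 1)"
          using one_minus_norm_pos[OF u] powr_mono2'[of "- real CARD('n) - 1" "1 - (norm u)\<^sup>2" 1] by simp
        then have "1 \<le> tau_weight u" using u by (simp add: tau_weight_def)
        then have "ennreal (cmod (h (invol a u)) powr p) * 1 \<le> ennreal (cmod (h (invol a u)) powr p) * tau_weight u"
          by (rule mult_left_mono) simp
        then show ?thesis using True u invol_ball[OF a u] by (simp add: invol_invol_ball[OF a u] H_def cut_def)
      qed simp
    qed
    also have "\<dots> = (\<integral>\<^sup>+u. (ennreal (cmod (H u) powr p) * indicator (ball 0 (1/4)) (invol a u)) * tau_weight u \<partial>lborel)"
      by (rule nn_integral_invol_lborel[OF a, where F="\<lambda>u. ennreal (cmod (H u) powr p) * indicator (ball 0 (1/4)) (invol a u)"]) measurable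
    also have "\<dots> = ennreal V * (\<integral>\<^sup>+u. ennreal (cmod (H u) powr p) * indicator (ball 0 (1/4)) (invol a u) \<partial>inv_vol)"
      by (subst nn_integral_inv_vol, measurable)
         (simp only: V V')
    also have "(\<integral>\<^sup>+u. ennreal (cmod (H u) powr p) * indicator (ball 0 (1/4)) (invol a u) \<partial>inv_vol) \<le> (\<integral>\<^sup>+w. ennreal (cmod (h w) powr p) * indicator {w. norm (invol a w) < 1/4} w \<partial>inv_vol)"
      by (intro nn_integral_mono) (auto simp: H_def cut_def indicator_def)
    finally show "ennreal (cmod (h a) powr p) \<le> ennreal (C * V) * (\<integral>\<^sup>+w. ennreal (cmod (h w) powr p) * indicator {w. norm (invol a w) < 1/4} w \<partial>inv_vol)"
      using C V by (simp add: ennreal_mult mult.assoc mult_left_mono)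
  qed
qed

subsection \<open>Pointwise bounds in the target space\<close>

lemma AE_vol_ball: "AE w in (vol :: (complex^'n) measure). norm w < 1"
proof -
  have "AE w in vol. w \<in> (ball 0 1 :: (complex^'n) set)" unfolding vol_def
    by (rule AE_uniform_measureI) auto
  then show ?thesis by simp
qed

lemma AE_inv_vol_ball: "AE w in (inv_vol :: (complex^'n) measure). norm w < 1"
  unfolding inv_vol_def by (subst AE_density) (use AE_vol_ball in auto)

text \<open>With \<open>D\<close> the modulus of \<open>1 - cinner w z\<close>,
  \<open>norm_invol\<close> gives 15/16 D^2 \<le> X Y, and the triangle inequality gives X \<le> 2 D
  and Y \<le> 2 D. Hence the two weights differ by a factor of at most 64/15, rounded up to
  5.\<close>

lemma invol_ball_comparable:
  fixes z w :: "complex^'n"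
  assumes z: "norm z < 1" and w: "norm w < 1" and d: "norm (invol z w) < 1/4"
  shows "1 - (norm w)\<^sup>2 \<le> 5 * (1 - (norm z)\<^sup>2)" "1 - (norm z)\<^sup>2 \<le> 5 * (1 - (norm w)\<^sup>2)"
proof -
  define X where "X = 1 - (norm z)\<^sup>2"
  define Y where "Y = 1 - (norm w)\<^sup>2"
  define D where "D = cmod (1 - cinner w z)"
  have pos: "X > 0" "Y > 0" "D > 0"
    using one_minus_norm_pos z w one_minus_cinner_neq_0[OF w z] by (auto simp: X_def Y_def D_def)
  have "(norm (invol z w))\<^sup>2 \<le> (1/4)\<^sup>2" using d by (intro power_mono) auto
  then have "15/16 \<le> 1 - (norm (invol z w))\<^sup>2" by (simp add: power2_eq_square)
  also have "\<dots> = X * Y / D\<^sup>2" unfolding norm_invol[OF z w] X_def Y_def D_def ..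
  finally have 1: "15/16 * D\<^sup>2 \<le> X * Y" using pos by (simp add: field_simps)
  have D: "1 - norm w * norm z \<le> D"
    unfolding D_def using norm_triangle_ineq2[of 1 "cinner w z"] norm_cinner_le[of w z] by simp
  have "norm w * norm z \<le> norm z" "norm w * norm z \<le> norm w"
    using z w by (auto intro!: mult_left_le_one_le mult_right_le_one_le)
  with D have D': "1 - norm z \<le> D" "1 - norm w \<le> D" by linarith+
  have "X = (1 - norm z) * (1 + norm z)" "Y = (1 - norm w) * (1 + norm w)"
    by (simp_all add: X_def Y_def power2_eq_square algebra_simps)
  moreover have "(1 - norm z) * (1 + norm z) \<le> D * 2" "(1 - norm w) * (1 + norm w) \<le> D * 2"
    using D' z w pos by (auto intro!: mult_mono)
  ultimately have "X \<le> D * 2" "Y \<le> D * 2" by simp_all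
  then have "X\<^sup>2 \<le> (D * 2)\<^sup>2" "Y\<^sup>2 \<le> (D * 2)\<^sup>2" using pos by (intro power_mono; simp)+
  then have "15/64 * (X * X) \<le> X * Y" "15/64 * (Y * Y) \<le> X * Y"
    using 1 by (simp_all add: power2_eq_square)
  then have "15/64 * X \<le> Y" "15/64 * Y \<le> X"
    using pos by (simp_all add: mult.commute[of X Y] mult.assoc[symmetric])
  then show "Y \<le> 5 * X" "X \<le> 5 * Y" using pos by linarith+
qed

lemma hol_ball_holo: "f \<in> hol_ball \<Longrightarrow> holo (ball 0 1) f"
  unfolding hol_ball_def holo_def by simp

lemma hol_ballI: "holo (ball 0 1) f \<Longrightarrow> (\<And>z. z \<notin> ball 0 1 \<Longrightarrow> f z = 0) \<Longrightarrow> f \<in> hol_ball"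
  unfolding hol_ball_def holo_def by simp

lemma continuous_on_grad:
  assumes "holo (ball 0 1) f" shows "continuous_on (ball 0 1) (grad f)"
  unfolding grad_def by (intro continuous_on_vec_lambda partial_d_continuous[OF assms]) auto

lemma norm_dh_le: "cmod (dh f z v) \<le> norm v * norm (grad f z)"
proof -
  have "cmod (dh f z v) \<le> (\<Sum>j\<in>UNIV. \<bar>cmod (v $ j)\<bar> * \<bar>cmod (grad f z $ j)\<bar>)"
    unfolding dh_def by (rule order_trans[OF norm_sum]) (simp add: norm_mult grad_def)
  also have "\<dots> \<le> norm v * norm (grad f z)"
    unfolding norm_vec_def by (rule L2_set_mult_ineq)
  finally show ?thesis .
qed

lemma epowr_mult: "0 < c \<Longrightarrow> epowr (ennreal c * x) a = ennreal (c powr a) * epowr x a"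
  by (cases x) (auto simp: epowr_def ennreal_mult[symmetric] ennreal_mult_top powr_mult)

lemma epowr_powr: "0 \<le> x \<Longrightarrow> 0 < p \<Longrightarrow> epowr (ennreal (x powr p)) (1 / p) = ennreal x"
  by (simp add: epowr_ennreal powr_powr)

text \<open>\<open>vol\<close> lives on the ball, and for holomorphic \<open>f\<close> the function
  \<open>cut (grad f)\<close> is Borel on the whole space.\<close>

lemma F_integral_cut:
  "(\<integral>\<^sup>+w. ennreal (norm (grad f w) powr p * (1 - norm w ^ 2) powr q) * epowr (green z w) s \<partial>vol)
  = (\<integral>\<^sup>+w. ennreal (norm (cut (grad f) w) powr p * (1 - norm w ^ 2) powr q) * epowr (green z w) s \<partial>vol)"
  by (rule nn_integral_cong_AE) (use AE_vol_ball in eventually_elim, simp add: cut_def)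

lemma measurable_green [measurable]: "green z \<in> borel_measurable borel"
  unfolding green_def[abs_def] by measurable

lemma F_norm_ge:
  fixes u :: "complex^'n \<Rightarrow> complex"
  assumes p: "0 < p" and z: "norm z < 1"
  shows "epowr (\<integral>\<^sup>+w. ennreal (norm (cut (grad u) w) powr p * (1 - norm w ^ 2) powr q) * epowr (green z w) s \<partial>vol) (1 / p) \<le> F_norm p q s u"
proof -
  have "(\<integral>\<^sup>+w. ennreal (norm (cut (grad u) w) powr p * (1 - norm w ^ 2) powr q) * epowr (green z w) s \<partial>vol)
    \<le> (SUP z\<in>ball 0 1. \<integral>\<^sup>+w. ennreal (norm (grad u w) powr p * (1 - norm w ^ 2) powr q) * epowr (green z w) s \<partial>vol)"
    unfolding F_integral_cut[symmetric] by (rule SUP_upper) (use z in simp)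
  then show ?thesis
    unfolding F_norm_def using p by (intro epowr_mono) (auto intro: add_increasing)
qed

lemma F_norm_ge_radial:
  fixes p q s :: real
  assumes p: "0 < p" and q: "- real CARD('n) - 1 < q" and s: "0 \<le> s"
  obtains C where "C > 0" "\<And>(u :: complex^'n \<Rightarrow> complex) z. u \<in> hol_ball \<Longrightarrow> norm z < 1 \<Longrightarrow>
    ennreal (cmod (radial_d u z) * (1 - (norm z)\<^sup>2) powr ((real CARD('n) + 1 + q) / p)) \<le> ennreal C * F_norm p q s u"
proof -
  obtain C where C: "C > 0" "\<And>(h :: complex^'n \<Rightarrow> complex) a. holo (ball 0 1) h \<Longrightarrow> norm a < 1 \<Longrightarrow>
    ennreal (cmod (h a) powr p) \<le> ennreal C * (\<integral>\<^sup>+w. ennreal (cmod (h w) powr p) * indicator {w. norm (invol a w) < 1/4} w \<partial>inv_vol)"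
    using holo_submean[where 'n='n, OF p] by blast
  obtain c where c: "c > 0" "\<And>(z :: complex^'n) r. 0 < r \<Longrightarrow> r \<le> 1/4 \<Longrightarrow> norm z \<le> r \<Longrightarrow>
    ennreal (c * r powr (- (2 * real CARD('n) - 2))) \<le> green0 z"
    using green0_lower[where 'n='n] by blast
  define e where "e = real CARD('n) + 1 + q"
  \<comment> \<open>\<open>d\<close> is the lower bound of the Green power on the Bergman ball of
    radius 1/4; in \<open>K\<close> it is combined with the price 5^e of replacing the weight at
    \<open>z\<close> by that at \<open>w\<close>.\<close>
  define d where "d = (c * (1/4) powr (- (2 * real CARD('n) - 2))) powr s"
  define K where "K = 5 powr e / d"
  have e: "e > 0" using q by (simp add: e_def)
  have d: "d > 0" using c by (simp add: d_def)
  have K: "K > 0" using d by (simp add: K_def)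
  show thesis
  proof
    show "(C * K) powr (1 / p) > 0" using C K by simp
    fix u :: "complex^'n \<Rightarrow> complex" and z :: "complex^'n" assume u: "u \<in> hol_ball" and z: "norm z < 1"
    define X where "X = 1 - (norm z)\<^sup>2"
    have X: "X > 0" unfolding X_def by (rule one_minus_norm_pos[OF z])
    have hu: "holo (ball 0 1) u" by (rule hol_ball_holo[OF u])
    have hr: "holo (ball 0 1) (radial_d u)" by (rule holo_radial_d[OF hu]) simp
    have [measurable]: "cut (radial_d u) \<in> borel_measurable borel" "cut (grad u) \<in> borel_measurable borel"
      by (rule measurable_cut, rule holo_continuous[OF hr], rule measurable_cut, rule continuous_on_grad[OF hu])
    let ?J = "\<integral>\<^sup>+w. ennreal (norm (cut (grad u) w) powr p * (1 - norm w ^ 2) powr q) * epowr (green z w) s \<partial>vol"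
    have G: "ennreal d \<le> epowr (green z w) s" if w: "norm w < 1" "norm (invol z w) < 1/4" for w
    proof -
      have "ennreal (c * (1/4) powr (- (2 * real CARD('n) - 2))) \<le> green z w"
        unfolding green_def using norm_invol_commute[OF z w(1)] w(2) by (intro c) auto
      then have "epowr (ennreal (c * (1/4) powr (- (2 * real CARD('n) - 2)))) s \<le> epowr (green z w) s"
        using s by (rule epowr_mono[rotated])
      then show ?thesis unfolding d_def using c by (subst (asm) epowr_ennreal) auto
    qed
    have "ennreal ((cmod (radial_d u z) * X powr (e / p)) powr p) = ennreal (X powr e) * ennreal (cmod (radial_d u z) powr p)"
      using p by (simp add: powr_mult powr_powr ennreal_mult[symmetric] mult.commute)
    also have "\<dots> \<le> ennreal (X powr e) * (ennreal C * (\<integral>\<^sup>+w. ennreal (cmod (radial_d u w) powr p) * indicator {w. norm (invol z w) < 1/4} w \<partial>inv_vol))"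
      by (intro mult_left_mono C(2)[OF hr z]) simp
    also have "(\<integral>\<^sup>+w. ennreal (cmod (radial_d u w) powr p) * indicator {w. norm (invol z w) < 1/4} w \<partial>inv_vol)
        = (\<integral>\<^sup>+w. ennreal (cmod (cut (radial_d u) w) powr p) * indicator {w. norm (invol z w) < 1/4} w \<partial>inv_vol)"
      by (rule nn_integral_cong_AE) (use AE_inv_vol_ball in eventually_elim, simp add: cut_def)
    also have "\<dots> = (\<integral>\<^sup>+w. ennreal (cmod (cut (radial_d u) w) powr p) * indicator {w. norm (invol z w) < 1/4} w * ennreal ((1 - (norm w)\<^sup>2) powr (- real CARD('n) - 1)) \<partial>vol)"
      by (rule nn_integral_inv_vol_vol) measurable
    also have "ennreal (X powr e) * (ennreal C * \<dots>) = ennreal C * (\<integral>\<^sup>+w. ennreal (X powr e) * (ennreal (cmod (cut (radial_d u) w) powr p) * indicator {w. norm (invol z w) < 1/4} w * ennreal ((1 - (norm w)\<^sup>2) powr (- real CARD('n) - 1))) \<partial>vol)"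
      by (subst nn_integral_cmult, measurable) (simp add: mult_ac)
    also have "\<dots> \<le> ennreal C * (\<integral>\<^sup>+w. ennreal K * (ennreal (norm (cut (grad u) w) powr p * (1 - norm w ^ 2) powr q) * epowr (green z w) s) \<partial>vol)"
    proof (rule mult_left_mono[OF nn_integral_mono_AE])
      show "AE w in vol. ennreal (X powr e) * (ennreal (cmod (cut (radial_d u) w) powr p) * indicator {w. norm (invol z w) < 1/4} w * ennreal ((1 - (norm w)\<^sup>2) powr (- real CARD('n) - 1)))
        \<le> ennreal K * (ennreal (norm (cut (grad u) w) powr p * (1 - norm w ^ 2) powr q) * epowr (green z w) s)"
        using AE_vol_ball
      proof eventually_elim
        case (elim w)
        show ?case
        proof (cases "norm (invol z w) < 1/4")
          case True
          define Y where "Y = 1 - (norm w)\<^sup>2"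
          have Y: "Y > 0" unfolding Y_def by (rule one_minus_norm_pos[OF elim])
          have "X \<le> 5 * Y" unfolding X_def Y_def by (rule invol_ball_comparable(2)[OF z elim True])
          then have "X powr e \<le> (5 * Y) powr e" using X e by (intro powr_mono2) auto
          also have "\<dots> = 5 powr e * Y powr e" using Y by (simp add: powr_mult)
          finally have 1: "X powr e \<le> 5 powr e * Y powr e" .
          have 2: "cmod (radial_d u w) powr p \<le> norm (grad u w) powr p"
          proof (rule powr_mono2)
            have "cmod (radial_d u w) \<le> norm w * norm (grad u w)" unfolding radial_d_dh by (rule norm_dh_le)
            also have "\<dots> \<le> 1 * norm (grad u w)" using elim by (intro mult_right_mono) auto
            finally show "cmod (radial_d u w) \<le> norm (grad u w)" by simp
          qed (use p in auto)
          have "X powr e * (cmod (radial_d u w) powr p * Y powr (- real CARD('n) - 1))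
            \<le> (5 powr e * Y powr e) * (norm (grad u w) powr p * Y powr (- real CARD('n) - 1))"
            using 1 2 by (intro mult_mono) auto
          also have "\<dots> = 5 powr e * (norm (grad u w) powr p * (Y powr e * Y powr (- real CARD('n) - 1)))"
            by (simp add: mult_ac)
          also have "Y powr e * Y powr (- real CARD('n) - 1) = Y powr q"
            by (simp add: powr_add[symmetric] e_def)
          also have "5 powr e * (norm (grad u w) powr p * Y powr q) = K * ((norm (grad u w) powr p * Y powr q) * d)"
            using d by (simp add: K_def)
          finally have "ennreal (X powr e * (cmod (radial_d u w) powr p * Y powr (- real CARD('n) - 1))) \<le> ennreal (K * ((norm (grad u w) powr p * Y powr q) * d))"
            by (rule ennreal_leI)
          also have "\<dots> = ennreal K * (ennreal (norm (grad u w) powr p * Y powr q) * ennreal d)"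
            using K d by (simp add: ennreal_mult)
          also have "\<dots> \<le> ennreal K * (ennreal (norm (grad u w) powr p * Y powr q) * epowr (green z w) s)"
            by (intro mult_left_mono G elim True) auto
          finally show ?thesis using True elim by (simp add: cut_def Y_def ennreal_mult)
        qed simp
      qed
    qed simp
    also have "\<dots> = ennreal C * (ennreal K * ?J)" by (subst nn_integral_cmult, measurable)
    finally have "epowr (ennreal ((cmod (radial_d u z) * X powr (e / p)) powr p)) (1 / p) \<le> epowr (ennreal (C * K) * ?J) (1 / p)"
      using p C K by (intro epowr_mono) (auto simp: ennreal_mult mult.assoc)
    also have "\<dots> = ennreal ((C * K) powr (1 / p)) * epowr ?J (1 / p)" using C K by (intro epowr_mult) auto
    also have "\<dots> \<le> ennreal ((C * K) powr (1 / p)) * F_norm p q s u"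
      by (intro mult_left_mono F_norm_ge p z) simp
    finally show "ennreal (cmod (radial_d u z) * (1 - (norm z)\<^sup>2) powr ((real CARD('n) + 1 + q) / p)) \<le> ennreal ((C * K) powr (1 / p)) * F_norm p q s u"
      using p by (subst (asm) epowr_powr) (auto simp: X_def e_def)
  qed
qed

text \<open>Under this bound the powers of \<open>1 - (norm w)\<^sup>2\<close> combine to exactly
  the density of \<open>inv_vol\<close>. The integral of the Green power is then the same for all
  \<open>z\<close>, and s > 1 together with the dimension condition makes it finite.
  \<open>K + 1\<close> in place of \<open>K\<close> secures a positive constant.\<close>

lemma F_norm_le:
  fixes p q s :: real
  assumes p: "0 < p" and s: "1 < s" and n: "s * (real CARD('n) - 1) < real CARD('n)"
  obtains C where "C > 0" "\<And>(u :: complex^'n \<Rightarrow> complex) A. holo (ball 0 1) u \<Longrightarrow> u 0 = 0 \<Longrightarrow> 0 \<le> A \<Longrightarrow>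
    (\<And>w. norm w < 1 \<Longrightarrow> norm (grad u w) \<le> A * (1 - (norm w)\<^sup>2) powr (- ((real CARD('n) + 1 + q) / p))) \<Longrightarrow>
    F_norm p q s u \<le> ennreal (C * A)"
proof -
  obtain K where K: "(\<integral>\<^sup>+w. epowr (green0 w) s \<partial>(inv_vol :: (complex^'n) measure)) = ennreal K" "K \<ge> 0"
    using green0_integrable[OF s n] by (cases "\<integral>\<^sup>+w. epowr (green0 w) s \<partial>(inv_vol :: (complex^'n) measure)") auto
  show thesis
  proof
    show "(K + 1) powr (1 / p) > 0" using K by simp
    fix u :: "complex^'n \<Rightarrow> complex" and A assume u: "holo (ball 0 1) u" "u 0 = 0" and A: "0 \<le> A"
      and g: "\<And>w. norm w < 1 \<Longrightarrow> norm (grad u w) \<le> A * (1 - (norm w)\<^sup>2) powr (- ((real CARD('n) + 1 + q) / p))"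
    have [measurable]: "cut (grad u) \<in> borel_measurable borel"
      by (rule measurable_cut, rule continuous_on_grad[OF u(1)])
    have I: "(\<integral>\<^sup>+w. ennreal (norm (grad u w) powr p * (1 - norm w ^ 2) powr q) * epowr (green z w) s \<partial>vol) \<le> ennreal (A powr p * (K + 1))"
      if z: "norm z < 1" for z
    proof -
      have "(\<integral>\<^sup>+w. ennreal (norm (grad u w) powr p * (1 - norm w ^ 2) powr q) * epowr (green z w) s \<partial>vol)
        \<le> (\<integral>\<^sup>+w. ennreal (A powr p) * (epowr (green0 (invol z w)) s * ennreal ((1 - (norm w)\<^sup>2) powr (- real CARD('n) - 1))) \<partial>vol)"
      proof (rule nn_integral_mono_AE)
        show "AE w in vol. ennreal (norm (grad u w) powr p * (1 - norm w ^ 2) powr q) * epowr (green z w) s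
          \<le> ennreal (A powr p) * (epowr (green0 (invol z w)) s * ennreal ((1 - (norm w)\<^sup>2) powr (- real CARD('n) - 1)))"
          using AE_vol_ball
        proof eventually_elim
          case (elim w)
          define Y where "Y = 1 - (norm w)\<^sup>2"
          have Y: "Y > 0" unfolding Y_def by (rule one_minus_norm_pos[OF elim])
          have gr: "green z w = green0 (invol z w)"
            unfolding green_def by (rule green0_norm_cong) (rule norm_invol_commute[OF elim z])
          have "norm (grad u w) powr p \<le> (A * Y powr (- ((real CARD('n) + 1 + q) / p))) powr p"
            unfolding Y_def using p by (intro powr_mono2 g elim) auto
          also have "\<dots> = A powr p * Y powr (- (real CARD('n) + 1 + q))"
            using p A by (simp add: powr_mult powr_powr)
          finally have "norm (grad u w) powr p * Y powr q \<le> (A powr p * Y powr (- (real CARD('n) + 1 + q))) * Y powr q"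
            by (rule mult_right_mono) simp
          also have "\<dots> = A powr p * (Y powr (- (real CARD('n) + 1 + q)) * Y powr q)" by simp
          also have "Y powr (- (real CARD('n) + 1 + q)) * Y powr q = Y powr (- real CARD('n) - 1)"
            by (simp add: powr_add[symmetric])
          finally have "ennreal (norm (grad u w) powr p * Y powr q) * epowr (green z w) s \<le> ennreal (A powr p * Y powr (- real CARD('n) - 1)) * epowr (green z w) s"
            by (intro mult_right_mono ennreal_leI) auto
          then show ?case unfolding gr Y_def by (simp add: ennreal_mult mult_ac)
        qed
      qed
      also have "\<dots> = ennreal (A powr p) * (\<integral>\<^sup>+w. epowr (green0 (invol z w)) s * ennreal ((1 - (norm w)\<^sup>2) powr (- real CARD('n) - 1)) \<partial>vol)"
        by (rule nn_integral_cmult) measurable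
      also have "(\<integral>\<^sup>+w. epowr (green0 (invol z w)) s * ennreal ((1 - (norm w)\<^sup>2) powr (- real CARD('n) - 1)) \<partial>vol) = (\<integral>\<^sup>+w. epowr (green0 (invol z w)) s \<partial>inv_vol)"
        by (rule nn_integral_inv_vol_vol[symmetric]) measurable
      also have "\<dots> = ennreal K"
        unfolding K(1)[symmetric] by (rule nn_integral_invol[OF z, where F="\<lambda>w. epowr (green0 w) s"]) measurable
      also have "ennreal (A powr p) * ennreal K \<le> ennreal (A powr p * (K + 1))"
        using K by (simp add: ennreal_mult[symmetric] ennreal_leI mult_left_mono)
      finally show ?thesis .
    qed
    have "F_norm p q s u \<le> epowr (ennreal (A powr p * (K + 1))) (1 / p)"
      unfolding F_norm_def using p I by (intro epowr_mono) (auto simp: u intro!: SUP_least)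
    also have "\<dots> = ennreal ((A powr p * (K + 1)) powr (1 / p))" using K by (intro epowr_ennreal) auto
    also have "(A powr p * (K + 1)) powr (1 / p) = (K + 1) powr (1 / p) * A"
      using p A K by (simp add: powr_mult powr_powr)
    finally show "F_norm p q s u \<le> ennreal ((K + 1) powr (1 / p) * A)" .
  qed
qed

lemma continuous_invol_0:
  fixes z :: "complex^'n"
  assumes z: "norm z < 1" shows "isCont (invol z) 0"
proof -
  have "isCont (\<lambda>w. \<Sum>j\<in>UNIV. axis j (invol z w $ j)) 0"
  proof (intro isCont_sum ballI)
    fix j :: 'n
    have bl: "bounded_linear (\<lambda>c::complex. axis j c :: complex^'n)"
      by (auto simp: linear_conv_bounded_linear[symmetric] vec_eq_iff axis_def intro!: linearI)
    have "isCont (\<lambda>w. invol z w $ j) 0"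
      using holo_continuous[OF holo_invol[OF z, of j]] by (simp add: continuous_on_eq_continuous_at)
    then show "isCont (\<lambda>w. axis j (invol z w $ j)) 0"
      by (rule isCont_o2[OF _ linear_continuous_at[OF bl]])
  qed
  then show ?thesis by (simp add: sum_axis)
qed

text \<open>If the gradient does not vanish at \<open>z\<close>, it is bounded below on a Bergman
  ball around \<open>z\<close> by continuity. In that ball the Green power is at least a constant
  times the power -2 n of \<open>norm (invol z w)\<close>, whose integral diverges at the origin;
  invariance transports the divergence to \<open>z\<close>.\<close>

lemma F_space_degenerate:
  fixes p q s :: real and u :: "complex^'n \<Rightarrow> complex"
  assumes p: "0 < p" and q: "- real CARD('n) - 1 < q" and s: "1 < s" and n: "real CARD('n) \<le> s * (real CARD('n) - 1)"
    and u: "u \<in> F_space p q s" and z: "norm z < 1"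
  shows "grad u z = 0"
proof (rule ccontr)
  assume g0: "grad u z \<noteq> 0"
  have hu: "holo (ball 0 1) u" and fin: "F_norm p q s u < \<infinity>"
    using u hol_ball_holo by (auto simp: F_space_def)
  have cg: "continuous_on (ball 0 1) (grad u)" by (rule continuous_on_grad[OF hu])
  have [measurable]: "cut (grad u) \<in> borel_measurable borel" by (rule measurable_cut[OF cg])
  define a where "a = norm (grad u z) / 2"
  have a: "a > 0" using g0 by (simp add: a_def)
  have "isCont (grad u) (invol z 0)" using cg z by (simp add: invol_0 continuous_on_eq_continuous_at)
  then have "isCont (\<lambda>w. norm (grad u (invol z w))) 0"
    by (intro continuous_norm isCont_o2[OF continuous_invol_0[OF z]])
  then have "((\<lambda>w. norm (grad u (invol z w))) \<longlongrightarrow> norm (grad u z)) (at 0)"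
    by (simp add: isCont_def invol_0)
  then have "\<forall>\<^sub>F w in at 0. a < norm (grad u (invol z w))"
    by (rule order_tendstoD) (use a in \<open>simp add: a_def\<close>)
  then obtain \<epsilon>' where \<epsilon>': "\<epsilon>' > 0" "\<And>w. w \<noteq> 0 \<Longrightarrow> norm w < \<epsilon>' \<Longrightarrow> a < norm (grad u (invol z w))"
    unfolding eventually_at by (auto simp: dist_norm)
  define \<epsilon> where "\<epsilon> = min \<epsilon>' (1/4)"
  have \<epsilon>: "0 < \<epsilon>" "\<epsilon> \<le> 1/4" "\<epsilon> < 1" using \<epsilon>' by (auto simp: \<epsilon>_def)
  have ga: "a \<le> norm (grad u w)" if w: "norm w < 1" "norm (invol z w) < \<epsilon>" for w
  proof (cases "invol z w = 0")
    case True
    then have "w = z" using invol_invol_ball[OF z w(1)] by (simp add: invol_0)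
    then show ?thesis by (simp add: a_def)
  next
    case False
    then show ?thesis using \<epsilon>'(2)[of "invol z w"] w invol_invol_ball[OF z w(1)] by (simp add: \<epsilon>_def)
  qed
  obtain c where c: "c > 0" "\<And>(z :: complex^'n) r. 0 < r \<Longrightarrow> r \<le> 1/4 \<Longrightarrow> norm z \<le> r \<Longrightarrow>
    ennreal (c * r powr (- (2 * real CARD('n) - 2))) \<le> green0 z"
    using green0_lower[where 'n='n] by blast
  define X where "X = 1 - (norm z)\<^sup>2"
  have X: "X > 0" unfolding X_def by (rule one_minus_norm_pos[OF z])
  define e where "e = real CARD('n) + 1 + q"
  have e: "e > 0" using q by (simp add: e_def)
  define k where "k = a powr p * (X / 5) powr e * c powr s"
  have k: "k > 0" using a X c by (simp add: k_def)
  define F where "F = (\<lambda>w :: complex^'n. ennreal (norm w powr (- 2 * real CARD('n))) * indicator (ball 0 \<epsilon>) w)"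
  have [measurable]: "F \<in> borel_measurable borel" unfolding F_def by measurable
  let ?J = "\<integral>\<^sup>+w. ennreal (norm (cut (grad u) w) powr p * (1 - norm w ^ 2) powr q) * epowr (green z w) s \<partial>vol"
  have "\<infinity> = (\<integral>\<^sup>+w. F w \<partial>vol)" unfolding F_def using vol_powr_infinite[where 'n='n, OF \<epsilon>(1,3)] by simp
  also have "\<dots> \<le> (\<integral>\<^sup>+w. F w * ennreal ((1 - (norm w)\<^sup>2) powr (- real CARD('n) - 1)) \<partial>vol)"
  proof (rule nn_integral_mono_AE)
    show "AE w in vol. F w \<le> F w * ennreal ((1 - (norm w)\<^sup>2) powr (- real CARD('n) - 1))"
      using AE_vol_ball
    proof eventually_elim
      case (elim w)
      have "1 \<le> (1 - (norm w)\<^sup>2) powr (- real CARD('n) - 1)"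
        using one_minus_norm_pos[OF elim] powr_mono2'[of "- real CARD('n) - 1" "1 - (norm w)\<^sup>2" 1] by simp
      then have "F w * 1 \<le> F w * ennreal ((1 - (norm w)\<^sup>2) powr (- real CARD('n) - 1))"
        by (intro mult_left_mono) auto
      then show ?case by simp
    qed
  qed
  also have "\<dots> = (\<integral>\<^sup>+w. F w \<partial>inv_vol)" by (rule nn_integral_inv_vol_vol[symmetric]) measurable
  also have "\<dots> = (\<integral>\<^sup>+w. F (invol z w) \<partial>inv_vol)" by (rule nn_integral_invol[symmetric, OF z]) measurable
  finally have inf: "(\<integral>\<^sup>+w. F (invol z w) \<partial>inv_vol) = \<infinity>" by (simp add: top_unique)
  have "ennreal k * (\<integral>\<^sup>+w. F (invol z w) \<partial>inv_vol) = (\<integral>\<^sup>+w. ennreal k * (F (invol z w) * ennreal ((1 - (norm w)\<^sup>2) powr (- real CARD('n) - 1))) \<partial>vol)"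
    by (subst nn_integral_inv_vol_vol, measurable, subst nn_integral_cmult, measurable)
  also have "\<dots> \<le> ?J"
  proof (rule nn_integral_mono_AE)
    show "AE w in vol. ennreal k * (F (invol z w) * ennreal ((1 - (norm w)\<^sup>2) powr (- real CARD('n) - 1)))
      \<le> ennreal (norm (cut (grad u) w) powr p * (1 - norm w ^ 2) powr q) * epowr (green z w) s"
      using AE_vol_ball
    proof eventually_elim
      case (elim w)
      define v where "v = invol z w"
      define Y where "Y = 1 - (norm w)\<^sup>2"
      have Y: "Y > 0" unfolding Y_def by (rule one_minus_norm_pos[OF elim])
      show ?case
      proof (cases "norm v < \<epsilon> \<and> v \<noteq> 0")
        case True
        then have v: "norm v < \<epsilon>" "norm v > 0" "norm v < 1/4" using \<epsilon> by auto
        have "ennreal (c * norm v powr (- (2 * real CARD('n) - 2))) \<le> green z w"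
          unfolding green_def using norm_invol_commute[OF z elim] v by (intro c) (auto simp: v_def)
        then have "epowr (ennreal (c * norm v powr (- (2 * real CARD('n) - 2)))) s \<le> epowr (green z w) s"
          using s by (intro epowr_mono) auto
        moreover have "c powr s * norm v powr (- 2 * real CARD('n)) \<le> (c * norm v powr (- (2 * real CARD('n) - 2))) powr s"
        proof -
          have "norm v powr (- 2 * real CARD('n)) \<le> norm v powr (- (2 * real CARD('n) - 2) * s)"
            using v n by (intro powr_mono') (auto simp: algebra_simps)
          then show ?thesis using c by (simp add: powr_mult powr_powr)
        qed
        ultimately have 1: "ennreal (c powr s * norm v powr (- 2 * real CARD('n))) \<le> epowr (green z w) s"
          using c by (subst (asm) epowr_ennreal) (auto intro: order_trans[OF ennreal_leI])
        have 2: "a powr p \<le> norm (grad u w) powr p" using ga[OF elim] v a p by (intro powr_mono2) (auto simp: v_def)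
        have "X \<le> 5 * Y" unfolding X_def Y_def
          by (rule invol_ball_comparable(2)[OF z elim]) (use v in \<open>simp add: v_def\<close>)
        then have 3: "(X / 5) powr e \<le> Y powr e" using X e by (intro powr_mono2) auto
        have "k * (norm v powr (- 2 * real CARD('n)) * Y powr (- real CARD('n) - 1))
          = (a powr p * ((X / 5) powr e * Y powr (- real CARD('n) - 1))) * (c powr s * norm v powr (- 2 * real CARD('n)))"
          by (simp add: k_def mult_ac)
        also have "\<dots> \<le> (norm (grad u w) powr p * (Y powr e * Y powr (- real CARD('n) - 1))) * (c powr s * norm v powr (- 2 * real CARD('n)))"
          using 2 3 by (intro mult_right_mono mult_mono) auto
        also have "Y powr e * Y powr (- real CARD('n) - 1) = Y powr q"
          by (simp add: powr_add[symmetric] e_def)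
        finally have "ennreal (k * (norm v powr (- 2 * real CARD('n)) * Y powr (- real CARD('n) - 1)))
           \<le> ennreal (norm (grad u w) powr p * Y powr q) * ennreal (c powr s * norm v powr (- 2 * real CARD('n)))"
          by (simp add: ennreal_mult[symmetric] ennreal_leI)
        also have "\<dots> \<le> ennreal (norm (grad u w) powr p * Y powr q) * epowr (green z w) s"
          by (rule mult_left_mono[OF 1]) simp
        finally show ?thesis using v k elim unfolding F_def v_def[symmetric] Y_def[symmetric]
          by (simp add: cut_def ennreal_mult)
      next
        case False
        then have "F v = 0" by (auto simp: F_def indicator_def)
        then show ?thesis by (simp add: v_def)
      qed
    qed
  qed
  finally have "?J = \<infinity>" using inf k by (simp add: ennreal_mult_top top_unique)
  then show False using F_norm_ge[OF p z, of u q s] fin by (simp add: epowr_def top_unique)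
qed

subsection \<open>The integral operator\<close>

lemma scaleR_scale: "r *\<^sub>R (v :: complex^'n) = complex_of_real r *s v"
  by (simp only: vec_eq_iff vector_smult_component vector_scaleR_component) (simp add: scaleR_conv_of_real)

lemma dh_scaleR: "dh f z (r *\<^sub>R v) = of_real r * dh f z v"
  by (simp add: scaleR_scale dh_scale)

lemma norm_scaleR_ball: "norm z < 1 \<Longrightarrow> 0 \<le> r \<Longrightarrow> r \<le> 1 \<Longrightarrow> norm (r *\<^sub>R z) < 1"
  by (simp add: mult_left_le_one_le le_less_trans[of _ "norm z"])

lemma radial_d_0 [simp]: "radial_d g 0 = 0" by (simp add: radial_d_def)

lemma continuous_on_dh:
  assumes "holo S f" "open S"
  shows "continuous_on S (\<lambda>z. dh f z v)"
  unfolding dh_def by (intro continuous_intros partial_d_continuous[OF assms])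

text \<open>The integrand of \<open>T_op\<close> with the factor 1 / r cancelled: the radial
  derivative of \<open>g\<close> at \<open>r *\<^sub>R z\<close> is \<open>r\<close> times
  \<open>dh g (r *\<^sub>R z) z\<close>. In this form it is continuous up to r = 0.\<close>

definition T_kernel :: "(complex^'n \<Rightarrow> complex) \<Rightarrow> (complex^'n \<Rightarrow> complex) \<Rightarrow> complex^'n \<Rightarrow> real \<Rightarrow> complex" where
  "T_kernel g f z r = f (r *\<^sub>R z) * dh g (r *\<^sub>R z) z"

lemma T_kernel_continuous:
  assumes "holo (ball 0 1) f" "holo (ball 0 1) g" "norm z < 1"
  shows "continuous_on {0..1} (T_kernel g f z)"
  unfolding T_kernel_def
  by (intro continuous_on_mult continuous_on_compose2[OF holo_continuous[OF assms(1)]]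
      continuous_on_compose2[OF continuous_on_dh[OF assms(2)]] continuous_intros)
     (use norm_scaleR_ball[OF assms(3)] in auto)

lemma T_op_eq_integral:
  fixes f g :: "complex^'n \<Rightarrow> complex"
  assumes f: "holo (ball 0 1) f" and g: "holo (ball 0 1) g" and z: "norm z < 1"
  shows "T_op g f z = integral {0..1} (T_kernel g f z)"
proof -
  have si: "set_integrable lborel {0..1} (T_kernel g f z)"
    unfolding set_integrable_def by (rule borel_integrable_compact) (use T_kernel_continuous[OF f g z] in auto)
  then have si': "set_integrable lborel {0<..<1} (T_kernel g f z)"
    by (rule set_integrable_subset) auto
  have "T_op g f z = (LBINT r:{0<..<1}. T_kernel g f z r)"
    unfolding T_op_def using z
    by (auto intro!: set_lebesgue_integral_cong simp: T_kernel_def radial_d_dh dh_scaleR)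
  also have "\<dots> = integral {0<..<1} (T_kernel g f z)"
    by (rule set_borel_integral_eq_integral(2)[OF si'])
  also have "\<dots> = integral {0..1} (T_kernel g f z)"
    by (rule integral_open_interval_real[symmetric])
  finally show ?thesis .
qed

lemma T_op_outside: "z \<notin> ball 0 1 \<Longrightarrow> T_op g f z = 0"
  by (simp add: T_op_def)

lemma T_op_0: "T_op g f 0 = 0"
  by (simp add: T_op_def)

text \<open>Supplies the derivative of the kernel at r = 0. The radial derivative vanishes at the
  origin, and its linear part there is that of \<open>g\<close>.\<close>

lemma dh_mult_radial_0:
  assumes f: "holo (ball 0 1) f" and g: "holo (ball 0 1) g"
  shows "dh (\<lambda>z. f z * radial_d g z) 0 v = f 0 * dh g 0 v"
proof -
  have "(radial_d g has_derivative (\<lambda>v. \<Sum>j\<in>UNIV. 0 $ j * dh (partial_d j g) 0 v + v $ j * partial_d j g 0)) (at 0)"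
    unfolding radial_d_def
    by (intro has_derivative_sum has_derivative_mult bounded_linear_imp_has_derivative bounded_linear_vec_nth
        holo_has_derivative[OF holo_partial_d[OF g]]) auto
  moreover have "dh g 0 = (\<lambda>v. \<Sum>j\<in>UNIV. v $ j * partial_d j g 0)" by (simp add: dh_def fun_eq_iff)
  ultimately have "(radial_d g has_derivative dh g 0) (at 0)" by simp
  from has_derivative_mult[OF holo_has_derivative[OF f, of 0] this]
  have "((\<lambda>z. f z * radial_d g z) has_derivative (\<lambda>v. f 0 * dh g 0 v)) (at 0)" by simp
  then have "dh (\<lambda>z. f z * radial_d g z) 0 = (\<lambda>v. f 0 * dh g 0 v)"
    by (rule dh_unique) (simp add: dh_scale)
  then show ?thesis by simp
qed

text \<open>For r > 0 the kernel is k (r z) / r, and the chain rule restores the factor r; at r = 0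
  the previous lemma shows that the same formula holds. The derivative of the kernel is thus jointly
  continuous, and differentiation under the integral is allowed.\<close>

lemma T_op_has_derivative:
  fixes f g :: "complex^'n \<Rightarrow> complex"
  assumes f: "holo (ball 0 1) f" and g: "holo (ball 0 1) g" and z0: "norm z0 < 1"
  defines "k \<equiv> \<lambda>z. f z * radial_d g z"
  shows "(T_op g f has_derivative (\<lambda>v. integral {0..1} (\<lambda>r. dh k (r *\<^sub>R z0) v))) (at z0)"
proof -
  have k: "holo (ball 0 1) k" unfolding k_def by (intro holo_mult f holo_radial_d[OF g]) simp
  have cont: "continuous_on (ball 0 1 \<times> cbox 0 1) (\<lambda>(z, r). dhb k (r *\<^sub>R z))"
    unfolding split_beta
    by (intro continuous_on_compose2[OF continuous_on_dhb[OF partial_d_continuous[OF k]]] continuous_intros)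
       (use norm_scaleR_ball in auto)
  have "((\<lambda>z. integral (cbox 0 1) (T_kernel g f z)) has_derivative blinfun_apply (integral (cbox 0 1) (\<lambda>r. dhb k (r *\<^sub>R z0)))) (at z0 within ball 0 1)"
  proof (rule leibniz_rule[OF _ _ cont])
    fix z r assume z: "z \<in> ball (0 :: complex^'n) 1" and r: "r \<in> cbox 0 (1::real)"
    have rz: "norm (r *\<^sub>R z) < 1" using norm_scaleR_ball z r by auto
    have "((\<lambda>z. T_kernel g f z r) has_derivative dh k (r *\<^sub>R z)) (at z)"
    proof (cases "r = 0")
      case True
      have bl: "bounded_linear (\<lambda>v. f 0 * dh g 0 v)"
        unfolding dh_def by (intro bounded_linear_intros bounded_linear_const_mult bounded_linear_sum bounded_linear_mult_left[THEN bounded_linear_compose] bounded_linear_vec_nth)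
      have "T_kernel g f = (\<lambda>z r. f (r *\<^sub>R z) * dh g (r *\<^sub>R z) z)" by (simp add: fun_eq_iff T_kernel_def)
      moreover have "dh k 0 = (\<lambda>v. f 0 * dh g 0 v)"
        unfolding k_def by (rule ext) (rule dh_mult_radial_0[OF f g])
      ultimately show ?thesis using True bounded_linear_imp_has_derivative[OF bl] by simp
    next
      case False
      have "((\<lambda>z. r *\<^sub>R z) has_derivative (\<lambda>v. r *\<^sub>R v)) (at z)"
        by (auto intro!: derivative_eq_intros)
      from has_derivative_compose[OF this holo_has_derivative[OF k, of "r *\<^sub>R z"]] rz
      have "((\<lambda>z. k (r *\<^sub>R z)) has_derivative (\<lambda>v. dh k (r *\<^sub>R z) (r *\<^sub>R v))) (at z)" by simp
      then have "((\<lambda>z. k (r *\<^sub>R z) * (1 / of_real r)) has_derivative (\<lambda>v. dh k (r *\<^sub>R z) (r *\<^sub>R v) * (1 / of_real r))) (at z)"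
        by (rule has_derivative_mult_left)
      moreover have "k (r *\<^sub>R z) * (1 / of_real r) = T_kernel g f z r" for z
        using False by (simp add: k_def T_kernel_def radial_d_dh dh_scaleR)
      moreover have "(\<lambda>v. dh k (r *\<^sub>R z) (r *\<^sub>R v) * (1 / of_real r)) = dh k (r *\<^sub>R z)"
        using False by (simp add: dh_scaleR fun_eq_iff)
      ultimately show ?thesis by simp
    qed
    then show "((\<lambda>z. T_kernel g f z r) has_derivative blinfun_apply (dhb k (r *\<^sub>R z))) (at z within ball 0 1)"
      by (simp add: dhb_apply[abs_def] has_derivative_at_withinI)
  next
    fix z :: "complex^'n" assume "z \<in> ball 0 1"
    then show "T_kernel g f z integrable_on cbox 0 1"
      using integrable_continuous_real[OF T_kernel_continuous[OF f g]] by simp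
  qed (use z0 in auto)
  then have d: "((\<lambda>z. integral (cbox 0 1) (T_kernel g f z)) has_derivative blinfun_apply (integral (cbox 0 1) (\<lambda>r. dhb k (r *\<^sub>R z0)))) (at z0)"
    using z0 by (simp add: at_within_open[of z0 "ball 0 1"])
  have "continuous_on (cbox 0 1) (\<lambda>r. case (z0, r) of (z, r) \<Rightarrow> dhb k (r *\<^sub>R z))"
    by (rule continuous_on_compose2[OF cont]) (use z0 in \<open>auto intro!: continuous_intros\<close>)
  then have int: "(\<lambda>r. dhb k (r *\<^sub>R z0)) integrable_on cbox 0 1" by (simp add: integrable_continuous_real)
  have D: "blinfun_apply (integral (cbox 0 1) (\<lambda>r. dhb k (r *\<^sub>R z0))) = (\<lambda>v. integral {0..1} (\<lambda>r. dh k (r *\<^sub>R z0) v))"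
    by (rule ext) (subst blinfun_apply_integral[OF int], simp add: dhb_apply)
  show ?thesis
    unfolding D[symmetric]
    by (rule has_derivative_transform_within_open[OF d, of "ball 0 1"])
       (use z0 T_op_eq_integral[OF f g] in auto)
qed

lemma T_op_dh:
  fixes f g :: "complex^'n \<Rightarrow> complex"
  assumes f: "holo (ball 0 1) f" and g: "holo (ball 0 1) g" and z: "norm z < 1"
  shows "dh (T_op g f) z v = integral {0..1} (\<lambda>r. dh (\<lambda>z. f z * radial_d g z) (r *\<^sub>R z) v)"
proof -
  have "dh (T_op g f) z = (\<lambda>v. integral {0..1} (\<lambda>r. dh (\<lambda>z. f z * radial_d g z) (r *\<^sub>R z) v))"
    by (rule dh_unique[OF T_op_has_derivative[OF assms]]) (simp add: dh_scale)
  then show ?thesis by simp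
qed

lemma T_op_hol_ball:
  assumes f: "holo (ball 0 1) f" and g: "holo (ball 0 1) g"
  shows "T_op g f \<in> hol_ball"
proof (rule hol_ballI)
  show "holo (ball 0 1) (T_op g f)"
    by (rule holoI, rule T_op_has_derivative[OF f g]) (auto simp: dh_scale)
qed (rule T_op_outside)

text \<open>In the direction \<open>z\<close> itself the differentiated integrand is the derivative
  of k (r z) in \<open>r\<close>, so the fundamental theorem of calculus gives
  \<open>k z - k 0\<close>, and \<open>k 0 = 0\<close>.\<close>

lemma T_op_radial_d:
  fixes f g :: "complex^'n \<Rightarrow> complex"
  assumes f: "holo (ball 0 1) f" and g: "holo (ball 0 1) g" and z: "norm z < 1"
  shows "radial_d (T_op g f) z = f z * radial_d g z"
proof -
  define k where "k = (\<lambda>z. f z * radial_d g z)"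
  have k: "holo (ball 0 1) k" unfolding k_def by (intro holo_mult f holo_radial_d[OF g]) simp
  have "((\<lambda>r. dh k (r *\<^sub>R z) z) has_integral k (1 *\<^sub>R z) - k (0 *\<^sub>R z)) {0..1}"
  proof (rule fundamental_theorem_of_calculus)
    fix r :: real assume r: "r \<in> {0..1}"
    have rz: "norm (r *\<^sub>R z) < 1" using norm_scaleR_ball z r by auto
    have "((\<lambda>r. r *\<^sub>R z) has_derivative (\<lambda>a. a *\<^sub>R z)) (at r within {0..1})"
      by (auto intro!: derivative_eq_intros)
    from has_derivative_compose[OF this holo_has_derivative[OF k, of "r *\<^sub>R z"]] rz
    show "((\<lambda>r. k (r *\<^sub>R z)) has_vector_derivative dh k (r *\<^sub>R z) z) (at r within {0..1})"
      by (simp add: has_vector_derivative_def dh_scaleR scaleR_conv_of_real[where 'a=complex])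
  qed simp
  moreover have "k 0 = 0" by (simp add: k_def)
  ultimately show ?thesis
    unfolding radial_d_dh[of "T_op g f"] T_op_dh[OF assms] k_def[symmetric]
    by (simp add: integral_unique) (simp add: k_def)
qed

lemma T_op_linear:
  fixes f h g :: "complex^'n \<Rightarrow> complex"
  assumes f: "holo (ball 0 1) f" and h: "holo (ball 0 1) h" and g: "holo (ball 0 1) g"
  shows "T_op g (\<lambda>z. a * f z + b * h z) = (\<lambda>z. a * T_op g f z + b * T_op g h z)"
proof
  fix z :: "complex^'n"
  show "T_op g (\<lambda>z. a * f z + b * h z) z = a * T_op g f z + b * T_op g h z"
  proof (cases "norm z < 1")
    case True
    have fh: "holo (ball 0 1) (\<lambda>z. a * f z + b * h z)" by (intro holo_add holo_mult holo_const f h)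
    note i = integrable_continuous_real[OF T_kernel_continuous[OF _ g True]]
    have "T_kernel g (\<lambda>z. a * f z + b * h z) z = (\<lambda>r. a * T_kernel g f z r + b * T_kernel g h z r)"
      by (simp add: T_kernel_def fun_eq_iff algebra_simps)
    then show ?thesis
      unfolding T_op_eq_integral[OF fh g True] T_op_eq_integral[OF f g True] T_op_eq_integral[OF h g True]
      using i[OF f] i[OF h] by (simp add: integral_add integrable_on_mult_right)
  qed (simp add: T_op_outside)
qed

lemma T_op_diff_symbol:
  fixes f h g :: "complex^'n \<Rightarrow> complex"
  assumes f: "holo (ball 0 1) f" and h: "holo (ball 0 1) h" and g: "holo (ball 0 1) g"
  shows "T_op (\<lambda>z. g z - h z) f = (\<lambda>z. T_op g f z - T_op h f z)"
proof
  fix z :: "complex^'n"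
  show "T_op (\<lambda>z. g z - h z) f z = T_op g f z - T_op h f z"
  proof (cases "norm z < 1")
    case True
    have gh: "holo (ball 0 1) (\<lambda>z. g z - h z)" by (intro holo_diff g h)
    note i = integrable_continuous_real[OF T_kernel_continuous[OF f _ True]]
    have "integral {0..1} (T_kernel (\<lambda>z. g z - h z) f z) = integral {0..1} (\<lambda>r. T_kernel g f z r - T_kernel h f z r)"
      by (rule integral_cong) (use norm_scaleR_ball[OF True] in \<open>auto simp: T_kernel_def dh_sub[OF g h] algebra_simps\<close>)
    then show ?thesis
      unfolding T_op_eq_integral[OF f gh True] T_op_eq_integral[OF f g True] T_op_eq_integral[OF f h True]
      using i[OF g] i[OF h] by (simp add: integral_diff)
  qed (simp add: T_op_outside)
qed

text \<open>The antiderivative carries the factor 1 / \<rho>, harmless only away from 0; for \<rho>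
  \<le> 1/2 the integrand itself is bounded. The constant adds up the two cases.\<close>

lemma integral_one_minus_powr:
  fixes \<alpha> \<rho> :: real
  assumes \<alpha>: "\<alpha> > 0" and \<rho>: "0 \<le> \<rho>" "\<rho> < 1"
  shows "integral {0..1} (\<lambda>r. (1 - r * \<rho>) powr (- \<alpha> - 1)) \<le> (2 / \<alpha> + 2 powr (\<alpha> + 1)) * (1 - \<rho>) powr (- \<alpha>)"
proof (cases "\<rho> \<le> 1/2")
  case True
  have pos: "1/2 \<le> 1 - r * \<rho>" if "r \<in> {0..1}" for r
    using that True \<rho> mult_mono[of r 1 \<rho> "1/2"] by auto
  have "integral {0..1} (\<lambda>r. (1 - r * \<rho>) powr (- \<alpha> - 1)) \<le> integral {0..1} (\<lambda>r::real. 2 powr (\<alpha> + 1))"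
  proof (rule integral_le)
    show "(\<lambda>r. (1 - r * \<rho>) powr (- \<alpha> - 1)) integrable_on {0..1}"
      by (intro integrable_continuous_real continuous_intros) (use pos in force)
    fix r :: real assume "r \<in> {0..1}"
    then have "(1 - r * \<rho>) powr (- \<alpha> - 1) \<le> (1/2) powr (- \<alpha> - 1)"
      using pos \<alpha> by (intro powr_mono2') auto
    also have "(1/2) powr (- \<alpha> - 1) = (2::real) powr (\<alpha> + 1)"
      using powr_minus_divide[of "1/2::real" "\<alpha> + 1"] by (simp add: powr_divide)
    finally show "(1 - r * \<rho>) powr (- \<alpha> - 1) \<le> 2 powr (\<alpha> + 1)" .
  qed auto
  also have "\<dots> = 2 powr (\<alpha> + 1) * 1" by simp
  also have "\<dots> \<le> (2 / \<alpha> + 2 powr (\<alpha> + 1)) * (1 - \<rho>) powr (- \<alpha>)"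
    using \<alpha> \<rho> powr_mono2'[of "-\<alpha>" "1 - \<rho>" 1] by (intro mult_mono) auto
  finally show ?thesis .
next
  case False
  have pos: "0 < 1 - r * \<rho>" if "r \<in> {0..1}" for r
    using that \<rho> mult_left_le_one_le[of \<rho> r] by auto
  have "((\<lambda>r. (1 - r * \<rho>) powr (- \<alpha> - 1)) has_integral (1 - 1 * \<rho>) powr (- \<alpha>) / (\<alpha> * \<rho>) - (1 - 0 * \<rho>) powr (- \<alpha>) / (\<alpha> * \<rho>)) {0..1}"
  proof (rule fundamental_theorem_of_calculus)
    fix r :: real assume r: "r \<in> {0..1}"
    have "((\<lambda>r. (1 - r * \<rho>) powr (- \<alpha>) / (\<alpha> * \<rho>)) has_real_derivative (1 - r * \<rho>) powr (- \<alpha> - 1)) (at r)"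
      using pos[OF r] \<alpha> False by (auto intro!: derivative_eq_intros simp: field_simps)
    then show "((\<lambda>r. (1 - r * \<rho>) powr (- \<alpha>) / (\<alpha> * \<rho>)) has_vector_derivative (1 - r * \<rho>) powr (- \<alpha> - 1)) (at r within {0..1})"
      by (simp add: has_real_derivative_iff_has_vector_derivative has_vector_derivative_at_within)
  qed simp
  then have "integral {0..1} (\<lambda>r. (1 - r * \<rho>) powr (- \<alpha> - 1)) = (1 - \<rho>) powr (- \<alpha>) / (\<alpha> * \<rho>) - 1 / (\<alpha> * \<rho>)"
    by (simp add: integral_unique)
  also have "\<dots> \<le> (1 - \<rho>) powr (- \<alpha>) * (1 / (\<alpha> * \<rho>))" using \<alpha> \<rho> by simp
  also have "\<dots> \<le> (1 - \<rho>) powr (- \<alpha>) * (2 / \<alpha>)"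
    using \<alpha> False by (intro mult_left_mono) (auto simp: field_simps)
  also have "\<dots> \<le> (2 / \<alpha> + 2 powr (\<alpha> + 1)) * (1 - \<rho>) powr (- \<alpha>)"
  proof -
    have "0 \<le> 2 powr (\<alpha> + 1) * (1 - \<rho>) powr (- \<alpha>)" by simp
    then show ?thesis by (simp add: algebra_simps)
  qed
  finally show ?thesis .
qed

text \<open>Passes from the product \<open>f z * radial_d g z\<close> to the full gradient. The
  Cauchy estimate on discs of half the distance to the sphere raises the exponent to \<alpha> + 1,
  and integration along the ray lowers it to \<alpha> again, as \<alpha> > 0.\<close>

lemma T_op_grad_le:
  fixes \<alpha> :: real
  assumes \<alpha>: "\<alpha> > 0"
  obtains C where "C > 0" "\<And>(f :: complex^'n \<Rightarrow> complex) g A z. holo (ball 0 1) f \<Longrightarrow> holo (ball 0 1) g \<Longrightarrow> 0 \<le> A \<Longrightarrow>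
    (\<And>z. norm z < 1 \<Longrightarrow> cmod (f z * radial_d g z) \<le> A * (1 - (norm z)\<^sup>2) powr (- \<alpha>)) \<Longrightarrow> norm z < 1 \<Longrightarrow>
    norm (grad (T_op g f) z) \<le> C * A * (1 - (norm z)\<^sup>2) powr (- \<alpha>)"
proof
  define c where "c = 2 / \<alpha> + 2 powr (\<alpha> + 1)"
  have c: "c > 0" using \<alpha> by (auto simp: c_def intro!: add_pos_pos)
  define C where "C = real CARD('n) * (2 powr (\<alpha> + 1) * (c * 2 powr \<alpha>))"
  show "C > 0" using c card_pos[where 'n='n] by (simp add: C_def)
  fix f :: "complex^'n \<Rightarrow> complex" and g :: "complex^'n \<Rightarrow> complex" and A and z :: "complex^'n"
  assume f: "holo (ball 0 1) f" and g: "holo (ball 0 1) g" and A: "0 \<le> A" and z: "norm z < 1"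
    and bd: "\<And>z. norm z < 1 \<Longrightarrow> cmod (f z * radial_d g z) \<le> A * (1 - (norm z)\<^sup>2) powr (- \<alpha>)"
  define k where "k = (\<lambda>z. f z * radial_d g z)"
  have k: "holo (ball 0 1) k" unfolding k_def by (intro holo_mult f holo_radial_d[OF g]) simp
  have dk: "cmod (dh k y (axis j 1)) \<le> A * 2 powr (\<alpha> + 1) * (1 - norm y) powr (- \<alpha> - 1)" if y: "norm y < 1" for y j
  proof -
    define R where "R = (1 - norm y) / 2"
    have R: "R > 0" using y by (simp add: R_def)
    have ny: "norm (y + a *s axis j 1) \<le> 1 - R" if "cmod a \<le> R" for a
    proof -
      have "norm (a *s axis j 1 :: complex^'n) = cmod a" by (simp add: norm_scale norm_axis_complex)
      then have "norm (y + a *s axis j 1) \<le> norm y + R" using norm_triangle_ineq[of y "a *s axis j 1"] that by linarith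
      then show ?thesis unfolding R_def by (simp add: field_simps)
    qed
    have "cmod (k (y + a *s axis j 1)) \<le> A * R powr (- \<alpha>)" if a: "cmod a \<le> R" for a
    proof -
      let ?w = "y + a *s axis j 1"
      have w: "norm ?w < 1" using ny[OF a] R by simp
      have "(norm ?w)\<^sup>2 \<le> norm ?w" using w by (simp add: power2_eq_square mult_left_le_one_le)
      then have "R \<le> 1 - (norm ?w)\<^sup>2" using ny[OF a] by simp
      then have "(1 - (norm ?w)\<^sup>2) powr (- \<alpha>) \<le> R powr (- \<alpha>)" using R \<alpha> by (intro powr_mono2') auto
      then have "A * (1 - (norm ?w)\<^sup>2) powr (- \<alpha>) \<le> A * R powr (- \<alpha>)" using A by (rule mult_left_mono)
      then show ?thesis using bd[OF w] by (simp add: k_def)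
    qed
    then have "cmod (dh k y (axis j 1)) \<le> A * R powr (- \<alpha>) / R"
    proof (intro dh_Cauchy_estimate[OF k _ R])
      show "y + a *s axis j 1 \<in> ball 0 1" if "cmod a \<le> R" for a
        using ny[OF that] R by simp
    qed auto
    also have "\<dots> = A * R powr (- \<alpha> - 1)" using R by (simp add: powr_diff)
    also have "R powr (- \<alpha> - 1) = 2 powr (\<alpha> + 1) * (1 - norm y) powr (- \<alpha> - 1)"
      using y powr_minus_divide[of 2 "\<alpha> + 1"] by (simp add: R_def powr_divide)
    finally show ?thesis by (simp add: mult.assoc)
  qed
  have pd: "cmod (partial_d j (T_op g f) z) \<le> A * 2 powr (\<alpha> + 1) * (c * (1 - norm z) powr (- \<alpha>))" for j
  proof -
    have pos: "0 < 1 - r * norm z" if "r \<in> {0..1}" for r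
      using that z mult_left_le_one_le[of "norm z" r] by auto
    have rz: "norm (r *\<^sub>R z) < 1" if "r \<in> {0..1}" for r using norm_scaleR_ball z that by auto
    have "cmod (partial_d j (T_op g f) z) = cmod (integral {0..1} (\<lambda>r. dh k (r *\<^sub>R z) (axis j 1)))"
      unfolding partial_d_dh T_op_dh[OF f g z] k_def ..
    also have "\<dots> \<le> integral {0..1} (\<lambda>r. A * 2 powr (\<alpha> + 1) * (1 - r * norm z) powr (- \<alpha> - 1))"
    proof (rule integral_norm_bound_integral)
      show "(\<lambda>r. dh k (r *\<^sub>R z) (axis j 1)) integrable_on {0..1}"
        by (intro integrable_continuous_real continuous_on_compose2[OF continuous_on_dh[OF k]] continuous_intros)
           (use rz in auto)
      show "(\<lambda>r. A * 2 powr (\<alpha> + 1) * (1 - r * norm z) powr (- \<alpha> - 1)) integrable_on {0..1}"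
        by (intro integrable_continuous_real continuous_intros) (use pos in force)
      fix r :: real assume r: "r \<in> {0..1}"
      then show "cmod (dh k (r *\<^sub>R z) (axis j 1)) \<le> A * 2 powr (\<alpha> + 1) * (1 - r * norm z) powr (- \<alpha> - 1)"
        using dk[OF rz[OF r]] by simp
    qed
    also have "\<dots> = A * 2 powr (\<alpha> + 1) * integral {0..1} (\<lambda>r. (1 - r * norm z) powr (- \<alpha> - 1))"
      by (rule integral_mult_right)
    also have "\<dots> \<le> A * 2 powr (\<alpha> + 1) * (c * (1 - norm z) powr (- \<alpha>))"
      unfolding c_def using A z \<alpha> by (intro mult_left_mono integral_one_minus_powr) auto
    finally show ?thesis .
  qed
  have "1 - (norm z)\<^sup>2 = (1 - norm z) * (1 + norm z)" by (simp add: power2_eq_square algebra_simps)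
  also have "\<dots> \<le> (1 - norm z) * 2" using z by (intro mult_left_mono) auto
  finally have "((1 - norm z) * 2) powr (- \<alpha>) \<le> (1 - (norm z)\<^sup>2) powr (- \<alpha>)"
    using z \<alpha> one_minus_norm_pos[OF z] by (intro powr_mono2') auto
  then have "2 powr \<alpha> * (((1 - norm z) * 2) powr (- \<alpha>)) \<le> 2 powr \<alpha> * (1 - (norm z)\<^sup>2) powr (- \<alpha>)"
    by (rule mult_left_mono) simp
  moreover have "2 powr \<alpha> * (((1 - norm z) * 2) powr (- \<alpha>)) = (1 - norm z) powr (- \<alpha>)"
  proof -
    have "((1 - norm z) * 2) powr (- \<alpha>) = (1 - norm z) powr (- \<alpha>) * 2 powr (- \<alpha>)"
      by (rule powr_mult)
    then show ?thesis by (simp add: powr_minus[of 2])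
  qed
  ultimately have zz: "(1 - norm z) powr (- \<alpha>) \<le> 2 powr \<alpha> * (1 - (norm z)\<^sup>2) powr (- \<alpha>)" by (simp only:)
  have "norm (grad (T_op g f) z) \<le> (\<Sum>j\<in>UNIV. cmod (grad (T_op g f) z $ j))"
    unfolding norm_vec_def by (rule L2_set_le_sum) simp
  also have "\<dots> \<le> (\<Sum>j\<in>(UNIV :: 'n set). A * 2 powr (\<alpha> + 1) * (c * (1 - norm z) powr (- \<alpha>)))"
    by (rule sum_mono) (use pd in \<open>simp add: grad_def\<close>)
  also have "\<dots> = real CARD('n) * (A * 2 powr (\<alpha> + 1) * (c * (1 - norm z) powr (- \<alpha>)))" by simp
  also have "\<dots> \<le> real CARD('n) * (A * 2 powr (\<alpha> + 1) * (c * (2 powr \<alpha> * (1 - (norm z)\<^sup>2) powr (- \<alpha>))))"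
    using zz A c by (intro mult_left_mono) auto
  also have "\<dots> = C * A * (1 - (norm z)\<^sup>2) powr (- \<alpha>)" by (simp add: C_def mult_ac)
  finally show "norm (grad (T_op g f) z) \<le> C * A * (1 - (norm z)\<^sup>2) powr (- \<alpha>)" .
qed

lemma F_norm_T_op_le:
  fixes p q s :: real
  assumes p: "0 < p" and q: "- real CARD('n) - 1 < q" and s: "1 < s" and n: "s * (real CARD('n) - 1) < real CARD('n)"
  obtains C where "C > 0" "\<And>(f :: complex^'n \<Rightarrow> complex) g A. holo (ball 0 1) f \<Longrightarrow> holo (ball 0 1) g \<Longrightarrow> 0 \<le> A \<Longrightarrow>
    (\<And>z. norm z < 1 \<Longrightarrow> cmod (f z * radial_d g z) \<le> A * (1 - (norm z)\<^sup>2) powr (- ((real CARD('n) + 1 + q) / p))) \<Longrightarrow>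
    F_norm p q s (T_op g f) \<le> ennreal (C * A)"
proof -
  have "(real CARD('n) + 1 + q) / p > 0" using p q by simp
  then obtain C1 where C1: "C1 > 0" "\<And>(f :: complex^'n \<Rightarrow> complex) g A z. holo (ball 0 1) f \<Longrightarrow> holo (ball 0 1) g \<Longrightarrow> 0 \<le> A \<Longrightarrow>
    (\<And>z. norm z < 1 \<Longrightarrow> cmod (f z * radial_d g z) \<le> A * (1 - (norm z)\<^sup>2) powr (- ((real CARD('n) + 1 + q) / p))) \<Longrightarrow> norm z < 1 \<Longrightarrow>
    norm (grad (T_op g f) z) \<le> C1 * A * (1 - (norm z)\<^sup>2) powr (- ((real CARD('n) + 1 + q) / p))"
    using T_op_grad_le[where 'n='n] by blast
  obtain C2 where C2: "C2 > 0" "\<And>(u :: complex^'n \<Rightarrow> complex) A. holo (ball 0 1) u \<Longrightarrow> u 0 = 0 \<Longrightarrow> 0 \<le> A \<Longrightarrow>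
    (\<And>w. norm w < 1 \<Longrightarrow> norm (grad u w) \<le> A * (1 - (norm w)\<^sup>2) powr (- ((real CARD('n) + 1 + q) / p))) \<Longrightarrow>
    F_norm p q s u \<le> ennreal (C2 * A)"
    using F_norm_le[where 'n='n, OF p s n] by blast
  show thesis
  proof
    show "C2 * C1 > 0" using C1 C2 by simp
    fix f :: "complex^'n \<Rightarrow> complex" and g A
    assume *: "holo (ball 0 1) f" "holo (ball 0 1) g" "0 \<le> A"
      "\<And>z. norm z < 1 \<Longrightarrow> cmod (f z * radial_d g z) \<le> A * (1 - (norm z)\<^sup>2) powr (- ((real CARD('n) + 1 + q) / p))"
    have "F_norm p q s (T_op g f) \<le> ennreal (C2 * (C1 * A))"
      by (rule C2(2)[OF hol_ball_holo[OF T_op_hol_ball[OF *(1,2)]] T_op_0])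
         (use C1 * in auto)
    then show "F_norm p q s (T_op g f) \<le> ennreal (C2 * C1 * A)" by (simp add: mult.assoc)
  qed
qed

subsection \<open>Derivatives of higher order\<close>

lemma dh_sum:
  assumes "finite I" "\<And>i. i \<in> I \<Longrightarrow> holo S (f i)" "z \<in> S"
  shows "dh (\<lambda>z. \<Sum>i\<in>I. c i * f i z) z v = (\<Sum>i\<in>I. c i * dh (f i) z v)"
proof -
  have "dh (\<lambda>z. \<Sum>i\<in>I. c i * f i z) z = (\<lambda>v. \<Sum>i\<in>I. c i * dh (f i) z v)"
  proof (rule dh_unique)
    show "((\<lambda>z. \<Sum>i\<in>I. c i * f i z) has_derivative (\<lambda>v. \<Sum>i\<in>I. c i * dh (f i) z v)) (at z)"
      by (intro has_derivative_sum has_derivative_mult_right holo_has_derivative[OF assms(2) assms(3)])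
  qed (simp add: dh_scale sum_distrib_left mult_ac)
  then show ?thesis by simp
qed

lemma holo_foldr_partial: "holo S f \<Longrightarrow> open S \<Longrightarrow> holo S (foldr partial_d js f)"
  by (induction js) (auto intro: holo_partial_d)

lemma foldr_partial_insert:
  assumes f: "holo S f" and S: "open S" and z: "z \<in> S"
  shows "foldr partial_d (xs @ a # ys) f z = partial_d a (foldr partial_d (xs @ ys) f) z"
  using z
proof (induction xs arbitrary: z)
  case (Cons b xs)
  have "foldr partial_d ((b # xs) @ a # ys) f z = partial_d b (foldr partial_d (xs @ a # ys) f) z" by simp
  also have "\<dots> = partial_d b (partial_d a (foldr partial_d (xs @ ys) f)) z"
    by (rule partial_d_cong[OF S Cons.prems Cons.IH])
  also have "\<dots> = partial_d a (partial_d b (foldr partial_d (xs @ ys) f)) z"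
    by (rule partial_d_commute[OF holo_foldr_partial[OF f S] S Cons.prems])
  finally show ?case by simp
qed simp

lemma foldr_partial_mset:
  assumes f: "holo S f" and S: "open S" and z: "z \<in> S" and m: "mset xs = mset ys"
  shows "foldr partial_d xs f z = foldr partial_d ys f z"
  using z m
proof (induction xs arbitrary: ys z)
  case (Cons a xs)
  then have "a \<in> set ys" by (metis list.set_intros(1) mset_eq_setD)
  then obtain l1 l2 where ys: "ys = l1 @ a # l2" by (meson split_list)
  then have m: "mset xs = mset (l1 @ l2)" using Cons.prems by simp
  have "foldr partial_d (a # xs) f z = partial_d a (foldr partial_d xs f) z" by simp
  also have "\<dots> = partial_d a (foldr partial_d (l1 @ l2) f) z"
    by (rule partial_d_cong[OF S Cons.prems(1)]) (rule Cons.IH[OF _ m])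
  also have "\<dots> = foldr partial_d ys f z"
    unfolding ys by (rule foldr_partial_insert[OF f S Cons.prems(1), symmetric])
  finally show ?case .
qed simp

text \<open>The list chosen inside \<open>multi_d\<close> is a permutation of \<open>js\<close>, and
  for holomorphic \<open>f\<close> the order of the derivatives is immaterial.\<close>

lemma multi_d_foldr:
  fixes f :: "complex^'n \<Rightarrow> complex"
  assumes f: "holo S f" and S: "open S" and z: "z \<in> S"
  shows "multi_d (count_list js) f z = foldr partial_d js f z"
proof -
  define js' where "js' = (SOME xs :: 'n list. \<forall>j. count_list xs j = count_list js j)"
  have "\<forall>j. count_list js' j = count_list js j"
    unfolding js'_def by (rule someI_ex) blast
  then have "mset js' = mset js" by (simp add: multiset_eq_iff count_mset)
  then show ?thesis
    unfolding multi_d_def js'_def[symmetric] by (rule foldr_partial_mset[OF f S z])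
qed

lemma multi_d_list:
  fixes m :: "'n::finite \<Rightarrow> nat"
  obtains js where "m = count_list js" "multi_d m = foldr partial_d js" "length js = sum m UNIV"
proof -
  define js where "js = (SOME xs. \<forall>j. count_list xs j = m j)"
  have c: "\<forall>j. count_list js j = m j"
    unfolding js_def by (rule someI_ex) (rule multi_index_list_exists)
  then have "m = count_list js" by auto
  moreover have "multi_d m = foldr partial_d js" by (simp add: fun_eq_iff multi_d_def js_def)
  moreover have "length js = sum m UNIV"
    using sum_count_set[of js UNIV] c by simp
  ultimately show thesis using that by blast
qed

lemma holo_multi_d: "holo S f \<Longrightarrow> open S \<Longrightarrow> holo S (multi_d m f)"
  by (rule multi_d_list[of m]) (simp add: holo_foldr_partial)

lemma finite_multi_index: "finite {m :: 'n::finite \<Rightarrow> nat. sum m UNIV \<le> k}"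
proof (rule finite_subset)
  show "{m :: 'n \<Rightarrow> nat. sum m UNIV \<le> k} \<subseteq> (UNIV \<rightarrow>\<^sub>E {..k})"
  proof
    fix m :: "'n \<Rightarrow> nat" assume "m \<in> {m. sum m UNIV \<le> k}"
    then have "m j \<le> k" for j using member_le_sum[of j UNIV m] by (auto intro: order_trans)
    then show "m \<in> UNIV \<rightarrow>\<^sub>E {..k}" by auto
  qed
  show "finite ((UNIV :: 'n set) \<rightarrow>\<^sub>E {..k})" by (intro finite_PiE) auto
qed

lemma finite_multi_index_eq: "finite {m :: 'n::finite \<Rightarrow> nat. sum m UNIV = k}"
  by (rule finite_subset[OF _ finite_multi_index[of k]]) auto

section \<open>Directional derivatives and Taylor's formula along rays\<close>

primrec dird :: "complex^'n \<Rightarrow> nat \<Rightarrow> (complex^'n \<Rightarrow> complex) \<Rightarrow> complex^'n \<Rightarrow> complex" where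
  "dird v 0 f = f"
| "dird v (Suc k) f = (\<lambda>z. dh (dird v k f) z v)"

lemma holo_dh: "holo S f \<Longrightarrow> open S \<Longrightarrow> holo S (\<lambda>z. dh f z v)"
  unfolding dh_def by (intro holo_sum holo_mult holo_const holo_partial_d) auto

lemma holo_dird: "holo S f \<Longrightarrow> open S \<Longrightarrow> holo S (dird v k f)"
  by (induction k) (auto intro: holo_dh)

text \<open>Words of length \<open>k\<close> index the partial derivatives together with their
  order, so that the expansion of \<open>dird\<close> has no multinomial coefficients.\<close>

definition lists_of :: "nat \<Rightarrow> 'n::finite list set" where "lists_of k = {js. length js = k}"

lemma finite_lists_of: "finite (lists_of k :: 'n::finite list set)"
  using finite_lists_length_eq[of "UNIV :: 'n set" k] by (simp add: lists_of_def)

lemma card_lists_of: "card (lists_of k :: 'n::finite list set) = CARD('n) ^ k"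
  using card_lists_length_eq[of "UNIV :: 'n set" k] by (simp add: lists_of_def)

lemma sum_lists_of_Suc:
  "(\<Sum>js\<in>lists_of (Suc k). F js) = (\<Sum>js\<in>lists_of k. \<Sum>j\<in>(UNIV :: 'n::finite set). F (j # js))"
proof -
  have "(\<Sum>js\<in>lists_of k. \<Sum>j\<in>(UNIV :: 'n set). F (j # js)) = (\<Sum>(js, j)\<in>lists_of k \<times> UNIV. F (j # js))"
    by (rule sum.cartesian_product)
  also have "\<dots> = (\<Sum>js\<in>lists_of (Suc k). F js)"
    by (rule sum.reindex_bij_witness[of _ "\<lambda>js. (tl js, hd js)" "\<lambda>(js, j). j # js"])
       (auto simp: lists_of_def length_Suc_conv)
  finally show ?thesis ..
qed

lemma dird_expansion:
  fixes f :: "complex^'n \<Rightarrow> complex"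
  assumes f: "holo S f" and S: "open S" and z: "z \<in> S"
  shows "dird v k f z = (\<Sum>js\<in>lists_of k. prod_list (map (($) v) js) * foldr partial_d js f z)"
  using z
proof (induction k arbitrary: z)
  case 0
  have "lists_of 0 = {[] :: 'n list}" by (auto simp: lists_of_def)
  then show ?case by simp
next
  case (Suc k)
  have "dird v (Suc k) f z = dh (\<lambda>z. \<Sum>js\<in>lists_of k. prod_list (map (($) v) js) * foldr partial_d js f z) z v"
    unfolding dird.simps by (rule dh_cong[OF S Suc.prems Suc.IH])
  also have "\<dots> = (\<Sum>js\<in>lists_of k. prod_list (map (($) v) js) * dh (foldr partial_d js f) z v)"
    by (rule dh_sum[OF finite_lists_of holo_foldr_partial[OF f S] Suc.prems])
  also have "\<dots> = (\<Sum>js\<in>lists_of k. \<Sum>j\<in>UNIV. prod_list (map (($) v) (j # js)) * foldr partial_d (j # js) f z)"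
    by (intro sum.cong refl) (simp add: dh_def sum_distrib_left mult_ac)
  also have "\<dots> = (\<Sum>js\<in>lists_of (Suc k). prod_list (map (($) v) js) * foldr partial_d js f z)"
    by (rule sum_lists_of_Suc[symmetric])
  finally show ?case .
qed

lemma norm_dird_le:
  fixes f :: "complex^'n \<Rightarrow> complex"
  assumes f: "holo S f" and S: "open S" and z: "z \<in> S" and v: "norm v \<le> 1"
  shows "cmod (dird v k f z) \<le> real (CARD('n) ^ k) * (\<Sum>m | sum m UNIV = k. cmod (multi_d m f z))"
proof -
  have vj: "cmod (v $ j) \<le> 1" for j
    using Finite_Cartesian_Product.norm_nth_le[of v j] v by linarith
  have pv: "cmod (prod_list (map (($) v) js)) \<le> 1" for js
    by (induction js) (auto simp: norm_mult intro!: mult_le_one vj)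
  have "cmod (dird v k f z) \<le> (\<Sum>js\<in>lists_of k. cmod (prod_list (map (($) v) js)) * cmod (foldr partial_d js f z))"
    unfolding dird_expansion[OF f S z] by (rule order_trans[OF norm_sum]) (simp add: norm_mult)
  also have "\<dots> \<le> (\<Sum>js\<in>(lists_of k :: 'n list set). \<Sum>m | sum m UNIV = k. cmod (multi_d m f z))"
  proof (rule sum_mono)
    fix js :: "'n list" assume js: "js \<in> lists_of k"
    have "cmod (prod_list (map (($) v) js)) * cmod (foldr partial_d js f z) \<le> 1 * cmod (foldr partial_d js f z)"
      by (intro mult_right_mono pv) simp
    also have "\<dots> = cmod (multi_d (count_list js) f z)" using multi_d_foldr[OF f S z] by simp
    also have "\<dots> \<le> (\<Sum>m | sum m UNIV = k. cmod (multi_d m f z))"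
    proof (rule member_le_sum)
      have "sum (count_list js) UNIV = length js" by (rule sum_count_set) auto
      then show "count_list js \<in> {m. sum m UNIV = k}" using js by (simp add: lists_of_def)
    qed (auto intro: finite_multi_index_eq)
    finally show "cmod (prod_list (map (($) v) js)) * cmod (foldr partial_d js f z) \<le> (\<Sum>m | sum m UNIV = k. cmod (multi_d m f z))" .
  qed
  also have "\<dots> = real (CARD('n) ^ k) * (\<Sum>m | sum m UNIV = k. cmod (multi_d m f z))"
    by (simp add: card_lists_of)
  finally show ?thesis .
qed

lemma Taylor_line:
  fixes f :: "complex^'n \<Rightarrow> complex"
  assumes f: "holo (ball 0 1) f" and v: "norm v \<le> 1" and \<rho>: "0 \<le> \<rho>" "\<rho> < 1" and N: "0 < N"
  shows "((\<lambda>u. ((\<rho> - u) ^ (N - 1) / fact (N - 1)) *\<^sub>R dird v N f (u *\<^sub>R v)) has_integral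
    f (\<rho> *\<^sub>R v) - (\<Sum>k<N. (\<rho> ^ k / fact k) *\<^sub>R dird v k f 0)) {0..\<rho>}"
proof -
  have mem: "norm (u *\<^sub>R v) < 1" if "u \<in> {0..\<rho>}" for u
    using that v \<rho> mult_mono[of u \<rho> "norm v" 1] by auto
  have "((\<lambda>u. ((\<rho> - u) ^ (N - 1) / fact (N - 1)) *\<^sub>R dird v N f (u *\<^sub>R v)) has_integral
    f (\<rho> *\<^sub>R v) - (\<Sum>k<N. ((\<rho> - 0) ^ k / fact k) *\<^sub>R dird v k f (0 *\<^sub>R v))) {0..\<rho>}"
  proof (rule Taylor_has_integral[where Df="\<lambda>k u. dird v k f (u *\<^sub>R v)" and f="\<lambda>u. f (u *\<^sub>R v)"])
    fix k u assume "0 \<le> u" "u \<le> \<rho>"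
    then have u: "u *\<^sub>R v \<in> ball 0 1" using mem[of u] by simp
    have "((\<lambda>u. u *\<^sub>R v) has_derivative (\<lambda>a. a *\<^sub>R v)) (at u within {0..\<rho>})"
      by (auto intro!: derivative_eq_intros)
    from has_derivative_compose[OF this holo_has_derivative[OF holo_dird[OF f open_ball, of v k] u]]
    show "((\<lambda>u. dird v k f (u *\<^sub>R v)) has_vector_derivative dird v (Suc k) f (u *\<^sub>R v)) (at u within {0..\<rho>})"
      by (simp add: has_vector_derivative_def dh_scaleR scaleR_conv_of_real[where 'a=complex])
  qed (use \<rho> N in auto)
  then show ?thesis by simp
qed

text \<open>Reduces growth to the derivatives of order \<open>N\<close>, the only ones the Besov
  norm controls away from the origin. The remainder kernel (\<rho> - u)^(N - 1) is enlarged to (1 -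
  u)^(N - 1), which no longer depends on the endpoint.\<close>

lemma Taylor_bound:
  fixes f :: "complex^'n \<Rightarrow> complex"
  assumes f: "holo (ball 0 1) f" and v: "norm v \<le> 1" and \<rho>: "0 \<le> \<rho>" "\<rho> < 1" and N: "0 < N"
  shows "ennreal (cmod (f (\<rho> *\<^sub>R v))) \<le> ennreal (\<Sum>k<N. cmod (dird v k f 0)) +
    (\<integral>\<^sup>+u. ennreal ((1 - u) ^ (N - 1) * cmod (dird v N f (u *\<^sub>R v))) * indicator {0..\<rho>} u \<partial>lborel)"
proof -
  have mem: "norm (u *\<^sub>R v) < 1" if "u \<in> {0..\<rho>}" for u
    using that v \<rho> mult_mono[of u \<rho> "norm v" 1] by auto
  let ?i = "\<lambda>u. ((\<rho> - u) ^ (N - 1) / fact (N - 1)) *\<^sub>R dird v N f (u *\<^sub>R v)"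
  let ?h = "\<lambda>u. (1 - u) ^ (N - 1) * cmod (dird v N f (u *\<^sub>R v))"
  note T = Taylor_line[OF assms]
  have hi: "?h integrable_on {0..\<rho>}"
    by (intro integrable_continuous_real continuous_intros continuous_on_compose2[OF holo_continuous[OF holo_dird[OF f open_ball]]])
       (use mem in auto)
  have "cmod (integral {0..\<rho>} ?i) \<le> integral {0..\<rho>} ?h"
  proof (rule integral_norm_bound_integral[OF has_integral_integrable[OF T] hi])
    fix u assume u: "u \<in> {0..\<rho>}"
    have "(\<rho> - u) ^ (N - 1) / fact (N - 1) \<le> (\<rho> - u) ^ (N - 1) / 1"
      using u by (intro divide_left_mono) (auto intro: fact_ge_1)
    also have "\<dots> \<le> (1 - u) ^ (N - 1)" using u \<rho> by (auto intro: power_mono)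
    finally have "(\<rho> - u) ^ (N - 1) / fact (N - 1) * cmod (dird v N f (u *\<^sub>R v)) \<le> ?h u"
      by (rule mult_right_mono) simp
    then show "cmod (?i u) \<le> ?h u" using u by simp
  qed
  moreover have "cmod (\<Sum>k<N. (\<rho> ^ k / fact k) *\<^sub>R dird v k f 0) \<le> (\<Sum>k<N. cmod (dird v k f 0))"
  proof (rule order_trans[OF norm_sum sum_mono])
    fix k
    have "\<rho> ^ k / fact k \<le> 1 / 1" using \<rho> by (intro frac_le) (auto intro: fact_ge_1 power_le_one)
    then have "(\<rho> ^ k / fact k) * cmod (dird v k f 0) \<le> 1 * cmod (dird v k f 0)"
      by (intro mult_right_mono) auto
    then show "cmod ((\<rho> ^ k / fact k) *\<^sub>R dird v k f 0) \<le> cmod (dird v k f 0)" using \<rho> by simp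
  qed
  moreover have "cmod (f (\<rho> *\<^sub>R v)) \<le> cmod (\<Sum>k<N. (\<rho> ^ k / fact k) *\<^sub>R dird v k f 0) + cmod (integral {0..\<rho>} ?i)"
  proof -
    have "f (\<rho> *\<^sub>R v) = (\<Sum>k<N. (\<rho> ^ k / fact k) *\<^sub>R dird v k f 0) + integral {0..\<rho>} ?i"
      using integral_unique[OF T] by simp
    then show ?thesis by (simp only: norm_triangle_ineq)
  qed
  ultimately have "cmod (f (\<rho> *\<^sub>R v)) \<le> (\<Sum>k<N. cmod (dird v k f 0)) + integral {0..\<rho>} ?h" by linarith
  then have "ennreal (cmod (f (\<rho> *\<^sub>R v))) \<le> ennreal (\<Sum>k<N. cmod (dird v k f 0)) + ennreal (integral {0..\<rho>} ?h)"
    by (subst ennreal_plus[symmetric]) (use hi \<rho> in \<open>auto intro!: ennreal_leI sum_nonneg integral_nonneg\<close>)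
  also have "ennreal (integral {0..\<rho>} ?h) = (\<integral>\<^sup>+u. ennreal (?h u) * indicator {0..\<rho>} u \<partial>lborel)"
    by (rule nn_integral_has_integral_lebesgue'[symmetric]) (use hi \<rho> in \<open>auto intro: integrable_integral\<close>)
  finally show ?thesis .
qed

text \<open>Stands in for Hoelder's inequality: after integration, a suitable choice of
  \<open>c\<close> yields the same power. Where x > c, the factor x^(1 - t) is at most c^(1 - t)
  because t \<ge> 1.\<close>

lemma le_add_powr:
  fixes x c t :: real
  assumes "0 \<le> x" "0 < c" "1 \<le> t"
  shows "x \<le> c + x powr t * c powr (1 - t)"
proof (cases "x \<le> c")
  case True
  have "0 \<le> x powr t * c powr (1 - t)" by simp
  with True show ?thesis by linarith
next
  case False
  then have x: "0 < x" using assms by auto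
  have "x = x powr t * x powr (1 - t)" using x by (simp add: powr_add[symmetric])
  also have "\<dots> \<le> x powr t * c powr (1 - t)" using False assms by (intro mult_left_mono powr_mono2') auto
  finally show ?thesis using assms by linarith
qed

lemma nn_integral_log_kernel:
  assumes "0 < a" "a \<le> b"
  shows "(\<integral>\<^sup>+u. ennreal (1 / (1 - u)) * indicator {u. a \<le> 1 - u \<and> 1 - u \<le> b} u \<partial>lborel) = ennreal (ln (b / a))"
proof -
  have "(\<integral>\<^sup>+u. ennreal (1 / (1 - u)) * indicator {u. a \<le> 1 - u \<and> 1 - u \<le> b} u \<partial>lborel)
    = (\<integral>\<^sup>+u. ennreal (1 / (1 - u)) * indicator {1 - b..1 - a} u \<partial>lborel)"
    by (intro nn_integral_cong) (auto simp: indicator_def)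
  also have "\<dots> = ennreal ((- ln (1 - (1 - a))) - (- ln (1 - (1 - b))))"
    by (rule nn_integral_FTC_Icc) (use assms in \<open>auto intro!: derivative_eq_intros simp: field_simps\<close>)
  also have "(- ln (1 - (1 - a))) - (- ln (1 - (1 - b))) = ln (b / a)" using assms by (simp add: ln_div)
  finally show ?thesis .
qed

subsection \<open>Growth of Besov functions\<close>

text \<open>Serves Tonelli over \<open>inv_vol\<close>, whose total mass is infinite; it has a
  finite density over the probability measure \<open>vol\<close>.\<close>

lemma sigma_finite_inv_vol: "sigma_finite_measure (inv_vol :: (complex^'n) measure)"
proof -
  have "finite_measure (vol :: (complex^'n) measure)"
    by (rule finite_measureI)
       (use emeasure_uniform_measure[of "ball 0 1" lborel "UNIV :: (complex^'n) set"] emeasure_unit_ball[where 'n='n]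
        in \<open>simp add: vol_def divide_eq_1_ennreal top.not_eq_extremum ennreal_divide_self\<close>)
  then interpret finite_measure "vol :: (complex^'n) measure" .
  show ?thesis unfolding inv_vol_def
    by (subst sigma_finite_iff_density_finite) auto
qed

lemma log_weight_ge: 
  assumes "norm (z :: 'a::real_normed_vector) < 1"
  shows "ln 2 \<le> ln (2 / (1 - (norm z)\<^sup>2))" "ln (1 / (1 - norm z)) \<le> ln (2 / (1 - (norm z)\<^sup>2))"
    "0 < ln (2 / (1 - (norm z)\<^sup>2))"
proof -
  have p: "0 < 1 - (norm z)\<^sup>2" by (rule one_minus_norm_pos[OF assms])
  have "2 \<le> 2 / (1 - (norm z)\<^sup>2)" using p by (simp add: field_simps)
  then show 1: "ln 2 \<le> ln (2 / (1 - (norm z)\<^sup>2))" by (intro ln_mono) auto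
  have "1 - (norm z)\<^sup>2 = (1 - norm z) * (1 + norm z)" by (simp add: power2_eq_square algebra_simps)
  also have "\<dots> \<le> (1 - norm z) * 2" using assms by (intro mult_left_mono) auto
  finally have "1 / (1 - norm z) \<le> 2 / (1 - (norm z)\<^sup>2)" using p assms by (simp add: field_simps)
  then show "ln (1 / (1 - norm z)) \<le> ln (2 / (1 - (norm z)\<^sup>2))" using assms p by (intro ln_mono) auto
  show "0 < ln (2 / (1 - (norm z)\<^sup>2))" using 1 ln_gt_zero[of "2::real"] by linarith
qed

lemma epowr_inverse_le:
  assumes "1 \<le> t" "0 \<le> M" "epowr x (1 / t) \<le> ennreal M"
  shows "x \<le> ennreal (M powr t)"
proof (cases x)
  case (real r)
  then have "r powr (1 / t) \<le> M" using assms by (simp add: epowr_ennreal)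
  then have "(r powr (1 / t)) powr t \<le> M powr t" using assms by (intro powr_mono2) auto
  then show ?thesis using real assms by (simp add: powr_powr ennreal_leI)
qed (use assms in \<open>simp add: epowr_def top_unique\<close>)

lemma besov_norm_bounds:
  fixes f :: "complex^'n \<Rightarrow> complex"
  assumes b: "besov_norm N t f \<le> ennreal M" and t: "1 \<le> t" and M: "0 \<le> M"
  shows "k \<le> N - 1 \<Longrightarrow> (\<Sum>m | sum m UNIV = k. cmod (multi_d m f 0)) \<le> M"
    and "sum m UNIV = N \<Longrightarrow> besov_term N t m f \<le> ennreal (M powr t)"
proof -
  assume k: "k \<le> N - 1"
  have "ennreal (\<Sum>m | sum m UNIV = k. cmod (multi_d m f 0)) = (\<Sum>m | sum m UNIV = k. ennreal (cmod (multi_d m f 0)))"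
    by (rule sum_ennreal[symmetric]) simp
  also have "\<dots> \<le> (\<Sum>m | sum m UNIV \<le> N - 1. ennreal (cmod (multi_d m f 0)))"
    by (rule sum_mono2[OF finite_multi_index]) (use k in auto)
  also have "\<dots> \<le> ennreal M" using b unfolding besov_norm_def by (rule order_trans[rotated]) simp
  finally show "(\<Sum>m | sum m UNIV = k. cmod (multi_d m f 0)) \<le> M" using M by (simp add: ennreal_le_iff)
next
  assume m: "sum m UNIV = N"
  have "epowr (besov_term N t m f) (1 / t) \<le> (\<Sum>m | sum m UNIV = N. epowr (besov_term N t m f) (1 / t))"
    by (rule member_le_sum) (use m in \<open>auto intro: finite_multi_index_eq\<close>)
  also have "\<dots> \<le> ennreal M" using b unfolding besov_norm_def by (rule order_trans[rotated]) simp
  finally show "besov_term N t m f \<le> ennreal (M powr t)" by (rule epowr_inverse_le[OF t M])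
qed

text \<open>Tonelli over the radius and the ball: each point of the ball lies in the Bergman ball
  around \<open>u v\<close> only for \<open>u\<close> in a range of bounded logarithmic length.\<close>

lemma radial_derivative_integral:
  fixes t :: real
  assumes t: "1 \<le> t"
  obtains C where "C > 0" "\<And>(f :: complex^'n \<Rightarrow> complex) m v. holo (ball 0 1) f \<Longrightarrow> norm v = 1 \<Longrightarrow>
    (\<integral>\<^sup>+u. ennreal (((1 - u) ^ N * cmod (cut (multi_d m f) (u *\<^sub>R v))) powr t) * (ennreal (1 / (1 - u)) * indicator {0..<1} u) \<partial>lborel)
     \<le> ennreal C * besov_term N t m f"
proof -
  obtain C0 where C0: "C0 > 0" "\<And>(h :: complex^'n \<Rightarrow> complex) a. holo (ball 0 1) h \<Longrightarrow> norm a < 1 \<Longrightarrow>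
    ennreal (cmod (h a) powr t) \<le> ennreal C0 * (\<integral>\<^sup>+w. ennreal (cmod (h w) powr t) * indicator {w. norm (invol a w) < 1/4} w \<partial>inv_vol)"
    using holo_submean[where 'n='n, OF less_le_trans[OF zero_less_one t]] by blast
  define K where "K = (5 ^ N) powr t"
  have K: "K > 0" by (simp add: K_def)
  show thesis
  proof
    show "C0 * K * ln 50 > 0" using C0 K by simp
    fix f :: "complex^'n \<Rightarrow> complex" and m v assume f: "holo (ball 0 1) f" and v: "norm (v :: complex^'n) = 1"
    define h where "h = multi_d m f"
    define H where "H = cut h"
    have householder: "holo (ball 0 1) h" unfolding h_def by (rule holo_multi_d[OF f]) simp
    have [measurable]: "H \<in> borel_measurable borel" unfolding H_def by (rule measurable_cut[OF holo_continuous[OF householder]])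
    define Y where "Y = (\<lambda>w :: complex^'n. 1 - (norm w)\<^sup>2)"
    have [measurable]: "Y \<in> borel_measurable borel" unfolding Y_def by measurable
    define \<Phi> where "\<Phi> = (\<lambda>w. ennreal ((\<bar>Y w\<bar> ^ N * cmod (H w)) powr t))"
    have [measurable]: "\<Phi> \<in> borel_measurable borel" unfolding \<Phi>_def by measurable
    have bt: "besov_term N t m f = (\<integral>\<^sup>+w. \<Phi> w \<partial>inv_vol)"
      unfolding besov_term_def
    proof (rule nn_integral_cong_AE)
      show "AE w in inv_vol. ennreal (cmod ((1 - norm w ^ 2) ^ N *\<^sub>R multi_d m f w) powr t) = \<Phi> w"
        using AE_inv_vol_ball
        by eventually_elim (simp add: \<Phi>_def H_def h_def cut_def Y_def power_abs)
    qed
    \<comment> \<open>A window containing each \<open>u\<close> for which \<open>w\<close> lies in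
      the Bergman ball around \<open>u *\<^sub>R v\<close>. The bounds are those of
      \<open>invol_ball_comparable\<close>, one of them doubled because 1 - u \<le> 1 - u^2 \<le> 2
      (1 - u). The logarithmic length of the window is ln (5 / (1 / 10)) = ln 50.\<close>
    define I where "I = (\<lambda>u w. indicator {u. Y w / 10 \<le> 1 - u \<and> 1 - u \<le> 5 * Y w} u :: ennreal)"
    have Im: "(\<lambda>(u, w). I u w) \<in> borel_measurable (borel \<Otimes>\<^sub>M borel)"
    proof -
      have "(\<lambda>(u, w). if Y w / 10 \<le> 1 - u \<and> 1 - u \<le> 5 * Y w then 1 else (0::ennreal)) \<in> borel_measurable (borel \<Otimes>\<^sub>M borel)"
        by measurable
      also have "(\<lambda>(u, w). if Y w / 10 \<le> 1 - u \<and> 1 - u \<le> 5 * Y w then 1 else (0::ennreal)) = (\<lambda>(u, w). I u w)"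
        by (auto simp: I_def indicator_def fun_eq_iff)
      finally show ?thesis .
    qed
    have Im1[measurable]: "(\<lambda>w. I u w) \<in> borel_measurable borel" for u
      using measurable_compose[OF _ Im, of "\<lambda>w. (u, w)" borel] by simp
    have Im2[measurable]: "(\<lambda>u. I u w) \<in> borel_measurable borel" for w
      using measurable_compose[OF _ Im, of "\<lambda>u. (u, w)" borel] by simp
    have 1: "ennreal (((1 - u) ^ N * cmod (H (u *\<^sub>R v))) powr t) \<le> ennreal (C0 * K) * (\<integral>\<^sup>+w. \<Phi> w * I u w \<partial>inv_vol)"
      if u: "0 \<le> u" "u < 1" for u
    proof -
      let ?a = "u *\<^sub>R v"
      have a: "norm ?a = u" "norm ?a < 1" using u v by auto
      have "ennreal (((1 - u) ^ N * cmod (H ?a)) powr t) = ennreal (((1 - u) ^ N) powr t) * ennreal (cmod (h ?a) powr t)"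
        using u a by (simp add: H_def cut_def powr_mult ennreal_mult)
      also have "\<dots> \<le> ennreal (((1 - u) ^ N) powr t) * (ennreal C0 * (\<integral>\<^sup>+w. ennreal (cmod (h w) powr t) * indicator {w. norm (invol ?a w) < 1/4} w \<partial>inv_vol))"
        by (intro mult_left_mono C0(2)[OF householder a(2)]) simp
      also have "(\<integral>\<^sup>+w. ennreal (cmod (h w) powr t) * indicator {w. norm (invol ?a w) < 1/4} w \<partial>inv_vol)
        = (\<integral>\<^sup>+w. ennreal (cmod (H w) powr t) * indicator {w. norm (invol ?a w) < 1/4} w \<partial>inv_vol)"
        by (rule nn_integral_cong_AE) (use AE_inv_vol_ball in eventually_elim, simp add: H_def cut_def)
      also have "ennreal (((1 - u) ^ N) powr t) * (ennreal C0 * \<dots>) = ennreal C0 * (\<integral>\<^sup>+w. ennreal (((1 - u) ^ N) powr t) * (ennreal (cmod (H w) powr t) * indicator {w. norm (invol ?a w) < 1/4} w) \<partial>inv_vol)"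
        by (subst nn_integral_cmult, measurable) (simp add: mult_ac)
      also have "\<dots> \<le> ennreal C0 * (\<integral>\<^sup>+w. ennreal K * (\<Phi> w * I u w) \<partial>inv_vol)"
      proof (rule mult_left_mono[OF nn_integral_mono_AE])
        show "AE w in inv_vol. ennreal (((1 - u) ^ N) powr t) * (ennreal (cmod (H w) powr t) * indicator {w. norm (invol ?a w) < 1/4} w) \<le> ennreal K * (\<Phi> w * I u w)"
          using AE_inv_vol_ball
        proof eventually_elim
          case (elim w)
          show ?case
          proof (cases "norm (invol ?a w) < 1/4")
            case True
            have Y: "Y w > 0" unfolding Y_def by (rule one_minus_norm_pos[OF elim])
            have c: "Y w \<le> 5 * (1 - u\<^sup>2)" "1 - u\<^sup>2 \<le> 5 * Y w"
              using invol_ball_comparable[OF a(2) elim True] unfolding a(1) Y_def by auto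
            have "u\<^sup>2 \<le> u" using u by (simp add: power2_eq_square mult_left_le_one_le)
            moreover have "1 - u\<^sup>2 \<le> 2 * (1 - u)"
            proof -
              have "0 \<le> (1 - u)\<^sup>2" by simp
              then show ?thesis by (simp add: power2_eq_square algebra_simps)
            qed
            ultimately have "Y w \<le> 10 * (1 - u) \<and> 1 - u \<le> 5 * Y w" using c by simp
            then have c': "Y w / 10 \<le> 1 - u" "1 - u \<le> 5 * Y w" by simp_all
            have "((1 - u) ^ N) powr t \<le> ((5 * Y w) ^ N) powr t"
              using c' u t by (intro powr_mono2 power_mono) auto
            also have "\<dots> = K * ((Y w) ^ N) powr t" using Y by (simp add: power_mult_distrib powr_mult K_def)
            finally have "((1 - u) ^ N) powr t * cmod (H w) powr t \<le> K * ((Y w) ^ N) powr t * cmod (H w) powr t"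
              by (rule mult_right_mono) simp
            also have "\<dots> = K * ((\<bar>Y w\<bar> ^ N * cmod (H w)) powr t)" using Y by (simp add: powr_mult)
            finally have "ennreal (((1 - u) ^ N) powr t * cmod (H w) powr t) \<le> ennreal (K * ((\<bar>Y w\<bar> ^ N * cmod (H w)) powr t))"
              by (rule ennreal_leI)
            then show ?thesis using True c' K by (simp add: I_def \<Phi>_def ennreal_mult)
          qed simp
        qed
      qed simp
      also have "\<dots> = ennreal (C0 * K) * (\<integral>\<^sup>+w. \<Phi> w * I u w \<partial>inv_vol)"
        by (subst nn_integral_cmult, measurable) (use C0 K in \<open>simp add: ennreal_mult mult.assoc\<close>)
      finally show ?thesis .
    qed
    interpret iv: sigma_finite_measure "inv_vol :: (complex^'n) measure" by (rule sigma_finite_inv_vol)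
    interpret pr: pair_sigma_finite "lborel :: real measure" "inv_vol :: (complex^'n) measure" ..
    let ?k = "\<lambda>u. ennreal (1 / (1 - u)) * indicator {0..<1} u"
    have "(\<integral>\<^sup>+u. ennreal (((1 - u) ^ N * cmod (H (u *\<^sub>R v))) powr t) * ?k u \<partial>lborel)
      \<le> (\<integral>\<^sup>+u. ennreal (C0 * K) * (\<integral>\<^sup>+w. \<Phi> w * I u w * ?k u \<partial>inv_vol) \<partial>lborel)"
    proof (rule nn_integral_mono)
      fix u :: real
      show "ennreal (((1 - u) ^ N * cmod (H (u *\<^sub>R v))) powr t) * ?k u \<le> ennreal (C0 * K) * (\<integral>\<^sup>+w. \<Phi> w * I u w * ?k u \<partial>inv_vol)"
      proof (cases "0 \<le> u \<and> u < 1")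
        case True
        have "ennreal (((1 - u) ^ N * cmod (H (u *\<^sub>R v))) powr t) * ?k u \<le> (ennreal (C0 * K) * (\<integral>\<^sup>+w. \<Phi> w * I u w \<partial>inv_vol)) * ?k u"
          by (rule mult_right_mono[OF 1]) (use True in auto)
        also have "\<dots> = ennreal (C0 * K) * (\<integral>\<^sup>+w. \<Phi> w * I u w * ?k u \<partial>inv_vol)"
          by (subst nn_integral_multc, measurable) (simp add: mult.assoc)
        finally show ?thesis .
      qed simp
    qed
    also have "\<dots> = ennreal (C0 * K) * (\<integral>\<^sup>+u. \<integral>\<^sup>+w. \<Phi> w * I u w * ?k u \<partial>inv_vol \<partial>lborel)"
    proof (rule nn_integral_cmult)
      show "(\<lambda>u. \<integral>\<^sup>+w. \<Phi> w * I u w * ?k u \<partial>inv_vol) \<in> borel_measurable lborel"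
        by (rule iv.borel_measurable_nn_integral) (use Im in \<open>measurable\<close>)
    qed
    also have "(\<integral>\<^sup>+u. \<integral>\<^sup>+w. \<Phi> w * I u w * ?k u \<partial>inv_vol \<partial>lborel) = (\<integral>\<^sup>+w. \<integral>\<^sup>+u. \<Phi> w * I u w * ?k u \<partial>lborel \<partial>inv_vol)"
      by (rule pr.Fubini'[symmetric]) (use Im in \<open>measurable\<close>)
    also have "\<dots> \<le> (\<integral>\<^sup>+w. \<Phi> w * ennreal (ln 50) \<partial>inv_vol)"
    proof (rule nn_integral_mono_AE)
      show "AE w in inv_vol. (\<integral>\<^sup>+u. \<Phi> w * I u w * ?k u \<partial>lborel) \<le> \<Phi> w * ennreal (ln 50)"
        using AE_inv_vol_ball
      proof eventually_elim
        case (elim w)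
        have Y: "Y w > 0" unfolding Y_def by (rule one_minus_norm_pos[OF elim])
        have "(\<integral>\<^sup>+u. \<Phi> w * I u w * ?k u \<partial>lborel) \<le> (\<integral>\<^sup>+u. \<Phi> w * (ennreal (1 / (1 - u)) * I u w) \<partial>lborel)"
          by (intro nn_integral_mono) (auto simp: indicator_def mult_ac)
        also have "\<dots> = \<Phi> w * (\<integral>\<^sup>+u. ennreal (1 / (1 - u)) * I u w \<partial>lborel)"
          by (rule nn_integral_cmult) measurable
        also have "(\<integral>\<^sup>+u. ennreal (1 / (1 - u)) * I u w \<partial>lborel) = ennreal (ln (5 * Y w / (Y w / 10)))"
          unfolding I_def by (rule nn_integral_log_kernel) (use Y in auto)
        also have "5 * Y w / (Y w / 10) = 50" using Y by simp
        finally show ?case .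
      qed
    qed
    also have "\<dots> = (\<integral>\<^sup>+w. \<Phi> w \<partial>inv_vol) * ennreal (ln 50)" by (rule nn_integral_multc) measurable
    finally have "(\<integral>\<^sup>+u. ennreal (((1 - u) ^ N * cmod (H (u *\<^sub>R v))) powr t) * ?k u \<partial>lborel) \<le> ennreal (C0 * K) * ((\<integral>\<^sup>+w. \<Phi> w \<partial>inv_vol) * ennreal (ln 50))"
      by (simp add: mult_left_mono)
    also have "\<dots> = ennreal (C0 * K * ln 50) * besov_term N t m f"
      unfolding bt using C0 K by (simp add: ennreal_mult mult_ac)
    finally show "(\<integral>\<^sup>+u. ennreal (((1 - u) ^ N * cmod (cut (multi_d m f) (u *\<^sub>R v))) powr t) * ?k u \<partial>lborel)
       \<le> ennreal (C0 * K * ln 50) * besov_term N t m f" unfolding H_def h_def .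
  qed
qed

text \<open>In Taylor's remainder (1 - u)^(N - 1) equals (1 - u)^N / (1 - u), so the weighted
  derivative is integrated against du / (1 - u). This measure has mass at most \<open>L\<close> on
  [0, norm z], and the weighted derivative has a t-th power integral at most a constant times M^t.
  Hoelder's inequality accounts for the power 1 - 1 / t of \<open>L\<close>.\<close>

lemma besov_growth:
  fixes t :: real
  assumes t: "1 \<le> t" and N: "0 < N"
  obtains C where "C > 0" "\<And>(f :: complex^'n \<Rightarrow> complex) M z. holo (ball 0 1) f \<Longrightarrow> 0 < M \<Longrightarrow>
    besov_norm N t f \<le> ennreal M \<Longrightarrow> norm z < 1 \<Longrightarrow>
    cmod (f z) \<le> C * M * ln (2 / (1 - (norm z)\<^sup>2)) powr ((t - 1) / t)"
proof -
  obtain C1 where C1: "C1 > 0" "\<And>(f :: complex^'n \<Rightarrow> complex) m v. holo (ball 0 1) f \<Longrightarrow> norm v = 1 \<Longrightarrow>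
    (\<integral>\<^sup>+u. ennreal (((1 - u) ^ N * cmod (cut (multi_d m f) (u *\<^sub>R v))) powr t) * (ennreal (1 / (1 - u)) * indicator {0..<1} u) \<partial>lborel)
     \<le> ennreal C1 * besov_term N t m f"
    using radial_derivative_integral[where 'n='n, OF t] by blast
  define n where "n = real CARD('n)"
  define A where "A = (\<Sum>k<N. n ^ k)"
  define D where "D = real (card {m :: 'n \<Rightarrow> nat. sum m UNIV = N})"
  define \<beta> where "\<beta> = (t - 1) / t"
  \<comment> \<open>The first summand trades the constant Taylor terms for L^\<beta>, using L \<ge>
    ln 2; the last one keeps \<open>C\<close> positive.\<close>
  define C where "C = A / ln 2 powr \<beta> + n ^ N * (D * (1 + C1)) + 1"
  have n: "n \<ge> 1" unfolding n_def using card_pos[where 'n='n] by simp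
  have A: "A \<ge> 0" unfolding A_def using n by (intro sum_nonneg) auto
  have D: "D \<ge> 0" by (simp add: D_def)
  have \<beta>: "\<beta> \<ge> 0" using t by (simp add: \<beta>_def)
  show thesis
  proof
    show "C > 0" unfolding C_def using A n D C1 by (intro add_nonneg_pos add_nonneg_nonneg mult_nonneg_nonneg divide_nonneg_nonneg) auto
    fix f :: "complex^'n \<Rightarrow> complex" and M and z :: "complex^'n"
    assume f: "holo (ball 0 1) f" and M: "0 < M" and b: "besov_norm N t f \<le> ennreal M" and z: "norm z < 1"
    define L where "L = ln (2 / (1 - (norm z)\<^sup>2))"
    have L: "ln 2 \<le> L" "ln (1 / (1 - norm z)) \<le> L" "0 < L" unfolding L_def by (rule log_weight_ge[OF z])+
    note bb = besov_norm_bounds[OF b t less_imp_le[OF M]]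
    have low: "(\<Sum>k<N. cmod (dird v k f 0)) \<le> A * M" if v: "norm v \<le> 1" for v
      unfolding A_def sum_distrib_right
    proof (rule sum_mono)
      fix k assume k: "k \<in> {..<N}"
      have "cmod (dird v k f 0) \<le> real (CARD('n) ^ k) * (\<Sum>m | sum m UNIV = k. cmod (multi_d m f 0))"
        by (rule norm_dird_le[OF f open_ball _ v]) simp
      also have "\<dots> \<le> real (CARD('n) ^ k) * M"
        using bb(1)[of k] k by (intro mult_left_mono) auto
      finally show "cmod (dird v k f 0) \<le> n ^ k * M" by (simp add: n_def)
    qed
    obtain v where v: "norm v = 1" "z = norm z *\<^sub>R v"
    proof (cases "z = 0")
      case True
      then show thesis using that[of "axis undefined 1"] by (simp add: norm_axis_complex)
    next
      case False
      then show thesis using that[of "(1 / norm z) *\<^sub>R z"] by simp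
    qed
    define h where "h = (\<lambda>m u. (1 - u) ^ N * cmod (cut (multi_d m f) (u *\<^sub>R v)))"
    have hm[measurable]: "h m \<in> borel_measurable borel" for m
    proof -
      have [measurable]: "cut (multi_d m f) \<in> borel_measurable borel"
        by (rule measurable_cut[OF holo_continuous[OF holo_multi_d[OF f open_ball]]])
      show ?thesis unfolding h_def by measurable
    qed
    \<comment> \<open>This value balances the two terms of \<open>le_add_powr\<close>: both c L and
      c^(1 - t) M^t become M L^\<beta>.\<close>
    define c where "c = M * L powr (- 1 / t)"
    have c: "c > 0" using M L by (simp add: c_def)
    have hI: "(\<integral>\<^sup>+u. ennreal (h m u * (1 / (1 - u))) * indicator {0..norm z} u \<partial>lborel) \<le> ennreal ((1 + C1) * M * L powr \<beta>)"
      if m: "sum m UNIV = N" for m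
    proof -
      have "(\<integral>\<^sup>+u. ennreal (h m u * (1 / (1 - u))) * indicator {0..norm z} u \<partial>lborel)
        \<le> (\<integral>\<^sup>+u. ennreal c * (ennreal (1 / (1 - u)) * indicator {u. 1 - norm z \<le> 1 - u \<and> 1 - u \<le> 1} u)
           + ennreal (c powr (1 - t)) * (ennreal (h m u powr t) * (ennreal (1 / (1 - u)) * indicator {0..<1} u)) \<partial>lborel)"
      proof (rule nn_integral_mono)
        fix u :: real
        show "ennreal (h m u * (1 / (1 - u))) * indicator {0..norm z} u \<le> ennreal c * (ennreal (1 / (1 - u)) * indicator {u. 1 - norm z \<le> 1 - u \<and> 1 - u \<le> 1} u)
           + ennreal (c powr (1 - t)) * (ennreal (h m u powr t) * (ennreal (1 / (1 - u)) * indicator {0..<1} u))"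
        proof (cases "u \<in> {0..norm z}")
          case True
          then have u: "0 \<le> u" "u < 1" "u \<le> norm z" using z by auto
          have h0: "0 \<le> h m u" using u by (simp add: h_def)
          have "h m u * (1 / (1 - u)) \<le> (c + h m u powr t * c powr (1 - t)) * (1 / (1 - u))"
            using u by (intro mult_right_mono le_add_powr h0 c t) auto
          also have "\<dots> = c * (1 / (1 - u)) + c powr (1 - t) * (h m u powr t * (1 / (1 - u)))"
            by (simp add: add_divide_distrib mult_ac)
          finally have "ennreal (h m u * (1 / (1 - u))) \<le> ennreal (c * (1 / (1 - u)) + c powr (1 - t) * (h m u powr t * (1 / (1 - u))))"
            by (rule ennreal_leI)
          also have "\<dots> = ennreal c * ennreal (1 / (1 - u)) + ennreal (c powr (1 - t)) * (ennreal (h m u powr t) * ennreal (1 / (1 - u)))"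
            using u c by (simp add: ennreal_plus ennreal_mult del: times_divide_eq_right)
          finally show ?thesis using True u by simp
        qed simp
      qed
      also have "\<dots> = ennreal c * (\<integral>\<^sup>+u. ennreal (1 / (1 - u)) * indicator {u. 1 - norm z \<le> 1 - u \<and> 1 - u \<le> 1} u \<partial>lborel)
         + ennreal (c powr (1 - t)) * (\<integral>\<^sup>+u. ennreal (h m u powr t) * (ennreal (1 / (1 - u)) * indicator {0..<1} u) \<partial>lborel)"
        by (subst nn_integral_add, measurable, measurable, subst nn_integral_cmult, measurable, subst nn_integral_cmult, measurable)
      also have "\<dots> \<le> ennreal c * ennreal L + ennreal (c powr (1 - t)) * (ennreal C1 * ennreal (M powr t))"
      proof (intro add_mono mult_left_mono)
        show "(\<integral>\<^sup>+u. ennreal (1 / (1 - u)) * indicator {u. 1 - norm z \<le> 1 - u \<and> 1 - u \<le> 1} u \<partial>lborel) \<le> ennreal L"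
          using L(2) z by (subst nn_integral_log_kernel) (auto intro: ennreal_leI)
        have "(\<integral>\<^sup>+u. ennreal (h m u powr t) * (ennreal (1 / (1 - u)) * indicator {0..<1} u) \<partial>lborel) \<le> ennreal C1 * besov_term N t m f"
          unfolding h_def by (rule C1(2)[OF f v(1)])
        also have "\<dots> \<le> ennreal C1 * ennreal (M powr t)" by (intro mult_left_mono bb(2) m) simp
        finally show "(\<integral>\<^sup>+u. ennreal (h m u powr t) * (ennreal (1 / (1 - u)) * indicator {0..<1} u) \<partial>lborel) \<le> ennreal C1 * ennreal (M powr t)" .
      qed auto
      also have "\<dots> = ennreal (c * L + c powr (1 - t) * (C1 * M powr t))"
        using c L C1 by (simp add: ennreal_plus ennreal_mult)
      also have "c * L = M * L powr \<beta>"
      proof -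
        have "L powr (- 1 / t) * L = L powr (- 1 / t) * L powr 1" using L by simp
        also have "\<dots> = L powr \<beta>" unfolding powr_add[symmetric] \<beta>_def using t by (simp add: field_simps)
        finally show ?thesis by (simp add: c_def)
      qed
      also have "c powr (1 - t) * (C1 * M powr t) = C1 * (M * L powr \<beta>)"
      proof -
        have "c powr (1 - t) = M powr (1 - t) * L powr \<beta>"
        proof -
          have e: "(- 1 / t) * (1 - t) = \<beta>" using t by (simp add: \<beta>_def field_simps)
          show ?thesis unfolding c_def powr_mult powr_powr e ..
        qed
        moreover have "M powr (1 - t) * M powr t = M" using M by (simp add: powr_add[symmetric])
        ultimately have "c powr (1 - t) * (C1 * M powr t) = C1 * ((M powr (1 - t) * M powr t) * L powr \<beta>)" by (simp only: mult_ac)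
        also have "M powr (1 - t) * M powr t = M" by fact
        finally show ?thesis .
      qed
      also have "M * L powr \<beta> + C1 * (M * L powr \<beta>) = (1 + C1) * M * L powr \<beta>" by (simp add: algebra_simps)
      finally show ?thesis .
    qed
    have "ennreal (cmod (f z)) \<le> ennreal (\<Sum>k<N. cmod (dird v k f 0)) +
      (\<integral>\<^sup>+u. ennreal ((1 - u) ^ (N - 1) * cmod (dird v N f (u *\<^sub>R v))) * indicator {0..norm z} u \<partial>lborel)"
      using Taylor_bound[OF f _ norm_ge_zero z N, of v] v by simp
    also have "\<dots> \<le> ennreal (A * M) + (\<integral>\<^sup>+u. ennreal (n ^ N) * (\<Sum>m | sum m UNIV = N. ennreal (h m u * (1 / (1 - u))) * indicator {0..norm z} u) \<partial>lborel)"
    proof (intro add_mono nn_integral_mono)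
      show "ennreal (\<Sum>k<N. cmod (dird v k f 0)) \<le> ennreal (A * M)" using v by (intro ennreal_leI low) simp
      fix u :: real
      show "ennreal ((1 - u) ^ (N - 1) * cmod (dird v N f (u *\<^sub>R v))) * indicator {0..norm z} u
        \<le> ennreal (n ^ N) * (\<Sum>m | sum m UNIV = N. ennreal (h m u * (1 / (1 - u))) * indicator {0..norm z} u)"
      proof (cases "u \<in> {0..norm z}")
        case True
        then have u: "0 \<le> u" "u < 1" using z by auto
        have uv: "u *\<^sub>R v \<in> ball 0 1" using u v by simp
        have e: "(1 - u) ^ (N - 1) * cmod (multi_d m f (u *\<^sub>R v)) = h m u * (1 / (1 - u))" for m
        proof -
          have "(1 - u) ^ N = (1 - u) ^ (N - 1) * (1 - u)" by (rule power_minus_mult[OF N, symmetric])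
          then show ?thesis using u uv by (simp add: h_def cut_def)
        qed
        have "(1 - u) ^ (N - 1) * cmod (dird v N f (u *\<^sub>R v)) \<le> (1 - u) ^ (N - 1) * (real (CARD('n) ^ N) * (\<Sum>m | sum m UNIV = N. cmod (multi_d m f (u *\<^sub>R v))))"
          using u v by (intro mult_left_mono norm_dird_le[OF f open_ball uv]) auto
        also have "\<dots> = n ^ N * (\<Sum>m | sum m UNIV = N. h m u * (1 / (1 - u)))"
          unfolding e[symmetric] sum_distrib_left[symmetric] by (simp add: n_def)
        finally have "ennreal ((1 - u) ^ (N - 1) * cmod (dird v N f (u *\<^sub>R v))) \<le> ennreal (n ^ N * (\<Sum>m | sum m UNIV = N. h m u * (1 / (1 - u))))"
          by (rule ennreal_leI)
        also have "\<dots> = ennreal (n ^ N) * (\<Sum>m | sum m UNIV = N. ennreal (h m u * (1 / (1 - u))))"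
          using u n by (subst sum_ennreal) (auto simp: h_def ennreal_mult sum_nonneg)
        finally show ?thesis using True by simp
      qed simp
    qed
    also have "(\<integral>\<^sup>+u. ennreal (n ^ N) * (\<Sum>m | sum m UNIV = N. ennreal (h m u * (1 / (1 - u))) * indicator {0..norm z} u) \<partial>lborel)
      = ennreal (n ^ N) * (\<Sum>m | sum m UNIV = N. \<integral>\<^sup>+u. ennreal (h m u * (1 / (1 - u))) * indicator {0..norm z} u \<partial>lborel)"
      by (subst nn_integral_cmult, measurable, subst nn_integral_sum, measurable)
    also have "ennreal (A * M) + ennreal (n ^ N) * (\<Sum>m | sum m UNIV = N. \<integral>\<^sup>+u. ennreal (h m u * (1 / (1 - u))) * indicator {0..norm z} u \<partial>lborel)
      \<le> ennreal (A * M) + ennreal (n ^ N) * (\<Sum>m\<in>{m :: 'n \<Rightarrow> nat. sum m UNIV = N}. ennreal ((1 + C1) * M * L powr \<beta>))"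
      by (intro add_left_mono mult_left_mono sum_mono hI) auto
    also have "(\<Sum>m\<in>{m :: 'n \<Rightarrow> nat. sum m UNIV = N}. ennreal ((1 + C1) * M * L powr \<beta>)) = ennreal (D * ((1 + C1) * M * L powr \<beta>))"
      using C1 M by (simp add: D_def ennreal_mult ennreal_of_nat_eq_real_of_nat)
    also have "ennreal (A * M) + ennreal (n ^ N) * ennreal (D * ((1 + C1) * M * L powr \<beta>)) = ennreal (A * M + n ^ N * (D * ((1 + C1) * M * L powr \<beta>)))"
      using A M n D C1 by (simp add: ennreal_plus ennreal_mult)
    finally have "cmod (f z) \<le> A * M + n ^ N * (D * ((1 + C1) * M * L powr \<beta>))"
      using A M n D C1 by (subst (asm) ennreal_le_iff) (auto intro!: add_nonneg_nonneg mult_nonneg_nonneg)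
    also have "\<dots> \<le> A / ln 2 powr \<beta> * M * L powr \<beta> + n ^ N * (D * ((1 + C1) * M * L powr \<beta>)) + M * L powr \<beta>"
    proof -
      have "ln 2 powr \<beta> \<le> L powr \<beta>" using L \<beta> by (intro powr_mono2) auto
      then have "A * M * ln 2 powr \<beta> \<le> A * M * L powr \<beta>" using A M by (intro mult_left_mono) auto
      then have "A * M \<le> A / ln 2 powr \<beta> * M * L powr \<beta>" by (simp add: field_simps)
      moreover have "0 \<le> M * L powr \<beta>" using M by simp
      ultimately show ?thesis by linarith
    qed
    also have "\<dots> = C * M * L powr \<beta>" by (simp add: C_def algebra_simps)
    finally show "cmod (f z) \<le> C * M * ln (2 / (1 - (norm z)\<^sup>2)) powr ((t - 1) / t)" unfolding L_def \<beta>_def .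
  qed
qed

subsection \<open>A critical Forelli--Rudin estimate\<close>

lemma one_minus_powr_integrable:
  assumes b: "real CARD('n) < b"
  obtains J where "J > 0" "(\<integral>\<^sup>+z. ennreal (\<bar>1 - (norm z)\<^sup>2\<bar> powr b) \<partial>(inv_vol :: (complex^'n) measure)) \<le> ennreal J"
proof -
  have "(\<integral>\<^sup>+z. ennreal (\<bar>1 - (norm z)\<^sup>2\<bar> powr b) \<partial>(inv_vol :: (complex^'n) measure))
    = (\<integral>\<^sup>+z. ennreal (\<bar>1 - (norm z)\<^sup>2\<bar> powr b) * ennreal ((1 - (norm z)\<^sup>2) powr (- real CARD('n) - 1)) \<partial>(vol :: (complex^'n) measure))"
    by (rule nn_integral_inv_vol_vol) measurable
  also have "\<dots> = (\<integral>\<^sup>+z. ennreal (norm z powr (-0) * (1 - (norm z)\<^sup>2) powr (b - real CARD('n) - 1)) \<partial>(vol :: (complex^'n) measure))"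
  proof (rule nn_integral_cong_AE)
    have "AE z in lborel. z \<noteq> (0 :: complex^'n)" by (rule AE_lborel_singleton)
    then have "AE z in vol. z \<noteq> (0 :: complex^'n)" unfolding vol_def by (auto intro: AE_uniform_measureI)
    then show "AE z in (vol :: (complex^'n) measure). ennreal (\<bar>1 - (norm z)\<^sup>2\<bar> powr b) * ennreal ((1 - (norm z)\<^sup>2) powr (- real CARD('n) - 1))
      = ennreal (norm z powr (-0) * (1 - (norm z)\<^sup>2) powr (b - real CARD('n) - 1))"
      using AE_vol_ball
    proof eventually_elim
      case (elim z)
      have p: "0 < 1 - (norm z)\<^sup>2" by (rule one_minus_norm_pos[OF elim(2)])
      have "b + (- real CARD('n) - 1) = b - real CARD('n) - 1" by simp
      then have "(1 - (norm z)\<^sup>2) powr b * (1 - (norm z)\<^sup>2) powr (- real CARD('n) - 1) = (1 - (norm z)\<^sup>2) powr (b - real CARD('n) - 1)"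
        unfolding powr_add[symmetric] by (simp only:)
      then show ?case using p elim(1) by (simp add: ennreal_mult[symmetric])
    qed
  qed
  also have "\<dots> < \<infinity>" by (rule vol_powr_finite) (use b card_pos[where 'n='n] in auto)
  finally obtain J where J: "(\<integral>\<^sup>+z. ennreal (\<bar>1 - (norm z)\<^sup>2\<bar> powr b) \<partial>(inv_vol :: (complex^'n) measure)) = ennreal J" "0 \<le> J"
    by (cases "\<integral>\<^sup>+z. ennreal (\<bar>1 - (norm z)\<^sup>2\<bar> powr b) \<partial>(inv_vol :: (complex^'n) measure)") auto
  show thesis by (rule that[of "J + 1"]) (use J in \<open>auto intro: ennreal_leI\<close>)
qed

text \<open>By \<open>norm_invol\<close> this is the power \<open>b\<close> of
  \<open>1 - (norm (invol a z))\<^sup>2\<close> inside the ball, hence its invariant integral does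
  not depend on \<open>a\<close>.\<close>

definition berezin :: "real \<Rightarrow> complex^'n \<Rightarrow> complex^'n \<Rightarrow> real" where
  "berezin b a z = (\<bar>1 - (norm z)\<^sup>2\<bar> * (1 - (norm a)\<^sup>2) / (cmod (1 - cinner z a))\<^sup>2) powr b"

lemma nn_integral_berezin:
  fixes a :: "complex^'n"
  assumes a: "norm a < 1"
  shows "(\<integral>\<^sup>+z. ennreal (berezin b a z) \<partial>inv_vol) = (\<integral>\<^sup>+z. ennreal (\<bar>1 - (norm z)\<^sup>2\<bar> powr b) \<partial>(inv_vol :: (complex^'n) measure))"
proof -
  have "(\<integral>\<^sup>+z. ennreal (berezin b a z) \<partial>inv_vol) = (\<integral>\<^sup>+z. ennreal (\<bar>1 - (norm (invol a z))\<^sup>2\<bar> powr b) \<partial>inv_vol)"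
  proof (rule nn_integral_cong_AE)
    show "AE z in inv_vol. ennreal (berezin b a z) = ennreal (\<bar>1 - (norm (invol a z))\<^sup>2\<bar> powr b)"
      using AE_inv_vol_ball
    proof eventually_elim
      case (elim z)
      have "0 < 1 - (norm (invol a z))\<^sup>2" "0 < 1 - (norm z)\<^sup>2"
        using one_minus_norm_pos invol_ball[OF a elim] elim by auto
      then show ?case
        unfolding berezin_def by (simp only: abs_of_pos) (simp only: norm_invol[OF a elim] mult.commute)
    qed
  qed
  also have "\<dots> = (\<integral>\<^sup>+z. ennreal (\<bar>1 - (norm z)\<^sup>2\<bar> powr b) \<partial>(inv_vol :: (complex^'n) measure))"
    by (rule nn_integral_invol[OF a, where F="\<lambda>z. ennreal (\<bar>1 - (norm z)\<^sup>2\<bar> powr b)"]) measurable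
  finally show ?thesis .
qed

text \<open>The critical Forelli--Rudin integral, as a logarithmic average of invariant ones over the
  segment from the origin to \<open>w\<close>.\<close>

lemma forelli_rudin_log:
  assumes b: "real CARD('n) < b"
  obtains C where "C > 0" "\<And>w :: complex^'n. norm w < 1 \<Longrightarrow>
    (\<integral>\<^sup>+z. ennreal (\<bar>1 - (norm z)\<^sup>2\<bar> powr b / cmod (1 - cinner z w) powr b) \<partial>inv_vol) \<le> ennreal (C * ln (2 / (1 - (norm w)\<^sup>2)))"
proof -
  obtain J where J: "J > 0" "(\<integral>\<^sup>+z. ennreal (\<bar>1 - (norm z)\<^sup>2\<bar> powr b) \<partial>(inv_vol :: (complex^'n) measure)) \<le> ennreal J"
    using one_minus_powr_integrable[OF b] by blast
  have b0: "b > 0" using b card_pos[where 'n='n] by simp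
  \<comment> \<open>The range D \<le> 1 - u \<le> 2 D has logarithmic length ln 2, and on it the
    kernel loses at most a factor 9^b.\<close>
  define K where "K = 9 powr b / ln 2"
  have K: "K > 0" by (simp add: K_def)
  define C where "C = 4 powr b * J / ln 2 + K * J"
  show thesis
  proof
    show "C > 0" using J K by (auto simp: C_def intro!: add_pos_pos)
    fix w :: "complex^'n" assume w: "norm w < 1"
    define L where "L = ln (2 / (1 - (norm w)\<^sup>2))"
    have L: "ln 2 \<le> L" "ln (1 / (1 - norm w)) \<le> L" "0 < L" unfolding L_def by (rule log_weight_ge[OF w])+
    obtain v where v: "norm v = 1" "w = norm w *\<^sub>R v"
    proof (cases "w = 0")
      case True
      then show thesis using that[of "axis undefined 1"] by (simp add: norm_axis_complex)
    next
      case False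
      then show thesis using that[of "(1 / norm w) *\<^sub>R w"] by simp
    qed
    let ?I = "\<lambda>u. indicator {u. 1 - norm w \<le> 1 - u \<and> 1 - u \<le> 1} u :: ennreal"
    have cs: "cinner z (u *\<^sub>R v) = of_real u * cinner z v" for z u
      by (simp add: scaleR_scale cinner_scale_right)
    have pt: "ennreal (\<bar>1 - (norm z)\<^sup>2\<bar> powr b / cmod (1 - cinner z w) powr b)
      \<le> ennreal (4 powr b) * ennreal (\<bar>1 - (norm z)\<^sup>2\<bar> powr b) + ennreal K * (\<integral>\<^sup>+u. ennreal (berezin b (u *\<^sub>R v) z) * (ennreal (1 / (1 - u)) * ?I u) \<partial>lborel)"
      if z: "norm z < 1" for z
    proof -
      define D where "D = cmod (1 - cinner z w)"
      define Z where "Z = 1 - (norm z)\<^sup>2"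
      have Z: "Z > 0" unfolding Z_def by (rule one_minus_norm_pos[OF z])
      have D: "D > 0" unfolding D_def using one_minus_cinner_neq_0[OF z w] by simp
      show ?thesis
      \<comment> \<open>For D < 1/4 the range D \<le> 1 - u \<le> 2 D lies within 0 \<le> u \<le>
        norm w, where the average is taken; for larger \<open>D\<close> the kernel is bounded by a
        constant.\<close>
      proof (cases "D \<ge> 1/4")
        case True
        have "(1/4) powr b \<le> D powr b" using True b0 by (intro powr_mono2) auto
        then have "1 / D powr b \<le> 1 / (1/4) powr b" using D by (intro divide_left_mono) auto
        also have "\<dots> = 4 powr b" by (simp add: powr_divide)
        finally have "Z powr b * (1 / D powr b) \<le> Z powr b * 4 powr b" by (intro mult_left_mono) auto
        then have "ennreal (\<bar>Z\<bar> powr b / D powr b) \<le> ennreal (4 powr b) * ennreal (\<bar>Z\<bar> powr b)"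
          using Z by (simp add: ennreal_mult[symmetric] ennreal_leI mult.commute)
        then show ?thesis unfolding D_def Z_def by (rule add_increasing2[rotated]) simp
      next
        case False
        have "norm z * norm w \<le> 1 * norm w" using z by (intro mult_right_mono) auto
        then have Dw: "1 - norm w \<le> D"
          unfolding D_def using norm_triangle_ineq2[of 1 "cinner z w"] norm_cinner_le[of z w] by simp
        have zv: "cmod (cinner z v) \<le> 1" using norm_cinner_le[of z v] v z by simp
        \<comment> \<open>For these \<open>u\<close> the point on the segment is so close to
          \<open>w\<close> that its denominator is at most 3 D, while 1 - u^2 is at least D; so Z (1
          - u^2) divided by the squared denominator is at least Z D / (3 D)^2 = Z / (9 D).\<close>
        have be: "Z powr b / D powr b / 9 powr b \<le> berezin b (u *\<^sub>R v) z" if u: "D \<le> 1 - u" "1 - u \<le> 2 * D" for u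
        proof -
          have u0: "0 \<le> u" "u < 1" "u \<le> norm w" using u False D Dw by auto
          have "1 - cinner z (u *\<^sub>R v) = (1 - cinner z w) + of_real (norm w - u) * cinner z v"
          proof -
            have "cinner z w = of_real (norm w) * cinner z v" using cs[of z "norm w"] v(2) by metis
            then show ?thesis by (simp only: cs) (simp add: algebra_simps)
          qed
          then have 1: "cmod (1 - cinner z (u *\<^sub>R v)) \<le> D + cmod (of_real (norm w - u) * cinner z v)"
            unfolding D_def by (metis norm_triangle_ineq)
          have 2: "cmod (of_real (norm w - u) * cinner z v) \<le> (norm w - u) * 1"
            unfolding norm_mult norm_of_real using u0 zv by (intro mult_mono) auto
          have 3: "D + (norm w - u) * 1 \<le> 3 * D" using u w by simp
          have "cmod (1 - cinner z (u *\<^sub>R v)) \<le> 3 * D"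
            by (rule order_trans[OF 1 order_trans[OF add_left_mono[OF 2] 3]])
          then have d: "(cmod (1 - cinner z (u *\<^sub>R v)))\<^sup>2 \<le> (3 * D)\<^sup>2" by (intro power_mono) auto
          have uv: "norm (u *\<^sub>R v) < 1" using u0 v by simp
          have d0: "0 < (cmod (1 - cinner z (u *\<^sub>R v)))\<^sup>2" using one_minus_cinner_neq_0[OF z uv] by simp
          have "u\<^sup>2 \<le> u" using u0 by (simp add: power2_eq_square mult_left_le_one_le)
          then have "D \<le> 1 - u\<^sup>2" using u by linarith
          then have "Z * D / (3 * D)\<^sup>2 \<le> Z * (1 - u\<^sup>2) / (cmod (1 - cinner z (u *\<^sub>R v)))\<^sup>2"
            using d d0 Z D by (intro frac_le mult_left_mono mult_nonneg_nonneg) auto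
          moreover have "Z * D / (3 * D)\<^sup>2 = Z / D / 9" using D by (simp add: power2_eq_square field_simps)
          ultimately have "(Z / D / 9) powr b \<le> (Z * (1 - u\<^sup>2) / (cmod (1 - cinner z (u *\<^sub>R v)))\<^sup>2) powr b"
            using Z D b0 by (intro powr_mono2) auto
          then show ?thesis using Z u0 v by (simp add: berezin_def powr_divide powr_mult Z_def)
        qed
        have "ennreal (Z powr b / D powr b) = ennreal K * (ennreal (Z powr b / D powr b / 9 powr b) * ennreal (ln (2 * D / D)))"
          using D K by (simp add: ennreal_mult[symmetric] K_def)
        also have "ennreal (ln (2 * D / D)) = (\<integral>\<^sup>+u. ennreal (1 / (1 - u)) * indicator {u. D \<le> 1 - u \<and> 1 - u \<le> 2 * D} u \<partial>lborel)"
          by (rule nn_integral_log_kernel[symmetric]) (use D in auto)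
        also have "ennreal (Z powr b / D powr b / 9 powr b) * \<dots> = (\<integral>\<^sup>+u. ennreal (Z powr b / D powr b / 9 powr b) * (ennreal (1 / (1 - u)) * indicator {u. D \<le> 1 - u \<and> 1 - u \<le> 2 * D} u) \<partial>lborel)"
          by (rule nn_integral_cmult[symmetric]) measurable
        also have "ennreal K * \<dots> \<le> ennreal K * (\<integral>\<^sup>+u. ennreal (berezin b (u *\<^sub>R v) z) * (ennreal (1 / (1 - u)) * ?I u) \<partial>lborel)"
        proof (intro mult_left_mono nn_integral_mono)
          fix u :: real
          show "ennreal (Z powr b / D powr b / 9 powr b) * (ennreal (1 / (1 - u)) * indicator {u. D \<le> 1 - u \<and> 1 - u \<le> 2 * D} u)
            \<le> ennreal (berezin b (u *\<^sub>R v) z) * (ennreal (1 / (1 - u)) * ?I u)"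
          proof (cases "D \<le> 1 - u \<and> 1 - u \<le> 2 * D")
            case True
            then have "1 - norm w \<le> 1 - u \<and> 1 - u \<le> 1" using Dw False by linarith
            with True show ?thesis using be[of u] by (auto intro!: mult_right_mono ennreal_leI)
          qed simp
        qed simp
        finally show ?thesis unfolding D_def Z_def using Z
          by (simp add: Z_def add_increasing)
      qed
    qed
    have [measurable]: "(\<lambda>(u, z). ennreal (berezin b (u *\<^sub>R v) z)) \<in> borel_measurable (borel \<Otimes>\<^sub>M borel)"
      unfolding berezin_def by measurable
    interpret iv: sigma_finite_measure "inv_vol :: (complex^'n) measure" by (rule sigma_finite_inv_vol)
    interpret pr: pair_sigma_finite "lborel :: real measure" "inv_vol :: (complex^'n) measure" ..
    let ?G = "\<lambda>z. \<integral>\<^sup>+u. ennreal (berezin b (u *\<^sub>R v) z) * (ennreal (1 / (1 - u)) * ?I u) \<partial>lborel"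
    have Gm[measurable]: "?G \<in> borel_measurable inv_vol"
      by (rule lborel.borel_measurable_nn_integral) measurable
    have "(\<integral>\<^sup>+z. ennreal (\<bar>1 - (norm z)\<^sup>2\<bar> powr b / cmod (1 - cinner z w) powr b) \<partial>inv_vol)
       \<le> (\<integral>\<^sup>+z. ennreal (4 powr b) * ennreal (\<bar>1 - (norm z)\<^sup>2\<bar> powr b) + ennreal K * ?G z \<partial>inv_vol)"
      by (rule nn_integral_mono_AE) (use AE_inv_vol_ball in eventually_elim, rule pt)
    also have "\<dots> = ennreal (4 powr b) * (\<integral>\<^sup>+z. ennreal (\<bar>1 - (norm z)\<^sup>2\<bar> powr b) \<partial>(inv_vol :: (complex^'n) measure)) + ennreal K * (\<integral>\<^sup>+z. ?G z \<partial>inv_vol)"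
      by (subst nn_integral_add, measurable, subst nn_integral_cmult, measurable, subst nn_integral_cmult, measurable)
    also have "(\<integral>\<^sup>+z. ?G z \<partial>inv_vol) = (\<integral>\<^sup>+u. \<integral>\<^sup>+z. ennreal (berezin b (u *\<^sub>R v) z) * (ennreal (1 / (1 - u)) * ?I u) \<partial>inv_vol \<partial>lborel)"
      by (rule pr.Fubini') measurable
    also have "\<dots> \<le> (\<integral>\<^sup>+u. ennreal J * (ennreal (1 / (1 - u)) * ?I u) \<partial>lborel)"
    proof (rule nn_integral_mono)
      fix u :: real
      have "(\<integral>\<^sup>+z. ennreal (berezin b (u *\<^sub>R v) z) * (ennreal (1 / (1 - u)) * ?I u) \<partial>inv_vol) = (\<integral>\<^sup>+z. ennreal (berezin b (u *\<^sub>R v) z) \<partial>inv_vol) * (ennreal (1 / (1 - u)) * ?I u)"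
        by (rule nn_integral_multc) (unfold berezin_def, measurable)
      also have "\<dots> \<le> ennreal J * (ennreal (1 / (1 - u)) * ?I u)"
      proof (cases "1 - norm w \<le> 1 - u \<and> 1 - u \<le> 1")
        case True
        then have "norm (u *\<^sub>R v) < 1" using v w by simp
        from nn_integral_berezin[OF this, of b] J(2) show ?thesis by (simp add: mult_right_mono)
      qed simp
      finally show "(\<integral>\<^sup>+z. ennreal (berezin b (u *\<^sub>R v) z) * (ennreal (1 / (1 - u)) * ?I u) \<partial>inv_vol) \<le> ennreal J * (ennreal (1 / (1 - u)) * ?I u)" .
    qed
    also have "(\<integral>\<^sup>+u. ennreal J * (ennreal (1 / (1 - u)) * ?I u) \<partial>lborel) = ennreal J * ennreal (ln (1 / (1 - norm w)))"
      by (subst nn_integral_cmult, measurable, subst nn_integral_log_kernel) (use w in auto)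
    finally have "(\<integral>\<^sup>+z. ennreal (\<bar>1 - (norm z)\<^sup>2\<bar> powr b / cmod (1 - cinner z w) powr b) \<partial>inv_vol)
      \<le> ennreal (4 powr b) * (\<integral>\<^sup>+z. ennreal (\<bar>1 - (norm z)\<^sup>2\<bar> powr b) \<partial>(inv_vol :: (complex^'n) measure)) + ennreal K * (ennreal J * ennreal (ln (1 / (1 - norm w))))"
      by (simp add: add_left_mono mult_left_mono)
    also have "\<dots> \<le> ennreal (4 powr b) * ennreal J + ennreal K * (ennreal J * ennreal L)"
      using J(2) L by (intro add_mono mult_left_mono ennreal_leI) auto
    also have "\<dots> = ennreal (4 powr b * J + K * (J * L))"
      using J K L by (simp add: ennreal_mult)
    also have "\<dots> \<le> ennreal (C * L)"
    proof (rule ennreal_leI)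
      have "4 powr b * J * ln 2 \<le> 4 powr b * J * L" using L J by (intro mult_left_mono) auto
      then have "4 powr b * J \<le> 4 powr b * J / ln 2 * L" by (simp add: field_simps)
      then show "4 powr b * J + K * (J * L) \<le> C * L" by (simp add: C_def algebra_simps)
    qed
    finally show "(\<integral>\<^sup>+z. ennreal (\<bar>1 - (norm z)\<^sup>2\<bar> powr b / cmod (1 - cinner z w) powr b) \<partial>inv_vol) \<le> ennreal (C * ln (2 / (1 - (norm w)\<^sup>2)))"
      unfolding L_def .
  qed
qed

section \<open>Besov norms of functions of an inner product\<close>

lemma cinner_axis_left: "cinner (axis j c) w = c * cnj (w $ j)"
  by (subst cinner_commute) (simp add: cinner_axis)

lemma cinner_less_1: "norm z < 1 \<Longrightarrow> norm w < 1 \<Longrightarrow> cmod (cinner z w) < 1"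
  using norm_cinner_le[of z w] mult_strict_mono'[of "norm z" 1 "norm w" 1] by simp

text \<open>\<open>G\<close> is a sequence of successive derivatives on the disc. By the chain rule
  each partial derivative advances the index and produces one conjugate coordinate of
  \<open>w\<close>.\<close>

lemma foldr_partial_cinner:
  fixes G :: "nat \<Rightarrow> complex \<Rightarrow> complex" and w z :: "complex^'n"
  assumes G: "\<And>k \<zeta>. cmod \<zeta> < 1 \<Longrightarrow> (G k has_field_derivative G (Suc k) \<zeta>) (at \<zeta>)"
    and w: "norm w < 1" and z: "norm z < 1"
  shows "foldr partial_d js (cut (\<lambda>z. G 0 (cinner z w))) z = prod_list (map (\<lambda>j. cnj (w $ j)) js) * G (length js) (cinner z w)"
  using z
proof (induction js arbitrary: z)
  case Nil then show ?case by (simp add: cut_def)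
next
  case (Cons j js)
  define c where "c = prod_list (map (\<lambda>j. cnj (w $ j)) js)"
  have "foldr partial_d (j # js) (cut (\<lambda>z. G 0 (cinner z w))) z = partial_d j (\<lambda>z. c * G (length js) (cinner z w)) z"
    unfolding foldr.simps o_apply c_def
    by (rule partial_d_cong[OF open_ball[of 0 1]]) (use Cons in auto)
  also have "\<dots> = deriv (\<lambda>\<zeta>. c * G (length js) (cinner z w + \<zeta> * cnj (w $ j))) 0"
    by (simp add: partial_d_def cinner_add_left cinner_axis_left)
  also have "\<dots> = c * (G (Suc (length js)) (cinner z w) * cnj (w $ j))"
  proof (rule DERIV_imp_deriv)
    have "((\<lambda>\<zeta>. cinner z w + \<zeta> * cnj (w $ j)) has_field_derivative cnj (w $ j)) (at 0)"
      by (auto intro!: derivative_eq_intros)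
    from DERIV_chain2[OF _ this, of "G (length js)" "G (Suc (length js)) (cinner z w)"]
      G[OF cinner_less_1[OF Cons.prems w], of "length js"]
    show "((\<lambda>\<zeta>. c * G (length js) (cinner z w + \<zeta> * cnj (w $ j))) has_field_derivative c * (G (Suc (length js)) (cinner z w) * cnj (w $ j))) (at 0)"
      by (intro DERIV_cmult) simp
  qed
  finally show ?case by (simp add: c_def)
qed

lemma holo_cut: "holo (ball 0 1) f \<Longrightarrow> holo (ball 0 1) (cut f)"
  by (rule holo_cong[of _ f]) (auto simp: cut_def)

lemma holo_field_compose:
  assumes f: "holo S f" and G: "\<And>z. z \<in> S \<Longrightarrow> (G has_field_derivative G' (f z)) (at (f z))"
  shows "holo S (\<lambda>z. G (f z))"
proof (rule holoI[where D="\<lambda>z v. G' (f z) * dh f z v"])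
  fix z assume z: "z \<in> S"
  show "((\<lambda>z. G (f z)) has_derivative (\<lambda>v. G' (f z) * dh f z v)) (at z)"
    using has_derivative_compose[OF holo_has_derivative[OF f z] G[OF z, unfolded has_field_derivative_def]] .
qed (simp add: dh_scale)

text \<open>Reduces a Besov estimate to one variable: the coordinates of \<open>w\<close> have
  modulus at most 1, so the terms at the origin are bounded through \<open>G k 0\<close>, and all
  terms of order \<open>N\<close> through a single integral.\<close>

lemma test_family_bound:
  fixes G :: "nat \<Rightarrow> complex \<Rightarrow> complex" and w :: "complex^'n" and t B :: real
  assumes t: "1 \<le> t" and N: "0 < N" and B: "0 < B"
    and G: "\<And>k \<zeta>. cmod \<zeta> < 1 \<Longrightarrow> (G k has_field_derivative G (Suc k) \<zeta>) (at \<zeta>)"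
    and w: "norm w < 1"
    and G0: "\<And>k. k < N \<Longrightarrow> cmod (G k 0) \<le> B"
    and GN: "(\<integral>\<^sup>+z. ennreal ((\<bar>1 - (norm z)\<^sup>2\<bar> ^ N * cmod (G N (cinner z w))) powr t) \<partial>inv_vol) \<le> ennreal (B powr t)"
  shows "cut (\<lambda>z. G 0 (cinner z w)) \<in> hol_ball"
    and "sum m UNIV = N \<Longrightarrow> besov_term N t m (cut (\<lambda>z. G 0 (cinner z w))) < \<infinity>"
    and "besov_norm N t (cut (\<lambda>z. G 0 (cinner z w))) \<le>
      ennreal (real (card {m :: 'n \<Rightarrow> nat. sum m UNIV \<le> N - 1}) * B + real (card {m :: 'n \<Rightarrow> nat. sum m UNIV = N}) * B)"
proof -
  define f where "f = cut (\<lambda>z. G 0 (cinner z w))"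
  have "holo (ball 0 1) (\<lambda>z. G 0 (cinner z w))"
    by (rule holo_field_compose[OF holo_cinner G]) (use cinner_less_1[OF _ w] in auto)
  then show "cut (\<lambda>z. G 0 (cinner z w)) \<in> hol_ball"
    by (intro hol_ballI holo_cut) (auto simp: cut_def)
  have le: "cmod (multi_d m f z) \<le> cmod (G (sum m UNIV) (cinner z w))" if z: "norm z < 1" for m z
  proof -
    obtain js where js: "multi_d m = foldr partial_d js" "length js = sum m UNIV" by (rule multi_d_list)
    have "cmod (prod_list (map (\<lambda>j. cnj (w $ j)) js)) \<le> 1" for js
    proof (induction js)
      case (Cons j js)
      have "cmod (w $ j) \<le> 1" using Finite_Cartesian_Product.norm_nth_le[of w j] w by linarith
      then show ?case using Cons by (simp add: norm_mult mult_le_one)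
    qed simp
    then have "cmod (prod_list (map (\<lambda>j. cnj (w $ j)) js)) * cmod (G (length js) (cinner z w)) \<le> 1 * cmod (G (length js) (cinner z w))"
      by (intro mult_right_mono) auto
    moreover have "foldr partial_d js f z = prod_list (map (\<lambda>j. cnj (w $ j)) js) * G (length js) (cinner z w)"
      unfolding f_def by (rule foldr_partial_cinner[where G=G, OF _ w z]) (rule G)
    ultimately show ?thesis by (simp add: norm_mult js)
  qed
  have bt: "besov_term N t m f \<le> ennreal (B powr t)" if m: "sum m UNIV = N" for m
  proof -
    have "besov_term N t m f \<le> (\<integral>\<^sup>+z. ennreal ((\<bar>1 - (norm z)\<^sup>2\<bar> ^ N * cmod (G N (cinner z w))) powr t) \<partial>inv_vol)"
      unfolding besov_term_def
    proof (rule nn_integral_mono_AE)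
      show "AE z in inv_vol. ennreal (cmod ((1 - norm z ^ 2) ^ N *\<^sub>R multi_d m f z) powr t) \<le> ennreal ((\<bar>1 - (norm z)\<^sup>2\<bar> ^ N * cmod (G N (cinner z w))) powr t)"
        using AE_inv_vol_ball
      proof eventually_elim
        case (elim z)
        have "\<bar>1 - (norm z)\<^sup>2\<bar> ^ N * cmod (multi_d m f z) \<le> \<bar>1 - (norm z)\<^sup>2\<bar> ^ N * cmod (G N (cinner z w))"
          using le[OF elim, of m] m by (intro mult_left_mono) auto
        then show ?case using t by (intro ennreal_leI powr_mono2) (auto simp: power_abs)
      qed
    qed
    with GN show ?thesis by simp
  qed
  show "besov_term N t m (cut (\<lambda>z. G 0 (cinner z w))) < \<infinity>" if "sum m UNIV = N"
    using bt[OF that] unfolding f_def by (rule le_less_trans) simp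
  have "besov_norm N t f \<le> (\<Sum>m\<in>{m :: 'n \<Rightarrow> nat. sum m UNIV \<le> N - 1}. ennreal B) + (\<Sum>m\<in>{m :: 'n \<Rightarrow> nat. sum m UNIV = N}. ennreal B)"
    unfolding besov_norm_def
  proof (intro add_mono sum_mono)
    fix m :: "'n \<Rightarrow> nat" assume "m \<in> {m. sum m UNIV \<le> N - 1}"
    then have "sum m UNIV < N" using N by auto
    then show "ennreal (cmod (multi_d m f 0)) \<le> ennreal B"
      using le[of 0 m] G0[of "sum m UNIV"] by (intro ennreal_leI) auto
  next
    fix m :: "'n \<Rightarrow> nat" assume m: "m \<in> {m. sum m UNIV = N}"
    have "epowr (besov_term N t m f) (1 / t) \<le> epowr (ennreal (B powr t)) (1 / t)"
      using t m by (intro epowr_mono bt) auto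
    then show "epowr (besov_term N t m f) (1 / t) \<le> ennreal B"
      using t B by (subst (asm) epowr_powr) auto
  qed
  also have "\<dots> = ennreal (real (card {m :: 'n \<Rightarrow> nat. sum m UNIV \<le> N - 1}) * B + real (card {m :: 'n \<Rightarrow> nat. sum m UNIV = N}) * B)"
    using B by (simp add: ennreal_mult ennreal_of_nat_eq_real_of_nat)
  finally show "besov_norm N t (cut (\<lambda>z. G 0 (cinner z w))) \<le>
      ennreal (real (card {m :: 'n \<Rightarrow> nat. sum m UNIV \<le> N - 1}) * B + real (card {m :: 'n \<Rightarrow> nat. sum m UNIV = N}) * B)"
    unfolding f_def .
qed

lemma one_minus_power_deriv:
  assumes "cmod \<zeta> < 1"
  shows "((\<lambda>\<zeta>. 1 / (1 - \<zeta>) ^ m) has_field_derivative of_nat m / (1 - \<zeta>) ^ Suc m) (at \<zeta>)"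
proof -
  have nz: "1 - \<zeta> \<noteq> 0" using assms by auto
  have "((\<lambda>\<zeta>. inverse ((1 - \<zeta>) ^ m)) has_field_derivative - (inverse ((1 - \<zeta>) ^ m) * (of_nat m * (0 - 1) * (1 - \<zeta>) ^ (m - Suc 0)) * inverse ((1 - \<zeta>) ^ m))) (at \<zeta>)"
    using nz by (auto intro!: derivative_eq_intros)
  moreover have "- (inverse (y ^ m) * (of_nat m * (0 - 1) * y ^ (m - Suc 0)) * inverse (y ^ m)) = of_nat m / y ^ Suc m"
    if "y \<noteq> 0" for y :: complex
    using that by (cases m) (simp_all add: field_simps)
  note this[OF nz]
  ultimately show ?thesis by (simp add: inverse_eq_divide)
qed

text \<open>The k-th derivative of the test function in the variable \<zeta> = <z, w>, where
  \<open>x\<close> stands for \<open>1 - (norm w)\<^sup>2\<close>. For t = 1 the function is x^N (1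
  - \<zeta>)^(-N). Otherwise it is log (2 / (1 - \<zeta>)) with the amplitude (ln (2 / x))^(-1 / t);
  its derivatives no longer contain the logarithm, hence the separate clause for k = 0.\<close>

definition test_der :: "real \<Rightarrow> nat \<Rightarrow> real \<Rightarrow> nat \<Rightarrow> complex \<Rightarrow> complex" where
  "test_der t N x k \<zeta> = (if t = 1 then of_real (x ^ N) * (pochhammer (of_nat N) k * (1 / (1 - \<zeta>) ^ (N + k)))
     else of_real (ln (2 / x) powr (- 1 / t)) * (if k = 0 then of_real (ln 2) - Ln (1 - \<zeta>) else of_nat (fact (k - 1)) * (1 / (1 - \<zeta>) ^ k)))"

lemma test_der_deriv:
  assumes \<zeta>: "cmod \<zeta> < 1"
  shows "(test_der t N x k has_field_derivative test_der t N x (Suc k) \<zeta>) (at \<zeta>)"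
proof (cases "t = 1")
  case True
  have "((\<lambda>\<zeta>. of_real (x ^ N) * (pochhammer (of_nat N) k * (1 / (1 - \<zeta>) ^ (N + k)))) has_field_derivative
     of_real (x ^ N) * (pochhammer (of_nat N) k * (of_nat (N + k) / (1 - \<zeta>) ^ Suc (N + k)))) (at \<zeta>)"
    by (intro DERIV_cmult one_minus_power_deriv \<zeta>)
  then show ?thesis using True by (simp add: test_der_def[abs_def] pochhammer_Suc mult_ac)
next
  case False
  show ?thesis
  proof (cases "k = 0")
    case True
    have "Re \<zeta> < 1" using complex_Re_le_cmod[of \<zeta>] \<zeta> by linarith
    then have "1 - \<zeta> \<notin> \<real>\<^sub>\<le>\<^sub>0" by (auto simp: complex_nonpos_Reals_iff)
    then have "((\<lambda>\<zeta>. of_real (ln (2 / x) powr (- 1 / t)) * (of_real (ln 2) - Ln (1 - \<zeta>))) has_field_derivative of_real (ln (2 / x) powr (- 1 / t)) * (1 / (1 - \<zeta>))) (at \<zeta>)"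
      by (intro DERIV_cmult) (auto intro!: derivative_eq_intros simp: divide_inverse)
    then show ?thesis using False True by (simp add: test_der_def[abs_def])
  next
    case k: False
    have fk: "of_nat (fact (k - 1)) * of_nat k = (of_nat (fact k) :: complex)"
      using k by (cases k) (simp_all add: algebra_simps)
    have eq: "of_nat (fact (k - 1)) * (of_nat k / Y) = of_nat (fact k) * (1 / Y)" for Y :: complex
      unfolding fk[symmetric] by simp
    have "((\<lambda>\<zeta>. of_real (ln (2 / x) powr (- 1 / t)) * (of_nat (fact (k - 1)) * (1 / (1 - \<zeta>) ^ k))) has_field_derivative
      of_real (ln (2 / x) powr (- 1 / t)) * (of_nat (fact k) * (1 / (1 - \<zeta>) ^ Suc k))) (at \<zeta>)"
      unfolding eq[symmetric] by (intro DERIV_cmult one_minus_power_deriv \<zeta>)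
    moreover have "test_der t N x k = (\<lambda>\<zeta>. of_real (ln (2 / x) powr (- 1 / t)) * (of_nat (fact (k - 1)) * (1 / (1 - \<zeta>) ^ k)))"
      using False k by (auto simp: test_der_def fun_eq_iff)
    moreover have "test_der t N x (Suc k) \<zeta> = of_real (ln (2 / x) powr (- 1 / t)) * (of_nat (fact k) * (1 / (1 - \<zeta>) ^ Suc k))"
      using False by (auto simp: test_der_def)
    ultimately show ?thesis by (simp only:)
  qed
qed

text \<open>The hypothesis on \<open>N\<close> says that b = N t exceeds n. For t = 1 the weighted
  N-th derivative is a multiple of \<open>berezin b w\<close>, whose integral is invariant. For t >
  1 its t-th power is the critical kernel of \<open>forelli_rudin_log\<close> divided by L, and this
  quotient cancels the logarithm of that estimate.\<close>

lemma test_der_bounds: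
  fixes t :: real
  assumes t: "1 \<le> t" and N: "0 < N" "real CARD('n) / t < real N"
  obtains B where "B > 0" 
    "\<And>(w :: complex^'n) k. norm w < 1 \<Longrightarrow> k < N \<Longrightarrow> cmod (test_der t N (1 - (norm w)\<^sup>2) k 0) \<le> B"
    "\<And>w :: complex^'n. norm w < 1 \<Longrightarrow> (\<integral>\<^sup>+z. ennreal ((\<bar>1 - (norm z)\<^sup>2\<bar> ^ N * cmod (test_der t N (1 - (norm w)\<^sup>2) N (cinner z w))) powr t) \<partial>inv_vol) \<le> ennreal (B powr t)"
proof -
  define b where "b = real N * t"
  have b: "real CARD('n) < b" using N t by (simp add: b_def field_simps)
  show thesis
  proof (cases "t = 1")
    case True
    obtain J where J: "J > 0" "(\<integral>\<^sup>+z. ennreal (\<bar>1 - (norm z)\<^sup>2\<bar> powr b) \<partial>(inv_vol :: (complex^'n) measure)) \<le> ennreal J"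
      using one_minus_powr_integrable[OF b] by blast
    define P where "P = (\<Sum>k\<le>N. pochhammer (real N) k)"
    have Pk: "0 \<le> pochhammer (real N) k" for k by (rule pochhammer_nonneg) (use N in auto)
    have P: "pochhammer (real N) k \<le> P" if "k \<le> N" for k
      unfolding P_def using that Pk by (intro member_le_sum) auto
    have P0: "P \<ge> 1" using P[of 0] by simp
    have nP: "cmod (pochhammer (of_nat N) k) = pochhammer (real N) k" for k
    proof -
      have "(pochhammer (of_nat N) k :: complex) = of_real (pochhammer (real N) k)"
        by (simp add: pochhammer_of_real[symmetric])
      then show ?thesis using Pk[of k] by simp
    qed
    show thesis
    proof (rule that[of "P * (J + 1)"])
      show "P * (J + 1) > 0" using P0 J by simp
      fix w :: "complex^'n" and k assume w: "norm w < 1"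
      define x where "x = 1 - (norm w)\<^sup>2"
      have x: "0 < x" "x \<le> 1" using one_minus_norm_pos[OF w] by (auto simp: x_def)
      show "cmod (test_der t N (1 - (norm w)\<^sup>2) k 0) \<le> P * (J + 1)" if k: "k < N"
      proof -
        have "x ^ N * pochhammer (real N) k \<le> 1 * P" using x P[of k] k Pk by (intro mult_mono power_le_one) auto
        also have "\<dots> \<le> P * (J + 1)" using P0 J by simp
        finally show ?thesis unfolding x_def[symmetric] using True x by (simp add: test_der_def norm_mult norm_power nP)
      qed
      have "(\<integral>\<^sup>+z. ennreal ((\<bar>1 - (norm z)\<^sup>2\<bar> ^ N * cmod (test_der t N (1 - (norm w)\<^sup>2) N (cinner z w))) powr t) \<partial>inv_vol)
        \<le> (\<integral>\<^sup>+z. ennreal P * ennreal (berezin b w z) \<partial>inv_vol)"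
      proof (rule nn_integral_mono_AE)
        show "AE z in inv_vol. ennreal ((\<bar>1 - (norm z)\<^sup>2\<bar> ^ N * cmod (test_der t N (1 - (norm w)\<^sup>2) N (cinner z w))) powr t) \<le> ennreal P * ennreal (berezin b w z)"
          using AE_inv_vol_ball
        proof eventually_elim
          case (elim z)
          define Z where "Z = 1 - (norm z)\<^sup>2"
          define D where "D = cmod (1 - cinner z w)"
          have pos: "0 < Z" "0 < D"
            using one_minus_norm_pos[OF elim] one_minus_cinner_neq_0[OF elim w] by (auto simp: Z_def D_def)
          have "\<bar>Z\<bar> ^ N * cmod (test_der t N x N (cinner z w)) = pochhammer (real N) N * (Z * x / D\<^sup>2) ^ N"
            using True x pos by (simp add: test_der_def norm_mult norm_divide norm_power nP D_def power_divide power_mult_distrib power2_eq_square power_add)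
          also have "\<dots> \<le> P * (Z * x / D\<^sup>2) ^ N" using P[of N] pos x by (intro mult_right_mono) auto
          also have "(Z * x / D\<^sup>2) ^ N = berezin b w z"
            using True pos x by (simp add: berezin_def b_def powr_realpow Z_def[symmetric] x_def[symmetric] D_def[symmetric])
          finally show ?case using True P0 unfolding Z_def[symmetric] x_def[symmetric]
            by (simp add: ennreal_mult[symmetric] ennreal_leI berezin_def)
        qed
      qed
      also have "\<dots> = ennreal P * (\<integral>\<^sup>+z. ennreal (\<bar>1 - (norm z)\<^sup>2\<bar> powr b) \<partial>(inv_vol :: (complex^'n) measure))"
        by (subst nn_integral_cmult) (unfold nn_integral_berezin[OF w], unfold berezin_def, measurable)
      also have "\<dots> \<le> ennreal P * ennreal J" by (intro mult_left_mono J) simp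
      also have "\<dots> \<le> ennreal ((P * (J + 1)) powr t)"
        using True P0 J by (simp add: ennreal_mult[symmetric] ennreal_leI)
      finally show "(\<integral>\<^sup>+z. ennreal ((\<bar>1 - (norm z)\<^sup>2\<bar> ^ N * cmod (test_der t N (1 - (norm w)\<^sup>2) N (cinner z w))) powr t) \<partial>inv_vol) \<le> ennreal ((P * (J + 1)) powr t)" .
    qed
  next
    case False
    then have t1: "1 < t" using t by simp
    obtain C where C: "C > 0" "\<And>w :: complex^'n. norm w < 1 \<Longrightarrow>
      (\<integral>\<^sup>+z. ennreal (\<bar>1 - (norm z)\<^sup>2\<bar> powr b / cmod (1 - cinner z w) powr b) \<partial>inv_vol) \<le> ennreal (C * ln (2 / (1 - (norm w)\<^sup>2)))"
      using forelli_rudin_log[OF b] by blast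
    define E where "E = ln 2 powr (- 1 / t)"
    define B where "B = E * fact N + fact N * C powr (1 / t)"
    have E: "E > 0" by (simp add: E_def)
    show thesis
    proof (rule that[of B])
      show B0: "B > 0" using E C by (auto simp: B_def intro!: add_pos_pos)
      fix w :: "complex^'n" and k assume w: "norm w < 1"
      define x where "x = 1 - (norm w)\<^sup>2"
      define L where "L = ln (2 / x)"
      have L: "ln 2 \<le> L" "0 < L" unfolding L_def x_def by (rule log_weight_ge[OF w])+
      have LE: "L powr (- 1 / t) \<le> E" unfolding E_def using L t by (intro powr_mono2') auto
      show "cmod (test_der t N (1 - (norm w)\<^sup>2) k 0) \<le> B" if k: "k < N"
      proof -
        have "cmod (if k = 0 then of_real (ln 2) - Ln (1 - 0) else of_nat (fact (k - 1)) * (1 / (1 - 0) ^ k)) \<le> (fact N :: real)"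
        proof (cases "k = 0")
          case True
          have "ln 2 \<le> (1::real)" using ln_le_minus_one[of "2::real"] by simp
          also have "1 \<le> (fact N :: real)" by (rule fact_ge_1)
          finally show ?thesis using True by simp
        next
          case False
          have "(fact (k - 1) :: real) \<le> fact N" using k by (intro fact_mono) auto
          then show ?thesis using False by simp
        qed
        then have "L powr (- 1 / t) * cmod (if k = 0 then of_real (ln 2) - Ln (1 - 0) else of_nat (fact (k - 1)) * (1 / (1 - 0) ^ k)) \<le> E * fact N"
          using LE E by (intro mult_mono) auto
        also have "\<dots> \<le> B" by (simp add: B_def)
        finally show ?thesis unfolding x_def[symmetric] using False by (simp add: test_der_def norm_mult L_def)
      qed
      have "(\<integral>\<^sup>+z. ennreal ((\<bar>1 - (norm z)\<^sup>2\<bar> ^ N * cmod (test_der t N (1 - (norm w)\<^sup>2) N (cinner z w))) powr t) \<partial>inv_vol)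
        = (\<integral>\<^sup>+z. ennreal (fact (N - 1) powr t / L) * ennreal (\<bar>1 - (norm z)\<^sup>2\<bar> powr b / cmod (1 - cinner z w) powr b) \<partial>inv_vol)"
      proof (rule nn_integral_cong_AE)
        show "AE z in inv_vol. ennreal ((\<bar>1 - (norm z)\<^sup>2\<bar> ^ N * cmod (test_der t N (1 - (norm w)\<^sup>2) N (cinner z w))) powr t) = ennreal (fact (N - 1) powr t / L) * ennreal (\<bar>1 - (norm z)\<^sup>2\<bar> powr b / cmod (1 - cinner z w) powr b)"
          using AE_inv_vol_ball
        proof eventually_elim
          case (elim z)
          define Z where "Z = 1 - (norm z)\<^sup>2"
          define D where "D = cmod (1 - cinner z w)"
          have pos: "0 < Z" "0 < D"
            using one_minus_norm_pos[OF elim] one_minus_cinner_neq_0[OF elim w] by (auto simp: Z_def D_def)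
          have "\<bar>Z\<bar> ^ N * cmod (test_der t N x N (cinner z w)) = fact (N - 1) * (L powr (- 1 / t) * (Z ^ N / D ^ N))"
            using False N pos by (simp add: test_der_def norm_mult norm_divide norm_power D_def L_def)
          also have "(fact (N - 1) * (L powr (- 1 / t) * (Z ^ N / D ^ N))) powr t = fact (N - 1) powr t * ((L powr (- 1 / t)) powr t * ((Z ^ N) powr t / (D ^ N) powr t))"
            by (simp only: powr_mult powr_divide)
          also have "(L powr (- 1 / t)) powr t = 1 / L"
          proof -
            have "(- 1 / t) * t = - 1" using t by simp
            then have "(L powr (- 1 / t)) powr t = L powr (- 1)" by (simp only: powr_powr)
            then show ?thesis using L powr_minus_divide[of L 1] by simp
          qed
          also have "(Z ^ N) powr t = Z powr b" using pos by (simp add: b_def powr_realpow[symmetric] powr_powr)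
          also have "(D ^ N) powr t = D powr b" using pos by (simp add: b_def powr_realpow[symmetric] powr_powr)
          finally have "(\<bar>Z\<bar> ^ N * cmod (test_der t N x N (cinner z w))) powr t = fact (N - 1) powr t / L * (Z powr b / D powr b)" by simp
          then show ?case unfolding Z_def[symmetric] x_def[symmetric] D_def[symmetric]
            using pos L by (simp add: ennreal_mult[symmetric])
        qed
      qed
      also have "\<dots> = ennreal (fact (N - 1) powr t / L) * (\<integral>\<^sup>+z. ennreal (\<bar>1 - (norm z)\<^sup>2\<bar> powr b / cmod (1 - cinner z w) powr b) \<partial>inv_vol)"
        by (rule nn_integral_cmult) measurable
      also have "\<dots> \<le> ennreal (fact (N - 1) powr t / L) * ennreal (C * L)"
        unfolding L_def x_def by (intro mult_left_mono C w) simp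
      also have "\<dots> = ennreal (fact (N - 1) powr t * C)" using L C by (simp add: ennreal_mult[symmetric])
      also have "\<dots> \<le> ennreal (B powr t)"
      proof (rule ennreal_leI)
        have "(fact (N - 1) :: real) \<le> fact N" by (intro fact_mono) auto
        then have "(fact (N - 1) :: real) powr t \<le> fact N powr t" using t by (intro powr_mono2) auto
        then have "fact (N - 1) powr t * C \<le> fact N powr t * C" using C by (intro mult_right_mono) auto
        also have "\<dots> = (fact N * C powr (1 / t)) powr t" using C t by (simp add: powr_mult powr_powr)
        also have "\<dots> \<le> B powr t" using E C t by (intro powr_mono2) (auto simp: B_def)
        finally show "fact (N - 1) powr t * C \<le> B powr t" .
      qed
      finally show "(\<integral>\<^sup>+z. ennreal ((\<bar>1 - (norm z)\<^sup>2\<bar> ^ N * cmod (test_der t N (1 - (norm w)\<^sup>2) N (cinner z w))) powr t) \<partial>inv_vol) \<le> ennreal (B powr t)" .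
    qed
  qed
qed

subsection \<open>Test functions\<close>

lemma compact_in_ball:
  fixes S :: "(complex^'n) set"
  assumes "compact S" "S \<subseteq> ball 0 1"
  obtains r where "0 \<le> r" "r < 1" "\<And>z. z \<in> S \<Longrightarrow> norm z \<le> r"
proof (cases "S = {}")
  case False
  then obtain y where "y \<in> S" "\<And>z. z \<in> S \<Longrightarrow> norm z \<le> norm y"
    using continuous_attains_sup[OF assms(1) False, of norm] by (auto intro: continuous_intros)
  then show thesis using that[of "norm y"] assms(2) by auto
qed (use that[of 0] in auto)

lemma tendsto_log_weight:
  fixes w :: "nat \<Rightarrow> complex^'n"
  assumes w: "\<And>k. norm (w k) < 1" and lim: "(\<lambda>k. norm (w k)) \<longlonglongrightarrow> 1"
  shows "filterlim (\<lambda>k. ln (2 / (1 - (norm (w k))\<^sup>2))) at_top sequentially"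
proof (rule filterlim_compose[OF ln_at_top])
  have "(\<lambda>k. 1 - (norm (w k))\<^sup>2) \<longlonglongrightarrow> 1 - 1\<^sup>2" by (intro tendsto_intros lim)
  then have "filterlim (\<lambda>k. 1 - (norm (w k))\<^sup>2) (at_right 0) sequentially"
    unfolding filterlim_at
  proof (intro conjI always_eventually allI)
    fix k
    show "1 - (norm (w k))\<^sup>2 \<in> {0<..}" using one_minus_norm_pos[OF w] by simp
    show "1 - (norm (w k))\<^sup>2 \<noteq> 0" using one_minus_norm_pos[OF w, of k] by linarith
  qed simp
  then show "filterlim (\<lambda>k. 2 / (1 - (norm (w k))\<^sup>2)) at_top sequentially"
    unfolding divide_inverse
    by (intro filterlim_tendsto_pos_mult_at_top[OF tendsto_const] filterlim_compose[OF filterlim_inverse_at_top_right]) auto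
qed

lemma besov_test_functions:
  fixes t :: real
  assumes t: "1 \<le> t" and N: "0 < N" "real CARD('n) / t < real N"
  obtains c F where "c > 0"
    "\<And>w :: complex^'n. norm w < 1 \<Longrightarrow> F w \<in> besov t"
    "\<And>w :: complex^'n. norm w < 1 \<Longrightarrow> besov_norm N t (F w) \<le> 1"
    "\<And>w :: complex^'n. norm w < 1 \<Longrightarrow> c * ln (2 / (1 - (norm w)\<^sup>2)) powr ((t - 1) / t) \<le> cmod (F w w)"
    "\<And>(w :: nat \<Rightarrow> complex^'n) S. (\<And>k. norm (w k) < 1) \<Longrightarrow> (\<lambda>k. norm (w k)) \<longlonglongrightarrow> 1 \<Longrightarrow>
       compact S \<Longrightarrow> S \<subseteq> ball 0 1 \<Longrightarrow> uniform_limit S (\<lambda>k. F (w k)) (\<lambda>z. 0) sequentially"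
proof -
  obtain B where B: "B > 0" 
    "\<And>(w :: complex^'n) k. norm w < 1 \<Longrightarrow> k < N \<Longrightarrow> cmod (test_der t N (1 - (norm w)\<^sup>2) k 0) \<le> B"
    "\<And>w :: complex^'n. norm w < 1 \<Longrightarrow> (\<integral>\<^sup>+z. ennreal ((\<bar>1 - (norm z)\<^sup>2\<bar> ^ N * cmod (test_der t N (1 - (norm w)\<^sup>2) N (cinner z w))) powr t) \<partial>inv_vol) \<le> ennreal (B powr t)"
    using test_der_bounds[where 'n='n, OF t N] by blast
  define K where "K = real (card {m :: 'n \<Rightarrow> nat. sum m UNIV \<le> N - 1}) + real (card {m :: 'n \<Rightarrow> nat. sum m UNIV = N})"
  \<comment> \<open>\<open>K\<close> counts the terms of the Besov norm, each of them at most
    \<open>B\<close>; dividing by \<open>(K + 1) * B\<close> brings the norm below 1 with a positive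
    divisor in any case.\<close>
  define D where "D = (K + 1) * B"
  have K: "K \<ge> 0" by (simp add: K_def)
  have D: "D > 0" using K B by (simp add: D_def)
  define G where "G = (\<lambda>(w :: complex^'n) k \<zeta>. of_real (1 / D) * test_der t N (1 - (norm w)\<^sup>2) k \<zeta>)"
  define F where "F = (\<lambda>w. cut (\<lambda>z. G w 0 (cinner z w)))"
  have G: "(G w k has_field_derivative G w (Suc k) \<zeta>) (at \<zeta>)" if "cmod \<zeta> < 1" for w k \<zeta>
    unfolding G_def by (intro DERIV_cmult test_der_deriv that)
  have nG: "cmod (G w k \<zeta>) = cmod (test_der t N (1 - (norm w)\<^sup>2) k \<zeta>) / D" for w k \<zeta>
    using D by (simp add: G_def norm_mult norm_divide)
  have G0: "cmod (G w k 0) \<le> B / D" if "norm w < 1" "k < N" for w k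
    unfolding nG using B(2)[OF that] D by (simp add: divide_right_mono)
  have GN: "(\<integral>\<^sup>+z. ennreal ((\<bar>1 - (norm z)\<^sup>2\<bar> ^ N * cmod (G w N (cinner z w))) powr t) \<partial>inv_vol) \<le> ennreal ((B / D) powr t)" if w: "norm w < 1" for w
  proof -
    have e: "ennreal ((\<bar>1 - (norm z)\<^sup>2\<bar> ^ N * cmod (G w N (cinner z w))) powr t)
       = ennreal ((\<bar>1 - (norm z)\<^sup>2\<bar> ^ N * cmod (test_der t N (1 - (norm w)\<^sup>2) N (cinner z w))) powr t) / ennreal (D powr t)" for z
      unfolding nG using D by (simp add: divide_ennreal powr_divide)
    have "(\<integral>\<^sup>+z. ennreal ((\<bar>1 - (norm z)\<^sup>2\<bar> ^ N * cmod (G w N (cinner z w))) powr t) \<partial>inv_vol)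
      = (\<integral>\<^sup>+z. ennreal ((\<bar>1 - (norm z)\<^sup>2\<bar> ^ N * cmod (test_der t N (1 - (norm w)\<^sup>2) N (cinner z w))) powr t) \<partial>inv_vol) / ennreal (D powr t)"
      unfolding e
    proof (rule nn_integral_divide)
      have [measurable]: "(\<lambda>z. test_der t N (1 - (norm w)\<^sup>2) N z) \<in> borel_measurable borel"
      proof -
        have "test_der t N x N = (\<lambda>z. if t = 1 then of_real (x ^ N) * (pochhammer (of_nat N) N * (1 / (1 - z) ^ (N + N)))
          else of_real (ln (2 / x) powr (- 1 / t)) * (of_nat (fact (N - 1)) * (1 / (1 - z) ^ N)))" for x
          using N(1) by (simp add: test_der_def fun_eq_iff)
        then show ?thesis by simp
      qed
      show "(\<lambda>z. ennreal ((\<bar>1 - (norm z)\<^sup>2\<bar> ^ N * cmod (test_der t N (1 - (norm w)\<^sup>2) N (cinner z w))) powr t)) \<in> borel_measurable inv_vol"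
        by measurable
    qed
    also have "\<dots> \<le> ennreal (B powr t) / ennreal (D powr t)"
      by (rule divide_right_mono_ennreal[OF B(3)[OF w]])
    also have "\<dots> = ennreal ((B / D) powr t)" using B D by (simp add: divide_ennreal powr_divide)
    finally show ?thesis .
  qed
  have BD: "B / D > 0" using B D by simp
  show thesis
  proof (rule that[of "1 / D" F])
    show "1 / D > 0" using D by simp
  next
    fix w :: "complex^'n" assume w: "norm w < 1"
    note fam = test_family_bound[where G="G w", OF t N(1) BD G w G0[OF w] GN[OF w]]
    show "F w \<in> besov t"
      unfolding besov_def F_def using fam(1,2) N by blast
  next
    fix w :: "complex^'n" assume w: "norm w < 1"
    note fam = test_family_bound[where G="G w", OF t N(1) BD G w G0[OF w] GN[OF w]]
    have "besov_norm N t (F w) \<le> ennreal (K * (B / D))"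
      using fam(3) unfolding F_def K_def distrib_right by simp
    also have "\<dots> \<le> ennreal 1"
    proof (rule ennreal_leI)
      have "B / D = 1 / (K + 1)" using B(1) K by (simp add: D_def)
      then show "K * (B / D) \<le> 1" using K by simp
    qed
    finally show "besov_norm N t (F w) \<le> 1" by simp
  next
    fix w :: "complex^'n" assume w: "norm w < 1"
    define x where "x = 1 - (norm w)\<^sup>2"
    have x: "x > 0" unfolding x_def by (rule one_minus_norm_pos[OF w])
    have L: "0 < ln (2 / x)" unfolding x_def by (rule log_weight_ge(3)[OF w])
    have z: "1 - cinner w w = of_real x" by (simp add: cinner_self x_def)
    have "cmod (test_der t N x 0 (cinner w w)) = ln (2 / x) powr ((t - 1) / t)"
    proof (cases "t = 1")
      case True
      then show ?thesis using x L by (simp add: test_der_def z norm_mult norm_divide norm_power)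
    next
      case False
      have "of_real (ln 2) - Ln (1 - cinner w w) = complex_of_real (ln (2 / x))"
        using x by (simp add: z Ln_of_real ln_div)
      then have "cmod (test_der t N x 0 (cinner w w)) = ln (2 / x) powr (- 1 / t) * ln (2 / x) powr 1"
        using False L by (simp add: test_der_def norm_mult)
      also have "\<dots> = ln (2 / x) powr ((t - 1) / t)"
        unfolding powr_add[symmetric] using t by (simp add: field_simps)
      finally show ?thesis .
    qed
    then show "1 / D * ln (2 / (1 - (norm w)\<^sup>2)) powr ((t - 1) / t) \<le> cmod (F w w)"
      using w D by (simp add: F_def cut_def nG x_def)
  next
    fix w :: "nat \<Rightarrow> complex^'n" and S :: "(complex^'n) set"
    assume w: "\<And>k. norm (w k) < 1" and lim: "(\<lambda>k. norm (w k)) \<longlonglongrightarrow> 1" and S: "compact S" "S \<subseteq> ball 0 1"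
    obtain r where r: "0 \<le> r" "r < 1" "\<And>z. z \<in> S \<Longrightarrow> norm z \<le> r" using compact_in_ball[OF S] by blast
    define x where "x = (\<lambda>k. 1 - (norm (w k))\<^sup>2)"
    \<comment> \<open>The amplitude of the test functions. It tends to 0, while the remaining
      factors are bounded for \<bar>\<zeta>\<bar> \<le> r, uniformly in \<open>k\<close>.\<close>
    define \<eta> where "\<eta> = (\<lambda>k. if t = 1 then x k ^ N else ln (2 / x k) powr (- 1 / t))"
    have "x \<longlonglongrightarrow> 1 - 1\<^sup>2" unfolding x_def by (intro tendsto_intros lim)
    then have x0: "x \<longlonglongrightarrow> 0" by simp
    have \<eta>: "\<eta> \<longlonglongrightarrow> 0"
    proof (cases "t = 1")
      case True
      have "(\<lambda>k. x k ^ N) \<longlonglongrightarrow> 0 ^ N" by (intro tendsto_intros x0)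
      then show ?thesis using True N by (simp add: \<eta>_def zero_power)
    next
      case False
      have "(\<lambda>k. ln (2 / x k) powr (- 1 / t)) \<longlonglongrightarrow> 0"
        unfolding x_def by (rule tendsto_neg_powr[OF _ tendsto_log_weight[OF w lim]]) (use t in auto)
      then show ?thesis using False by (simp add: \<eta>_def)
    qed
    have "continuous_on (cball 0 r) (\<lambda>\<zeta>. of_real (ln 2) - Ln (1 - \<zeta>))"
    proof (intro continuous_intros)
      fix \<zeta> :: complex assume "\<zeta> \<in> cball 0 r"
      then have "Re \<zeta> < 1" using complex_Re_le_cmod[of \<zeta>] r by auto
      then show "1 - \<zeta> \<notin> \<real>\<^sub>\<le>\<^sub>0" by (auto simp: complex_nonpos_Reals_iff)
    qed
    then have "bounded ((\<lambda>\<zeta>. of_real (ln 2) - Ln (1 - \<zeta>)) ` cball 0 r)"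
      by (intro compact_imp_bounded compact_continuous_image) auto
    then obtain M where "\<forall>\<zeta>\<in>cball 0 r. cmod (of_real (ln 2) - Ln (1 - \<zeta>)) \<le> M"
      unfolding bounded_iff by auto
    then have M: "cmod (of_real (ln 2) - Ln (1 - \<zeta>)) \<le> M" if "cmod \<zeta> \<le> r" for \<zeta> using that by simp
    \<comment> \<open>One bound for both families: \<open>M\<close> for the logarithm, the other
      summand for the power.\<close>
    define M' where "M' = \<bar>M\<bar> + 1 / (1 - r) ^ N"
    have le: "cmod (F (w k) z) \<le> \<eta> k * M' / D" if z: "z \<in> S" for k z
    proof -
      define \<zeta> where "\<zeta> = cinner z (w k)"
      have "cmod \<zeta> \<le> norm z * norm (w k)" unfolding \<zeta>_def by (rule norm_cinner_le)
      also have "\<dots> \<le> norm z * 1" using w[of k] by (intro mult_left_mono) auto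
      finally have \<zeta>: "cmod \<zeta> \<le> r" using r(3)[OF z] by simp
      have xk: "x k > 0" unfolding x_def by (rule one_minus_norm_pos[OF w])
      have "cmod (test_der t N (x k) 0 \<zeta>) \<le> \<eta> k * M'"
      proof (cases "t = 1")
        case True
        have "1 - r \<le> cmod (1 - \<zeta>)" using norm_triangle_ineq2[of 1 \<zeta>] \<zeta> by simp
        then have "1 / cmod (1 - \<zeta>) ^ N \<le> 1 / (1 - r) ^ N"
          using r by (intro divide_left_mono power_mono mult_pos_pos zero_less_power) auto
        also have "\<dots> \<le> M'" by (simp add: M'_def)
        finally have "x k ^ N * (1 / cmod (1 - \<zeta>) ^ N) \<le> x k ^ N * M'" using xk by (intro mult_left_mono) auto
        then show ?thesis using True xk by (simp add: test_der_def \<eta>_def norm_mult norm_divide norm_power)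
      next
        case False
        have "cmod (of_real (ln 2) - Ln (1 - \<zeta>)) \<le> M" by (rule M[OF \<zeta>])
        also have "\<dots> \<le> M'" using r by (simp add: M'_def add_increasing2)
        finally have "ln (2 / x k) powr (- 1 / t) * cmod (of_real (ln 2) - Ln (1 - \<zeta>)) \<le> ln (2 / x k) powr (- 1 / t) * M'"
          by (intro mult_left_mono) auto
        then show ?thesis using False by (simp add: test_der_def \<eta>_def norm_mult)
      qed
      then show ?thesis using z S(2) D by (auto simp: F_def cut_def nG \<zeta>_def x_def intro: divide_right_mono)
    qed
    have "(\<lambda>k. \<eta> k * M' / D) \<longlonglongrightarrow> 0 * M' / D" by (intro tendsto_intros \<eta>) (use D in auto)
    then have lim0: "(\<lambda>k. \<eta> k * M' / D) \<longlonglongrightarrow> 0" by simp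
    show "uniform_limit S (\<lambda>k. F (w k)) (\<lambda>z. 0) sequentially"
    proof (rule uniform_limitI)
      fix e :: real assume "e > 0"
      then have "\<forall>\<^sub>F k in sequentially. \<eta> k * M' / D < e" by (rule order_tendstoD(2)[OF lim0])
      then show "\<forall>\<^sub>F k in sequentially. \<forall>z\<in>S. dist (F (w k) z) 0 < e"
        by eventually_elim (use le in \<open>fastforce intro: le_less_trans\<close>)
    qed
  qed
qed

subsection \<open>The Bloch weight\<close>

definition wt :: "real \<Rightarrow> real \<Rightarrow> real \<Rightarrow> real" where
  "wt \<alpha> \<beta> x = x powr \<alpha> * ln (2 / x) powr \<beta>"

lemma bloch_weight_wt: "bloch_weight \<alpha> \<beta> g z = cmod (radial_d g z) * wt \<alpha> \<beta> (1 - (norm z)\<^sup>2)"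
  by (simp add: bloch_weight_def wt_def mult.assoc)

lemma wt_nonneg: "0 \<le> wt \<alpha> \<beta> x" by (simp add: wt_def)

text \<open>Passing from \<open>y\<close> down to x = y / s multiplies the logarithm by at most c
  s^\<eta>, since ln s \<le> s^\<eta> / \<eta>. The gain s^(\<eta> \<beta>) is compensated by the
  loss s^(-\<alpha>) of the power.\<close>

lemma wt_almost_increasing:
  assumes \<alpha>: "0 < \<alpha>" and \<beta>: "0 \<le> \<beta>"
  obtains C where "C \<ge> 1" "\<And>x y. 0 < x \<Longrightarrow> x \<le> y \<Longrightarrow> y \<le> 1 \<Longrightarrow> wt \<alpha> \<beta> x \<le> C * wt \<alpha> \<beta> y"
proof -
  \<comment> \<open>The denominator \<beta> + 1 gives \<eta> \<beta> \<le> \<alpha> and also covers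
    \<beta> = 0.\<close>
  define \<eta> where "\<eta> = \<alpha> / (\<beta> + 1)"
  define c where "c = 1 + 1 / (\<eta> * ln 2)"
  have \<eta>: "\<eta> > 0" "\<eta> * \<beta> \<le> \<alpha>" using \<alpha> \<beta> by (auto simp: \<eta>_def field_simps)
  have c: "c \<ge> 1" using \<eta> by (simp add: c_def)
  show thesis
  proof (rule that[of "c powr \<beta>"])
    show "c powr \<beta> \<ge> 1" using c \<beta> by (simp add: ge_one_powr_ge_zero)
    fix x y :: real assume x: "0 < x" "x \<le> y" "y \<le> 1"
    define s where "s = y / x"
    have s: "s \<ge> 1" "y = s * x" using x by (auto simp: s_def)
    have L: "ln 2 \<le> ln (2 / y)" using x by (intro ln_mono) (auto simp: field_simps)
    have ln2: "0 < ln (2::real)" by simp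
    have sp: "1 \<le> s powr \<eta>" using s \<eta> by (simp add: ge_one_powr_ge_zero)
    have "ln (s powr \<eta>) \<le> s powr \<eta> - 1" using s by (intro ln_le_minus_one) auto
    then have "\<eta> * ln s \<le> s powr \<eta>" using s by (simp add: ln_powr)
    then have lns: "ln s \<le> s powr \<eta> / \<eta>" using \<eta> by (simp add: field_simps)
    have "2 / x = 2 / y * s" using x by (simp add: s_def)
    then have "ln (2 / x) = ln (2 / y * s)" by (simp only:)
    also have "\<dots> = ln (2 / y) + ln s" by (rule ln_mult_pos) (use x s in auto)
    also have "\<dots> \<le> ln (2 / y) * s powr \<eta> + ln (2 / y) / ln 2 * (s powr \<eta> / \<eta>)"
    proof (rule add_mono)
      show "ln (2 / y) \<le> ln (2 / y) * s powr \<eta>"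
        using L ln2 sp mult_left_mono[of 1 "s powr \<eta>" "ln (2 / y)"] by linarith
      have "1 * ln s \<le> ln (2 / y) / ln 2 * ln s" using L ln2 s by (intro mult_right_mono) auto
      also have "\<dots> \<le> ln (2 / y) / ln 2 * (s powr \<eta> / \<eta>)" using L ln2 lns by (intro mult_left_mono divide_nonneg_pos) linarith+
      finally show "ln s \<le> ln (2 / y) / ln 2 * (s powr \<eta> / \<eta>)" by simp
    qed
    also have "\<dots> = c * s powr \<eta> * ln (2 / y)" by (simp add: c_def algebra_simps)
    finally have 1: "ln (2 / x) \<le> c * s powr \<eta> * ln (2 / y)" .
    have "0 \<le> ln (2 / x)" using x by simp
    with 1 have "ln (2 / x) powr \<beta> \<le> (c * s powr \<eta> * ln (2 / y)) powr \<beta>" using \<beta> by (intro powr_mono2) auto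
    also have "\<dots> = c powr \<beta> * s powr (\<eta> * \<beta>) * ln (2 / y) powr \<beta>" by (simp add: powr_mult powr_powr)
    also have "\<dots> \<le> c powr \<beta> * s powr \<alpha> * ln (2 / y) powr \<beta>"
      using s \<eta> by (intro mult_right_mono mult_left_mono powr_mono) auto
    finally have "x powr \<alpha> * ln (2 / x) powr \<beta> \<le> x powr \<alpha> * (c powr \<beta> * s powr \<alpha> * ln (2 / y) powr \<beta>)"
      by (intro mult_left_mono) auto
    also have "\<dots> = c powr \<beta> * (y powr \<alpha> * ln (2 / y) powr \<beta>)" unfolding s(2) by (simp add: powr_mult mult_ac)
    finally show "wt \<alpha> \<beta> x \<le> c powr \<beta> * wt \<alpha> \<beta> y" by (simp add: wt_def)
  qed
qed

text \<open>Half of the power is set aside; the other half absorbs the logarithm by comparison with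
  the value at 1.\<close>

lemma wt_bounded:
  assumes "0 < \<alpha>" "0 \<le> \<beta>"
  obtains K where "K > 0" "\<And>x. 0 < x \<Longrightarrow> x \<le> 1 \<Longrightarrow> wt \<alpha> \<beta> x \<le> K * x powr (\<alpha> / 2)" "\<And>x. 0 < x \<Longrightarrow> x \<le> 1 \<Longrightarrow> wt \<alpha> \<beta> x \<le> K"
proof -
  obtain C where C: "C \<ge> 1" "\<And>x y. 0 < x \<Longrightarrow> x \<le> y \<Longrightarrow> y \<le> 1 \<Longrightarrow> wt (\<alpha> / 2) \<beta> x \<le> C * wt (\<alpha> / 2) \<beta> y"
    using wt_almost_increasing[of "\<alpha> / 2" \<beta>] assms by auto
  define K where "K = C * wt (\<alpha> / 2) \<beta> 1"
  have K: "K > 0" using C by (simp add: K_def wt_def)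
  have *: "wt \<alpha> \<beta> x \<le> K * x powr (\<alpha> / 2)" if x: "0 < x" "x \<le> 1" for x
  proof -
    have "wt \<alpha> \<beta> x = x powr (\<alpha> / 2) * wt (\<alpha> / 2) \<beta> x"
      by (simp add: wt_def mult.assoc[symmetric] powr_add[symmetric])
    also have "\<dots> \<le> x powr (\<alpha> / 2) * K" unfolding K_def using x by (intro mult_left_mono C(2)) auto
    finally show ?thesis by (simp add: mult.commute)
  qed
  moreover have "wt \<alpha> \<beta> x \<le> K" if x: "0 < x" "x \<le> 1" for x
  proof -
    have "x powr (\<alpha> / 2) \<le> 1 powr (\<alpha> / 2)" using x assms by (intro powr_mono2) auto
    then have "K * x powr (\<alpha> / 2) \<le> K * 1" using K by (intro mult_left_mono) auto
    with *[OF x] show ?thesis by simp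
  qed
  ultimately show thesis using that K by blast
qed

section \<open>The limit towards the sphere and the distance to the little space\<close>

lemma eventually_to_sphere:
  "eventually P (to_sphere :: (complex^'n) filter) \<longleftrightarrow> (\<exists>\<delta><1. \<forall>z. \<delta> < norm z \<longrightarrow> norm z < 1 \<longrightarrow> P z)"
proof
  assume "eventually P (to_sphere :: (complex^'n) filter)"
  then obtain Q where Q: "eventually Q (at_left 1)" "\<And>z. Q (norm z) \<Longrightarrow> P z"
    unfolding to_sphere_def eventually_filtercomap by blast
  then obtain b where "b < 1" "\<And>y. b < y \<Longrightarrow> y < 1 \<Longrightarrow> Q y" unfolding eventually_at_left_field by blast
  with Q(2) show "\<exists>\<delta><1. \<forall>z. \<delta> < norm z \<longrightarrow> norm z < 1 \<longrightarrow> P z" by blast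
next
  assume "\<exists>\<delta><1. \<forall>z. \<delta> < norm z \<longrightarrow> norm z < 1 \<longrightarrow> P z"
  then obtain \<delta> where "\<delta> < 1" "\<And>z. \<delta> < norm z \<Longrightarrow> norm z < 1 \<Longrightarrow> P z" by blast
  then show "eventually P (to_sphere :: (complex^'n) filter)"
    unfolding to_sphere_def eventually_filtercomap eventually_at_left_field
    by (intro exI[of _ "\<lambda>y. \<delta> < y \<and> y < 1"]) blast
qed

lemma ball_in_to_sphere: "\<forall>\<^sub>F z in (to_sphere :: (complex^'n) filter). norm z < 1"
  unfolding eventually_to_sphere by (intro exI[of _ 0]) auto

lemma hol_ball_outside:
  assumes "f \<in> hol_ball" "z \<notin> ball 0 1" shows "f z = 0"
proof -
  have "\<forall>z. z \<notin> ball 0 1 \<longrightarrow> f z = 0" using assms(1) unfolding hol_ball_def by (rule CollectE) (erule conjunct2)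
  then show ?thesis using assms(2) by simp
qed

lemma hol_ball_diff:
  fixes f g :: "complex^'n \<Rightarrow> complex"
  assumes "f \<in> hol_ball" "g \<in> hol_ball" shows "(\<lambda>z. f z - g z) \<in> hol_ball"
proof (rule hol_ballI)
  show "holo (ball 0 1) (\<lambda>z. f z - g z)" by (intro holo_diff hol_ball_holo assms)
  fix z :: "complex^'n" assume "z \<notin> ball 0 1"
  then show "f z - g z = 0" using assms[THEN hol_ball_outside, of z] by simp
qed

lemma radial_d_diff:
  assumes "f \<in> hol_ball" "g \<in> hol_ball" "norm z < 1"
  shows "radial_d (\<lambda>z. f z - g z) z = radial_d f z - radial_d g z"
  unfolding radial_d_dh by (rule dh_sub[OF hol_ball_holo hol_ball_holo]) (use assms in auto)

lemma bloch_norm_ge: "norm z < 1 \<Longrightarrow> ennreal (bloch_weight \<alpha> \<beta> g z) \<le> bloch_norm \<alpha> \<beta> g"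
  unfolding bloch_norm_def by (rule SUP_upper) simp

text \<open>An \<open>h\<close> in the little space contributes nothing in the limit, so near the
  sphere the weight of \<open>g\<close> exceeds the norm of the difference by at most
  \<open>e\<close>.\<close>

lemma Limsup_le_dist:
  fixes g :: "complex^'n \<Rightarrow> complex"
  assumes g: "g \<in> bloch \<alpha> \<beta>"
  shows "Limsup to_sphere (\<lambda>z. ennreal (bloch_weight \<alpha> \<beta> g z)) \<le> dist_to (bloch_norm \<alpha> \<beta>) g (little_bloch \<alpha> \<beta>)"
  unfolding dist_to_def
proof (rule INF_greatest)
  fix h :: "complex^'n \<Rightarrow> complex" assume h: "h \<in> little_bloch \<alpha> \<beta>"
  have gh: "g \<in> hol_ball" "h \<in> hol_ball" using g h by (auto simp: bloch_def little_bloch_def)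
  show "Limsup to_sphere (\<lambda>z. ennreal (bloch_weight \<alpha> \<beta> g z)) \<le> bloch_norm \<alpha> \<beta> (\<lambda>z. g z - h z)"
  proof (rule ennreal_le_epsilon)
    fix e :: real assume e: "0 < e"
    have "\<forall>\<^sub>F z in to_sphere. bloch_weight \<alpha> \<beta> h z < e"
      using h order_tendstoD(2)[of "bloch_weight \<alpha> \<beta> h" 0 to_sphere e] e by (auto simp: little_bloch_def)
    then have "\<forall>\<^sub>F z in to_sphere. ennreal (bloch_weight \<alpha> \<beta> g z) \<le> bloch_norm \<alpha> \<beta> (\<lambda>z. g z - h z) + ennreal e"
      using ball_in_to_sphere
    proof eventually_elim
      case (elim z)
      have "cmod (radial_d g z) \<le> cmod (radial_d (\<lambda>z. g z - h z) z) + cmod (radial_d h z)"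
        unfolding radial_d_diff[OF gh elim(2)] using norm_triangle_ineq[of "radial_d g z - radial_d h z" "radial_d h z"] by simp
      then have "bloch_weight \<alpha> \<beta> g z \<le> bloch_weight \<alpha> \<beta> (\<lambda>z. g z - h z) z + bloch_weight \<alpha> \<beta> h z"
        unfolding bloch_weight_wt distrib_right[symmetric] by (rule mult_right_mono[OF _ wt_nonneg])
      also have "\<dots> \<le> bloch_weight \<alpha> \<beta> (\<lambda>z. g z - h z) z + e" using elim(1) by simp
      finally have "ennreal (bloch_weight \<alpha> \<beta> g z) \<le> ennreal (bloch_weight \<alpha> \<beta> (\<lambda>z. g z - h z) z + e)" by (rule ennreal_leI)
      also have "\<dots> = ennreal (bloch_weight \<alpha> \<beta> (\<lambda>z. g z - h z) z) + ennreal e"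
        using e by (intro ennreal_plus) (auto simp: bloch_weight_wt wt_nonneg)
      also have "\<dots> \<le> bloch_norm \<alpha> \<beta> (\<lambda>z. g z - h z) + ennreal e"
        by (intro add_right_mono bloch_norm_ge elim)
      finally show ?case .
    qed
    then show "Limsup to_sphere (\<lambda>z. ennreal (bloch_weight \<alpha> \<beta> g z)) \<le> bloch_norm \<alpha> \<beta> (\<lambda>z. g z - h z) + ennreal e"
      by (rule Limsup_bounded)
  qed
qed

definition dilate :: "real \<Rightarrow> (complex^'n \<Rightarrow> complex) \<Rightarrow> complex^'n \<Rightarrow> complex" where
  "dilate r g = cut (\<lambda>z. g (r *\<^sub>R z))"

lemma dilate_facts:
  fixes g :: "complex^'n \<Rightarrow> complex"
  assumes g: "g \<in> hol_ball" and r: "0 < r" "r < 1"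
  shows "dilate r g \<in> hol_ball" and "norm z < 1 \<Longrightarrow> radial_d (dilate r g) z = radial_d g (r *\<^sub>R z)"
proof -
  have mem: "r *\<^sub>R z \<in> ball 0 1" if "norm z < 1" for z :: "complex^'n"
    using norm_scaleR_ball[OF that, of r] r by simp
  have d: "((\<lambda>z. g (r *\<^sub>R z)) has_derivative (\<lambda>v. dh g (r *\<^sub>R z) (r *\<^sub>R v))) (at z)" if "norm z < 1" for z
  proof -
    have "((\<lambda>z. r *\<^sub>R z) has_derivative (\<lambda>v. r *\<^sub>R v)) (at z)" by (auto intro!: derivative_eq_intros)
    from has_derivative_compose[OF this holo_has_derivative[OF hol_ball_holo[OF g] mem[OF that]]] show ?thesis .
  qed
  have lin: "dh g y (r *\<^sub>R (c *s v)) = c * dh g y (r *\<^sub>R v)" for y c v by (simp add: dh_scaleR dh_scale)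
  have "holo (ball 0 1) (\<lambda>z. g (r *\<^sub>R z))"
    by (rule holoI, rule d) (auto simp: lin)
  then show "dilate r g \<in> hol_ball" unfolding dilate_def
    by (intro hol_ballI holo_cut) (auto simp: cut_def)
  assume z: "norm z < 1"
  have "radial_d (dilate r g) z = dh (\<lambda>z. g (r *\<^sub>R z)) z z"
    unfolding radial_d_dh dilate_def by (rule dh_cong[of "ball 0 1"]) (use z in \<open>auto simp: cut_def\<close>)
  also have "\<dots> = dh g (r *\<^sub>R z) (r *\<^sub>R z)"
    using dh_unique[OF d[OF z] lin] by simp
  finally show "radial_d (dilate r g) z = radial_d g (r *\<^sub>R z)" by (simp add: radial_d_dh)
qed

lemma tendsto_to_sphere_powr:
  assumes "a > 0"
  shows "((\<lambda>z :: complex^'n. (1 - (norm z)\<^sup>2) powr a) \<longlongrightarrow> 0) to_sphere"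
proof -
  have "filterlim norm (at_left 1) (to_sphere :: (complex^'n) filter)"
    unfolding to_sphere_def by (rule filterlim_filtercomap)
  moreover have "((\<lambda>y. (1 - y\<^sup>2) powr a) \<longlongrightarrow> (1 - 1\<^sup>2) powr a) (at_left (1::real))"
  proof (rule tendsto_powr2)
    show "((\<lambda>y. 1 - y\<^sup>2) \<longlongrightarrow> 1 - 1\<^sup>2) (at_left (1::real))" by (intro tendsto_intros)
    show "\<forall>\<^sub>F y in at_left (1::real). 0 \<le> 1 - y\<^sup>2"
      unfolding eventually_at_left_field by (intro exI[of _ 0]) (auto simp: power_le_one)
  qed (use assms in auto)
  ultimately show ?thesis by (auto dest: filterlim_compose[rotated])
qed

text \<open>The radial derivative of the dilation takes its values from \<open>cball 0 r\<close>,
  where that of \<open>g\<close> is bounded, and the weight itself tends to 0 at the sphere.\<close>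

lemma dilate_little_bloch:
  fixes g :: "complex^'n \<Rightarrow> complex"
  assumes g: "g \<in> hol_ball" and r: "0 < r" "r < 1" and \<alpha>: "0 < \<alpha>" and \<beta>: "0 \<le> \<beta>"
  shows "dilate r g \<in> little_bloch \<alpha> \<beta>"
proof -
  obtain K where K: "K > 0" "\<And>x. 0 < x \<Longrightarrow> x \<le> 1 \<Longrightarrow> wt \<alpha> \<beta> x \<le> K * x powr (\<alpha> / 2)" "\<And>x. 0 < x \<Longrightarrow> x \<le> 1 \<Longrightarrow> wt \<alpha> \<beta> x \<le> K"
    using wt_bounded[OF \<alpha> \<beta>] by blast
  have "continuous_on (cball 0 r) (radial_d g)"
    by (rule continuous_on_subset[OF holo_continuous[OF holo_radial_d[OF hol_ball_holo[OF g]]]]) (use r in auto)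
  then have "bounded (radial_d g ` cball 0 r)" by (intro compact_imp_bounded compact_continuous_image) auto
  then obtain M where M: "\<forall>y\<in>cball 0 r. cmod (radial_d g y) \<le> M" unfolding bounded_iff by auto
  have R: "cmod (radial_d (dilate r g) z) \<le> \<bar>M\<bar>" if z: "norm z < 1" for z
  proof -
    have "r * norm z \<le> r * 1" using z r by (intro mult_left_mono) auto
    then have "r *\<^sub>R z \<in> cball 0 r" using r by simp
    then show ?thesis unfolding dilate_facts(2)[OF g r z] using M by fastforce
  qed
  have le: "bloch_weight \<alpha> \<beta> (dilate r g) z \<le> \<bar>M\<bar> * (K * (1 - (norm z)\<^sup>2) powr (\<alpha> / 2))" "bloch_weight \<alpha> \<beta> (dilate r g) z \<le> \<bar>M\<bar> * K" if z: "norm z < 1" for z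
    unfolding bloch_weight_wt using K one_minus_norm_pos[OF z] by (auto intro!: mult_mono R z K wt_nonneg)
  have "bloch_norm \<alpha> \<beta> (dilate r g) \<le> ennreal (\<bar>M\<bar> * K)"
    unfolding bloch_norm_def by (rule SUP_least) (use le(2) in \<open>auto intro: ennreal_leI\<close>)
  then have "bloch_norm \<alpha> \<beta> (dilate r g) < \<infinity>" by (rule le_less_trans) simp
  moreover have "(bloch_weight \<alpha> \<beta> (dilate r g) \<longlongrightarrow> 0) to_sphere"
  proof (rule tendsto_sandwich[of "\<lambda>_. 0" _ _ "\<lambda>z. \<bar>M\<bar> * (K * (1 - (norm z)\<^sup>2) powr (\<alpha> / 2))"])
    show "\<forall>\<^sub>F z in to_sphere. bloch_weight \<alpha> \<beta> (dilate r g) z \<le> \<bar>M\<bar> * (K * (1 - (norm z)\<^sup>2) powr (\<alpha> / 2))"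
      using ball_in_to_sphere by eventually_elim (rule le)
    have "((\<lambda>z :: complex^'n. \<bar>M\<bar> * (K * (1 - (norm z)\<^sup>2) powr (\<alpha> / 2))) \<longlongrightarrow> \<bar>M\<bar> * (K * 0)) to_sphere"
      by (intro tendsto_intros tendsto_to_sphere_powr) (use \<alpha> in auto)
    then show "((\<lambda>z :: complex^'n. \<bar>M\<bar> * (K * (1 - (norm z)\<^sup>2) powr (\<alpha> / 2))) \<longlongrightarrow> 0) to_sphere" by simp
  qed (auto simp: bloch_weight_wt wt_nonneg)
  ultimately show ?thesis using dilate_facts(1)[OF g r] by (simp add: little_bloch_def bloch_def)
qed

text \<open>On a ball of radius \<open>\<delta>1\<close> the radial derivatives of \<open>g\<close>
  and of its dilation are close by uniform continuity. Outside it both \<open>z\<close> and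
  \<open>r *\<^sub>R z\<close> lie in the region where the weighted derivative is at most l +
  \<epsilon>, and the weight at \<open>z\<close> is at most \<open>C0\<close> times that at
  \<open>r *\<^sub>R z\<close>.\<close>

lemma dist_le_Limsup:
  assumes \<alpha>: "0 < \<alpha>" and \<beta>: "0 \<le> \<beta>"
  obtains C where "C > 0" "\<And>g :: complex^'n \<Rightarrow> complex. g \<in> hol_ball \<Longrightarrow>
    dist_to (bloch_norm \<alpha> \<beta>) g (little_bloch \<alpha> \<beta>) \<le> ennreal C * Limsup to_sphere (\<lambda>z. ennreal (bloch_weight \<alpha> \<beta> g z))"
proof -
  obtain C0 where C0: "C0 \<ge> 1" "\<And>x y. 0 < x \<Longrightarrow> x \<le> y \<Longrightarrow> y \<le> 1 \<Longrightarrow> wt \<alpha> \<beta> x \<le> C0 * wt \<alpha> \<beta> y"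
    using wt_almost_increasing[OF \<alpha> \<beta>] by blast
  obtain K where K: "K > 0" "\<And>x. 0 < x \<Longrightarrow> x \<le> 1 \<Longrightarrow> wt \<alpha> \<beta> x \<le> K * x powr (\<alpha> / 2)" "\<And>x. 0 < x \<Longrightarrow> x \<le> 1 \<Longrightarrow> wt \<alpha> \<beta> x \<le> K"
    using wt_bounded[OF \<alpha> \<beta>] by blast
  show thesis
  proof (rule that[of "1 + C0"])
    show "1 + C0 > 0" using C0(1) by simp
    fix g :: "complex^'n \<Rightarrow> complex" assume g: "g \<in> hol_ball"
    let ?S = "Limsup to_sphere (\<lambda>z. ennreal (bloch_weight \<alpha> \<beta> g z))"
    show "dist_to (bloch_norm \<alpha> \<beta>) g (little_bloch \<alpha> \<beta>) \<le> ennreal (1 + C0) * ?S"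
    proof (cases "?S")
      case top
      then show ?thesis using C0(1) by (simp add: ennreal_mult_top)
    next
      case (real l)
      have key: "dist_to (bloch_norm \<alpha> \<beta>) g (little_bloch \<alpha> \<beta>) \<le> ennreal ((1 + C0) * (l + \<epsilon>))" if \<epsilon>: "\<epsilon> > 0" for \<epsilon>
      proof -
        have "?S < ennreal (l + \<epsilon>)" unfolding real using real(1) \<epsilon> by (simp add: ennreal_less_iff)
        then have "\<forall>\<^sub>F z in to_sphere. ennreal (bloch_weight \<alpha> \<beta> g z) < ennreal (l + \<epsilon>)" by (rule Limsup_lessD)
        then obtain \<delta>0 where \<delta>0: "\<delta>0 < 1" "\<And>z. \<delta>0 < norm z \<Longrightarrow> norm z < 1 \<Longrightarrow> ennreal (bloch_weight \<alpha> \<beta> g z) < ennreal (l + \<epsilon>)"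
          unfolding eventually_to_sphere by blast
        define \<delta> where "\<delta> = max \<delta>0 0"
        define \<delta>1 where "\<delta>1 = (1 + \<delta>) / 2"
        have \<delta>: "0 \<le> \<delta>" "\<delta> < \<delta>1" "\<delta>1 < 1" "0 < \<delta>1" using \<delta>0(1) by (auto simp: \<delta>_def \<delta>1_def)
        have b: "bloch_weight \<alpha> \<beta> g z \<le> l + \<epsilon>" if "\<delta> < norm z" "norm z < 1" for z
        proof -
          have "ennreal (bloch_weight \<alpha> \<beta> g z) < ennreal (l + \<epsilon>)" using \<delta>0(2)[of z] that by (simp add: \<delta>_def)
          then show ?thesis by (subst (asm) ennreal_less_iff) (auto simp: bloch_weight_wt wt_nonneg)
        qed
        have "\<epsilon> / K > 0" using \<epsilon> K(1) by simp
        moreover have "uniformly_continuous_on (cball 0 \<delta>1) (radial_d g)"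
        proof (rule compact_uniformly_continuous)
          have "continuous_on (ball 0 1) (radial_d g)" by (rule holo_continuous[OF holo_radial_d[OF hol_ball_holo[OF g] open_ball]])
          then show "continuous_on (cball 0 \<delta>1) (radial_d g)" by (rule continuous_on_subset) (use \<delta> in auto)
        qed simp
        ultimately obtain d where d: "d > 0" "\<And>x y. x \<in> cball 0 \<delta>1 \<Longrightarrow> y \<in> cball 0 \<delta>1 \<Longrightarrow> dist y x < d \<Longrightarrow> dist (radial_d g y) (radial_d g x) < \<epsilon> / K"
          unfolding uniformly_continuous_on_def by blast
        define k where "k = \<delta> / \<delta>1"
        \<comment> \<open>\<open>1 - d / 2\<close> keeps \<open>r *\<^sub>R z\<close> within
          \<open>d\<close> of \<open>z\<close>, \<open>1/2\<close> keeps \<open>r\<close> positive,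
          and \<open>(k + 1) / 2\<close> exceeds \<delta> / \<delta>1, so that norm z > \<delta>1
          leaves \<open>r *\<^sub>R z\<close> outside the ball of radius \<delta>.\<close>
        define r where "r = max (1 - d / 2) (max (1/2) ((k + 1) / 2))"
        have "k < 1" using \<delta> by (simp add: k_def)
        then have r: "0 < r" "r < 1" "1 - d / 2 \<le> r" "k < r"
          using d(1) by (simp_all add: r_def less_max_iff_disj)
        have rd: "1 - r < d" using d(1) r(3) by (simp add: field_simps)
        have le: "bloch_weight \<alpha> \<beta> (\<lambda>z. g z - dilate r g z) z \<le> (1 + C0) * (l + \<epsilon>)" if z: "norm z < 1" for z
        proof -
          define x where "x = 1 - (norm z)\<^sup>2"
          have x: "0 < x" "x \<le> 1" using one_minus_norm_pos[OF z] by (auto simp: x_def)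
          have rad: "radial_d (\<lambda>z. g z - dilate r g z) z = radial_d g z - radial_d g (r *\<^sub>R z)"
            using radial_d_diff[OF g dilate_facts(1)[OF g r(1,2)] z] dilate_facts(2)[OF g r(1,2) z] by simp
          have rz: "norm (r *\<^sub>R z) \<le> norm z" using r by (simp add: mult_left_le_one_le)
          show ?thesis
          proof (cases "norm z \<le> \<delta>1")
            case True
            have "dist z (r *\<^sub>R z) = norm ((1 - r) *\<^sub>R z)" by (simp add: dist_norm scaleR_diff_left)
            also have "\<dots> = (1 - r) * norm z" using r by simp
            also have "\<dots> \<le> (1 - r) * 1" using r z by (intro mult_left_mono) auto
            also have "\<dots> < d" using rd by (simp only: mult_1_right)
            finally have "dist (radial_d g z) (radial_d g (r *\<^sub>R z)) < \<epsilon> / K"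
              using True rz by (intro d(2)) auto
            then have "cmod (radial_d g z - radial_d g (r *\<^sub>R z)) * wt \<alpha> \<beta> x \<le> \<epsilon> / K * K"
              using K(3)[OF x] \<epsilon> K(1) by (intro mult_mono wt_nonneg) (auto simp: dist_norm)
            also have "\<dots> \<le> (1 + C0) * (l + \<epsilon>)"
              using K(1) C0(1) \<epsilon> real(1) mult_mono[of 1 "1 + C0" \<epsilon> "l + \<epsilon>"] by simp
            finally show ?thesis unfolding bloch_weight_wt rad x_def .
          next
            case False
            then have z1: "\<delta> < norm z" using \<delta> by simp
            have "\<delta> < r * \<delta>1" using r(4) \<delta> by (simp add: k_def field_simps)
            also have "\<dots> \<le> r * norm z" using False r by (intro mult_left_mono) auto
            finally have z2: "\<delta> < norm (r *\<^sub>R z)" using r by simp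
            have z3: "norm (r *\<^sub>R z) < 1" using rz z by simp
            define y where "y = 1 - (norm (r *\<^sub>R z))\<^sup>2"
            have "(norm (r *\<^sub>R z))\<^sup>2 \<le> (norm z)\<^sup>2" using rz by (intro power_mono) auto
            then have y: "x \<le> y" "y \<le> 1" by (auto simp: x_def y_def)
            have "cmod (radial_d g z - radial_d g (r *\<^sub>R z)) * wt \<alpha> \<beta> x \<le> (cmod (radial_d g z) + cmod (radial_d g (r *\<^sub>R z))) * wt \<alpha> \<beta> x"
              by (intro mult_right_mono norm_triangle_ineq4 wt_nonneg)
            also have "\<dots> = cmod (radial_d g z) * wt \<alpha> \<beta> x + cmod (radial_d g (r *\<^sub>R z)) * wt \<alpha> \<beta> x"
              by (rule distrib_right)
            also have "\<dots> \<le> cmod (radial_d g z) * wt \<alpha> \<beta> x + cmod (radial_d g (r *\<^sub>R z)) * (C0 * wt \<alpha> \<beta> y)"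
              by (intro add_left_mono mult_left_mono C0(2) x y) auto
            also have "\<dots> = bloch_weight \<alpha> \<beta> g z + C0 * bloch_weight \<alpha> \<beta> g (r *\<^sub>R z)"
              by (simp only: bloch_weight_wt x_def y_def mult_ac)
            also have "\<dots> \<le> (l + \<epsilon>) + C0 * (l + \<epsilon>)"
              using C0(1) by (intro add_mono mult_left_mono b z z1 z2 z3) auto
            also have "\<dots> = (1 + C0) * (l + \<epsilon>)" by (simp add: algebra_simps)
            finally show ?thesis unfolding bloch_weight_wt rad x_def .
          qed
        qed
        have "dist_to (bloch_norm \<alpha> \<beta>) g (little_bloch \<alpha> \<beta>) \<le> bloch_norm \<alpha> \<beta> (\<lambda>z. g z - dilate r g z)"
          unfolding dist_to_def by (rule INF_lower) (rule dilate_little_bloch[OF g r(1,2) \<alpha> \<beta>])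
        also have "\<dots> \<le> ennreal ((1 + C0) * (l + \<epsilon>))"
          unfolding bloch_norm_def by (rule SUP_least) (use le in \<open>auto intro: ennreal_leI\<close>)
        finally show ?thesis .
      qed
      have "dist_to (bloch_norm \<alpha> \<beta>) g (little_bloch \<alpha> \<beta>) \<le> ennreal ((1 + C0) * l)"
      proof (rule ennreal_le_epsilon)
        fix e :: real assume e: "0 < e"
        have "dist_to (bloch_norm \<alpha> \<beta>) g (little_bloch \<alpha> \<beta>) \<le> ennreal ((1 + C0) * (l + e / (1 + C0)))"
          by (rule key) (use e C0(1) real(1) in auto)
        also have "(1 + C0) * (l + e / (1 + C0)) = (1 + C0) * l + e" using C0(1) by (simp add: distrib_left)
        also have "ennreal ((1 + C0) * l + e) = ennreal ((1 + C0) * l) + ennreal e"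
          using C0(1) real(1) e by (intro ennreal_plus) auto
        finally show "dist_to (bloch_norm \<alpha> \<beta>) g (little_bloch \<alpha> \<beta>) \<le> ennreal ((1 + C0) * l) + ennreal e" .
      qed
      then show ?thesis using C0(1) real by (simp add: ennreal_mult)
    qed
  qed
qed

subsection \<open>Norm estimates for the operator\<close>

lemma inverse_mult_le_ennreal:
  assumes "0 < C" "B \<le> ennreal C * A" shows "ennreal (inverse C) * B \<le> A"
proof -
  have "ennreal (inverse C) * B \<le> ennreal (inverse C) * (ennreal C * A)" by (intro mult_left_mono assms) simp
  also have "\<dots> = ennreal (inverse C * C) * A" using assms(1) by (simp add: ennreal_mult mult.assoc del: left_inverse)
  also have "\<dots> = A" using assms(1) by simp
  finally show ?thesis .
qed

lemma le_mult_INF_ennreal: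
  fixes f :: "'a \<Rightarrow> ennreal"
  assumes "0 < C" "\<And>x. x \<in> X \<Longrightarrow> B \<le> ennreal C * f x" shows "B \<le> ennreal C * (INF x\<in>X. f x)"
proof -
  have "ennreal (inverse C) * B \<le> (INF x\<in>X. f x)"
    by (rule INF_greatest) (rule inverse_mult_le_ennreal[OF assms(1) assms(2)])
  then have "ennreal (inverse (inverse C)) * (ennreal (inverse C) * B) \<le> ennreal C * (INF x\<in>X. f x)"
    by (simp add: mult_left_mono)
  moreover have "ennreal (inverse (inverse C)) * (ennreal (inverse C) * B) = ennreal (C * inverse C) * B"
    using assms(1) by (simp add: ennreal_mult mult.assoc del: right_inverse)
  ultimately show ?thesis using assms(1) by simp
qed

lemma tendsto_0_ennrealI:
  fixes X :: "'a \<Rightarrow> ennreal"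
  assumes "\<And>e. 0 < e \<Longrightarrow> \<forall>\<^sub>F k in F. X k \<le> ennreal e" shows "(X \<longlongrightarrow> 0) F"
proof (rule order_tendstoI)
  fix a :: ennreal assume "0 < a"
  then obtain b where b: "0 < b" "b < a" using dense by blast
  then obtain r where r: "b = ennreal r" "0 \<le> r" by (cases b) auto
  with b have "0 < r" by (simp add: ennreal_less_zero_iff)
  from assms[OF this] show "\<forall>\<^sub>F k in F. X k < a"
    by eventually_elim (use b r in \<open>auto intro: le_less_trans\<close>)
qed auto

lemma bloch_weight_bound:
  assumes "bloch_norm \<alpha> \<beta> u \<le> ennreal A" "0 \<le> A" "norm z < 1"
  shows "bloch_weight \<alpha> \<beta> u z \<le> A"
  using order_trans[OF bloch_norm_ge[OF assms(3)] assms(1)] assms(2) by (simp add: ennreal_le_iff)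

lemma besov_holo: "f \<in> besov t \<Longrightarrow> holo (ball 0 1) f"
  unfolding besov_def by (blast intro: hol_ball_holo)

text \<open>The logarithm in the growth of \<open>f\<close> is exactly the one in the weight of the
  symbol, so the product of \<open>f\<close> with the radial derivative is of order \<alpha> without
  a logarithm. \<open>A\<close> and \<open>M\<close> are real upper bounds instead of the norms
  themselves, which may be infinite or, for \<open>f\<close>, zero.\<close>

lemma F_norm_T_op_besov:
  fixes p q s t :: real
  assumes p: "0 < p" and q: "- real CARD('n) - 1 < q" and s: "1 < s" and n: "s * (real CARD('n) - 1) < real CARD('n)"
    and t: "1 \<le> t" and N: "0 < N"
  defines "\<alpha> \<equiv> (real CARD('n) + 1 + q) / p" and "\<beta> \<equiv> (t - 1) / t"
  obtains C where "C > 0" "\<And>(u :: complex^'n \<Rightarrow> complex) f A M. holo (ball 0 1) u \<Longrightarrow> holo (ball 0 1) f \<Longrightarrow> 0 \<le> A \<Longrightarrow> 0 < M \<Longrightarrow>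
    bloch_norm \<alpha> \<beta> u \<le> ennreal A \<Longrightarrow> besov_norm N t f \<le> ennreal M \<Longrightarrow> F_norm p q s (T_op u f) \<le> ennreal (C * (M * A))"
proof -
  obtain C1 where C1: "C1 > 0" "\<And>(f :: complex^'n \<Rightarrow> complex) M z. holo (ball 0 1) f \<Longrightarrow> 0 < M \<Longrightarrow>
    besov_norm N t f \<le> ennreal M \<Longrightarrow> norm z < 1 \<Longrightarrow>
    cmod (f z) \<le> C1 * M * ln (2 / (1 - (norm z)\<^sup>2)) powr ((t - 1) / t)"
    using besov_growth[where 'n='n, OF t N] by blast
  obtain C2 where C2: "C2 > 0" "\<And>(f :: complex^'n \<Rightarrow> complex) g A. holo (ball 0 1) f \<Longrightarrow> holo (ball 0 1) g \<Longrightarrow> 0 \<le> A \<Longrightarrow>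
    (\<And>z. norm z < 1 \<Longrightarrow> cmod (f z * radial_d g z) \<le> A * (1 - (norm z)\<^sup>2) powr (- ((real CARD('n) + 1 + q) / p))) \<Longrightarrow>
    F_norm p q s (T_op g f) \<le> ennreal (C2 * A)"
    using F_norm_T_op_le[where 'n='n, OF p q s n] by blast
  show thesis
  proof (rule that[of "C2 * C1"])
    show "C2 * C1 > 0" using C1(1) C2(1) by simp
    fix u f :: "complex^'n \<Rightarrow> complex" and A M
    assume u: "holo (ball 0 1) u" and f: "holo (ball 0 1) f" and A: "0 \<le> A" and M: "0 < M"
      and bu: "bloch_norm \<alpha> \<beta> u \<le> ennreal A" and bf: "besov_norm N t f \<le> ennreal M"
    have "F_norm p q s (T_op u f) \<le> ennreal (C2 * (C1 * M * A))"
    proof (rule C2(2)[OF f u])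
      show "0 \<le> C1 * M * A" using C1(1) A M by simp
      fix z :: "complex^'n" assume z: "norm z < 1"
      define x where "x = 1 - (norm z)\<^sup>2"
      define L where "L = ln (2 / x)"
      have x: "x > 0" using one_minus_norm_pos[OF z] by (simp add: x_def)
      have w: "cmod (radial_d u z) * x powr \<alpha> * L powr \<beta> \<le> A"
        using bloch_weight_bound[OF bu A z] by (simp add: bloch_weight_def x_def L_def)
      have "cmod (f z * radial_d u z) = cmod (f z) * cmod (radial_d u z)" by (rule norm_mult)
      also have "\<dots> \<le> C1 * M * L powr \<beta> * cmod (radial_d u z)"
        using C1(2)[OF f M bf z] by (intro mult_right_mono) (auto simp: x_def L_def \<beta>_def)
      also have "\<dots> = C1 * M * (cmod (radial_d u z) * x powr \<alpha> * L powr \<beta>) * x powr (- \<alpha>)"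
        using x by (simp add: powr_minus field_simps)
      also have "\<dots> \<le> C1 * M * A * x powr (- \<alpha>)"
        using w C1(1) M by (intro mult_right_mono mult_left_mono) auto
      finally show "cmod (f z * radial_d u z) \<le> C1 * M * A * (1 - (norm z)\<^sup>2) powr (- ((real CARD('n) + 1 + q) / p))"
        by (simp only: x_def \<alpha>_def)
    qed
    then show "F_norm p q s (T_op u f) \<le> ennreal (C2 * C1 * (M * A))" by (simp add: mult_ac)
  qed
qed

lemma epowr_finite: "x < \<infinity> \<Longrightarrow> epowr x a < \<infinity>"
  by (auto simp: epowr_def)

lemma besov_norm_finite:
  fixes f :: "complex^'n \<Rightarrow> complex"
  assumes "\<And>m. sum m UNIV = N \<Longrightarrow> besov_term N t m f < \<infinity>" shows "besov_norm N t f < \<infinity>"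
proof -
  have "epowr (besov_term N t m f) (1 / t) < top" if "sum m UNIV = N" for m
    using epowr_finite[OF assms[OF that]] by simp
  then show ?thesis
    unfolding besov_norm_def using finite_multi_index[where 'n='n, of "N - 1"] finite_multi_index_eq[where 'n='n, of N] by simp
qed

text \<open>Membership of \<open>f\<close> in \<open>besov t\<close> provides some order with finite
  terms; the estimate is applied with that order, which may depend on \<open>f\<close>.\<close>

lemma T_op_in_F_space:
  fixes p q s t :: real and g :: "complex^'n \<Rightarrow> complex"
  assumes p: "0 < p" and q: "- real CARD('n) - 1 < q" and s: "1 < s" and n: "s * (real CARD('n) - 1) < real CARD('n)"
    and t: "1 \<le> t" and g: "g \<in> bloch ((real CARD('n) + 1 + q) / p) ((t - 1) / t)" and f: "f \<in> besov t"
  shows "T_op g f \<in> F_space p q s"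
proof -
  obtain N where N: "0 < N" "\<And>m. sum m UNIV = N \<Longrightarrow> besov_term N t m f < \<infinity>"
    using f unfolding besov_def by blast
  obtain M where M: "besov_norm N t f = ennreal M" "0 \<le> M"
    using besov_norm_finite[OF N(2)] by (cases "besov_norm N t f") auto
  have g': "g \<in> hol_ball" "bloch_norm ((real CARD('n) + 1 + q) / p) ((t - 1) / t) g < \<infinity>" using g by (simp_all add: bloch_def)
  then obtain A where A: "bloch_norm ((real CARD('n) + 1 + q) / p) ((t - 1) / t) g = ennreal A" "0 \<le> A"
    by (cases "bloch_norm ((real CARD('n) + 1 + q) / p) ((t - 1) / t) g") auto
  obtain C where C: "C > 0" "\<And>(u :: complex^'n \<Rightarrow> complex) f A M. holo (ball 0 1) u \<Longrightarrow> holo (ball 0 1) f \<Longrightarrow> 0 \<le> A \<Longrightarrow> 0 < M \<Longrightarrow>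
    bloch_norm ((real CARD('n) + 1 + q) / p) ((t - 1) / t) u \<le> ennreal A \<Longrightarrow> besov_norm N t f \<le> ennreal M \<Longrightarrow> F_norm p q s (T_op u f) \<le> ennreal (C * (M * A))"
    using F_norm_T_op_besov[where 'n='n, OF p q s n t N(1)] by blast
  have h: "holo (ball 0 1) g" "holo (ball 0 1) f" by (rule hol_ball_holo[OF g'(1)], rule besov_holo[OF f])
  have "F_norm p q s (T_op g f) \<le> ennreal (C * ((M + 1) * A))"
    by (rule C(2)[OF h A(2)]) (use M A in \<open>auto intro: ennreal_leI\<close>)
  then have "F_norm p q s (T_op g f) < \<infinity>" by (rule order_le_less_trans) simp
  then show ?thesis unfolding F_space_def using T_op_hol_ball[OF h(2,1)] by blast
qed

subsection \<open>Compactness for symbols in the little Bloch space\<close>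

lemma T_op_bounded:
  fixes p q s t :: real and h :: "complex^'n \<Rightarrow> complex"
  assumes p: "0 < p" and q: "- real CARD('n) - 1 < q" and s: "1 < s" and n: "s * (real CARD('n) - 1) < real CARD('n)"
    and t: "1 \<le> t" and N: "0 < N" and h: "h \<in> bloch ((real CARD('n) + 1 + q) / p) ((t - 1) / t)"
  shows "\<exists>C::real. \<forall>f\<in>besov t. F_norm p q s (T_op h f) \<le> ennreal C * besov_norm N t f"
proof -
  obtain C0 where C0: "C0 > 0" "\<And>(u :: complex^'n \<Rightarrow> complex) f A M. holo (ball 0 1) u \<Longrightarrow> holo (ball 0 1) f \<Longrightarrow> 0 \<le> A \<Longrightarrow> 0 < M \<Longrightarrow>
    bloch_norm ((real CARD('n) + 1 + q) / p) ((t - 1) / t) u \<le> ennreal A \<Longrightarrow> besov_norm N t f \<le> ennreal M \<Longrightarrow> F_norm p q s (T_op u f) \<le> ennreal (C0 * (M * A))"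
    using F_norm_T_op_besov[where 'n='n, OF p q s n t N(1)] by blast
  have h': "h \<in> hol_ball" "bloch_norm ((real CARD('n) + 1 + q) / p) ((t - 1) / t) h < \<infinity>" using h by (simp_all add: bloch_def)
  then obtain A where A: "bloch_norm ((real CARD('n) + 1 + q) / p) ((t - 1) / t) h = ennreal A" "0 \<le> A"
    by (cases "bloch_norm ((real CARD('n) + 1 + q) / p) ((t - 1) / t) h") auto
  define C where "C = C0 * A + 1"
  have C: "C > 0" "C0 * A \<le> C" using C0(1) A(2) by (simp_all add: C_def add_nonneg_pos)
  have "F_norm p q s (T_op h f) \<le> ennreal C * besov_norm N t f" if f: "f \<in> besov t" for f
  proof (cases "besov_norm N t f")
    case top
    then show ?thesis using C(1) by (simp add: ennreal_mult_top)
  next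
    case (real m)
    have "F_norm p q s (T_op h f) \<le> ennreal (C * m)"
    \<comment> \<open>The estimate asks for a positive bound on the Besov norm, but \<open>m\<close>
      may be 0; hence the excess \<open>e / C\<close>.\<close>
    proof (rule ennreal_le_epsilon)
      fix e :: real assume e: "0 < e"
      have "F_norm p q s (T_op h f) \<le> ennreal (C0 * ((m + e / C) * A))"
        by (rule C0(2)[OF hol_ball_holo[OF h'(1)] besov_holo[OF f] A(2)])
          (use real e C(1) A in \<open>auto intro: ennreal_leI add_nonneg_pos\<close>)
      also have "\<dots> \<le> ennreal (C * m + e)"
      proof (rule ennreal_leI)
        have "C0 * ((m + e / C) * A) = (C0 * A) * (m + e / C)" by (simp only: mult_ac)
        also have "\<dots> \<le> C * (m + e / C)" using C e real(1) by (intro mult_right_mono) auto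
        also have "\<dots> = C * m + e" using C(1) by (simp add: distrib_left)
        finally show "C0 * ((m + e / C) * A) \<le> C * m + e" .
      qed
      also have "\<dots> = ennreal (C * m) + ennreal e" using C(1) e real(1) by (intro ennreal_plus) auto
      finally show "F_norm p q s (T_op h f) \<le> ennreal (C * m) + ennreal e" .
    qed
    then show ?thesis using real C(1) by (simp add: ennreal_mult)
  qed
  then show ?thesis by blast
qed

text \<open>Near the sphere the weighted derivative of the symbol is small and the growth bound
  controls the functions; on the remaining ball the functions themselves become uniformly small and
  the weighted derivative is bounded.\<close>

lemma T_op_little_bloch_tendsto_0:
  fixes p q s t :: real and h :: "complex^'n \<Rightarrow> complex"
  assumes p: "0 < p" and q: "- real CARD('n) - 1 < q" and s: "1 < s" and n: "s * (real CARD('n) - 1) < real CARD('n)"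
    and t: "1 \<le> t" and N: "0 < N" and h: "h \<in> little_bloch ((real CARD('n) + 1 + q) / p) ((t - 1) / t)"
    and f: "\<And>k. holo (ball 0 1) (f k)" "\<And>k. besov_norm N t (f k) \<le> ennreal M"
    and lim: "\<And>S. compact S \<Longrightarrow> S \<subseteq> ball 0 1 \<Longrightarrow> uniform_limit S f (\<lambda>z. 0) sequentially"
  shows "(\<lambda>k. F_norm p q s (T_op h (f k))) \<longlonglongrightarrow> 0"
proof (rule tendsto_0_ennrealI)
  fix e :: real assume e: "0 < e"
  define \<alpha> where "\<alpha> = (real CARD('n) + 1 + q) / p"
  define \<beta> where "\<beta> = (t - 1) / t"
  have \<beta>: "0 \<le> \<beta>" using t by (simp add: \<beta>_def)
  obtain C1 where C1: "C1 > 0" "\<And>(f :: complex^'n \<Rightarrow> complex) M z. holo (ball 0 1) f \<Longrightarrow> 0 < M \<Longrightarrow>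
    besov_norm N t f \<le> ennreal M \<Longrightarrow> norm z < 1 \<Longrightarrow>
    cmod (f z) \<le> C1 * M * ln (2 / (1 - (norm z)\<^sup>2)) powr ((t - 1) / t)"
    using besov_growth[where 'n='n, OF t N] by blast
  obtain C2 where C2: "C2 > 0" "\<And>(f :: complex^'n \<Rightarrow> complex) g A. holo (ball 0 1) f \<Longrightarrow> holo (ball 0 1) g \<Longrightarrow> 0 \<le> A \<Longrightarrow>
    (\<And>z. norm z < 1 \<Longrightarrow> cmod (f z * radial_d g z) \<le> A * (1 - (norm z)\<^sup>2) powr (- ((real CARD('n) + 1 + q) / p))) \<Longrightarrow>
    F_norm p q s (T_op g f) \<le> ennreal (C2 * A)"
    using F_norm_T_op_le[where 'n='n, OF p q s n] by blast
  have h': "h \<in> hol_ball" "bloch_norm \<alpha> \<beta> h < \<infinity>" "(bloch_weight \<alpha> \<beta> h \<longlongrightarrow> 0) to_sphere"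
    using h by (simp_all add: bloch_def little_bloch_def \<alpha>_def \<beta>_def)
  then obtain A where A: "bloch_norm \<alpha> \<beta> h = ennreal A" "0 \<le> A" by (cases "bloch_norm \<alpha> \<beta> h") auto
  define M1 where "M1 = \<bar>M\<bar> + 1"
  \<comment> \<open>The first summand serves points near the sphere, the second those with norm at
    most \<delta>, where the logarithm is replaced by its minimum ln 2.\<close>
  define D where "D = C1 * M1 + A * ln 2 powr (- \<beta>)"
  have M1: "M1 > 0" "M \<le> M1" by (simp_all add: M1_def)
  have D: "D > 0" using C1(1) M1(1) A(2) by (simp add: D_def add_pos_nonneg)
  define \<epsilon> where "\<epsilon> = e / (C2 * D)"
  have \<epsilon>: "\<epsilon> > 0" using e C2(1) D by (simp add: \<epsilon>_def)
  obtain \<delta> where \<delta>: "\<delta> < 1" "\<And>z. \<delta> < norm z \<Longrightarrow> norm z < 1 \<Longrightarrow> bloch_weight \<alpha> \<beta> h z < \<epsilon>"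
    using order_tendstoD(2)[OF h'(3) \<epsilon>] unfolding eventually_to_sphere by blast
  have "uniform_limit (cball 0 \<delta>) f (\<lambda>z. 0) sequentially" using \<delta>(1) by (intro lim) auto
  from uniform_limitD[OF this \<epsilon>] show "\<forall>\<^sub>F k in sequentially. F_norm p q s (T_op h (f k)) \<le> ennreal e"
  proof eventually_elim
    case (elim k)
    have "F_norm p q s (T_op h (f k)) \<le> ennreal (C2 * (\<epsilon> * D))"
    proof (rule C2(2)[OF f(1) hol_ball_holo[OF h'(1)]])
      show "0 \<le> \<epsilon> * D" using \<epsilon> D by simp
      fix z :: "complex^'n" assume z: "norm z < 1"
      define x where "x = 1 - (norm z)\<^sup>2"
      define L where "L = ln (2 / x)"
      have x: "x > 0" using one_minus_norm_pos[OF z] by (simp add: x_def)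
      have L: "ln 2 \<le> L" "0 < L" using log_weight_ge[OF z] by (simp_all add: L_def x_def)
      have w: "cmod (radial_d h z) * x powr \<alpha> * L powr \<beta> = bloch_weight \<alpha> \<beta> h z"
        by (simp add: bloch_weight_def x_def L_def)
      have "cmod (f k z * radial_d h z) \<le> \<epsilon> * D * x powr (- \<alpha>)"
      proof (cases "\<delta> < norm z")
        case True
        have "cmod (f k z * radial_d h z) = cmod (f k z) * cmod (radial_d h z)" by (rule norm_mult)
        also have "\<dots> \<le> C1 * M1 * L powr \<beta> * cmod (radial_d h z)"
          using C1(2)[OF f(1) M1(1) order_trans[OF f(2) ennreal_leI[OF M1(2)]] z]
          by (intro mult_right_mono) (simp_all add: x_def L_def \<beta>_def)
        also have "\<dots> = C1 * M1 * (cmod (radial_d h z) * x powr \<alpha> * L powr \<beta>) * x powr (- \<alpha>)"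
          using x by (simp add: powr_minus field_simps)
        also have "\<dots> \<le> C1 * M1 * \<epsilon> * x powr (- \<alpha>)"
          using \<delta>(2)[OF True z] C1(1) M1(1) unfolding w by (intro mult_right_mono mult_left_mono) simp_all
        also have "\<dots> \<le> D * \<epsilon> * x powr (- \<alpha>)"
          using A(2) \<epsilon> by (intro mult_right_mono) (simp_all add: D_def)
        finally show ?thesis by (simp only: mult_ac)
      next
        case False
        then have "dist (f k z) 0 < \<epsilon>" using elim by simp
        then have "cmod (f k z) \<le> \<epsilon>" by simp
        then have "cmod (f k z) * cmod (radial_d h z) \<le> \<epsilon> * cmod (radial_d h z)" by (rule mult_right_mono) simp
        also have "\<dots> = \<epsilon> * (cmod (radial_d h z) * x powr \<alpha> * L powr \<beta>) * (x powr (- \<alpha>) * L powr (- \<beta>))"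
          using x L(2) by (simp add: powr_minus field_simps)
        also have "\<dots> \<le> \<epsilon> * A * (x powr (- \<alpha>) * ln 2 powr (- \<beta>))"
        proof (intro mult_mono)
          show "cmod (radial_d h z) * x powr \<alpha> * L powr \<beta> \<le> A"
            unfolding w by (rule bloch_weight_bound[OF _ A(2) z]) (simp add: A(1))
          show "L powr - \<beta> \<le> ln 2 powr - \<beta>" using L(1) \<beta> by (intro powr_mono2') simp_all
        qed (use \<epsilon> A(2) in simp_all)
        also have "\<dots> = (A * ln 2 powr (- \<beta>)) * (\<epsilon> * x powr (- \<alpha>))" by (simp only: mult_ac)
        also have "\<dots> \<le> D * (\<epsilon> * x powr (- \<alpha>))"
          using C1(1) M1(1) \<epsilon> by (intro mult_right_mono) (simp_all add: D_def)
        finally show ?thesis by (simp only: mult_ac norm_mult)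
      qed
      then show "cmod (f k z * radial_d h z) \<le> \<epsilon> * D * (1 - (norm z)\<^sup>2) powr (- ((real CARD('n) + 1 + q) / p))"
        by (simp only: x_def \<alpha>_def)
    qed
    also have "C2 * (\<epsilon> * D) = e" using C2(1) D by (simp add: \<epsilon>_def)
    finally show ?case .
  qed
qed

lemma linear_op_T_op: "g \<in> hol_ball \<Longrightarrow> linear_op (besov t) (T_op g)"
  unfolding linear_op_def by (intro ballI allI T_op_linear besov_holo hol_ball_holo)

lemma compact_op_T_op:
  fixes p q s t :: real and h :: "complex^'n \<Rightarrow> complex"
  assumes p: "0 < p" and q: "- real CARD('n) - 1 < q" and s: "1 < s" and n: "s * (real CARD('n) - 1) < real CARD('n)"
    and t: "1 \<le> t" and N: "0 < N" and h: "h \<in> little_bloch ((real CARD('n) + 1 + q) / p) ((t - 1) / t)"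
  shows "compact_op (besov t) (besov_norm N t) (F_space p q s) (F_norm p q s) (T_op h)"
proof -
  have hb: "h \<in> bloch ((real CARD('n) + 1 + q) / p) ((t - 1) / t)" using h by (simp add: little_bloch_def)
  then have h0: "h \<in> hol_ball" by (simp add: bloch_def)
  show ?thesis
    unfolding compact_op_def
  proof (intro conjI allI impI)
    show "linear_op (besov t) (T_op h)" by (rule linear_op_T_op[OF h0])
    show "T_op h ` besov t \<subseteq> F_space p q s" using T_op_in_F_space[OF p q s n t hb] by (intro image_subsetI)
    show "\<exists>C::real. \<forall>f\<in>besov t. F_norm p q s (T_op h f) \<le> ennreal C * besov_norm N t f"
      by (rule T_op_bounded[OF p q s n t N hb])
    fix f :: "nat \<Rightarrow> complex^'n \<Rightarrow> complex"
    assume f: "range f \<subseteq> besov t \<and> (\<exists>M::real. \<forall>k. besov_norm N t (f k) \<le> ennreal M) \<and>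
        (\<forall>S. compact S \<and> S \<subseteq> ball 0 1 \<longrightarrow> uniform_limit S f (\<lambda>z. 0) sequentially)"
    then obtain M where M: "\<And>k. besov_norm N t (f k) \<le> ennreal M" by blast
    have b: "f k \<in> besov t" for k using f by blast
    show "(\<lambda>k. F_norm p q s (T_op h (f k))) \<longlonglongrightarrow> 0"
      by (rule T_op_little_bloch_tendsto_0[OF p q s n t N h besov_holo[OF b] M]) (use f in blast)
  qed
qed

lemma ess_norm_le_dist:
  fixes p q s t :: real
  assumes p: "0 < p" and q: "- real CARD('n) - 1 < q" and s: "1 < s" and n: "s * (real CARD('n) - 1) < real CARD('n)"
    and t: "1 \<le> t" and N: "0 < N"
  defines "\<alpha> \<equiv> (real CARD('n) + 1 + q) / p" and "\<beta> \<equiv> (t - 1) / t"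
  obtains C where "C > 0" "\<And>g :: complex^'n \<Rightarrow> complex. g \<in> bloch \<alpha> \<beta> \<Longrightarrow>
    ess_norm (besov t) (besov_norm N t) (F_space p q s) (F_norm p q s) (T_op g)
      \<le> ennreal C * dist_to (bloch_norm \<alpha> \<beta>) g (little_bloch \<alpha> \<beta>)"
proof -
  obtain C where C: "C > 0" "\<And>(u :: complex^'n \<Rightarrow> complex) f A M. holo (ball 0 1) u \<Longrightarrow> holo (ball 0 1) f \<Longrightarrow> 0 \<le> A \<Longrightarrow> 0 < M \<Longrightarrow>
    bloch_norm \<alpha> \<beta> u \<le> ennreal A \<Longrightarrow> besov_norm N t f \<le> ennreal M \<Longrightarrow> F_norm p q s (T_op u f) \<le> ennreal (C * (M * A))"
    unfolding \<alpha>_def \<beta>_def using F_norm_T_op_besov[where 'n='n, OF p q s n t N(1)] by blast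
  show thesis
  proof (rule that[OF C(1)])
    fix g :: "complex^'n \<Rightarrow> complex" assume g: "g \<in> bloch \<alpha> \<beta>"
    then have g': "holo (ball 0 1) g" by (intro hol_ball_holo) (simp add: bloch_def)
    show "ess_norm (besov t) (besov_norm N t) (F_space p q s) (F_norm p q s) (T_op g)
      \<le> ennreal C * dist_to (bloch_norm \<alpha> \<beta>) g (little_bloch \<alpha> \<beta>)"
      unfolding dist_to_def
    proof (rule le_mult_INF_ennreal[OF C(1)])
      fix h :: "complex^'n \<Rightarrow> complex" assume h: "h \<in> little_bloch \<alpha> \<beta>"
      then have h': "holo (ball 0 1) h" by (intro hol_ball_holo) (simp add: bloch_def little_bloch_def)
      have "compact_op (besov t) (besov_norm N t) (F_space p q s) (F_norm p q s) (T_op h)"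
        using h unfolding \<alpha>_def \<beta>_def by (rule compact_op_T_op[OF p q s n t N])
      then have "ess_norm (besov t) (besov_norm N t) (F_space p q s) (F_norm p q s) (T_op g)
          \<le> op_norm (besov t) (besov_norm N t) (F_norm p q s) (\<lambda>f z. T_op g f z - T_op h f z)"
        unfolding ess_norm_def by (intro INF_lower) simp
      also have "\<dots> \<le> ennreal C * bloch_norm \<alpha> \<beta> (\<lambda>z. g z - h z)"
      proof (cases "bloch_norm \<alpha> \<beta> (\<lambda>z. g z - h z)")
        case top
        then show ?thesis using C(1) by (simp add: ennreal_mult_top)
      next
        case (real A)
        show ?thesis
          unfolding op_norm_def
        proof (rule SUP_least)
          fix f :: "complex^'n \<Rightarrow> complex" assume "f \<in> {f \<in> besov t. besov_norm N t f \<le> 1}"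
          then have f: "holo (ball 0 1) f" "besov_norm N t f \<le> ennreal 1" using besov_holo by auto
          have "F_norm p q s (T_op (\<lambda>z. g z - h z) f) \<le> ennreal (C * (1 * A))"
            by (rule C(2)[OF holo_diff[OF g' h'] f(1) real(1) zero_less_one _ f(2)]) (simp add: real(2))
          then show "F_norm p q s (\<lambda>z. T_op g f z - T_op h f z) \<le> ennreal C * bloch_norm \<alpha> \<beta> (\<lambda>z. g z - h z)"
            unfolding T_op_diff_symbol[OF f(1) h' g'] real(2) using C(1) real(1) by (simp add: ennreal_mult)
        qed
      qed
      finally show "ess_norm (besov t) (besov_norm N t) (F_space p q s) (F_norm p q s) (T_op g)
          \<le> ennreal C * bloch_norm \<alpha> \<beta> (\<lambda>z. g z - h z)" .
    qed
  qed
qed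

subsection \<open>The lower bound for the essential norm\<close>

lemma F_space_hol_ball: "u \<in> F_space p q s \<Longrightarrow> u \<in> hol_ball"
  by (simp add: F_space_def)

lemma compact_op_tendsto:
  assumes K: "compact_op X nX Y nY K" and f: "range f \<subseteq> X" "\<exists>M::real. \<forall>k. nX (f k) \<le> ennreal M"
    "\<And>S. compact S \<Longrightarrow> S \<subseteq> ball 0 1 \<Longrightarrow> uniform_limit S f (\<lambda>z. 0) sequentially"
  shows "(\<lambda>k. nY (K (f k))) \<longlonglongrightarrow> 0"
proof -
  have *: "range f \<subseteq> X \<and> (\<exists>M::real. \<forall>k. nX (f k) \<le> ennreal M) \<and>
    (\<forall>S. compact S \<and> S \<subseteq> ball 0 1 \<longrightarrow> uniform_limit S f (\<lambda>z. 0) sequentially)"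
    by (intro conjI f(1,2) allI impI f(3)) (erule conjunct1, erule conjunct2)
  from K have "\<forall>f. range f \<subseteq> X \<and> (\<exists>M::real. \<forall>k. nX (f k) \<le> ennreal M) \<and>
      (\<forall>S. compact S \<and> S \<subseteq> ball 0 1 \<longrightarrow> uniform_limit S f (\<lambda>z. 0) sequentially)
      \<longrightarrow> (\<lambda>k. nY (K (f k))) \<longlonglongrightarrow> 0"
    unfolding compact_op_def by (elim conjE)
  from mp[OF spec[OF this, of f] *] show ?thesis .
qed

text \<open>At the point \<open>w k\<close> the lower bound of the test function converts the weight
  of \<open>g\<close> into the radial derivative of its image, which splits into the part of the
  difference and the part of \<open>K\<close>. Each part is bounded by its own
  \<open>F_norm\<close>, so the triangle inequality is used between complex numbers only.\<close>

lemma Limsup_le_ess_norm: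
  fixes p q s t :: real
  assumes p: "0 < p" and q: "- real CARD('n) - 1 < q" and s: "0 \<le> s" and t: "1 \<le> t"
    and N: "0 < N" "real CARD('n) / t < real N"
  defines "\<alpha> \<equiv> (real CARD('n) + 1 + q) / p" and "\<beta> \<equiv> (t - 1) / t"
  obtains C where "C > 0" "\<And>g :: complex^'n \<Rightarrow> complex. g \<in> hol_ball \<Longrightarrow>
    Limsup to_sphere (\<lambda>z. ennreal (bloch_weight \<alpha> \<beta> g z)) \<le>
      ennreal C * ess_norm (besov t) (besov_norm N t) (F_space p q s) (F_norm p q s) (T_op g)"
proof -
  obtain C where C: "C > 0" "\<And>(u :: complex^'n \<Rightarrow> complex) z. u \<in> hol_ball \<Longrightarrow> norm z < 1 \<Longrightarrow>
    ennreal (cmod (radial_d u z) * (1 - (norm z)\<^sup>2) powr ((real CARD('n) + 1 + q) / p)) \<le> ennreal C * F_norm p q s u"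
    using F_norm_ge_radial[where 'n='n, OF p q s] by blast
  show thesis
  proof (rule besov_test_functions[where 'n='n, OF t N])
    fix c :: real and F :: "complex^'n \<Rightarrow> complex^'n \<Rightarrow> complex"
    assume c: "c > 0"
      and F: "\<And>w. norm w < 1 \<Longrightarrow> F w \<in> besov t"
      "\<And>w. norm w < 1 \<Longrightarrow> besov_norm N t (F w) \<le> 1"
      "\<And>w. norm w < 1 \<Longrightarrow> c * ln (2 / (1 - (norm w)\<^sup>2)) powr ((t - 1) / t) \<le> cmod (F w w)"
      and Flim: "\<And>w S. (\<And>k. norm (w k) < 1) \<Longrightarrow> (\<lambda>k. norm (w k)) \<longlonglongrightarrow> 1 \<Longrightarrow>
         compact S \<Longrightarrow> S \<subseteq> ball 0 1 \<Longrightarrow> uniform_limit S (\<lambda>k. F (w k)) (\<lambda>z. 0) sequentially"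
    show thesis
    proof (rule that[of "C / c"])
      show "C / c > 0" using C(1) c by simp
      fix g :: "complex^'n \<Rightarrow> complex" assume g: "g \<in> hol_ball"
      note gh = hol_ball_holo[OF g]
      show "Limsup to_sphere (\<lambda>z. ennreal (bloch_weight \<alpha> \<beta> g z)) \<le>
        ennreal (C / c) * ess_norm (besov t) (besov_norm N t) (F_space p q s) (F_norm p q s) (T_op g)"
        unfolding ess_norm_def
      proof (rule le_mult_INF_ennreal)
        show "C / c > 0" using C(1) c by simp
        fix K :: "(complex^'n \<Rightarrow> complex) \<Rightarrow> complex^'n \<Rightarrow> complex"
        assume "K \<in> {K. compact_op (besov t) (besov_norm N t) (F_space p q s) (F_norm p q s) K}"
        then have cK: "compact_op (besov t) (besov_norm N t) (F_space p q s) (F_norm p q s) K" by (rule CollectD)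
        have K: "K ` besov t \<subseteq> F_space p q s"
          using cK unfolding compact_op_def by (elim conjE)
        define E where "E = op_norm (besov t) (besov_norm N t) (F_norm p q s) (\<lambda>f z. T_op g f z - K f z)"
        show "Limsup to_sphere (\<lambda>z. ennreal (bloch_weight \<alpha> \<beta> g z)) \<le> ennreal (C / c) *
            op_norm (besov t) (besov_norm N t) (F_norm p q s) (\<lambda>f z. T_op g f z - K f z)"
          unfolding E_def[symmetric]
        \<comment> \<open>For \<open>y\<close> strictly below the limes superior, points with weight
          at least \<open>y\<close> accumulate at the sphere. A sequence of them suffices, and the
          limit in \<open>k\<close> is taken with \<open>y\<close> fixed.\<close>
        proof (rule dense_le)
          fix y assume y: "y < Limsup to_sphere (\<lambda>z. ennreal (bloch_weight \<alpha> \<beta> g z))"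
          have "\<not> (\<forall>\<^sub>F z in to_sphere. ennreal (bloch_weight \<alpha> \<beta> g z) \<le> y)"
            using y Limsup_bounded[of "\<lambda>z. ennreal (bloch_weight \<alpha> \<beta> g z)" y to_sphere] by (meson not_le)
          then have ex: "\<exists>z. \<delta> < norm z \<and> norm z < 1 \<and> y \<le> ennreal (bloch_weight \<alpha> \<beta> g z)" if "\<delta> < 1" for \<delta>
            using that unfolding eventually_to_sphere by (meson nle_le)
          have "\<exists>z. 1 - 1 / real (Suc k) < norm z \<and> norm z < 1 \<and> y \<le> ennreal (bloch_weight \<alpha> \<beta> g z)" for k
            by (rule ex) simp
          then obtain w where w: "\<And>k. 1 - 1 / real (Suc k) < norm (w k)" "\<And>k. norm (w k) < 1"
            "\<And>k. y \<le> ennreal (bloch_weight \<alpha> \<beta> g (w k))" by metis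
          have lim: "(\<lambda>k. norm (w k)) \<longlonglongrightarrow> 1"
          proof (rule tendsto_sandwich)
            have "(\<lambda>k. 1 - 1 / real (Suc k)) \<longlonglongrightarrow> 1 - 0"
              by (intro tendsto_diff tendsto_const) (rule LIMSEQ_Suc[OF lim_1_over_n])
            then show "(\<lambda>k. 1 - 1 / real (Suc k)) \<longlonglongrightarrow> 1" by simp
            show "\<forall>\<^sub>F k in sequentially. 1 - 1 / real (Suc k) \<le> norm (w k)" using w(1) by (simp add: less_imp_le)
            show "\<forall>\<^sub>F k in sequentially. norm (w k) \<le> 1" using w(2) by (simp add: less_imp_le)
          qed simp
          have K0: "(\<lambda>k. F_norm p q s (K (F (w k)))) \<longlonglongrightarrow> 0"
          proof (rule compact_op_tendsto[OF cK])
            show "range (\<lambda>k. F (w k)) \<subseteq> besov t" using F(1)[OF w(2)] by (rule image_subsetI)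
            show "\<exists>M::real. \<forall>k. besov_norm N t (F (w k)) \<le> ennreal M"
              using F(2)[OF w(2)] by (intro exI[of _ 1]) simp
            show "uniform_limit S (\<lambda>k. F (w k)) (\<lambda>z. 0) sequentially" if "compact S" "S \<subseteq> ball 0 1" for S
              using that by (intro Flim w(2) lim)
          qed
          have le: "ennreal c * y \<le> ennreal C * E + ennreal C * F_norm p q s (K (F (w k)))" for k
          proof -
            define v where "v = w k"
            define x where "x = 1 - (norm v)\<^sup>2"
            have v: "norm v < 1" using w(2) by (simp add: v_def)
            have b: "F v \<in> besov t" by (rule F(1)[OF v])
            have Kb: "K (F v) \<in> hol_ball" by (rule F_space_hol_ball[OF subsetD[OF K imageI[OF b]]])
            have Tb: "T_op g (F v) \<in> hol_ball" by (rule T_op_hol_ball[OF besov_holo[OF b] gh])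
            have x: "x > 0" using one_minus_norm_pos[OF v] by (simp add: x_def)
            have "ennreal c * y \<le> ennreal c * ennreal (bloch_weight \<alpha> \<beta> g v)"
              unfolding v_def by (intro mult_left_mono w(3)) simp
            also have "\<dots> = ennreal (c * bloch_weight \<alpha> \<beta> g v)"
              using c by (simp add: ennreal_mult bloch_weight_wt wt_nonneg)
            also have "\<dots> \<le> ennreal (cmod (radial_d (\<lambda>z. T_op g (F v) z - K (F v) z) v) * x powr \<alpha>
                + cmod (radial_d (K (F v)) v) * x powr \<alpha>)"
            proof (rule ennreal_leI)
              have "c * bloch_weight \<alpha> \<beta> g v = (c * ln (2 / x) powr \<beta>) * (cmod (radial_d g v) * x powr \<alpha>)"
                by (simp add: bloch_weight_def x_def mult_ac)
              also have "\<dots> \<le> cmod (F v v) * (cmod (radial_d g v) * x powr \<alpha>)"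
                using F(3)[OF v] by (intro mult_right_mono) (simp_all add: x_def \<beta>_def)
              also have "\<dots> = cmod (radial_d (T_op g (F v)) v) * x powr \<alpha>"
                unfolding T_op_radial_d[OF besov_holo[OF b] gh v] by (simp add: norm_mult)
              also have "\<dots> \<le> (cmod (radial_d (\<lambda>z. T_op g (F v) z - K (F v) z) v) + cmod (radial_d (K (F v)) v)) * x powr \<alpha>"
                unfolding radial_d_diff[OF Tb Kb v]
                using norm_triangle_ineq[of "radial_d (T_op g (F v)) v - radial_d (K (F v)) v" "radial_d (K (F v)) v"]
                by (intro mult_right_mono) simp_all
              finally show "c * bloch_weight \<alpha> \<beta> g v \<le> cmod (radial_d (\<lambda>z. T_op g (F v) z - K (F v) z) v) * x powr \<alpha>
                + cmod (radial_d (K (F v)) v) * x powr \<alpha>" by (simp only: distrib_right)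
            qed
            also have "\<dots> = ennreal (cmod (radial_d (\<lambda>z. T_op g (F v) z - K (F v) z) v) * x powr \<alpha>)
                + ennreal (cmod (radial_d (K (F v)) v) * x powr \<alpha>)" by (intro ennreal_plus) simp_all
            also have "\<dots> \<le> ennreal C * F_norm p q s (\<lambda>z. T_op g (F v) z - K (F v) z) + ennreal C * F_norm p q s (K (F v))"
              unfolding x_def \<alpha>_def by (rule add_mono[OF C(2)[OF hol_ball_diff[OF Tb Kb] v] C(2)[OF Kb v]])
            also have "\<dots> \<le> ennreal C * E + ennreal C * F_norm p q s (K (F v))"
            proof (intro add_right_mono mult_left_mono)
              show "F_norm p q s (\<lambda>z. T_op g (F v) z - K (F v) z) \<le> E"
                unfolding E_def op_norm_def by (rule SUP_upper2[of "F v"]) (use b F(2)[OF v] in simp_all)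
            qed simp
            finally show ?thesis unfolding v_def .
          qed
          have "(\<lambda>k. ennreal C * E + ennreal C * F_norm p q s (K (F (w k)))) \<longlonglongrightarrow> ennreal C * E + ennreal C * 0"
            by (intro tendsto_add tendsto_const ennreal_tendsto_cmult K0) simp
          then have "ennreal c * y \<le> ennreal C * E + ennreal C * 0"
            by (rule LIMSEQ_le_const) (intro exI[of _ 0] allI impI le)
          then have "ennreal c * y \<le> ennreal C * E" by simp
          then have "ennreal (inverse c) * (ennreal c * y) \<le> ennreal (inverse c) * (ennreal C * E)"
            by (rule mult_left_mono) simp
          moreover have "ennreal (inverse c) * (ennreal c * y) = ennreal (inverse c * c) * y"
            using c by (simp add: ennreal_mult mult.assoc del: left_inverse)
          moreover have "ennreal (inverse c) * (ennreal C * E) = ennreal (C / c) * E"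
            using c C(1) by (subst mult.assoc[symmetric], subst ennreal_mult[symmetric]) (simp_all only: divide_inverse mult.commute less_imp_le inverse_nonnegative_iff_nonnegative)
          ultimately show "y \<le> ennreal (C / c) * E" using c by simp
        qed
      qed
    qed
  qed
qed

subsection \<open>The degenerate range of exponents\<close>

lemma T_op_eq_0:
  assumes "\<And>z. norm z < 1 \<Longrightarrow> radial_d g z = 0" shows "T_op g f = (\<lambda>z. 0)"
proof
  fix z
  show "T_op g f z = 0"
  proof (cases "norm z < 1")
    case True
    have "radial_d g (r *\<^sub>R z) = 0" if "r \<in> {0<..<1}" for r :: real
    proof (rule assms)
      have "r * norm z \<le> 1 * norm z" using that by (intro mult_right_mono) auto
      then show "norm (r *\<^sub>R z) < 1" using that True by simp
    qed
    then have "(\<lambda>r::real. indicator {0<..<1} r *\<^sub>R (f (r *\<^sub>R z) * radial_d g (r *\<^sub>R z) / of_real r)) = (\<lambda>r. 0)"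
      by (intro ext) (simp add: indicator_def)
    then show ?thesis by (simp add: T_op_def set_lebesgue_integral_def)
  qed (simp add: T_op_def)
qed

lemma F_norm_0: "0 < p \<Longrightarrow> F_norm p q s (\<lambda>z :: complex^'n. 0) = 0"
proof -
  assume p: "0 < p"
  have "grad (\<lambda>z. 0) w = 0" for w :: "complex^'n" by (simp add: grad_def partial_d_def vec_eq_iff)
  then show ?thesis using p by (simp add: F_norm_def epowr_def)
qed

lemma compact_op_0:
  assumes p: "0 < p"
  shows "compact_op (besov t) (besov_norm N t) (F_space p q s :: (complex^'n \<Rightarrow> complex) set) (F_norm p q s) (\<lambda>f z. 0)"
proof -
  have "(\<lambda>z. 0) \<in> (hol_ball :: (complex^'n \<Rightarrow> complex) set)" by (rule hol_ballI) (simp_all add: holo_const)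
  then have "(\<lambda>z. 0) \<in> (F_space p q s :: (complex^'n \<Rightarrow> complex) set)" by (simp add: F_space_def F_norm_0[OF p])
  then show ?thesis
    unfolding compact_op_def linear_op_def F_norm_0[OF p] by (intro conjI exI[of _ 0]) auto
qed

text \<open>Images have zero gradient. At each \<open>z\<close> the test function \<open>F z\<close>
  does not vanish at its own centre, so the radial derivative of \<open>g\<close> vanishes there;
  the operator is then zero, and the zero operator is compact.\<close>

lemma ess_norm_degenerate:
  fixes p q s t :: real and g :: "complex^'n \<Rightarrow> complex"
  assumes p: "0 < p" and q: "- real CARD('n) - 1 < q" and s: "1 < s" and n: "real CARD('n) \<le> s * (real CARD('n) - 1)"
    and t: "1 \<le> t" and N: "0 < N" "real CARD('n) / t < real N"
    and g: "g \<in> hol_ball" and maps: "T_op g ` besov t \<subseteq> F_space p q s"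
  shows "ess_norm (besov t) (besov_norm N t) (F_space p q s) (F_norm p q s) (T_op g) = 0"
proof (rule besov_test_functions[where 'n='n, OF t N])
  fix c :: real and F :: "complex^'n \<Rightarrow> complex^'n \<Rightarrow> complex"
  assume c: "c > 0"
    and F: "\<And>w. norm w < 1 \<Longrightarrow> F w \<in> besov t"
    "\<And>w. norm w < 1 \<Longrightarrow> c * ln (2 / (1 - (norm w)\<^sup>2)) powr ((t - 1) / t) \<le> cmod (F w w)"
  have "radial_d g z = 0" if z: "norm z < 1" for z
  proof -
    have "T_op g (F z) \<in> F_space p q s" using maps F(1)[OF z] by blast
    then have "grad (T_op g (F z)) z = 0" by (rule F_space_degenerate[OF p q s n _ z])
    then have "radial_d (T_op g (F z)) z = 0" using norm_dh_le[of "T_op g (F z)" z z] by (simp add: radial_d_dh)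
    then have "F z z * radial_d g z = 0"
      unfolding T_op_radial_d[OF besov_holo[OF F(1)[OF z]] hol_ball_holo[OF g] z] .
    moreover have "0 < c * ln (2 / (1 - (norm z)\<^sup>2)) powr ((t - 1) / t)"
      using c log_weight_ge(3)[OF z] by simp
    then have "F z z \<noteq> 0" using F(2)[OF z] by auto
    ultimately show ?thesis by simp
  qed
  then have T: "T_op g f = (\<lambda>z. 0)" for f by (rule T_op_eq_0)
  have "ess_norm (besov t) (besov_norm N t) (F_space p q s) (F_norm p q s) (T_op g)
     \<le> op_norm (besov t) (besov_norm N t) (F_norm p q s) (\<lambda>f z. T_op g f z - 0)"
    unfolding ess_norm_def by (rule INF_lower) (simp add: compact_op_0[OF p])
  also have "\<dots> \<le> 0" unfolding op_norm_def T by (rule SUP_least) (simp add: F_norm_0[OF p])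
  finally show "ess_norm (besov t) (besov_norm N t) (F_space p q s) (F_norm p q s) (T_op g) = 0" by simp
qed

lemma comparableI:
  assumes "0 < C1" "0 < C2" "A \<le> ennreal C1 * B" "B \<le> ennreal C2 * A" "C1 \<le> C" "C2 \<le> C"
  shows "comparable C A B"
proof -
  have "0 < C" using assms by simp
  moreover have "B \<le> ennreal C * A"
    by (rule order_trans[OF assms(4)]) (intro mult_right_mono ennreal_leI assms(6), simp)
  ultimately have "ennreal (inverse C) * B \<le> A" by (rule inverse_mult_le_ennreal)
  moreover have "A \<le> ennreal C * B"
    by (rule order_trans[OF assms(3)]) (intro mult_right_mono ennreal_leI assms(5), simp)
  ultimately show ?thesis unfolding comparable_def ..
qed

theorem theorem4p2:
  fixes t p q s :: real and N :: nat
  assumes "1 \<le> t" "0 < p" "- real CARD('n::finite) - 1 < q" "1 < s" "s + q > -1"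
    and "N > 0" "real N > real CARD('n) / t"
  defines "\<alpha> \<equiv> (real CARD('n) + 1 + q) / p" and "\<beta> \<equiv> (t - 1) / t"
  shows "\<exists>C>0. \<forall>g \<in> (bloch \<alpha> \<beta> :: (complex^'n \<Rightarrow> complex) set).
     (real CARD('n) \<le> s * (real CARD('n) - 1) \<longrightarrow> T_op g ` besov t \<subseteq> F_space p q s) \<longrightarrow>
     comparable C
       (ess_norm (besov t) (besov_norm N t) (F_space p q s) (F_norm p q s) (T_op g))
       (dist_to (bloch_norm \<alpha> \<beta>) g (little_bloch \<alpha> \<beta>)) \<and>
     comparable C
       (dist_to (bloch_norm \<alpha> \<beta>) g (little_bloch \<alpha> \<beta>))
       (Limsup to_sphere (\<lambda>z. ennreal (bloch_weight \<alpha> \<beta> g z)))"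
proof -
  let ?ess = "\<lambda>g :: complex^'n \<Rightarrow> complex. ess_norm (besov t) (besov_norm N t) (F_space p q s) (F_norm p q s) (T_op g)"
  let ?dist = "\<lambda>g :: complex^'n \<Rightarrow> complex. dist_to (bloch_norm \<alpha> \<beta>) g (little_bloch \<alpha> \<beta>)"
  let ?lim = "\<lambda>g :: complex^'n \<Rightarrow> complex. Limsup to_sphere (\<lambda>z. ennreal (bloch_weight \<alpha> \<beta> g z))"
  have \<alpha>: "0 < \<alpha>" using assms(2,3) by (simp add: \<alpha>_def)
  have \<beta>: "0 \<le> \<beta>" using assms(1) by (simp add: \<beta>_def)
  \<comment> \<open>Together with \<open>Limsup_le_dist\<close>, the estimates close a cycle: the
    distance is controlled by the limes superior, this by the essential norm, and that again by the
    distance.\<close>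
  obtain C1 where C1: "C1 > 0" "\<And>g. g \<in> hol_ball \<Longrightarrow> ?dist g \<le> ennreal C1 * ?lim g"
    using dist_le_Limsup[where 'n='n, OF \<alpha> \<beta>] by blast
  obtain C3 where C3: "C3 > 0" "\<And>g. g \<in> hol_ball \<Longrightarrow> ?lim g \<le> ennreal C3 * ?ess g"
    unfolding \<alpha>_def \<beta>_def using Limsup_le_ess_norm[where 'n='n, OF assms(2,3) _ assms(1,6,7), of s] assms(4) by auto
  \<comment> \<open>The upper bound depends on the range of exponents. In the degenerate range the
    essential norm is 0 and any positive constant serves; otherwise it holds for every symbol in the
    Bloch-type space.\<close>
  have "\<exists>C2>0. \<forall>g\<in>bloch \<alpha> \<beta>. (real CARD('n) \<le> s * (real CARD('n) - 1) \<longrightarrow> T_op g ` besov t \<subseteq> F_space p q s) \<longrightarrow>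
      ?ess g \<le> ennreal C2 * ?dist g"
  proof (cases "real CARD('n) \<le> s * (real CARD('n) - 1)")
    case True
    have "?ess g = 0" if "g \<in> bloch \<alpha> \<beta>" "T_op g ` besov t \<subseteq> F_space p q s" for g
      using that by (intro ess_norm_degenerate[OF assms(2,3,4) True assms(1,6,7)]) (simp_all add: bloch_def)
    then show ?thesis using True by (intro exI[of _ 1]) simp
  next
    case False
    then have n: "s * (real CARD('n) - 1) < real CARD('n)" by simp
    obtain C2 where "C2 > 0" "\<And>g. g \<in> bloch \<alpha> \<beta> \<Longrightarrow> ?ess g \<le> ennreal C2 * ?dist g"
      unfolding \<alpha>_def \<beta>_def using ess_norm_le_dist[where 'n='n, OF assms(2,3,4) n assms(1,6)] by blast
    then show ?thesis by blast
  qed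
  then obtain C2 where C2: "C2 > 0" "\<And>g. g \<in> bloch \<alpha> \<beta> \<Longrightarrow>
      (real CARD('n) \<le> s * (real CARD('n) - 1) \<longrightarrow> T_op g ` besov t \<subseteq> F_space p q s) \<Longrightarrow> ?ess g \<le> ennreal C2 * ?dist g" by blast
  have C13: "0 < C1 * C3" using C1(1) C3(1) by simp
  define C where "C = 1 + C1 * C3 + C1 + C2"
  have C: "1 \<le> C" "C1 * C3 \<le> C" "C1 \<le> C" "C2 \<le> C" using C1(1) C2(1) C13 by (simp_all add: C_def)
  show ?thesis
  proof (intro exI[of _ C] conjI ballI impI)
    show "0 < C" using C(1) by simp
    fix g :: "complex^'n \<Rightarrow> complex"
    assume g: "g \<in> bloch \<alpha> \<beta>"
      and m: "real CARD('n) \<le> s * (real CARD('n) - 1) \<longrightarrow> T_op g ` besov t \<subseteq> F_space p q s"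
    have gh: "g \<in> hol_ball" using g by (simp add: bloch_def)
    have "?dist g \<le> ennreal C1 * (ennreal C3 * ?ess g)"
      by (rule order_trans[OF C1(2)[OF gh] mult_left_mono[OF C3(2)[OF gh]]]) simp
    also have "\<dots> = ennreal (C1 * C3) * ?ess g" using C1(1) C3(1) by (simp add: ennreal_mult mult.assoc)
    finally have de: "?dist g \<le> ennreal (C1 * C3) * ?ess g" .
    show "comparable C (?ess g) (?dist g)"
      by (rule comparableI[OF C2(1) C13 C2(2)[OF g m] de C(4,2)])
    have "?lim g \<le> ennreal 1 * ?dist g" using Limsup_le_dist[OF g] by simp
    then show "comparable C (?dist g) (?lim g)"
      by (rule comparableI[OF C1(1) zero_less_one C1(2)[OF gh] _ C(3,1)])
  qed
qed

end
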